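(* Let $T$ be a simple theory in which the extension property is first-order. Then: (1) Let $\mathcal U$ be an unbounded $\tilde\tau^f$-set over $\emptyset$. Then there exists an unbounded $\tau^f$-open set $\mathcal U^*$ over some finite set $A^*$ such that $\mathcal U^*\subseteq\mathcal U$. In fact, if $V(x,z_1,\dots,z_l)$ is a pre-$\tilde\tau^f$-set relation such that $\mathcal U=\{a\mid\exists d_1\dots d_l\,V(a,d_1,\dots,d_l)\}$, and $(d_1^*,\dots,d_m^* )$ (with $0\le m\le l$) is any maximal sequence (with respect to extension) such that $\exists d_{m+1}\dots d_l\,V(\mathcal C,d_1^*,\dots,d_m^*,d_{m+1},\dots,d_l)$ is unbounded, then $$\mathcal U^*=\exists d_{m+1}\dots d_l\,V(\mathcal C,d_1^*,\dots,d_m^*,d_{m+1},\dots,d_l)$$ is a $\tau^f$-open set over $d_1^*\dots d_m^*$. (2) Let $\mathcal U$ be an unbounded $\tilde\tau^f_{st}$-set over $\emptyset$. Then there exists an unbounded $\tau^f_\infty$-open set $\mathcal U^*$ over some finite set $A^*$ such that $\mathcal U^*\subseteq\mathcal U$. In fact, if $V(x,z_1,\dots,z_l)$ is a pre-$\tilde\tau^f_{st}$-set relation such that $\mathcal U=\{a\mid\exists d_1\dots d_l\,V(a,d_1,\dots,d_l)\}$, and $(d_1^*,\dots,d_m^* )$ (with $0\le m\le l$) is any maximal sequence (with respect to extension) such that $\exists d_{m+1}\dots d_l\,V(\mathcal C,d_1^*,\dots,d_m^*,d_{m+1},\dots,d_l)$ is non-algebraic, then $$\mathcal U^*=\exists d_{m+1}\dots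 d_l\,V(\mathcal C,d_1^*,\dots,d_m^*,d_{m+1},\dots,d_l)$$ is a basic $\tau^f_\infty$-open set over $d_1^*\dots d_m^*$.
   Context: $T$ is a complete first-order theory in a language $L$; $\mathcal C$ is a highly saturated, highly strongly homogeneous model of $T$; parameter sets are small; independence means non-forking. An $A$-invariant set is unbounded (equivalently, non-algebraic) if it is not contained in $acl(A)$. For a relation $W(x,\bar z)$ and $\bar d$, $\exists \bar d'\,W(\mathcal C,\bar d,\bar d')$ denotes the set of $a$ in $\mathcal C$ such that $W(a,\bar d,\bar d')$ holds for some $\bar d'$. Extension property: a pair is an $L\cup\{P\}$-structure $(M,P^M)$ with $M\models T$ and $P^M$ the universe of an elementary submodel of $M$. The pair satisfies the extension property if for every $A\subseteq M$ with $|A|\le|T|$ and every complete $L$-type $p$ over $A$ in at most $|T|$ variables there is $a\in p^M$ (a realization in $M$) that is independent from $P^M$ over $A$. Let $T_{Ext}$ be the intersection of the complete $L\cup\{P\}$-theories of all pairs satisfying the extension property. The extension property is first-order in $T$ if every $|T|^+$-saturated pair that is a model of $T_{Ext}$ satisfies the extension property. Forking topologies: for a finite tuple of variables $x$, a basic $\tau^f$-open set over $A$ is a set $\{a\mid\phi(a,y)\text{ forks over }A\}$ with $\phi(x,y)\in L(A)$; these form a basis of the $\tau^f$-topology on $S_x(A)$, whose open sets (viewed as $A$-invariant sets) are the $\tau^f$-open sets over $A$. The $\tau^f_\infty$-topology on $S_x(A)$ has as basis the family of type-definable $\tau^f$-open sets over $A$; these basis elements are the basic $\tau^f_\infty$-open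 sets over $A$. A relation $V(x,z_1,\dots,z_l)$ is a pre-$\tilde\tau^f$-set relation if there are $\theta(x,\tilde x,z_1,\dots,z_l)\in L$ and $\phi_i(\tilde x,y_i)\in L$ for $0\le i\le l$ such that for all $a,d_1,\dots,d_l$ in $\mathcal C$: $V(a,d_1,\dots,d_l)$ iff $$\exists\tilde a\,\Big[\theta(a,\tilde a,d_1,\dots,d_l)\wedge\bigwedge_{i=0}^l\big(\phi_i(\tilde a,y_i)\text{ forks over }d_1d_2\dots d_i\big)\Big]$$ (for $i=0$ the sequence $d_1\dots d_i$ is $\emptyset$). If in addition every $\phi_i(\tilde x,y_i)$ is a stable formula, $V$ is a pre-$\tilde\tau^f_{st}$-set relation. A $\tilde\tau^f$-set (resp. $\tilde\tau^f_{st}$-set) over $\emptyset$ is a set of the form $\{a\mid\exists d_1,\dots,d_l\,V(a,d_1,\dots,d_l)\}$ for some pre-$\tilde\tau^f$-set relation (resp. pre-$\tilde\tau^f_{st}$-set relation) $V$. *)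

theory Defs
  imports Main
begin

unbundle cardinal_syntax

section \<open>First-order logic\<close>

record ('f, 'r) lang =
  funs :: "'f set"
  rels :: "'r set"
  farity :: "'f \<Rightarrow> nat"
  rarity :: "'r \<Rightarrow> nat"

record ('f, 'r, 'u) struct =
  dom :: "'u set"
  fint :: "'f \<Rightarrow> 'u list \<Rightarrow> 'u"
  rint :: "'r \<Rightarrow> 'u list \<Rightarrow> bool"

datatype 'f trm = Var nat | Fn 'f "'f trm list"

datatype ('f, 'r) fm =
    Eq "'f trm" "'f trm"
  | Rel 'r "'f trm list"
  | Neg "('f, 'r) fm"
  | And "('f, 'r) fm" "('f, 'r) fm"
  | Ex nat "('f, 'r) fm"

fun fvt :: "'f trm \<Rightarrow> nat set" where
  "fvt (Var v) = {v}"
| "fvt (Fn f ts) = (\<Union>t\<in>set ts. fvt t)"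

fun fv :: "('f, 'r) fm \<Rightarrow> nat set" where
  "fv (Eq s t) = fvt s \<union> fvt t"
| "fv (Rel r ts) = (\<Union>t\<in>set ts. fvt t)"
| "fv (Neg \<phi>) = fv \<phi>"
| "fv (And \<phi> \<psi>) = fv \<phi> \<union> fv \<psi>"
| "fv (Ex v \<phi>) = fv \<phi> - {v}"

fun wft :: "('f, 'r) lang \<Rightarrow> 'f trm \<Rightarrow> bool" where
  "wft L (Var v) \<longleftrightarrow> True"
| "wft L (Fn f ts) \<longleftrightarrow> f \<in> funs L \<and> length ts = farity L f \<and> (\<forall>t\<in>set ts. wft L t)"

fun wff :: "('f, 'r) lang \<Rightarrow> ('f, 'r) fm \<Rightarrow> bool" where
  "wff L (Eq s t) \<longleftrightarrow> wft L s \<and> wft L t"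
| "wff L (Rel r ts) \<longleftrightarrow> r \<in> rels L \<and> length ts = rarity L r \<and> (\<forall>t\<in>set ts. wft L t)"
| "wff L (Neg \<phi>) \<longleftrightarrow> wff L \<phi>"
| "wff L (And \<phi> \<psi>) \<longleftrightarrow> wff L \<phi> \<and> wff L \<psi>"
| "wff L (Ex v \<phi>) \<longleftrightarrow> wff L \<phi>"

fun val :: "('f, 'r, 'u) struct \<Rightarrow> (nat \<Rightarrow> 'u) \<Rightarrow> 'f trm \<Rightarrow> 'u" where
  "val M e (Var v) = e v"
| "val M e (Fn f ts) = fint M f (map (val M e) ts)"

fun sat :: "('f, 'r, 'u) struct \<Rightarrow> (nat \<Rightarrow> 'u) \<Rightarrow> ('f, 'r) fm \<Rightarrow> bool" where
  "sat M e (Eq s t) \<longleftrightarrow> val M e s = val M e t"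
| "sat M e (Rel r ts) \<longleftrightarrow> rint M r (map (val M e) ts)"
| "sat M e (Neg \<phi>) \<longleftrightarrow> \<not> sat M e \<phi>"
| "sat M e (And \<phi> \<psi>) \<longleftrightarrow> sat M e \<phi> \<and> sat M e \<psi>"
| "sat M e (Ex v \<phi>) \<longleftrightarrow> (\<exists>x\<in>dom M. sat M (e(v := x)) \<phi>)"

text \<open>A finite tuple is a list.  A formula \<open>\<phi>(x, y)\<close> in tuples of variables of lengths
  \<open>m\<close> and \<open>n\<close> is a member of \<open>fmlas L (m + n)\<close>, and \<open>\<phi>(a, b)\<close> is \<open>holds M \<phi> (a @ b)\<close>.\<close>

definition fmlas :: "('f, 'r) lang \<Rightarrow> nat \<Rightarrow> ('f, 'r) fm set" where
  "fmlas L n = {\<phi>. wff L \<phi> \<and> fv \<phi> \<subseteq> {..<n}}"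

definition holds :: "('f, 'r, 'u) struct \<Rightarrow> ('f, 'r) fm \<Rightarrow> 'u list \<Rightarrow> bool" where
  "holds M \<phi> xs \<longleftrightarrow> sat M (\<lambda>i. xs ! i) \<phi>"

definition tuples :: "('f, 'r, 'u) struct \<Rightarrow> nat \<Rightarrow> 'u list set" where
  "tuples M n = {xs. length xs = n \<and> set xs \<subseteq> dom M}"

definition sentences :: "('f, 'r) lang \<Rightarrow> ('f, 'r) fm set" where
  "sentences L = fmlas L 0"

definition is_struct :: "('f, 'r) lang \<Rightarrow> ('f, 'r, 'u) struct \<Rightarrow> bool" where
  "is_struct L M \<longleftrightarrow> dom M \<noteq> {} \<and>
     (\<forall>f\<in>funs L. \<forall>xs\<in>tuples M (farity L f). fint M f xs \<in> dom M)"

definition models :: "('f, 'r, 'u) struct \<Rightarrow> ('f, 'r) fm set \<Rightarrow> bool" where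
  "models M S \<longleftrightarrow> (\<forall>\<sigma>\<in>S. holds M \<sigma> [])"

text \<open>Consistency is not part of this definition: below \<open>T\<close> always comes with a model.  Such a
  \<open>T\<close> is deductively closed, so its cardinality is that of the set of all \<open>L\<close>-formulas.\<close>

definition complete_theory :: "('f, 'r) lang \<Rightarrow> ('f, 'r) fm set \<Rightarrow> bool" where
  "complete_theory L T \<longleftrightarrow>
     T \<subseteq> sentences L \<and> (\<forall>\<sigma>\<in>sentences L. \<sigma> \<in> T \<or> Neg \<sigma> \<in> T)"

definition theory_of :: "('f, 'r) lang \<Rightarrow> ('f, 'r, 'u) struct \<Rightarrow> ('f, 'r) fm set" where
  "theory_of L M = {\<sigma>\<in>sentences L. holds M \<sigma> []}"

definition elem_submodel :: "('f, 'r) lang \<Rightarrow> 'u set \<Rightarrow> ('f, 'r, 'u) struct \<Rightarrow> bool" where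
  "elem_submodel L N M \<longleftrightarrow>
     N \<subseteq> dom M \<and> is_struct L (M\<lparr>dom := N\<rparr>) \<and>
     (\<forall>n. \<forall>\<phi>\<in>fmlas L n. \<forall>xs\<in>tuples (M\<lparr>dom := N\<rparr>) n. holds (M\<lparr>dom := N\<rparr>) \<phi> xs \<longleftrightarrow> holds M \<phi> xs)"

section \<open>Types, saturation, the monster model\<close>

text \<open>For a family of variables \<open>(x\<^sub>i)\<close> indexed by \<open>i \<in> I\<close>, the triple \<open>(\<phi>, js, c)\<close> is the
  formula \<open>\<phi>(x\<^sub>j\<^sub>1, \<dots>, x\<^sub>j\<^sub>k, c)\<close> with \<open>js = [j\<^sub>1, \<dots>, j\<^sub>k]\<close> and parameters \<open>c\<close> from \<open>A\<close>.\<close>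

definition instances :: "('f, 'r) lang \<Rightarrow> 'i set \<Rightarrow> 'u set \<Rightarrow> (('f, 'r) fm \<times> 'i list \<times> 'u list) set" where
  "instances L I A =
     {(\<phi>, js, c). js \<in> lists I \<and> c \<in> lists A \<and> \<phi> \<in> fmlas L (length js + length c)}"

definition realizes ::
  "('f, 'r, 'u) struct \<Rightarrow> 'i set \<Rightarrow> ('i \<Rightarrow> 'u) \<Rightarrow> (('f, 'r) fm \<times> 'i list \<times> 'u list) set \<Rightarrow> bool" where
  "realizes M I a p \<longleftrightarrow>
     (\<forall>i\<in>I. a i \<in> dom M) \<and> (\<forall>(\<phi>, js, c)\<in>p. holds M \<phi> (map a js @ c))"

definition complete_type ::
  "('f, 'r) lang \<Rightarrow> ('f, 'r, 'u) struct \<Rightarrow> 'i set \<Rightarrow> 'u set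
     \<Rightarrow> (('f, 'r) fm \<times> 'i list \<times> 'u list) set \<Rightarrow> bool" where
  "complete_type L M I A p \<longleftrightarrow>
     p \<subseteq> instances L I A \<and>
     (\<forall>q. finite q \<and> q \<subseteq> p \<longrightarrow> (\<exists>a. realizes M I a q)) \<and>
     (\<forall>(\<phi>, js, c)\<in>instances L I A. (\<phi>, js, c) \<in> p \<or> (Neg \<phi>, js, c) \<in> p)"

definition saturated :: "'k rel \<Rightarrow> ('f, 'r) lang \<Rightarrow> ('f, 'r, 'u) struct \<Rightarrow> bool" where
  "saturated \<kappa> L M \<longleftrightarrow>
     (\<forall>A\<subseteq>dom M. |A| <o \<kappa> \<longrightarrow>
       (\<forall>n p. complete_type L M {..<n::nat} A p \<longrightarrow> (\<exists>a. realizes M {..<n} a p)))"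

definition elem_map ::
  "('f, 'r) lang \<Rightarrow> ('f, 'r, 'u) struct \<Rightarrow> 'u set \<Rightarrow> ('u \<Rightarrow> 'u) \<Rightarrow> bool" where
  "elem_map L M A g \<longleftrightarrow>
     A \<subseteq> dom M \<and> g ` A \<subseteq> dom M \<and>
     (\<forall>c\<in>lists A. \<forall>\<phi>\<in>fmlas L (length c). holds M \<phi> c \<longleftrightarrow> holds M \<phi> (map g c))"

definition automorphism :: "('f, 'r) lang \<Rightarrow> ('f, 'r, 'u) struct \<Rightarrow> ('u \<Rightarrow> 'u) \<Rightarrow> bool" where
  "automorphism L M g \<longleftrightarrow>
     bij_betw g (dom M) (dom M) \<and>
     (\<forall>f\<in>funs L. \<forall>xs\<in>tuples M (farity L f). g (fint M f xs) = fint M f (map g xs)) \<and>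
     (\<forall>r\<in>rels L. \<forall>xs\<in>tuples M (rarity L r). rint M r xs \<longleftrightarrow> rint M r (map g xs))"

definition strongly_homogeneous :: "'k rel \<Rightarrow> ('f, 'r) lang \<Rightarrow> ('f, 'r, 'u) struct \<Rightarrow> bool" where
  "strongly_homogeneous \<kappa> L M \<longleftrightarrow>
     (\<forall>A g. |A| <o \<kappa> \<and> elem_map L M A g \<longrightarrow>
       (\<exists>h. automorphism L M h \<and> (\<forall>a\<in>A. h a = g a)))"

text \<open>A set is small if its cardinality is below \<open>\<kappa>\<close>.  Taking \<open>\<kappa>\<close> above \<open>2\<close> to the power \<open>|T|\<close>
  makes \<open>C\<close> contain a copy of every pair that matters for the extension property below.\<close>

definition monster_model ::
  "('f, 'r) lang \<Rightarrow> ('f, 'r) fm set \<Rightarrow> 'k rel \<Rightarrow> ('f, 'r, 'u) struct \<Rightarrow> bool" where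
  "monster_model L T \<kappa> C \<longleftrightarrow>
     Card_order \<kappa> \<and> |Pow T| <o \<kappa> \<and>
     is_struct L C \<and> models C T \<and> saturated \<kappa> L C \<and> strongly_homogeneous \<kappa> L C"

definition acl :: "('f, 'r) lang \<Rightarrow> ('f, 'r, 'u) struct \<Rightarrow> 'u set \<Rightarrow> 'u set" where
  "acl L C A = {b\<in>dom C. \<exists>c\<in>lists A. \<exists>\<phi>\<in>fmlas L (Suc (length c)).
     holds C \<phi> (b # c) \<and> finite {b'\<in>dom C. holds C \<phi> (b' # c)}}"

definition unbounded :: "('f, 'r) lang \<Rightarrow> ('f, 'r, 'u) struct \<Rightarrow> 'u set \<Rightarrow> 'u list set \<Rightarrow> bool" where
  "unbounded L C A U \<longleftrightarrow> \<not> U \<subseteq> lists (acl L C A)"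

section \<open>Forking, simplicity, stability\<close>

definition tp :: "('f, 'r) lang \<Rightarrow> ('f, 'r, 'u) struct \<Rightarrow> 'u set \<Rightarrow> 'u list \<Rightarrow> (('f, 'r) fm \<times> 'u list) set" where
  "tp L C A b = {(\<phi>, c). c \<in> lists A \<and> \<phi> \<in> fmlas L (length b + length c) \<and> holds C \<phi> (b @ c)}"

text \<open>\<open>divides L C A m \<phi> b\<close> and \<open>forks L C A m \<phi> b\<close>: the formula \<open>\<phi>(b, y)\<close> in the \<open>m\<close>-tuple of
  variables \<open>y\<close> divides (forks) over \<open>A\<close>.  The parameters precede the variables.\<close>

definition divides ::
  "('f, 'r) lang \<Rightarrow> ('f, 'r, 'u) struct \<Rightarrow> 'u set \<Rightarrow> nat \<Rightarrow> ('f, 'r) fm \<Rightarrow> 'u list \<Rightarrow> bool" where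
  "divides L C A m \<phi> b \<longleftrightarrow>
     (\<exists>k. \<exists>s :: nat \<Rightarrow> 'u list.
       (\<forall>i. s i \<in> tuples C (length b) \<and> tp L C A (s i) = tp L C A b) \<and>
       (\<forall>S. finite S \<and> card S = k \<longrightarrow> \<not> (\<exists>y\<in>tuples C m. \<forall>i\<in>S. holds C \<phi> (s i @ y))))"

definition forks ::
  "('f, 'r) lang \<Rightarrow> ('f, 'r, 'u) struct \<Rightarrow> 'u set \<Rightarrow> nat \<Rightarrow> ('f, 'r) fm \<Rightarrow> 'u list \<Rightarrow> bool" where
  "forks L C A m \<phi> b \<longleftrightarrow>
     (\<exists>\<Psi>. finite \<Psi> \<and>
       (\<forall>(\<psi>, c)\<in>\<Psi>. c \<in> lists (dom C) \<and> \<psi> \<in> fmlas L (length c + m) \<and> divides L C A m \<psi> c) \<and>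
       (\<forall>y\<in>tuples C m. holds C \<phi> (b @ y) \<longrightarrow> (\<exists>(\<psi>, c)\<in>\<Psi>. holds C \<psi> (c @ y))))"

text \<open>The (possibly infinite) tuple \<open>(a\<^sub>i)\<close>, \<open>i \<in> I\<close>, is independent from \<open>B\<close> over \<open>A\<close>:
  its type over \<open>A \<union> B\<close> does not fork over \<open>A\<close>.\<close>

definition independent ::
  "('f, 'r) lang \<Rightarrow> ('f, 'r, 'u) struct \<Rightarrow> 'i set \<Rightarrow> ('i \<Rightarrow> 'u) \<Rightarrow> 'u set \<Rightarrow> 'u set \<Rightarrow> bool" where
  "independent L C I a A B \<longleftrightarrow>
     (\<forall>js\<in>lists I. \<forall>b\<in>lists (A \<union> B). \<forall>\<phi>\<in>fmlas L (length b + length js).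
       holds C \<phi> (b @ map a js) \<longrightarrow> \<not> forks L C A (length js) \<phi> b)"

text \<open>The tree property for \<open>\<phi>(y, x)\<close>, with \<open>|y| = m\<close> and \<open>|x| = n\<close>.  Nodes of the tree are finite
  sequences of natural numbers; the branch through \<open>\<eta>\<close> consists of its initial segments.\<close>

definition tree_property ::
  "('f, 'r, 'u) struct \<Rightarrow> nat \<Rightarrow> nat \<Rightarrow> ('f, 'r) fm \<Rightarrow> bool" where
  "tree_property C m n \<phi> \<longleftrightarrow>
     (\<exists>k. \<exists>b :: nat list \<Rightarrow> 'u list.
       (\<forall>\<nu>. b \<nu> \<in> tuples C m) \<and>
       (\<forall>\<nu> S. finite S \<and> card S = k \<longrightarrow>
          \<not> (\<exists>x\<in>tuples C n. \<forall>i\<in>S. holds C \<phi> (b (\<nu> @ [i]) @ x))) \<and>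
       (\<forall>\<eta> :: nat \<Rightarrow> nat. \<exists>x\<in>tuples C n. \<forall>j. holds C \<phi> (b (map \<eta> [0..<j]) @ x)))"

definition simple_theory :: "('f, 'r) lang \<Rightarrow> ('f, 'r, 'u) struct \<Rightarrow> bool" where
  "simple_theory L C \<longleftrightarrow> (\<forall>m n. \<forall>\<phi>\<in>fmlas L (m + n). \<not> tree_property C m n \<phi>)"

definition stable_formula :: "('f, 'r, 'u) struct \<Rightarrow> nat \<Rightarrow> nat \<Rightarrow> ('f, 'r) fm \<Rightarrow> bool" where
  "stable_formula C m n \<phi> \<longleftrightarrow>
     \<not> (\<exists>(a :: nat \<Rightarrow> 'u list) (b :: nat \<Rightarrow> 'u list).
          (\<forall>i. a i \<in> tuples C m \<and> b i \<in> tuples C n) \<and>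
          (\<forall>i j. holds C \<phi> (a i @ b j) \<longleftrightarrow> i < j))"

section \<open>Pairs and the extension property\<close>

text \<open>The new unary predicate \<open>P\<close> is the relation symbol \<open>None\<close>.\<close>

definition pair_lang :: "('f, 'r) lang \<Rightarrow> ('f, 'r option) lang" where
  "pair_lang L = \<lparr>funs = funs L, rels = insert None (Some ` rels L),
     farity = farity L, rarity = case_option 1 (rarity L)\<rparr>"

definition pair_struct ::
  "('f, 'r, 'u) struct \<Rightarrow> 'u set \<Rightarrow> 'u set \<Rightarrow> ('f, 'r option, 'u) struct" where
  "pair_struct C M P = \<lparr>dom = M, fint = fint C,
     rint = case_option (\<lambda>xs. hd xs \<in> P) (rint C)\<rparr>"

text \<open>As usual, models of \<open>T\<close> are elementary submodels of the monster model \<open>C\<close>, and independence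
  inside them is computed in \<open>C\<close>.\<close>

definition is_pair :: "('f, 'r) lang \<Rightarrow> ('f, 'r, 'u) struct \<Rightarrow> 'u set \<Rightarrow> 'u set \<Rightarrow> bool" where
  "is_pair L C M P \<longleftrightarrow> elem_submodel L M C \<and> elem_submodel L P (C\<lparr>dom := M\<rparr>)"

text \<open>Index sets of at most \<open>|T|\<close> variables are, without loss of generality, sets of formulas.\<close>

definition extension_property ::
  "('f, 'r) lang \<Rightarrow> ('f, 'r) fm set \<Rightarrow> ('f, 'r, 'u) struct \<Rightarrow> 'u set \<Rightarrow> 'u set \<Rightarrow> bool" where
  "extension_property L T C M P \<longleftrightarrow>
     (\<forall>A\<subseteq>M. |A| \<le>o |T| \<longrightarrow>
       (\<forall>(I :: ('f, 'r) fm set) p. |I| \<le>o |T| \<and> complete_type L (C\<lparr>dom := M\<rparr>) I A p \<longrightarrow>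
         (\<exists>a. realizes (C\<lparr>dom := M\<rparr>) I a p \<and> independent L C I a A P)))"

definition T_Ext :: "('f, 'r) lang \<Rightarrow> ('f, 'r) fm set \<Rightarrow> ('f, 'r, 'u) struct \<Rightarrow> ('f, 'r option) fm set" where
  "T_Ext L T C = {\<sigma>\<in>sentences (pair_lang L). \<forall>M P.
     is_pair L C M P \<and> extension_property L T C M P \<longrightarrow>
       \<sigma> \<in> theory_of (pair_lang L) (pair_struct C M P)}"

definition extension_property_first_order ::
  "('f, 'r) lang \<Rightarrow> ('f, 'r) fm set \<Rightarrow> ('f, 'r, 'u) struct \<Rightarrow> bool" where
  "extension_property_first_order L T C \<longleftrightarrow>
     (\<forall>M P. is_pair L C M P \<and>
        saturated (cardSuc |T| ) (pair_lang L) (pair_struct C M P) \<and>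
        models (pair_struct C M P) (T_Ext L T C) \<longrightarrow>
        extension_property L T C M P)"

section \<open>Forking topologies\<close>

definition basic_tauf_open ::
  "('f, 'r) lang \<Rightarrow> ('f, 'r, 'u) struct \<Rightarrow> 'u set \<Rightarrow> nat \<Rightarrow> 'u list set \<Rightarrow> bool" where
  "basic_tauf_open L C A n U \<longleftrightarrow>
     (\<exists>m. \<exists>c\<in>lists A. \<exists>\<phi>\<in>fmlas L (length c + n + m).
       U = {a\<in>tuples C n. forks L C A m \<phi> (c @ a)})"

definition tauf_open ::
  "('f, 'r) lang \<Rightarrow> ('f, 'r, 'u) struct \<Rightarrow> 'u set \<Rightarrow> nat \<Rightarrow> 'u list set \<Rightarrow> bool" where
  "tauf_open L C A n U \<longleftrightarrow> (\<exists>\<B>. (\<forall>B\<in>\<B>. basic_tauf_open L C A n B) \<and> U = \<Union>\<B>)"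

definition type_definable ::
  "('f, 'r) lang \<Rightarrow> ('f, 'r, 'u) struct \<Rightarrow> 'u set \<Rightarrow> nat \<Rightarrow> 'u list set \<Rightarrow> bool" where
  "type_definable L C A n U \<longleftrightarrow>
     (\<exists>\<Sigma>. (\<forall>(\<psi>, c)\<in>\<Sigma>. c \<in> lists A \<and> \<psi> \<in> fmlas L (n + length c)) \<and>
       U = {a\<in>tuples C n. \<forall>(\<psi>, c)\<in>\<Sigma>. holds C \<psi> (a @ c)})"

definition basic_tauf_inf_open ::
  "('f, 'r) lang \<Rightarrow> ('f, 'r, 'u) struct \<Rightarrow> 'u set \<Rightarrow> nat \<Rightarrow> 'u list set \<Rightarrow> bool" where
  "basic_tauf_inf_open L C A n U \<longleftrightarrow> type_definable L C A n U \<and> tauf_open L C A n U"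

definition tauf_inf_open ::
  "('f, 'r) lang \<Rightarrow> ('f, 'r, 'u) struct \<Rightarrow> 'u set \<Rightarrow> nat \<Rightarrow> 'u list set \<Rightarrow> bool" where
  "tauf_inf_open L C A n U \<longleftrightarrow> (\<exists>\<B>. (\<forall>B\<in>\<B>. basic_tauf_inf_open L C A n B) \<and> U = \<Union>\<B>)"

section \<open>The \<open>\<tau>\<close>-tilde sets\<close>

text \<open>In a relation \<open>V(x, z\<^sub>1, \<dots>, z\<^sub>l)\<close> all variables stand for finite tuples: \<open>|x| = n\<close> and
  \<open>rs = [|z\<^sub>1|, \<dots>, |z\<^sub>l|]\<close>.  Only the values of \<open>V\<close> on tuples of these lengths matter.\<close>

definition tuple_seqs :: "('f, 'r, 'u) struct \<Rightarrow> nat list \<Rightarrow> 'u list list set" where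
  "tuple_seqs C rs = {ds. list_all2 (\<lambda>d r. d \<in> tuples C r) ds rs}"

definition pre_tilde_witness ::
  "('f, 'r) lang \<Rightarrow> ('f, 'r, 'u) struct \<Rightarrow> nat \<Rightarrow> nat list \<Rightarrow> ('u list \<Rightarrow> 'u list list \<Rightarrow> bool)
     \<Rightarrow> nat \<Rightarrow> ('f, 'r) fm \<Rightarrow> (nat \<Rightarrow> nat) \<Rightarrow> (nat \<Rightarrow> ('f, 'r) fm) \<Rightarrow> bool" where
  "pre_tilde_witness L C n rs V k \<theta> m \<phi> \<longleftrightarrow>
     \<theta> \<in> fmlas L (n + k + sum_list rs) \<and>
     (\<forall>i\<le>length rs. \<phi> i \<in> fmlas L (k + m i)) \<and>
     (\<forall>a\<in>tuples C n. \<forall>ds\<in>tuple_seqs C rs.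
        V a ds \<longleftrightarrow>
        (\<exists>a'\<in>tuples C k. holds C \<theta> (a @ a' @ concat ds) \<and>
           (\<forall>i\<le>length rs. forks L C (set (concat (take i ds))) (m i) (\<phi> i) a')))"

definition pre_tilde_rel ::
  "('f, 'r) lang \<Rightarrow> ('f, 'r, 'u) struct \<Rightarrow> nat \<Rightarrow> nat list \<Rightarrow> ('u list \<Rightarrow> 'u list list \<Rightarrow> bool) \<Rightarrow> bool" where
  "pre_tilde_rel L C n rs V \<longleftrightarrow> (\<exists>k \<theta> m \<phi>. pre_tilde_witness L C n rs V k \<theta> m \<phi>)"

definition pre_tilde_st_rel ::
  "('f, 'r) lang \<Rightarrow> ('f, 'r, 'u) struct \<Rightarrow> nat \<Rightarrow> nat list \<Rightarrow> ('u list \<Rightarrow> 'u list list \<Rightarrow> bool) \<Rightarrow> bool" where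
  "pre_tilde_st_rel L C n rs V \<longleftrightarrow>
     (\<exists>k \<theta> m \<phi>. pre_tilde_witness L C n rs V k \<theta> m \<phi> \<and>
        (\<forall>i\<le>length rs. stable_formula C k (m i) (\<phi> i)))"

text \<open>For \<open>ds = [d\<^sub>1, \<dots>, d\<^sub>m]\<close> this is the set
  \<open>\<exists>d\<^sub>m\<^sub>+\<^sub>1 \<dots> d\<^sub>l. V(C, d\<^sub>1, \<dots>, d\<^sub>m, d\<^sub>m\<^sub>+\<^sub>1, \<dots>, d\<^sub>l)\<close>.\<close>

definition section_set ::
  "('f, 'r, 'u) struct \<Rightarrow> nat \<Rightarrow> nat list \<Rightarrow> ('u list \<Rightarrow> 'u list list \<Rightarrow> bool) \<Rightarrow> 'u list list \<Rightarrow> 'u list set" where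
  "section_set C n rs V ds =
     {a\<in>tuples C n. \<exists>es\<in>tuple_seqs C (drop (length ds) rs). V a (ds @ es)}"

definition tilde_set ::
  "('f, 'r) lang \<Rightarrow> ('f, 'r, 'u) struct \<Rightarrow> nat \<Rightarrow> 'u list set \<Rightarrow> bool" where
  "tilde_set L C n U \<longleftrightarrow>
     (\<exists>rs V. pre_tilde_rel L C n rs V \<and> U = {a\<in>tuples C n. \<exists>ds\<in>tuple_seqs C rs. V a ds})"

definition tilde_st_set ::
  "('f, 'r) lang \<Rightarrow> ('f, 'r, 'u) struct \<Rightarrow> nat \<Rightarrow> 'u list set \<Rightarrow> bool" where
  "tilde_st_set L C n U \<longleftrightarrow>
     (\<exists>rs V. pre_tilde_st_rel L C n rs V \<and> U = {a\<in>tuples C n. \<exists>ds\<in>tuple_seqs C rs. V a ds})"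

definition unbounded_section ::
  "('f, 'r) lang \<Rightarrow> ('f, 'r, 'u) struct \<Rightarrow> nat \<Rightarrow> nat list \<Rightarrow> ('u list \<Rightarrow> 'u list list \<Rightarrow> bool)
     \<Rightarrow> 'u list list \<Rightarrow> bool" where
  "unbounded_section L C n rs V ds \<longleftrightarrow>
     length ds \<le> length rs \<and> ds \<in> tuple_seqs C (take (length ds) rs) \<and>
     unbounded L C (set (concat ds)) (section_set C n rs V ds)"

definition maximal_unbounded_section ::
  "('f, 'r) lang \<Rightarrow> ('f, 'r, 'u) struct \<Rightarrow> nat \<Rightarrow> nat list \<Rightarrow> ('u list \<Rightarrow> 'u list list \<Rightarrow> bool)
     \<Rightarrow> 'u list list \<Rightarrow> bool" where
  "maximal_unbounded_section L C n rs V ds \<longleftrightarrow>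
     unbounded_section L C n rs V ds \<and>
     (\<forall>es. es \<noteq> [] \<longrightarrow> \<not> unbounded_section L C n rs V (ds @ es))"

end

(*
Forking can be shifted to a larger base: if phi(e, b, y) forks over A and A is contained in e, then some
chi(e, y) forks over A such that phi(e, b, y) & ~chi(e, y) forks over e.

If the extension property is first-order, then for all formulas psi and phi the set of those e for which
some a satisfies psi(e, a) while phi(e, a, y) forks over e is a union of 0-definable sets.  Otherwise
compactness for pairs gives a saturated pair (M, P) with the extension property and a member e of this set
in M such that P realizes phi(e, a, y) for every a in M satisfying psi(e, a).  By the extension property
one such a, with phi(e, a, y) forking over e, is independent from P over e, a contradiction to symmetry.

Both facts together eliminate the quantified variables z_l, z_(l-1), ... one at a time, provided that x
belongs to all bases of forking but the first.  For a maximal sequence d* this can be arranged, because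
there x is algebraic over d* together with any further z.  For stable formulas forking is dividing with a
bound on the degree of inconsistency, so that sections are type-definable by compactness.
*)
theory Submission
 imports Defs "HOL-Library.Ramsey" "HOL-Library.Countable"
begin

section \<open>Renaming variables and definable predicates\<close>

text \<open>Forking over e is not a first-order condition on e; pairs make it visible. If P realizes
  every formula over M that does not fork over e, then an e without a suitable a satisfies a
  first-order statement: for every a, P realizes one of the given formulas. Such dense pairs must
  also have the extension property. They are unions of chains of length |T|^+, where each stage
  enlarges P freely from the previous M and then realizes all small types freely from the new P.
  Forking is computed in C, so all pairs live inside C; stages have size at most 2^|T|, whence the
  bound on the saturation of C.

  The definable neighbourhood only handles forking over the full tuple e. Conditions over shorter
  bases are first split by the shift into a part that no longer mentions the eliminated tuple and a
  remainder that forks over e.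

  Forking = dividing, symmetry and transitivity are derived from the failure of the tree property
  through a local rank, with independent sequences that need not be indiscernible.\<close>

lemma finite_fvt: "finite (fvt t)"
 by (induction t) auto

lemma finite_fv: "finite (fv \<phi>)"
 by (induction \<phi>) (auto simp: finite_fvt)

lemma val_cong:
 assumes "\<And>v. v \<in> fvt t \<Longrightarrow> e v = e' v"
 shows "val M e t = val M e' t"
 using assms
proof (induction t)
 case (Fn f ts)
 have "map (val M e) ts = map (val M e') ts"
 proof (rule map_cong)
  fix t assume "t \<in> set ts"
  thus "val M e t = val M e' t" by (intro Fn.IH Fn.prems) auto
 qed simp
 thus ?case by (simp del: map_eq_conv)
qed simp

lemma sat_cong:
 assumes "\<And>v. v \<in> fv \<phi> \<Longrightarrow> e v = e' v"
 shows "sat M e \<phi> \<longleftrightarrow> sat M e' \<phi>"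
 using assms
proof (induction \<phi> arbitrary: e e')
 case (Eq s t)
 have "val M e s = val M e' s" by (rule val_cong, rule Eq.prems) simp
 moreover have "val M e t = val M e' t" by (rule val_cong, rule Eq.prems) simp
 ultimately show ?case by simp
next
 case (Rel r ts)
 have "map (val M e) ts = map (val M e') ts"
 proof (rule map_cong)
  fix t assume "t \<in> set ts"
  thus "val M e t = val M e' t" by (intro val_cong Rel.prems) auto
 qed simp
 thus ?case by (simp del: map_eq_conv)
next
 case (Neg \<phi>)
 show ?case using Neg.IH[OF Neg.prems] by simp
next
 case (And \<phi> \<psi>)
 have "sat M e \<phi> \<longleftrightarrow> sat M e' \<phi>" by (rule And.IH(1), rule And.prems) simp
 moreover have "sat M e \<psi> \<longleftrightarrow> sat M e' \<psi>" by (rule And.IH(2), rule And.prems) simp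
 ultimately show ?case by simp
next
 case (Ex v \<phi>)
 have "sat M (e(v := x)) \<phi> \<longleftrightarrow> sat M (e'(v := x)) \<phi>" for x
  by (rule Ex.IH) (simp add: Ex.prems)
 thus ?case by simp
qed

section \<open>Capture-avoiding renaming of variables\<close>

fun rent :: "(nat \<Rightarrow> nat) \<Rightarrow> 'f trm \<Rightarrow> 'f trm" where
 "rent g (Var v) = Var (g v)"
| "rent g (Fn f ts) = Fn f (map (rent g) ts)"

text \<open>The renaming \<open>g\<close> need not be injective. A bound variable is therefore
  replaced by a number larger than the images of all free variables of the body, which rules out
  capture.\<close>

fun ren :: "(nat \<Rightarrow> nat) \<Rightarrow> ('f, 'r) fm \<Rightarrow> ('f, 'r) fm" where
 "ren g (Eq s t) = Eq (rent g s) (rent g t)"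
| "ren g (Rel r ts) = Rel r (map (rent g) ts)"
| "ren g (Neg \<phi>) = Neg (ren g \<phi>)"
| "ren g (And \<phi> \<psi>) = And (ren g \<phi>) (ren g \<psi>)"
| "ren g (Ex v \<phi>) = (let w = Suc (Max (insert 0 (g ` fv \<phi>))) in Ex w (ren (g(v := w)) \<phi>))"

lemma val_rent: "val M e (rent g t) = val M (e \<circ> g) t"
 by (induction t) (auto simp: comp_def cong: map_cong)

lemma fvt_rent: "fvt (rent g t) = g ` fvt t"
 by (induction t) auto

lemma wft_rent: "wft L (rent g t) \<longleftrightarrow> wft L t"
 by (induction t) auto

lemma fresh_ren: "u \<in> fv \<phi> \<Longrightarrow> g u \<noteq> Suc (Max (insert 0 (g ` fv \<phi>)))"
proof -
 assume "u \<in> fv \<phi>"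
 hence "g u \<le> Max (insert 0 (g ` fv \<phi>))" by (intro Max_ge) (auto simp: finite_fv)
 thus ?thesis by simp
qed

lemma sat_ren: "sat M e (ren g \<phi>) \<longleftrightarrow> sat M (e \<circ> g) \<phi>"
proof (induction \<phi> arbitrary: e g)
 case (Ex v \<phi>)
 let ?w = "Suc (Max (insert 0 (g ` fv \<phi>)))"
 have "sat M (e(?w := x)) (ren (g(v := ?w)) \<phi>) \<longleftrightarrow> sat M ((e \<circ> g)(v := x)) \<phi>" for x
  unfolding Ex.IH by (rule sat_cong) (auto simp: fresh_ren)
 thus ?case by (simp add: Let_def del: comp_apply)
qed (auto simp: val_rent comp_def)

lemma fv_ren: "fv (ren g \<phi>) = g ` fv \<phi>"
proof (induction \<phi> arbitrary: g)
 case (Ex v \<phi>)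
 show ?case by (auto simp: Let_def Ex.IH dest: fresh_ren)
qed (auto simp: fvt_rent)

lemma wff_ren: "wff L (ren g \<phi>) \<longleftrightarrow> wff L \<phi>"
 by (induction \<phi> arbitrary: g) (auto simp: wft_rent Let_def)

section \<open>Predicates on assignments that are definable uniformly in all structures\<close>

text \<open>Variables may come from any type: pairs, sums and the parameters themselves serve as
  names, and the map \<open>v\<close> from numbers to names hides the index arithmetic. The formula
  does not depend on \<open>M\<close>, so a predicate can be compared between a model and its
  submodels.\<close>

definition dfn :: "('f, 'r) lang \<Rightarrow> 'x set \<Rightarrow> (('f, 'r, 'u) struct \<Rightarrow> ('x \<Rightarrow> 'u) \<Rightarrow> bool) \<Rightarrow> bool" where
 "dfn L X D \<longleftrightarrow> (\<exists>\<phi> v. wff L \<phi> \<and> v ` fv \<phi> \<subseteq> X \<and> (\<forall>M a. D M a \<longleftrightarrow> sat M (\<lambda>i. a (v i)) \<phi>))"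

lemma dfnI:
 assumes "wff L \<phi>" "v ` fv \<phi> \<subseteq> X" "\<And>M a. D M a \<longleftrightarrow> sat M (\<lambda>i. a (v i)) \<phi>"
 shows "dfn L X D"
 unfolding dfn_def using assms by (intro exI[of _ \<phi>] exI[of _ v]) simp

lemma dfnE:
 assumes "dfn L X D"
 obtains \<phi> v where "wff L \<phi>" "v ` fv \<phi> \<subseteq> X" "\<And>M a. D M a \<longleftrightarrow> sat M (\<lambda>i. a (v i)) \<phi>"
 using assms unfolding dfn_def by (elim exE conjE) (rule that, assumption, assumption, simp)

lemma dfn_mono:
 assumes "dfn L X D" "X \<subseteq> Y"
 shows "dfn L Y D"
proof -
 obtain \<phi> v where "wff L \<phi>" "v ` fv \<phi> \<subseteq> X" "\<And>M a. D M a \<longleftrightarrow> sat M (\<lambda>i. a (v i)) \<phi>"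
  using assms(1) by (rule dfnE) (rule that)
 thus ?thesis using assms(2) by (intro dfnI[of L \<phi> v]) fast+
qed

lemma dfn_cong:
 assumes "dfn L X D" "\<And>x. x \<in> X \<Longrightarrow> a x = a' x"
 shows "D M a \<longleftrightarrow> D M a'"
proof -
 obtain \<phi> v where *: "wff L \<phi>" "v ` fv \<phi> \<subseteq> X" "\<And>M a. D M a \<longleftrightarrow> sat M (\<lambda>i. a (v i)) \<phi>"
  using assms(1) by (rule dfnE) (rule that)
 show ?thesis unfolding *(3) by (rule sat_cong) (use * assms(2) in auto)
qed

text \<open>A formula has finitely many free variables. With infinite \<open>X\<close>, this is what
  lets a finite subsystem be turned into one formula.\<close>

lemma dfn_support:
 assumes "dfn L X D"
 obtains V where "finite V" "V \<subseteq> X" "dfn L V D"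
proof -
 obtain \<phi> v where "wff L \<phi>" "v ` fv \<phi> \<subseteq> X" "\<And>M a. D M a \<longleftrightarrow> sat M (\<lambda>i. a (v i)) \<phi>"
  using assms(1) by (rule dfnE) (rule that)
 thus ?thesis
  by (intro that[of "v ` fv \<phi>"]) (auto simp: finite_fv dfn_def)
qed

lemma dfn_Neg: "dfn L X D \<Longrightarrow> dfn L X (\<lambda>M a. \<not> D M a)"
proof -
 assume "dfn L X D"
 then obtain \<phi> v where "wff L \<phi>" "v ` fv \<phi> \<subseteq> X" "\<And>M a. D M a \<longleftrightarrow> sat M (\<lambda>i. a (v i)) \<phi>"
  by (rule dfnE) (rule that)
 thus ?thesis by (intro dfnI[where \<phi> = "Neg \<phi>"]) auto
qed

lemma dfn_And:
 assumes "dfn L X D" "dfn L X E"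
 shows "dfn L X (\<lambda>M a. D M a \<and> E M a)"
proof -
 obtain \<phi> v where 1: "wff L \<phi>" "v ` fv \<phi> \<subseteq> X" "\<And>M a. D M a \<longleftrightarrow> sat M (\<lambda>i. a (v i)) \<phi>"
  using assms(1) by (rule dfnE) (rule that)
 obtain \<psi> w where 2: "wff L \<psi>" "w ` fv \<psi> \<subseteq> X" "\<And>M a. E M a \<longleftrightarrow> sat M (\<lambda>i. a (w i)) \<psi>"
  using assms(2) by (rule dfnE) (rule that)
 \<comment> \<open>The two formulas come with unrelated maps of names, so their variables are moved
   apart to even and odd numbers.\<close>
 let ?u = "\<lambda>i. if even i then v (i div 2) else w (i div 2)"
 show ?thesis
  by (rule dfnI[where \<phi> = "And (ren (\<lambda>i. 2 * i) \<phi>) (ren (\<lambda>i. 2 * i + 1) \<psi>)" and v = ?u])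
   (use 1(1,2) 2(1,2) in \<open>auto simp: 1(3) 2(3) wff_ren fv_ren sat_ren comp_def\<close>)
qed

lemma dfn_Or:
 assumes "dfn L X D" "dfn L X E"
 shows "dfn L X (\<lambda>M a. D M a \<or> E M a)"
 using dfn_Neg[OF dfn_And[OF dfn_Neg[OF assms(1)] dfn_Neg[OF assms(2)]]] by simp

lemma dfn_Imp:
 assumes "dfn L X D" "dfn L X E"
 shows "dfn L X (\<lambda>M a. D M a \<longrightarrow> E M a)"
 unfolding imp_conv_disj by (rule dfn_Or[OF dfn_Neg[OF assms(1)] assms(2)])

lemma dfn_Iff:
 assumes "dfn L X D" "dfn L X E"
 shows "dfn L X (\<lambda>M a. D M a \<longleftrightarrow> E M a)"
 unfolding iff_conv_conj_imp by (rule dfn_And[OF dfn_Imp[OF assms] dfn_Imp[OF assms(2,1)]])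

lemma dfn_const: "dfn L X (\<lambda>M a. b)"
proof (cases b)
 case True
 thus ?thesis
  by (intro dfnI[where \<phi> = "Neg (Ex 0 (Neg (Eq (Var 0) (Var 0))))"]) auto
next
 case False
 thus ?thesis
  by (intro dfnI[where \<phi> = "Ex 0 (Neg (Eq (Var 0) (Var 0)))"]) auto
qed

lemma dfn_ball:
 assumes "finite S" "\<And>s. s \<in> S \<Longrightarrow> dfn L X (D s)"
 shows "dfn L X (\<lambda>M a. \<forall>s\<in>S. D s M a)"
 using assms by (induction S rule: finite_induct) (auto intro: dfn_const dfn_And)

lemma dfn_bex:
 assumes "finite S" "\<And>s. s \<in> S \<Longrightarrow> dfn L X (D s)"
 shows "dfn L X (\<lambda>M a. \<exists>s\<in>S. D s M a)"
 using assms by (induction S rule: finite_induct) (auto intro: dfn_const dfn_Or)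

lemma dfn_ex1:
 fixes D :: "('f, 'r, 'u) struct \<Rightarrow> ('x \<Rightarrow> 'u) \<Rightarrow> bool"
 assumes "dfn L (insert x X) D"
 shows "dfn L X (\<lambda>M a. \<exists>u\<in>dom M. D M (a(x := u)))"
proof -
 obtain \<phi> v where *: "wff L \<phi>" "v ` fv \<phi> \<subseteq> insert x X" "\<And>M a. D M a \<longleftrightarrow> sat M (\<lambda>i. a (v i)) \<phi>"
  using assms(1) by (rule dfnE) (rule that)
 \<comment> \<open>Several numbers may carry the name \<open>x\<close>; all of them become the
   quantified variable 0, and the others move up by one to make room.\<close>
 let ?g = "\<lambda>i. if v i = x then 0 else Suc i"
 have "sat M (\<lambda>i. (a(x := u)) (v i)) \<phi> \<longleftrightarrow> sat M ((\<lambda>i. a (v (i - 1)))(0 := u)) (ren ?g \<phi>)" for M :: "('f, 'r, 'u) struct" and a u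
  unfolding sat_ren by (rule sat_cong) auto
 note key = this
 show ?thesis
 proof (rule dfnI[where \<phi> = "Ex 0 (ren ?g \<phi>)" and v = "\<lambda>i. v (i - 1)"])
  show "wff L (Ex 0 (ren ?g \<phi>))" using * by (simp add: wff_ren)
  show "(\<lambda>i. v (i - 1)) ` fv (Ex 0 (ren ?g \<phi>)) \<subseteq> X"
   using *(2) by (auto simp: fv_ren split: if_splits)
  show "(\<exists>u\<in>dom M. D M (a(x := u))) \<longleftrightarrow> sat M (\<lambda>i. a (v (i - 1))) (Ex 0 (ren ?g \<phi>))"
   for M :: "('f, 'r, 'u) struct" and a
   unfolding *(3) key by simp
 qed
qed

lemma dfn_ex_set:
 fixes D :: "('f, 'r, 'u) struct \<Rightarrow> ('x \<Rightarrow> 'u) \<Rightarrow> bool"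
 assumes "finite Z" "dfn L (Z \<union> X) D"
 shows "dfn L X (\<lambda>M a. \<exists>b. b ` Z \<subseteq> dom M \<and> D M (override_on a b Z))"
 using assms
proof (induction Z arbitrary: D rule: finite_induct)
 case empty
 thus ?case by simp
next
 case (insert z Z)
 have "dfn L (insert z (Z \<union> X)) D" using insert.prems by simp
 hence "dfn L (Z \<union> X) (\<lambda>M a. \<exists>u\<in>dom M. D M (a(z := u)))" by (rule dfn_ex1)
 note insert.IH[OF this]
 moreover have "(\<exists>b. b ` Z \<subseteq> dom M \<and> (\<exists>u\<in>dom M. D M ((override_on a b Z)(z := u))))
  \<longleftrightarrow> (\<exists>b. b ` insert z Z \<subseteq> dom M \<and> D M (override_on a b (insert z Z)))" for M :: "('f, 'r, 'u) struct" and a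
 proof -
  have eq: "(override_on a b Z)(z := u) = override_on a (b(z := u)) (insert z Z)" for b u
   by (auto simp: override_on_def fun_eq_iff)
  show ?thesis
  proof
   assume "\<exists>b. b ` Z \<subseteq> dom M \<and> (\<exists>u\<in>dom M. D M ((override_on a b Z)(z := u)))"
   then obtain b u where "b ` Z \<subseteq> dom M" "u \<in> dom M" "D M ((override_on a b Z)(z := u))" by blast
   thus "\<exists>b. b ` insert z Z \<subseteq> dom M \<and> D M (override_on a b (insert z Z))"
    unfolding eq using insert.hyps by (intro exI[of _ "b(z := u)"]) auto
  next
   assume "\<exists>b. b ` insert z Z \<subseteq> dom M \<and> D M (override_on a b (insert z Z))"
   then obtain b where b: "b ` insert z Z \<subseteq> dom M" "D M (override_on a b (insert z Z))" by blast
   thus "\<exists>b. b ` Z \<subseteq> dom M \<and> (\<exists>u\<in>dom M. D M ((override_on a b Z)(z := u)))"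
    unfolding eq by (intro exI[of _ b] conjI bexI[of _ "b z"]) auto
  qed
 qed
 ultimately show ?case by (simp only:)
qed

lemma dfn_reindex:
 assumes "dfn L Y E" "f ` Y \<subseteq> X"
 shows "dfn L X (\<lambda>M a. E M (\<lambda>y. a (f y)))"
proof -
 obtain \<phi> v where *: "wff L \<phi>" "v ` fv \<phi> \<subseteq> Y" "\<And>M a. E M a \<longleftrightarrow> sat M (\<lambda>i. a (v i)) \<phi>"
  using assms(1) by (rule dfnE) (rule that)
 thus ?thesis using assms(2)
  by (intro dfnI[where \<phi> = \<phi> and v = "\<lambda>i. f (v i)"]) force+
qed

lemma dfn_ex_tuple:
 fixes D :: "('f, 'r, 'u) struct \<Rightarrow> ('x + nat \<Rightarrow> 'u) \<Rightarrow> bool"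
 assumes "dfn L (Inl ` X \<union> Inr ` {..<m}) D"
 shows "dfn L X (\<lambda>M a. \<exists>y\<in>tuples M m. D M (case_sum a (nth y)))"
proof -
 let ?Z = "Inr ` {..<m} :: ('x + nat) set"
 have "dfn L (Inl ` X) (\<lambda>M a. \<exists>b. b ` ?Z \<subseteq> dom M \<and> D M (override_on a b ?Z))"
  using assms by (intro dfn_ex_set) (auto simp: Un_commute)
 hence "dfn L X (\<lambda>M a. \<exists>b. b ` ?Z \<subseteq> dom M \<and> D M (override_on (\<lambda>y. a (projl y)) b ?Z))"
  by (rule dfn_reindex) auto
 moreover have "(\<exists>b. b ` ?Z \<subseteq> dom M \<and> D M (override_on (\<lambda>y. a (projl y)) b ?Z))
   \<longleftrightarrow> (\<exists>y\<in>tuples M m. D M (case_sum a (nth y)))" for M :: "('f, 'r, 'u) struct" and a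
 proof
  assume "\<exists>b. b ` ?Z \<subseteq> dom M \<and> D M (override_on (\<lambda>y. a (projl y)) b ?Z)"
  then obtain b where b: "b ` ?Z \<subseteq> dom M" "D M (override_on (\<lambda>y. a (projl y)) b ?Z)" by blast
  have "D M (case_sum a (nth (map (\<lambda>i. b (Inr i)) [0..<m])))"
   using b(2) by (subst dfn_cong[OF assms]) (auto simp: override_on_def)
  thus "\<exists>y\<in>tuples M m. D M (case_sum a (nth y))"
   using b(1) by (intro bexI[of _ "map (\<lambda>i. b (Inr i)) [0..<m]"]) (auto simp: tuples_def)
 next
  assume "\<exists>y\<in>tuples M m. D M (case_sum a (nth y))"
  then obtain y where y: "y \<in> tuples M m" "D M (case_sum a (nth y))" by blast
  have "D M (override_on (\<lambda>y. a (projl y)) (case_sum a (nth y)) ?Z)"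
   using y(2) by (subst dfn_cong[OF assms]) (auto simp: override_on_def)
  moreover have "(case_sum a (nth y)) ` ?Z \<subseteq> dom M"
   using y(1) by (auto simp: tuples_def)
  ultimately show "\<exists>b. b ` ?Z \<subseteq> dom M \<and> D M (override_on (\<lambda>y. a (projl y)) b ?Z)" by blast
 qed
 ultimately show ?thesis by simp
qed

lemma dfn_holds:
 assumes "\<phi> \<in> fmlas L (length xs)" "set xs \<subseteq> X"
 shows "dfn L X (\<lambda>M a. holds M \<phi> (map a xs))"
proof (rule dfnI[where \<phi> = \<phi> and v = "nth xs"])
 show "wff L \<phi>" using assms(1) by (simp add: fmlas_def)
 show "nth xs ` fv \<phi> \<subseteq> X" using assms by (force simp: fmlas_def)
 show "holds M \<phi> (map a xs) \<longleftrightarrow> sat M (\<lambda>i. a (xs ! i)) \<phi>" for M and a :: "'c \<Rightarrow> 'd"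
  unfolding holds_def by (rule sat_cong) (use assms(1) in \<open>auto simp: fmlas_def\<close>)
qed

lemma dfn_to_fm:
 assumes "dfn L (set xs) D"
 obtains \<phi> where "\<phi> \<in> fmlas L (length xs)" "\<And>M a. D M a \<longleftrightarrow> holds M \<phi> (map a xs)"
proof -
 obtain \<phi> v where *: "wff L \<phi>" "v ` fv \<phi> \<subseteq> set xs" "\<And>M a. D M a \<longleftrightarrow> sat M (\<lambda>i. a (v i)) \<phi>"
  using assms(1) by (rule dfnE) (rule that)
 have "\<forall>i\<in>fv \<phi>. \<exists>j<length xs. xs ! j = v i" using *(2) by (auto simp: in_set_conv_nth subset_iff)
 \<comment> \<open>If a name occurs more than once in \<open>xs\<close>, any of its positions will
   do.\<close>
 then obtain g where g: "\<And>i. i \<in> fv \<phi> \<Longrightarrow> g i < length xs \<and> xs ! (g i) = v i" by metis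
 show ?thesis
 proof (rule that[of "ren g \<phi>"])
  show "ren g \<phi> \<in> fmlas L (length xs)" using * g by (auto simp: fmlas_def wff_ren fv_ren)
  show "D M a \<longleftrightarrow> holds M (ren g \<phi>) (map a xs)" for M a
   unfolding holds_def sat_ren *(3) by (rule sat_cong) (auto simp: g)
 qed
qed

lemma holds_cong_fmlas:
 assumes "\<phi> \<in> fmlas L n" "\<And>i. i < n \<Longrightarrow> xs ! i = ys ! i"
 shows "holds M \<phi> xs \<longleftrightarrow> holds M \<phi> ys"
 unfolding holds_def by (rule sat_cong) (use assms in \<open>auto simp: fmlas_def\<close>)

lemma fmlas_mono: "\<phi> \<in> fmlas L n \<Longrightarrow> n \<le> m \<Longrightarrow> \<phi> \<in> fmlas L m"
 unfolding fmlas_def by auto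

lemma holds_append: "\<phi> \<in> fmlas L (length xs) \<Longrightarrow> holds M \<phi> (xs @ ys) \<longleftrightarrow> holds M \<phi> xs"
 by (rule holds_cong_fmlas) (auto simp: nth_append)

lemma fm_exists:
 fixes D :: "('f, 'r, 'u) struct \<Rightarrow> (nat \<Rightarrow> 'u) \<Rightarrow> bool"
 assumes "dfn L {..<n} D"
 obtains \<phi> where "\<phi> \<in> fmlas L n" "\<And>M xs. length xs = n \<Longrightarrow> holds M \<phi> xs \<longleftrightarrow> D M (nth xs)"
proof -
 have "dfn L (set [0..<n]) D" using assms by (simp add: atLeast0LessThan)
 then obtain \<phi> where \<phi>: "\<phi> \<in> fmlas L (length [0..<n])" "\<And>M a. D M a \<longleftrightarrow> holds M \<phi> (map a [0..<n])"
  by (rule dfn_to_fm) (rule that)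
 show ?thesis
 proof (rule that[of \<phi>])
  show "\<phi> \<in> fmlas L n" using \<phi> by simp
  fix M :: "('f, 'r, 'u) struct" and xs :: "'u list" assume "length xs = n"
  hence "map (nth xs) [0..<n] = xs" using map_nth[of xs] by simp
  thus "holds M \<phi> xs \<longleftrightarrow> D M (nth xs)" using \<phi>(2)[of M "nth xs"] by simp
 qed
qed

section \<open>Saturation for infinitely many variables\<close>

text \<open>Saturation for partial types in a single variable, the form in which values are chosen
  for one variable after another; \<open>saturated\<close> speaks of complete types in finitely many
  variables.\<close>

definition saturated1 :: "'k rel \<Rightarrow> ('f, 'r) lang \<Rightarrow> ('f, 'r, 'u) struct \<Rightarrow> bool" where
 "saturated1 \<kappa> L M \<longleftrightarrow> (\<forall>A\<subseteq>dom M. |A| <o \<kappa> \<longrightarrow>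
   (\<forall>q \<subseteq> {(\<phi>, c). c \<in> lists A \<and> \<phi> \<in> fmlas L (Suc (length c))}.
    (\<forall>q0\<subseteq>q. finite q0 \<longrightarrow> (\<exists>u\<in>dom M. \<forall>(\<phi>, c)\<in>q0. holds M \<phi> (u # c))) \<longrightarrow>
    (\<exists>u\<in>dom M. \<forall>(\<phi>, c)\<in>q. holds M \<phi> (u # c))))"

text \<open>A graph of a partial assignment that is maximal among those that remain finitely
 satisfiable is total.\<close>

lemma saturated_assignment:
 fixes M :: "('f, 'r, 'u) struct" and X :: "'x set"
 assumes sat: "saturated1 \<kappa> L M" and X: "|X| <o \<kappa>"
  and D: "\<And>j. j \<in> J \<Longrightarrow> dfn L X (D j)" and B: "B \<subseteq> X"
  and fin: "\<And>J0. J0 \<subseteq> J \<Longrightarrow> finite J0 \<Longrightarrow> \<exists>a. a ` X \<subseteq> dom M \<and> (\<forall>x\<in>B. a x = b x) \<and> (\<forall>j\<in>J0. D j M a)"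
 shows "\<exists>a. a ` X \<subseteq> dom M \<and> (\<forall>x\<in>B. a x = b x) \<and> (\<forall>j\<in>J. D j M a)"
proof -
 let ?ext = "\<lambda>G J0 a. a ` X \<subseteq> dom M \<and> (\<forall>(x, u)\<in>G. a x = u) \<and> (\<forall>j\<in>J0. D j M a)"
 \<comment> \<open>\<open>G\<close> is the graph of a partial assignment. Only its finite parts are
   tested, together with finitely many constraints, so that \<open>ok\<close> passes to unions of
   chains. Applied to two pairs with the same first entry, the test makes \<open>G\<close>
   single-valued.\<close>
 define ok where "ok G \<longleftrightarrow> G \<subseteq> X \<times> dom M \<and>
  (\<forall>G1 J0. G1 \<subseteq> G \<and> finite G1 \<and> J0 \<subseteq> J \<and> finite J0 \<longrightarrow> (\<exists>a. ?ext G1 J0 a))" for G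
 have okD: "\<exists>a. ?ext G1 J0 a" if "ok G" "G1 \<subseteq> G" "finite G1" "J0 \<subseteq> J" "finite J0" for G G1 J0
  using that unfolding ok_def by (elim conjE allE[of _ G1] allE[of _ J0]) simp
 have okX: "G \<subseteq> X \<times> dom M" if "ok G" for G using that unfolding ok_def by (rule conjunct1)
 define G0 where "G0 = (\<lambda>x. (x, b x)) ` B"
 have ok0: "ok G0" unfolding ok_def
 proof (intro conjI allI impI)
  obtain a where "a ` X \<subseteq> dom M" "\<forall>x\<in>B. a x = b x" using fin[of "{}"] by auto
  thus "G0 \<subseteq> X \<times> dom M" using B by (force simp: G0_def)
  fix G1 J0 assume *: "G1 \<subseteq> G0 \<and> finite G1 \<and> J0 \<subseteq> J \<and> finite J0"
  then obtain a where "a ` X \<subseteq> dom M" "\<forall>x\<in>B. a x = b x" "\<forall>j\<in>J0. D j M a" using fin[of J0] by blast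
  thus "\<exists>a. ?ext G1 J0 a" using * by (intro exI[of _ a]) (auto simp: G0_def)
 qed
 have functional: "u = u'" if G: "ok G" "(x, u) \<in> G" "(x, u') \<in> G" for G x u u'
  using okD[OF G(1), of "{(x, u), (x, u')}" "{}"] G(2,3) by auto
 have "\<forall>j\<in>J. \<exists>V. finite V \<and> V \<subseteq> X \<and> dfn L V (D j)"
 proof
  fix j assume "j \<in> J"
  then obtain V where "finite V" "V \<subseteq> X" "dfn L V (D j)" using D by (meson dfn_support)
  thus "\<exists>V. finite V \<and> V \<subseteq> X \<and> dfn L V (D j)" by blast
 qed
 from bchoice[OF this] obtain V where "\<forall>j\<in>J. finite (V j) \<and> V j \<subseteq> X \<and> dfn L (V j) (D j)" ..
 hence V: "\<And>j. j \<in> J \<Longrightarrow> finite (V j)" "\<And>j. j \<in> J \<Longrightarrow> V j \<subseteq> X" "\<And>j. j \<in> J \<Longrightarrow> dfn L (V j) (D j)" by auto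
 let ?Z = "{G. ok G \<and> G0 \<subseteq> G}"
 have "\<exists>G\<in>?Z. \<forall>G'\<in>?Z. G \<subseteq> G' \<longrightarrow> G' = G"
 proof (rule subset_Zorn_nonempty)
  show "?Z \<noteq> {}" using ok0 by auto
  fix \<C> assume ne: "\<C> \<noteq> {}" and ch: "subset.chain ?Z \<C>"
  hence C: "\<And>G. G \<in> \<C> \<Longrightarrow> ok G \<and> G0 \<subseteq> G" unfolding subset_chain_def by blast
  have "ok (\<Union>\<C>)" unfolding ok_def
  proof (intro conjI allI impI)
   show "\<Union>\<C> \<subseteq> X \<times> dom M" using C okX by blast
   fix G1 J0 assume *: "G1 \<subseteq> \<Union>\<C> \<and> finite G1 \<and> J0 \<subseteq> J \<and> finite J0"
   then obtain G where "G \<in> \<C>" "G1 \<subseteq> G" using finite_subset_Union_chain[of G1 \<C>] ne ch by metis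
   thus "\<exists>a. ?ext G1 J0 a" using okD[of G G1 J0] C * by blast
  qed
  thus "\<Union>\<C> \<in> ?Z" using C ne by blast
 qed
 then obtain G where G: "ok G" "G0 \<subseteq> G" and max: "\<And>G'. ok G' \<Longrightarrow> G \<subseteq> G' \<Longrightarrow> G' = G"
  by (auto intro: order_trans)
 define g where "g y = (THE u. (y, u) \<in> G)" for y
 have g: "g y = u" if "(y, u) \<in> G" for y u
  unfolding g_def using that by (blast intro: the_equality functional[OF G(1)])
 have gG: "(y, g y) \<in> G" if "y \<in> Domain G" for y using that g by auto
 have gM: "g ` Domain G \<subseteq> dom M" using gG okX[OF G(1)] by blast
 have ext: "\<exists>a. a ` X \<subseteq> dom M \<and> (\<forall>y\<in>Y. a y = g y) \<and> (\<forall>j\<in>J0. D j M a)"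
  if "finite Y" "Y \<subseteq> Domain G" "J0 \<subseteq> J" "finite J0" for Y J0
 proof -
  have "(\<lambda>y. (y, g y)) ` Y \<subseteq> G" using gG that(2) by blast
  thus ?thesis using okD[OF G(1), of "(\<lambda>y. (y, g y)) ` Y" J0] that by simp
 qed
 have dom: "Domain G = X"
 proof (rule ccontr)
  assume "Domain G \<noteq> X"
  then obtain x where x: "x \<in> X" "x \<notin> Domain G" using okX[OF G(1)] by fastforce
  let ?A = "g ` Domain G"
  have DX: "Domain G \<subseteq> X" using okX[OF G(1)] by blast
  have "|?A| \<le>o |X|"
   by (rule ordLeq_transitive[OF card_of_image card_of_mono1[OF DX]])
  hence cA: "|?A| <o \<kappa>" using X by (rule ordLeq_ordLess_trans)
  \<comment> \<open>A variable \<open>x\<close> without a value is to receive one. For a finite set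
    \<open>J0\<close> of constraints, \<open>E J0\<close> quantifies away the unassigned variables
    \<open>Z J0\<close> other than \<open>x\<close>, which leaves a formula about \<open>x\<close>
    and the values already given to \<open>ds J0\<close>. These formulas form the type
    \<open>q\<close> of \<open>x\<close>, over fewer than \<open>\<kappa>\<close>
    parameters.\<close>
  define F where "F = {J0. J0 \<subseteq> J \<and> finite J0}"
  define W where "W J0 = (\<Union>j\<in>J0. V j)" for J0
  define Z where "Z J0 = W J0 - Domain G - {x}" for J0
  have W: "finite (W J0)" "W J0 \<subseteq> X" if "J0 \<in> F" for J0
   using that V(1,2) unfolding F_def W_def by auto
  have "\<exists>ds. set ds = W J0 \<inter> Domain G" if "J0 \<in> F" for J0
   using W[OF that] by (intro finite_list) simp
  then obtain ds where ds: "\<And>J0. J0 \<in> F \<Longrightarrow> set (ds J0) = W J0 \<inter> Domain G" by metis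
  define E where "E J0 M a \<longleftrightarrow> (\<exists>b. b ` Z J0 \<subseteq> dom M \<and> (\<forall>j\<in>J0. D j M (override_on a b (Z J0))))"
   for J0 and M :: "('f, 'r, 'u) struct" and a
  have "dfn L (set (x # ds J0)) (E J0)" if "J0 \<in> F" for J0
  proof -
   have "dfn L (Z J0 \<union> set (x # ds J0)) (\<lambda>M a. \<forall>j\<in>J0. D j M a)"
   proof (rule dfn_ball)
    show "finite J0" using that by (simp add: F_def)
    fix j assume "j \<in> J0"
    hence "j \<in> J" "V j \<subseteq> Z J0 \<union> set (x # ds J0)"
     using that ds[OF that] unfolding F_def Z_def W_def by auto
    thus "dfn L (Z J0 \<union> set (x # ds J0)) (D j)" using V(3) dfn_mono by metis
   qed
   thus ?thesis unfolding E_def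
    by (intro dfn_ex_set) (use W[OF that] in \<open>auto simp: Z_def\<close>)
  qed
  hence "\<exists>\<phi>. \<phi> \<in> fmlas L (Suc (length (ds J0))) \<and> (\<forall>M a. E J0 M a \<longleftrightarrow> holds M \<phi> (a x # map a (ds J0)))"
   if "J0 \<in> F" for J0
   using that dfn_to_fm[of L "x # ds J0" "E J0"] by (metis length_Cons list.simps(9))
  then obtain \<phi> where \<phi>: "\<And>J0. J0 \<in> F \<Longrightarrow> \<phi> J0 \<in> fmlas L (Suc (length (ds J0)))"
   "\<And>J0 M a. J0 \<in> F \<Longrightarrow> E J0 M a \<longleftrightarrow> holds M (\<phi> J0) (a x # map a (ds J0))"
   by metis
  define q where "q = (\<lambda>J0. (\<phi> J0, map g (ds J0))) ` F"
  have q: "q \<subseteq> {(\<phi>, c). c \<in> lists ?A \<and> \<phi> \<in> fmlas L (Suc (length c))}"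
  proof
   fix p assume "p \<in> q"
   then obtain J0 where J0: "J0 \<in> F" "p = (\<phi> J0, map g (ds J0))" unfolding q_def by blast
   have "set (ds J0) \<subseteq> Domain G" using ds[OF J0(1)] by simp
   hence "map g (ds J0) \<in> lists ?A" by (simp add: lists_eq_set image_mono)
   thus "p \<in> {(\<phi>, c). c \<in> lists ?A \<and> \<phi> \<in> fmlas L (Suc (length c))}"
    using \<phi>(1)[OF J0(1)] J0(2) by simp
  qed
  have "\<exists>u\<in>dom M. \<forall>(\<phi>, c)\<in>q0. holds M \<phi> (u # c)" if "q0 \<subseteq> q" "finite q0" for q0
  proof -
   obtain F0 where F0: "F0 \<subseteq> F" "finite F0" "q0 = (\<lambda>J0. (\<phi> J0, map g (ds J0))) ` F0"
    using finite_subset_image[OF \<open>finite q0\<close> \<open>q0 \<subseteq> q\<close>[unfolded q_def]] by blast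
   let ?Y = "\<Union>J0\<in>F0. set (ds J0)"
   have "finite ?Y" "?Y \<subseteq> Domain G" "\<Union>F0 \<subseteq> J" "finite (\<Union>F0)" using F0 ds unfolding F_def by auto
   from ext[OF this] obtain a where a: "a ` X \<subseteq> dom M" "\<forall>y\<in>?Y. a y = g y" "\<forall>j\<in>\<Union>F0. D j M a"
    by (elim exE conjE) (rule that)
   have "holds M (\<phi> J0) (a x # map g (ds J0))" if "J0 \<in> F0" for J0
   proof -
    have J0: "J0 \<in> F" using that F0 by auto
    have "Z J0 \<subseteq> X" using W(2)[OF J0] unfolding Z_def by blast
    hence "a ` Z J0 \<subseteq> dom M" using a(1) by (meson image_mono order_trans)
    moreover have "override_on a a (Z J0) = a" by (simp add: override_on_def)
    ultimately have "E J0 M a" unfolding E_def using a(3) that by (intro exI[of _ a]) auto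
    moreover have "map a (ds J0) = map g (ds J0)" using a(2) that by auto
    ultimately show ?thesis using \<phi>(2)[OF J0] by metis
   qed
   moreover have "a x \<in> dom M" using a(1) x(1) by auto
   ultimately show ?thesis unfolding F0(3) by (intro bexI[of _ "a x"]) simp_all
  qed
  then obtain u where u: "u \<in> dom M" "\<forall>(\<phi>, c)\<in>q. holds M \<phi> (u # c)"
   using sat[unfolded saturated1_def, rule_format, OF gM cA q] by blast
  have "ok (insert (x, u) G)" unfolding ok_def
  proof (intro conjI allI impI)
   show "insert (x, u) G \<subseteq> X \<times> dom M" using okX[OF G(1)] x u by auto
   fix G1 J0 assume *: "G1 \<subseteq> insert (x, u) G \<and> finite G1 \<and> J0 \<subseteq> J \<and> finite J0"
   hence J0: "J0 \<in> F" by (simp add: F_def)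
   have "holds M (\<phi> J0) (u # map g (ds J0))" using u(2) J0 unfolding q_def by auto
   moreover have "map (g(x := u)) (ds J0) = map g (ds J0)" using ds[OF J0] x(2) by auto
   ultimately have "E J0 M (g(x := u))" unfolding \<phi>(2)[OF J0] by (simp only: fun_upd_same)
   then obtain b where b: "b ` Z J0 \<subseteq> dom M" "\<forall>j\<in>J0. D j M (override_on (g(x := u)) b (Z J0))"
    unfolding E_def by blast
   \<comment> \<open>The witnesses for \<open>Z J0\<close> are added to the extended assignment;
     \<open>u\<close> is only a default value in the domain for the remaining variables.\<close>
   define a where "a y = (if y \<in> Z J0 then b y else if y \<in> insert x (Domain G) then (g(x := u)) y else u)" for y
   show "\<exists>a. ?ext G1 J0 a"
   proof (intro exI[of _ a] conjI)
    have "g y \<in> dom M" if "(y, v) \<in> G" for y v using gM that by blast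
    thus "a ` X \<subseteq> dom M" using b(1) u(1) gM unfolding a_def by auto
    have "a y = v" if "(y, v) \<in> G" for y v
     using g[OF that] that x(2) unfolding a_def Z_def by auto
    moreover have "a x = u" unfolding a_def Z_def by simp
    ultimately show "\<forall>(x, u)\<in>G1. a x = u" using * by auto
    show "\<forall>j\<in>J0. D j M a"
    proof
     fix j assume j: "j \<in> J0"
     have "D j M a \<longleftrightarrow> D j M (override_on (g(x := u)) b (Z J0))"
     proof (rule dfn_cong[OF V(3)])
      show "j \<in> J" using j J0 by (auto simp: F_def)
      fix y assume "y \<in> V j"
      hence "y \<in> W J0" using j by (auto simp: W_def)
      thus "a y = override_on (g(x := u)) b (Z J0) y"
       by (auto simp: a_def override_on_def Z_def)
     qed
     thus "D j M a" using b(2) j by blast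
    qed
   qed
  qed
  hence "insert (x, u) G = G" using max by blast
  thus False using x(2) by auto
 qed
 have "D j M g" if j: "j \<in> J" for j
 proof -
  obtain a where a: "\<forall>y\<in>V j. a y = g y" "D j M a" using ext[of "V j" "{j}"] V(1,2)[OF j] dom j by auto
  have "D j M g \<longleftrightarrow> D j M a" by (rule dfn_cong[OF V(3)[OF j]]) (use a(1) in simp)
  thus ?thesis using a(2) by simp
 qed
 moreover have "\<forall>x\<in>B. g x = b x" using g G(2) unfolding G0_def by auto
 ultimately show ?thesis using gM unfolding dom by blast
qed

lemma dfn_ex_holds:
 fixes \<phi> :: "'i \<Rightarrow> ('f, 'r) fm" and X :: "'x set"
 assumes "finite S" "\<And>i. i \<in> S \<Longrightarrow> \<phi> i \<in> fmlas L (length (xs i) + m)" "\<And>i. i \<in> S \<Longrightarrow> set (xs i) \<subseteq> X"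
 shows "dfn L X (\<lambda>(M :: ('f, 'r, 'u) struct) a. \<exists>y\<in>tuples M m. \<forall>i\<in>S. holds M (\<phi> i) (map a (xs i) @ y))"
proof -
 let ?ys = "\<lambda>i. map Inl (xs i) @ map Inr [0..<m]"
 have "dfn L (Inl ` X \<union> Inr ` {..<m}) (\<lambda>(M :: ('f, 'r, 'u) struct) a. \<forall>i\<in>S. holds M (\<phi> i) (map a (?ys i)))"
 proof (rule dfn_ball[OF assms(1)])
  fix i assume i: "i \<in> S"
  have "set (?ys i) \<subseteq> Inl ` X \<union> Inr ` {..<m}" using assms(3)[OF i] by auto
  thus "dfn L (Inl ` X \<union> Inr ` {..<m}) (\<lambda>(M :: ('f, 'r, 'u) struct) a. holds M (\<phi> i) (map a (?ys i)))"
   by (intro dfn_holds) (use assms(2)[OF i] in simp_all)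
 qed
 note dfn_ex_tuple[OF this]
 moreover have "map (case_sum a (nth y)) (?ys i) = map a (xs i) @ y" if "y \<in> tuples M m"
  for M :: "('f, 'r, 'u) struct" and a y i
  using that map_nth[of y] by (simp add: tuples_def case_sum_o_inj)
 hence "(\<lambda>(M :: ('f, 'r, 'u) struct) a. \<exists>y\<in>tuples M m. \<forall>i\<in>S. holds M (\<phi> i) (map (case_sum a (nth y)) (?ys i)))
   = (\<lambda>M a. \<exists>y\<in>tuples M m. \<forall>i\<in>S. holds M (\<phi> i) (map a (xs i) @ y))"
  by (intro ext bex_cong refl) (simp add: case_sum_o_inj)
 ultimately show ?thesis by (simp only:)
qed

lemma tuplesD: "y \<in> tuples M n \<Longrightarrow> length y = n" "y \<in> tuples M n \<Longrightarrow> set y \<subseteq> dom M"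
 by (simp_all add: tuples_def)

lemma holds_Neg: "holds M (Neg \<phi>) xs \<longleftrightarrow> \<not> holds M \<phi> xs"
 by (simp add: holds_def)

lemma holds_And: "holds M (And \<phi> \<psi>) xs \<longleftrightarrow> holds M \<phi> xs \<and> holds M \<psi> xs"
 by (simp add: holds_def)

lemma fmlas_Neg: "Neg \<phi> \<in> fmlas L n \<longleftrightarrow> \<phi> \<in> fmlas L n"
 by (simp add: fmlas_def)

lemma fmlas_And: "And \<phi> \<psi> \<in> fmlas L n \<longleftrightarrow> \<phi> \<in> fmlas L n \<and> \<psi> \<in> fmlas L n"
 by (auto simp: fmlas_def)

text \<open>A variable \<open>Inl i\<close> stands for the \<open>i\<close>th coordinate of a tuple, \<open>Inr c\<close> for the parameter \<open>c\<close>.\<close>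

lemma fm_coords:
 fixes M :: "('f, 'r, 'u) struct"
 assumes "\<phi> \<in> fmlas L (length ks)" "set ks \<subseteq> {..<n} <+> A"
 obtains cs \<phi>' where "cs \<in> lists A" "\<phi>' \<in> fmlas L (n + length cs)"
  "\<And>M :: ('f, 'r, 'u) struct. \<And>b. length b = n \<Longrightarrow>
   holds M \<phi>' (b @ cs) \<longleftrightarrow> holds M \<phi> (map (case_sum (nth b) id) ks)"
proof -
 have "finite {a. Inr a \<in> set ks}"
  by (rule finite_surj[of "set ks" _ projr]) force+
 then obtain cs where cs: "set cs = {a. Inr a \<in> set ks}" using finite_list by blast
 let ?ks = "map Inl [0..<n] @ map Inr cs"
 have "set ks \<subseteq> set ?ks" using assms(2) by (auto simp: cs)
 hence "dfn L (set ?ks) (\<lambda>M a. holds (M :: ('f, 'r, 'u) struct) \<phi> (map a ks))"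
  by (intro dfn_holds assms(1))
 then obtain \<phi>' where \<phi>': "\<phi>' \<in> fmlas L (length ?ks)"
  "\<And>M :: ('f, 'r, 'u) struct. \<And>a. holds M \<phi> (map a ks) \<longleftrightarrow> holds M \<phi>' (map a ?ks)"
  by (rule dfn_to_fm) (rule that)
 show ?thesis
 proof (rule that[of cs \<phi>'])
  show "cs \<in> lists A" using cs assms(2) by (auto simp: lists_eq_set)
  show "\<phi>' \<in> fmlas L (n + length cs)" using \<phi>' by simp
  fix M :: "('f, 'r, 'u) struct" and b :: "'u list" assume "length b = n"
  hence "map (case_sum (nth b) id) ?ks = b @ cs" using map_nth[of b] by (simp add: comp_def)
  thus "holds M \<phi>' (b @ cs) \<longleftrightarrow> holds M \<phi> (map (case_sum (nth b) id) ks)"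
   using \<phi>'(2)[of M "case_sum (nth b) id"] by simp
 qed
qed

section \<open>The monster model\<close>

locale monster =
 fixes L :: "('f, 'r) lang" and T :: "('f, 'r) fm set"
  and \<kappa> :: "'k rel" and C :: "('f, 'r, 'u) struct"
 assumes complete: "complete_theory L T"
  and monster: "monster_model L T \<kappa> C"
  and simple: "simple_theory L C"
begin

text \<open>A complete theory contains each sentence or its negation, and there are infinitely many
  sentences. Infinity of \<open>T\<close> lets |T| absorb finite and countable sets in all later
  counts.\<close>

lemma infinite_T: "infinite T"
proof
 assume "finite T"
 moreover have "sentences L \<subseteq> T \<union> Neg -` T"
  using complete unfolding complete_theory_def by auto
 moreover have "inj Neg" by (simp add: inj_on_def)
 ultimately have "finite (sentences L)"
  by (meson finite_Un finite_subset finite_vimageI)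
 moreover have "range (\<lambda>n. Ex n (Eq (Var n) (Var n))) \<subseteq> sentences L"
  by (auto simp: sentences_def fmlas_def)
 ultimately have "finite (range (\<lambda>n. Ex n (Eq (Var n) (Var n)) :: ('f, 'r) fm))"
  by (rule rev_finite_subset)
 moreover have "inj (\<lambda>n. Ex n (Eq (Var n) (Var n)) :: ('f, 'r) fm)" by (simp add: inj_on_def)
 ultimately show False using finite_imageD by blast
qed

abbreviation small :: "'x set \<Rightarrow> bool" where "small A \<equiv> |A| <o \<kappa>"

abbreviation tup :: "nat \<Rightarrow> 'u list set" where "tup \<equiv> tuples C"

abbreviation inC :: "'u set \<Rightarrow> bool" where "inC A \<equiv> A \<subseteq> dom C"
abbreviation fms :: "'u list \<Rightarrow> nat \<Rightarrow> ('f, 'r) fm set" where "fms b m \<equiv> fmlas L (length b + m)"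

lemma small_PowT: "small (Pow T)" and Card_kappa: "Card_order \<kappa>"
 and struct_C: "is_struct L C" and hom: "strongly_homogeneous \<kappa> L C" and saturated_C: "saturated \<kappa> L C"
 using monster unfolding monster_model_def by auto

lemma small_le: "|A| \<le>o |B| \<Longrightarrow> small B \<Longrightarrow> small A"
 by (rule ordLeq_ordLess_trans)

lemma small_T: "small T"
 using small_PowT card_of_Pow ordLess_transitive by blast

lemma Cinf_kappa: "Cinfinite \<kappa>"
proof -
 have "|T| \<le>o \<kappa>" using small_T ordLess_imp_ordLeq by blast
 moreover have "cinfinite |T|" using infinite_T by (simp add: cinfinite_def Field_card_of)
 ultimately show ?thesis using cinfinite_mono Card_kappa by blast
qed

lemma small_finite: "finite A \<Longrightarrow> small A"
 using Cfinite_ordLess_Cinfinite[of "|A|" \<kappa>] Cinf_kappa by (simp add: cfinite_def Field_card_of card_of_card_order_on)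

lemma small_Un: "small A \<Longrightarrow> small B \<Longrightarrow> small (A \<union> B)"
 using Un_Cinfinite_bound_strict Cinf_kappa by blast

lemma small_subset: "A \<subseteq> B \<Longrightarrow> small B \<Longrightarrow> small A"
 by (rule small_le[OF card_of_mono1])

lemma small_image: "small A \<Longrightarrow> small (f ` A)"
 by (rule small_le[OF card_of_image])

lemma small_countable: "small (A :: 'x :: countable set)"
proof -
 have "|A| \<le>o |UNIV :: nat set|"
  using card_of_ordLeq[of A "UNIV :: nat set"] inj_on_subset[OF inj_to_nat, of A] by blast
 moreover have "|UNIV :: nat set| \<le>o |T|" using infinite_T infinite_iff_card_of_nat by blast
 ultimately show ?thesis using small_T ordLeq_transitive small_le by blast
qed

lemma dom_nonempty: "dom C \<noteq> {}"
 using struct_C by (simp add: is_struct_def)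

lemma tup_nonempty: "\<exists>y. y \<in> tup n"
proof -
 obtain u where "u \<in> dom C" using dom_nonempty by auto
 hence "replicate n u \<in> tup n" by (auto simp: tuples_def)
 thus ?thesis ..
qed

text \<open>Zorn's lemma completes the partial type. If a maximal one omitted both an instance and
  its negation, each would be refuted by a finite part, but a realization of both finite parts
  satisfies one of the two.\<close>

lemma saturated1_C: "saturated1 \<kappa> L C"
 unfolding saturated1_def
proof (intro allI impI)
 fix A q assume A: "inC A" "small A"
  and q: "q \<subseteq> {(\<phi>, c). c \<in> lists A \<and> \<phi> \<in> fmlas L (Suc (length c))}"
  and fin: "\<forall>q0\<subseteq>q. finite q0 \<longrightarrow> (\<exists>u\<in>dom C. \<forall>(\<phi>, c)\<in>q0. holds C \<phi> (u # c))"
 let ?I = "{..<1::nat}"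
 define f where "f = (\<lambda>(\<phi> :: ('f, 'r) fm, c :: 'u list). (\<phi>, [0::nat], c))"
 define fs where "fs p \<longleftrightarrow> (\<forall>q. finite q \<and> q \<subseteq> p \<longrightarrow> (\<exists>a. realizes C ?I a q))" for p
 let ?S = "{p. f ` q \<subseteq> p \<and> p \<subseteq> instances L ?I A \<and> fs p}"
 have "fs (f ` q)" unfolding fs_def
 proof (intro allI impI)
  fix p assume "finite p \<and> p \<subseteq> f ` q"
  then obtain q0 where q0: "q0 \<subseteq> q" "finite q0" "p = f ` q0"
   using finite_subset_image[of p f q] by blast
  then obtain u where u: "u \<in> dom C" "\<forall>(\<phi>, c)\<in>q0. holds C \<phi> (u # c)" using fin by blast
  have "realizes C ?I (\<lambda>_. u) p" unfolding realizes_def q0(3) f_def using u by auto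
  thus "\<exists>a. realizes C ?I a p" by blast
 qed
 moreover have "f ` q \<subseteq> instances L ?I A"
  using q by (auto simp: f_def instances_def)
 ultimately have ne: "?S \<noteq> {}" by blast
 have "\<exists>p\<in>?S. \<forall>p'\<in>?S. p \<subseteq> p' \<longrightarrow> p' = p"
 proof (rule subset_Zorn_nonempty[OF ne])
  fix \<C> assume ne: "\<C> \<noteq> {}" and ch: "subset.chain ?S \<C>"
  have "fs (\<Union>\<C>)" unfolding fs_def
  proof (intro allI impI)
   fix q0 assume "finite q0 \<and> q0 \<subseteq> \<Union>\<C>"
   then obtain p where "p \<in> \<C>" "q0 \<subseteq> p"
    using finite_subset_Union_chain[of q0 \<C>] ne ch by (auto simp: subset_chain_def)
   moreover have "fs p" using ch \<open>p \<in> \<C>\<close> by (auto simp: subset_chain_def)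
   ultimately show "\<exists>a. realizes C ?I a q0"
    using \<open>finite q0 \<and> q0 \<subseteq> \<Union>\<C>\<close> unfolding fs_def by blast
  qed
  moreover have "\<forall>p\<in>\<C>. f ` q \<subseteq> p \<and> p \<subseteq> instances L ?I A" using ch by (auto simp: subset_chain_def)
  ultimately show "\<Union>\<C> \<in> ?S" using ne by blast
 qed
 then obtain p where p0: "p \<in> ?S" and max: "\<forall>p'\<in>?S. p \<subseteq> p' \<longrightarrow> p' = p" by (elim bexE) (rule that)
 have p: "f ` q \<subseteq> p" "p \<subseteq> instances L ?I A" "fs p" using p0 by simp_all
 have key: "\<exists>q0. finite q0 \<and> q0 \<subseteq> p \<and> \<not> (\<exists>a. realizes C ?I a (insert x q0))"
  if "x \<in> instances L ?I A" "x \<notin> p" for x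
 proof -
  have "\<not> fs (insert x p)"
  proof
   assume "fs (insert x p)"
   hence "insert x p \<in> ?S" using p that(1) by auto
   hence "insert x p = p" using max by (meson subset_insertI)
   thus False using that(2) by auto
  qed
  then obtain q1 where q1: "finite q1" "q1 \<subseteq> insert x p" "\<not> (\<exists>a. realizes C ?I a q1)"
   unfolding fs_def by blast
  have "\<not> (\<exists>a. realizes C ?I a (insert x (q1 - {x})))"
   using q1(3) unfolding realizes_def by blast
  thus ?thesis using q1 by (intro exI[of _ "q1 - {x}"]) auto
 qed
 have "complete_type L C ?I A p" unfolding complete_type_def
 proof (intro conjI ballI)
  show "p \<subseteq> instances L ?I A" by fact
  show "\<forall>q. finite q \<and> q \<subseteq> p \<longrightarrow> (\<exists>a. realizes C ?I a q)" using p(3) unfolding fs_def .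
  fix x assume x: "x \<in> instances L ?I A"
  obtain \<phi> js c where [simp]: "x = (\<phi>, js, c)" by (cases x)
  have x': "(Neg \<phi>, js, c) \<in> instances L ?I A" using x by (simp add: instances_def fmlas_Neg)
  have "(\<phi>, js, c) \<in> p \<or> (Neg \<phi>, js, c) \<in> p"
  proof (rule ccontr)
   assume "\<not> ?thesis"
   then obtain q1 q2 where q: "finite q1" "q1 \<subseteq> p" "\<not> (\<exists>a. realizes C ?I a (insert x q1))"
    "finite q2" "q2 \<subseteq> p" "\<not> (\<exists>a. realizes C ?I a (insert (Neg \<phi>, js, c) q2))"
    using key[OF x] key[OF x'] by auto
   have "finite (q1 \<union> q2) \<and> q1 \<union> q2 \<subseteq> p" using q by auto
   then obtain a where "realizes C ?I a (q1 \<union> q2)" using p(3) unfolding fs_def by blast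
   hence "realizes C ?I a (insert x q1) \<or> realizes C ?I a (insert (Neg \<phi>, js, c) q2)"
    unfolding realizes_def by (auto simp: holds_Neg)
   thus False using q by blast
  qed
  thus "case x of (\<phi>, js, c) \<Rightarrow> (\<phi>, js, c) \<in> p \<or> (Neg \<phi>, js, c) \<in> p" by simp
 qed
 then obtain a where a: "realizes C ?I a p"
  using saturated_C A unfolding saturated_def by blast
 show "\<exists>u\<in>dom C. \<forall>(\<phi>, c)\<in>q. holds C \<phi> (u # c)"
 proof (intro bexI[of _ "a 0"] ballI)
  show "a 0 \<in> dom C" using a by (simp add: realizes_def)
  fix x assume "x \<in> q"
  hence "f x \<in> p" using p(1) by auto
  thus "case x of (\<phi>, c) \<Rightarrow> holds C \<phi> (a 0 # c)"
   using a unfolding realizes_def f_def by (auto split: prod.splits)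
 qed
qed

lemmas assignment_C = saturated_assignment[OF saturated1_C]

text \<open>The parameters enter the system as variables \<open>Inl\<close> whose values are
  prescribed.\<close>

lemma sat_tuple:
 assumes "inC A" "small A" "\<Phi> \<subseteq> {(\<phi>, c). c \<in> lists A \<and> \<phi> \<in> fms c m}"
  and fin: "\<And>\<Phi>0. \<Phi>0 \<subseteq> \<Phi> \<Longrightarrow> finite \<Phi>0 \<Longrightarrow> \<exists>y\<in>tup m. \<forall>(\<phi>, c)\<in>\<Phi>0. holds C \<phi> (c @ y)"
 shows "\<exists>y\<in>tup m. \<forall>(\<phi>, c)\<in>\<Phi>. holds C \<phi> (c @ y)"
proof -
 let ?X = "Inl ` A \<union> Inr ` {..<m} :: ('u + nat) set"
 let ?ks = "\<lambda>c. map Inl c @ map Inr [0..<m] :: ('u + nat) list"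
 let ?D = "\<lambda>j M a. holds M (fst j) (map a (?ks (snd j)))"
 have dfn: "dfn L ?X (?D j)" if "j \<in> \<Phi>" for j
 proof (rule dfn_holds)
  have j: "snd j \<in> lists A" "fst j \<in> fmlas L (length (snd j) + m)" using assms(3) that by auto
  thus "set (?ks (snd j)) \<subseteq> ?X" by (auto simp: lists_eq_set)
  show "fst j \<in> fmlas L (length (?ks (snd j)))" using j(2) by simp
 qed
 have small: "small ?X" by (intro small_Un small_image assms small_finite) simp
 have "\<exists>a. a ` ?X \<subseteq> dom C \<and> (\<forall>x\<in>Inl ` A. a x = projl x) \<and> (\<forall>j\<in>\<Phi>. ?D j C a)"
 proof (rule assignment_C[OF small dfn])
  fix \<Phi>0 assume "\<Phi>0 \<subseteq> \<Phi>" "finite \<Phi>0"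
  then obtain y where y: "y \<in> tup m" "\<forall>(\<phi>, c)\<in>\<Phi>0. holds C \<phi> (c @ y)" using fin by blast
  have "map (case_sum id (nth y)) (?ks c) = c @ y" for c
   using y(1) map_nth[of y] by (simp add: tuples_def comp_def)
  hence "?D j C (case_sum id (nth y))" if "j \<in> \<Phi>0" for j
   using y(2) that by (simp add: split_beta)
  moreover have "inC (case_sum id (nth y) ` ?X)"
   using y(1) assms(1) by (auto simp: tuples_def)
  ultimately show "\<exists>a. a ` ?X \<subseteq> dom C \<and> (\<forall>x\<in>Inl ` A. a x = projl x) \<and> (\<forall>j\<in>\<Phi>0. ?D j C a)"
   by (intro exI[of _ "case_sum id (nth y)"]) auto
 qed auto
 then obtain a where a: "inC (a ` ?X)" "\<forall>x\<in>Inl ` A. a x = projl x" "\<forall>j\<in>\<Phi>. ?D j C a"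
  by (elim exE conjE) (rule that)
 let ?y = "map (\<lambda>i. a (Inr i)) [0..<m]"
 have "?y \<in> tup m" using a(1) by (auto simp: tuples_def)
 moreover have "holds C \<phi> (c @ ?y)" if "(\<phi>, c) \<in> \<Phi>" for \<phi> c
 proof -
  have "map (\<lambda>x. a (Inl x)) c = c"
   using a(2) assms(3) that by (intro map_idI) (auto simp: lists_eq_set)
  hence "map a (?ks c) = c @ ?y" by (simp add: comp_def)
  moreover have "?D (\<phi>, c) C a" using a(3) that by blast
  ultimately show ?thesis by (simp add: comp_def)
 qed
 ultimately show ?thesis by blast
qed

subsection \<open>Automorphisms\<close>

text \<open>Values outside \<open>dom C\<close> are unconstrained, so identities between
  automorphisms are only available on \<open>dom C\<close>.\<close>

definition auts :: "'u set \<Rightarrow> ('u \<Rightarrow> 'u) set" where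
 "auts A = {h. automorphism L C h \<and> (\<forall>a\<in>A. h a = a)}"

lemma auts_mono: "A \<subseteq> B \<Longrightarrow> auts B \<subseteq> auts A"
 by (auto simp: auts_def)

lemma auts_empty: "h \<in> auts A \<Longrightarrow> h \<in> auts {}"
 by (auto simp: auts_def)

lemma auts_fix: "h \<in> auts A \<Longrightarrow> c \<in> lists A \<Longrightarrow> map h c = c"
 by (auto simp: auts_def lists_eq_set intro!: map_idI)

lemma auts_bij: "h \<in> auts A \<Longrightarrow> bij_betw h (dom C) (dom C)"
 by (simp add: auts_def automorphism_def)

lemma auts_dom: "h \<in> auts A \<Longrightarrow> x \<in> dom C \<Longrightarrow> h x \<in> dom C"
 using auts_bij bij_betwE by blast

lemma auts_dom_lists: "h \<in> auts A \<Longrightarrow> xs \<in> lists (dom C) \<Longrightarrow> map h xs \<in> lists (dom C)"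
 using auts_dom by (auto simp: lists_eq_set)

lemma auts_tup: "h \<in> auts A \<Longrightarrow> xs \<in> tup n \<Longrightarrow> map h xs \<in> tup n"
 using auts_dom by (auto simp: tuples_def)

lemma val_dom:
 assumes "wft L t" "\<And>v. v \<in> fvt t \<Longrightarrow> e v \<in> dom C"
 shows "val C e t \<in> dom C"
 using assms
proof (induction t)
 case (Fn f ts)
 have "map (val C e) ts \<in> tuples C (farity L f)"
  using Fn by (fastforce simp: tuples_def)
 thus ?case using struct_C Fn.prems by (simp add: is_struct_def)
qed simp

lemma aut_val:
 assumes "h \<in> auts A" "wft L t" "\<And>v. v \<in> fvt t \<Longrightarrow> e v \<in> dom C"
 shows "val C (\<lambda>i. h (e i)) t = h (val C e t)"
 using assms(2,3)
proof (induction t)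
 case (Fn f ts)
 have m: "map (val C e) ts \<in> tuples C (farity L f)"
  using Fn val_dom by (fastforce simp: tuples_def)
 have "map (val C (\<lambda>i. h (e i))) ts = map (h \<circ> val C e) ts"
 proof (rule map_cong)
  fix t assume "t \<in> set ts"
  hence "val C (\<lambda>i. h (e i)) t = h (val C e t)" using Fn.prems by (intro Fn.IH) auto
  thus "val C (\<lambda>i. h (e i)) t = (h \<circ> val C e) t" by simp
 qed simp
 hence "val C (\<lambda>i. h (e i)) (Fn f ts) = fint C f (map h (map (val C e) ts))" by (simp only: val.simps map_map)
 also have "\<dots> = h (fint C f (map (val C e) ts))"
  using assms(1) m Fn.prems(1) by (simp add: auts_def automorphism_def del: map_map)
 finally show ?case by simp
qed simp

lemma aut_sat:
 assumes "h \<in> auts A" "wff L \<phi>" "\<And>v. v \<in> fv \<phi> \<Longrightarrow> e v \<in> dom C"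
 shows "sat C (\<lambda>i. h (e i)) \<phi> \<longleftrightarrow> sat C e \<phi>"
 using assms(2,3)
proof (induction \<phi> arbitrary: e)
 case (Eq s t)
 have "val C (\<lambda>i. h (e i)) s = h (val C e s)" "val C (\<lambda>i. h (e i)) t = h (val C e t)"
  by (rule aut_val[OF assms(1)]; use Eq.prems in simp)+
 moreover have "val C e s \<in> dom C" "val C e t \<in> dom C" by (rule val_dom; use Eq.prems in simp)+
 moreover have "inj_on h (dom C)" using auts_bij[OF assms(1)] by (simp add: bij_betw_def)
 ultimately show ?case by (simp only: sat.simps inj_on_eq_iff)
next
 case (Rel r ts)
 have m: "map (val C e) ts \<in> tuples C (rarity L r)"
  using Rel val_dom by (fastforce simp: tuples_def)
 have "map (val C (\<lambda>i. h (e i))) ts = map (h \<circ> val C e) ts"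
 proof (rule map_cong)
  fix t assume "t \<in> set ts"
  hence "val C (\<lambda>i. h (e i)) t = h (val C e t)"
   using Rel by (intro aut_val[OF assms(1)]) auto
  thus "val C (\<lambda>i. h (e i)) t = (h \<circ> val C e) t" by simp
 qed simp
 hence "sat C (\<lambda>i. h (e i)) (Rel r ts) \<longleftrightarrow> rint C r (map h (map (val C e) ts))"
  by (simp only: sat.simps map_map)
 also have "\<dots> \<longleftrightarrow> rint C r (map (val C e) ts)"
  using assms(1) m Rel.prems(1) by (simp add: auts_def automorphism_def del: map_map)
 finally show ?case by simp
next
 case (Neg \<phi>)
 have "sat C (\<lambda>i. h (e i)) \<phi> \<longleftrightarrow> sat C e \<phi>" by (rule Neg.IH) (use Neg.prems in simp_all)
 thus ?case by simp
next
 case (And \<phi> \<psi>)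
 have "sat C (\<lambda>i. h (e i)) \<phi> \<longleftrightarrow> sat C e \<phi>" by (rule And.IH) (use And.prems in simp_all)
 moreover have "sat C (\<lambda>i. h (e i)) \<psi> \<longleftrightarrow> sat C e \<psi>" by (rule And.IH) (use And.prems in simp_all)
 ultimately show ?case by simp
next
 case (Ex v \<phi>)
 have eq: "sat C ((\<lambda>i. h (e i))(v := h x)) \<phi> \<longleftrightarrow> sat C (e(v := x)) \<phi>" if "x \<in> dom C" for x
 proof -
  have "sat C (\<lambda>i. h ((e(v := x)) i)) \<phi> \<longleftrightarrow> sat C (e(v := x)) \<phi>"
   by (rule Ex.IH) (use Ex.prems that in auto)
  moreover have "(\<lambda>i. h ((e(v := x)) i)) = (\<lambda>i. h (e i))(v := h x)" by (auto simp: fun_eq_iff)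
  ultimately show ?thesis by simp
 qed
 have "(\<exists>x\<in>dom C. sat C ((\<lambda>i. h (e i))(v := x)) \<phi>) \<longleftrightarrow> (\<exists>x\<in>h ` dom C. sat C ((\<lambda>i. h (e i))(v := x)) \<phi>)"
  using auts_bij[OF assms(1)] by (simp add: bij_betw_def)
 also have "\<dots> \<longleftrightarrow> (\<exists>x\<in>dom C. sat C (e(v := x)) \<phi>)" using eq by auto
 finally show ?case by simp
qed

lemma aut_holds:
 assumes "h \<in> auts A" "\<phi> \<in> fmlas L (length xs)" "xs \<in> lists (dom C)"
 shows "holds C \<phi> (map h xs) \<longleftrightarrow> holds C \<phi> xs"
proof -
 have "xs ! v \<in> dom C" if "v \<in> fv \<phi>" for v
 proof -
  have "v < length xs" using assms(2) that by (auto simp: fmlas_def)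
  thus ?thesis using assms(3) nth_mem by (auto simp: lists_eq_set)
 qed
 hence "sat C (\<lambda>i. h (xs ! i)) \<phi> \<longleftrightarrow> sat C (nth xs) \<phi>"
  by (intro aut_sat[OF assms(1)]) (use assms(2) in \<open>auto simp: fmlas_def\<close>)
 moreover have "sat C (nth (map h xs)) \<phi> \<longleftrightarrow> sat C (\<lambda>i. h (xs ! i)) \<phi>"
  by (rule sat_cong) (use assms(2) in \<open>auto simp: fmlas_def\<close>)
 ultimately show ?thesis by (simp add: holds_def)
qed

lemma auts_inv:
 assumes "h \<in> auts A" "inC A"
 obtains g where "g \<in> auts A" "\<And>x. x \<in> dom C \<Longrightarrow> g (h x) = x" "\<And>x. x \<in> dom C \<Longrightarrow> h (g x) = x"
proof -
 let ?g = "inv_into (dom C) h"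
 have b: "bij_betw h (dom C) (dom C)" using auts_bij assms by blast
 hence gh: "?g (h x) = x" "h (?g x) = x" "?g x \<in> dom C" if "x \<in> dom C" for x
  using that bij_betw_inv_into_left bij_betw_inv_into_right bij_betwE[OF bij_betw_inv_into] by metis+
 have m: "map ?g xs \<in> tuples C n" "map h (map ?g xs) = xs" if "xs \<in> tuples C n" for xs n
  using that gh by (auto simp: tuples_def intro!: map_idI)
 have "?g \<in> auts A" unfolding auts_def automorphism_def
 proof (intro CollectI conjI ballI)
  show "bij_betw ?g (dom C) (dom C)" using b by (rule bij_betw_inv_into)
  fix f xs assume f: "f \<in> funs L" "xs \<in> tuples C (farity L f)"
  have "h (fint C f (map ?g xs)) = fint C f (map h (map ?g xs))"
   using assms(1) f(1) m(1)[OF f(2)] by (simp add: auts_def automorphism_def del: map_map)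
  hence "h (fint C f (map ?g xs)) = fint C f xs" using m(2)[OF f(2)] by simp
  moreover have "fint C f (map ?g xs) \<in> dom C"
   using struct_C f(1) m(1)[OF f(2)] by (simp add: is_struct_def)
  ultimately show "?g (fint C f xs) = fint C f (map ?g xs)" using gh(1) by metis
 next
  fix r xs assume r: "r \<in> rels L" "xs \<in> tuples C (rarity L r)"
  have "rint C r (map ?g xs) \<longleftrightarrow> rint C r (map h (map ?g xs))"
   using assms(1) r(1) m(1)[OF r(2)] by (simp add: auts_def automorphism_def del: map_map)
  thus "rint C r xs \<longleftrightarrow> rint C r (map ?g xs)" using m(2)[OF r(2)] by simp
 next
  fix a assume a: "a \<in> A"
  hence "h a = a" "a \<in> dom C" using assms by (auto simp: auts_def)
  thus "?g a = a" using gh(1)[of a] by simp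
 qed
 thus ?thesis using that gh by blast
qed

lemma auts_comp:
 assumes "g \<in> auts A" "h \<in> auts A"
 shows "g \<circ> h \<in> auts A"
 unfolding auts_def automorphism_def
proof (intro CollectI conjI ballI)
 show "bij_betw (g \<circ> h) (dom C) (dom C)"
  using assms auts_bij bij_betw_trans by blast
 fix f xs assume f: "f \<in> funs L" "xs \<in> tuples C (farity L f)"
 thus "(g \<circ> h) (fint C f xs) = fint C f (map (g \<circ> h) xs)"
  using assms auts_tup[OF assms(2) f(2)] by (simp add: auts_def automorphism_def flip: map_map)
next
 fix r xs assume r: "r \<in> rels L" "xs \<in> tuples C (rarity L r)"
 thus "rint C r xs \<longleftrightarrow> rint C r (map (g \<circ> h) xs)"
  using assms auts_tup[OF assms(2) r(2)] by (simp add: auts_def automorphism_def flip: map_map)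
next
 fix a assume "a \<in> A" thus "(g \<circ> h) a = a" using assms by (simp add: auts_def)
qed

text \<open>\<open>tp\<close> fixes the shape "tuple followed by parameters"; here entries and
  parameters may come in any order and with repetitions.\<close>

lemma tp_coords:
 assumes "tp L C A b' = tp L C A b" "length b' = length b" "\<phi> \<in> fmlas L (length ks)"
  "set ks \<subseteq> {..<length b} <+> A"
 shows "holds C \<phi> (map (case_sum (nth b') id) ks) \<longleftrightarrow> holds C \<phi> (map (case_sum (nth b) id) ks)"
proof -
 obtain cs \<phi>' where cs: "cs \<in> lists A" "\<phi>' \<in> fmlas L (length b + length cs)"
  "\<And>M :: ('f, 'r, 'u) struct. \<And>d. length d = length b \<Longrightarrow>
   holds M \<phi>' (d @ cs) \<longleftrightarrow> holds M \<phi> (map (case_sum (nth d) id) ks)"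
  using fm_coords[OF assms(3,4)] by blast
 have "(\<phi>', cs) \<in> tp L C A b' \<longleftrightarrow> (\<phi>', cs) \<in> tp L C A b" using assms(1) by simp
 hence "holds C \<phi>' (b' @ cs) \<longleftrightarrow> holds C \<phi>' (b @ cs)"
  using cs(1,2) assms(2) by (simp add: tp_def)
 thus ?thesis using cs(3) assms(2) by simp
qed

text \<open>Equal types make the map that takes \<open>b\<close> to \<open>b'\<close> and fixes
  \<open>A\<close> elementary, and strong homogeneity extends it.\<close>

lemma tp_aut:
 assumes A: "inC A" "small A" and b: "b \<in> lists (dom C)" "b' \<in> lists (dom C)"
  and tp: "tp L C A b' = tp L C A b" and len: "length b' = length b"
 obtains h where "h \<in> auts A" "map h b = b'"
proof -
 \<comment> \<open>\<open>b\<close> may repeat entries and may meet \<open>A\<close>. The equations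
   \<open>b ! i = b ! j\<close> and \<open>b ! i = a\<close> belong to the type, so neither the
   chosen position nor the overlap with \<open>A\<close> causes a conflict.\<close>
 define g where "g x = (if \<exists>i<length b. b ! i = x then b' ! (SOME i. i < length b \<and> b ! i = x) else x)" for x
 have eq: "b ! i = b ! j \<longleftrightarrow> b' ! i = b' ! j" if "i < length b" "j < length b" for i j
  using tp_coords[OF tp len, of "Eq (Var 0) (Var 1)" "[Inl i, Inl j]"] that
  by (auto simp: fmlas_def holds_def Plus_def)
 have eqA: "b ! i = a \<longleftrightarrow> b' ! i = a" if "i < length b" "a \<in> A" for i a
  using tp_coords[OF tp len, of "Eq (Var 0) (Var 1)" "[Inl i, Inr a]"] that
  by (auto simp: fmlas_def holds_def Plus_def)
 have gb: "g (b ! i) = b' ! i" if "i < length b" for i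
 proof -
  let ?j = "SOME j. j < length b \<and> b ! j = b ! i"
  have "?j < length b \<and> b ! ?j = b ! i" by (rule someI[of _ i]) (use that in simp)
  hence "b' ! ?j = b' ! i" using eq that by metis
  thus ?thesis using that by (auto simp: g_def)
 qed
 have gA: "g a = a" if "a \<in> A" for a
 proof (cases "\<exists>i<length b. b ! i = a")
  case True
  then obtain i where "i < length b" "b ! i = a" by blast
  thus ?thesis using gb eqA that by metis
 qed (auto simp: g_def)
 have "elem_map L C (A \<union> set b) g" unfolding elem_map_def
 proof (intro conjI ballI)
  show "inC (A \<union> set b)" using A b by (auto simp: lists_eq_set)
  have "g x \<in> dom C" if x: "x \<in> set b" for x
  proof -
   obtain i where "i < length b" "b ! i = x" using x by (auto simp: in_set_conv_nth)
   thus ?thesis using gb b(2) len by (metis in_lists_conv_set nth_mem)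
  qed
  thus "inC (g ` (A \<union> set b))" using gA A by auto
  fix c \<phi> assume c: "c \<in> lists (A \<union> set b)" and \<phi>: "\<phi> \<in> fmlas L (length c)"
  define k where "k x = (if x \<in> A then Inr x else Inl (SOME i. i < length b \<and> b ! i = x))" for x
  have k: "k x \<in> {..<length b} <+> A \<and> case_sum (nth b) id (k x) = x \<and> case_sum (nth b') id (k x) = g x"
   if "x \<in> A \<union> set b" for x
  proof (cases "x \<in> A")
   case True thus ?thesis using gA by (simp add: k_def InrI)
  next
   case False
   hence "\<exists>i. i < length b \<and> b ! i = x" using that by (auto simp: in_set_conv_nth)
   hence "(SOME i. i < length b \<and> b ! i = x) < length b \<and> b ! (SOME i. i < length b \<and> b ! i = x) = x"
    by (rule someI_ex)
   moreover from this have "g x = b' ! (SOME i. i < length b \<and> b ! i = x)" using gb by metis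
   ultimately show ?thesis using False by (simp add: k_def InlI)
  qed
  have "holds C \<phi> (map (case_sum (nth b') id) (map k c)) \<longleftrightarrow> holds C \<phi> (map (case_sum (nth b) id) (map k c))"
   by (rule tp_coords[OF tp len]) (use \<phi> c k in \<open>auto simp: lists_eq_set\<close>)
  moreover have "map (case_sum (nth b') id) (map k c) = map g c"
   using c k by (auto simp: lists_eq_set)
  moreover have "map (case_sum (nth b) id) (map k c) = c"
   using c k by (auto simp: lists_eq_set intro!: map_idI)
  ultimately show "holds C \<phi> c \<longleftrightarrow> holds C \<phi> (map g c)" by (simp only:)
 qed
 moreover have "small (A \<union> set b)" by (intro small_Un A small_finite) simp
 ultimately obtain h where h: "automorphism L C h" "\<forall>a\<in>A \<union> set b. h a = g a"
  using hom unfolding strongly_homogeneous_def by blast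
 have "h \<in> auts A" using h gA by (auto simp: auts_def)
 moreover have "map h b = b'"
  by (rule nth_equalityI) (use h gb len in auto)
 ultimately show ?thesis using that by blast
qed

lemma aut_tp:
 assumes "h \<in> auts A" "inC A" "b \<in> lists (dom C)"
 shows "tp L C A (map h b) = tp L C A b"
proof -
 have "holds C \<phi> (map h b @ c) \<longleftrightarrow> holds C \<phi> (b @ c)"
  if "c \<in> lists A" "\<phi> \<in> fmlas L (length b + length c)" for \<phi> c
  using aut_holds[OF assms(1), of \<phi> "b @ c"] that assms auts_fix[OF assms(1) that(1)]
  by (auto simp: lists_eq_set)
 thus ?thesis unfolding tp_def by auto
qed

subsection \<open>Dividing and forking\<close>

definition kinc :: "nat \<Rightarrow> ('f, 'r) fm \<Rightarrow> nat \<Rightarrow> (nat \<Rightarrow> 'u list) \<Rightarrow> bool" where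
 "kinc m \<phi> k s \<longleftrightarrow> (\<forall>S. finite S \<and> card S = k \<longrightarrow> \<not> (\<exists>y\<in>tup m. \<forall>i\<in>S. holds C \<phi> (s i @ y)))"

text \<open>Dividing with prescribed degree of inconsistency \<open>k\<close>. Over a small set, the
  tuples with the type of \<open>b\<close> are its images under automorphisms, and automorphisms are
  easier to compose, invert and restrict than sequences of tuples. The degree stays visible because
  both the rank and the stable case depend on it.\<close>

definition kdiv :: "'u set \<Rightarrow> nat \<Rightarrow> nat \<Rightarrow> ('f, 'r) fm \<Rightarrow> 'u list \<Rightarrow> bool" where
 "kdiv A m k \<phi> b \<longleftrightarrow> (\<exists>h. (\<forall>i. h i \<in> auts A) \<and> kinc m \<phi> k (\<lambda>i. map (h i) b))"

lemma kincD: "kinc m \<phi> k s \<Longrightarrow> finite S \<Longrightarrow> card S = k \<Longrightarrow> y \<in> tup m \<Longrightarrow> \<forall>i\<in>S. holds C \<phi> (s i @ y) \<Longrightarrow> False"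
 unfolding kinc_def by blast

lemma kinc_mono:
 assumes "kinc m \<phi> k s" "k \<le> k'"
 shows "kinc m \<phi> k' s"
 unfolding kinc_def
proof (intro allI impI notI)
 fix S assume S: "finite S \<and> card S = k'" and "\<exists>y\<in>tup m. \<forall>i\<in>S. holds C \<phi> (s i @ y)"
 then obtain y where y: "y \<in> tup m" "\<forall>i\<in>S. holds C \<phi> (s i @ y)" by blast
 obtain S' where "S' \<subseteq> S" "card S' = k" using obtain_subset_with_card_n[of k S] S assms(2) by auto
 thus False using kincD[OF assms(1), of S' y] y S finite_subset by blast
qed

lemma kinc_subseq:
 assumes "kinc m \<phi> k s" "inj r"
 shows "kinc m \<phi> k (\<lambda>i. s (r i))"
 unfolding kinc_def
proof (intro allI impI notI)
 fix S assume S: "finite S \<and> card S = k" and "\<exists>y\<in>tup m. \<forall>i\<in>S. holds C \<phi> (s (r i) @ y)"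
 then obtain y where y: "y \<in> tup m" "\<forall>i\<in>S. holds C \<phi> (s (r i) @ y)" by blast
 have "card (r ` S) = k" using S assms(2) by (simp add: card_image inj_on_subset)
 thus False using kincD[OF assms(1), of "r ` S" y] y S by auto
qed

lemma kinc_aut:
 assumes "kinc m \<phi> k s" "g \<in> auts {}" "\<And>i. s i \<in> tup p" "\<phi> \<in> fmlas L (p + m)"
 shows "kinc m \<phi> k (\<lambda>i. map g (s i))"
 unfolding kinc_def
proof (intro allI impI notI)
 fix S :: "nat set" assume S: "finite S \<and> card S = k" and "\<exists>y\<in>tup m. \<forall>i\<in>S. holds C \<phi> (map g (s i) @ y)"
 then obtain y where y: "y \<in> tup m" "\<forall>i\<in>S. holds C \<phi> (map g (s i) @ y)" by blast
 obtain g' where g': "g' \<in> auts {}" "\<And>x. x \<in> dom C \<Longrightarrow> g' (g x) = x" "\<And>x. x \<in> dom C \<Longrightarrow> g (g' x) = x"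
  using auts_inv[OF assms(2)] by auto
 have y': "map g' y \<in> tup m" "map g (map g' y) = y"
  using y(1) g' auts_tup[OF g'(1)] by (auto simp: tuples_def intro!: map_idI)
 have "holds C \<phi> (s i @ map g' y)" if "i \<in> S" for i
 proof -
  have "holds C \<phi> (map g (s i) @ map g (map g' y))" using y(2) that y'(2) by simp
  hence "holds C \<phi> (map g (s i @ map g' y))" by (simp only: map_append)
  moreover have "s i @ map g' y \<in> lists (dom C)" "\<phi> \<in> fmlas L (length (s i @ map g' y))"
   using assms(3)[of i] y'(1) assms(4) by (auto simp: tuples_def lists_eq_set)
  ultimately show ?thesis using aut_holds[OF assms(2)] by blast
 qed
 thus False using kincD[OF assms(1) _ _ y'(1)] S by blast
qed

lemma kdiv_base: "kdiv A' m k \<phi> b \<Longrightarrow> A \<subseteq> A' \<Longrightarrow> kdiv A m k \<phi> b"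
 unfolding kdiv_def using auts_mono by blast

lemma kdivI:
 assumes "inC A" "small A" "b \<in> lists (dom C)"
  "\<And>i. s i \<in> tup (length b)" "\<And>i. tp L C A (s i) = tp L C A b" "kinc m \<phi> k s"
 shows "kdiv A m k \<phi> b"
proof -
 have "\<exists>h. h \<in> auts A \<and> map h b = s i" for i
 proof -
  have "s i \<in> lists (dom C)" "length (s i) = length b"
   using assms(4)[of i] by (auto simp: tuples_def)
  thus ?thesis using tp_aut[OF assms(1-3) _ assms(5)] by metis
 qed
 then obtain h where h: "\<And>i. h i \<in> auts A" "\<And>i. map (h i) b = s i" by metis
 hence "kinc m \<phi> k (\<lambda>i. map (h i) b)" using assms(6) by simp
 thus ?thesis using h(1) unfolding kdiv_def by blast
qed

text \<open>Smallness of \<open>A\<close> enters because tuples of equal type over \<open>A\<close>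
  have to be conjugate.\<close>

lemma divides_kdiv:
 assumes "inC A" "small A" "b \<in> lists (dom C)"
 shows "divides L C A m \<phi> b \<longleftrightarrow> (\<exists>k. kdiv A m k \<phi> b)"
proof
 assume "divides L C A m \<phi> b"
 then obtain k s where "\<forall>i. s i \<in> tup (length b) \<and> tp L C A (s i) = tp L C A b" "kinc m \<phi> k s"
  unfolding divides_def kinc_def by blast
 thus "\<exists>k. kdiv A m k \<phi> b" using kdivI[OF assms, of s] by blast
next
 assume "\<exists>k. kdiv A m k \<phi> b"
 then obtain k h where h: "\<And>i. h i \<in> auts A" "kinc m \<phi> k (\<lambda>i. map (h i) b)"
  unfolding kdiv_def by blast
 have "map (h i) b \<in> tup (length b) \<and> tp L C A (map (h i) b) = tp L C A b" for i
  using auts_dom_lists[OF h(1) assms(3)] aut_tp[OF h(1) assms(1,3)]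
  by (auto simp: tuples_def lists_eq_set)
 thus "divides L C A m \<phi> b"
  unfolding divides_def using h(2) unfolding kinc_def
  by (intro exI[of _ k] exI[of _ "\<lambda>i. map (h i) b"]) blast
qed

text \<open>The automorphisms over \<open>A\<close> that witness dividing are conjugated by
  \<open>g\<close>.\<close>

lemma kdiv_aut:
 assumes "kdiv A m k \<phi> b" "g \<in> auts {}" "inC A" "b \<in> lists (dom C)" "\<phi> \<in> fms b m"
 shows "kdiv (g ` A) m k \<phi> (map g b)"
proof -
 obtain h where h: "\<And>i. h i \<in> auts A" "kinc m \<phi> k (\<lambda>i. map (h i) b)"
  using assms(1) unfolding kdiv_def by blast
 obtain g' where g': "g' \<in> auts {}" "\<And>x. x \<in> dom C \<Longrightarrow> g' (g x) = x" "\<And>x. x \<in> dom C \<Longrightarrow> g (g' x) = x"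
  using auts_inv[OF assms(2)] by auto
 have "g \<circ> h i \<circ> g' \<in> auts (g ` A)" for i
 proof -
  have "g \<circ> h i \<circ> g' \<in> auts {}"
   using auts_comp[OF auts_comp[OF assms(2) auts_empty[OF h(1)]] g'(1)] .
  moreover have "(g \<circ> h i \<circ> g') (g a) = g a" if "a \<in> A" for a
  proof -
   have "h i a = a" using h(1)[of i] that by (simp add: auts_def)
   thus ?thesis using g'(2) that assms(3) by auto
  qed
  ultimately show ?thesis by (auto simp: auts_def)
 qed
 moreover have "kinc m \<phi> k (\<lambda>i. map (g \<circ> h i \<circ> g') (map g b))"
 proof -
  have eq: "map (g \<circ> h i \<circ> g') (map g b) = map g (map (h i) b)" for i
   using g'(2) assms(4) by (auto simp: lists_eq_set)
  have "map (h i) b \<in> tup (length b)" for i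
   using auts_dom_lists[OF h(1) assms(4)] by (auto simp: tuples_def lists_eq_set)
  thus ?thesis unfolding eq by (rule kinc_aut[OF h(2) assms(2) _ assms(5)])
 qed
 ultimately show ?thesis unfolding kdiv_def by (intro exI[of _ "\<lambda>i. g \<circ> h i \<circ> g'"]) blast
qed

text \<open>Forking for an arbitrary set of tuples instead of a formula. The sets that fork over
  \<open>A\<close> form an ideal, and differences of solution sets need no formula of their
  own.\<close>

definition forkset :: "'u set \<Rightarrow> nat \<Rightarrow> 'u list set \<Rightarrow> bool" where
 "forkset A m Y \<longleftrightarrow> (\<exists>\<Psi>. finite \<Psi> \<and>
   (\<forall>(\<psi>, c)\<in>\<Psi>. c \<in> lists (dom C) \<and> \<psi> \<in> fms c m \<and> (\<exists>k. kdiv A m k \<psi> c)) \<and>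
   (\<forall>y\<in>Y. \<exists>(\<psi>, c)\<in>\<Psi>. holds C \<psi> (c @ y)))"

definition sols :: "nat \<Rightarrow> ('f, 'r) fm \<Rightarrow> 'u list \<Rightarrow> 'u list set" where
 "sols m \<phi> b = {y\<in>tup m. holds C \<phi> (b @ y)}"

abbreviation fork :: "'u set \<Rightarrow> nat \<Rightarrow> ('f, 'r) fm \<Rightarrow> 'u list \<Rightarrow> bool" where
 "fork A m \<phi> b \<equiv> forkset A m (sols m \<phi> b)"

lemma ball_Collect_conj: "(\<forall>y\<in>{y\<in>Y. P y}. Q y) \<longleftrightarrow> (\<forall>y\<in>Y. P y \<longrightarrow> Q y)"
 by blast

lemma forks_forkset:
 assumes "inC A" "small A"
 shows "forks L C A m \<phi> b \<longleftrightarrow> fork A m \<phi> b"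
proof -
 have "(\<forall>(\<psi>, c)\<in>\<Psi>. c \<in> lists (dom C) \<and> \<psi> \<in> fms c m \<and> divides L C A m \<psi> c)
  \<longleftrightarrow> (\<forall>(\<psi>, c)\<in>\<Psi>. c \<in> lists (dom C) \<and> \<psi> \<in> fms c m \<and> (\<exists>k. kdiv A m k \<psi> c))" for \<Psi>
 proof (rule ball_cong[OF refl])
  fix x assume "x \<in> \<Psi>"
  obtain \<psi> c where x: "x = (\<psi>, c)" by (cases x)
  show "(case x of (\<psi>, c) \<Rightarrow> c \<in> lists (dom C) \<and> \<psi> \<in> fms c m \<and> divides L C A m \<psi> c)
   \<longleftrightarrow> (case x of (\<psi>, c) \<Rightarrow> c \<in> lists (dom C) \<and> \<psi> \<in> fms c m \<and> (\<exists>k. kdiv A m k \<psi> c))"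
   unfolding x prod.case using divides_kdiv[OF assms, of c m \<psi>] by blast
 qed
 thus ?thesis unfolding forks_def forkset_def sols_def
  by (simp only: ball_Collect_conj)
qed

lemma forkset_mono: "forkset A m Y \<Longrightarrow> Y' \<subseteq> Y \<Longrightarrow> forkset A m Y'"
 unfolding forkset_def by (meson subsetD)

lemma forkset_Un:
 assumes "forkset A m Y" "forkset A m Z"
 shows "forkset A m (Y \<union> Z)"
proof -
 obtain \<Psi> where 1: "finite \<Psi>"
   "\<forall>(\<psi>, c)\<in>\<Psi>. c \<in> lists (dom C) \<and> \<psi> \<in> fms c m \<and> (\<exists>k. kdiv A m k \<psi> c)"
   "\<forall>y\<in>Y. \<exists>(\<psi>, c)\<in>\<Psi>. holds C \<psi> (c @ y)" using assms(1) unfolding forkset_def by (elim exE conjE) (rule that)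
 obtain \<Phi> where 2: "finite \<Phi>"
   "\<forall>(\<psi>, c)\<in>\<Phi>. c \<in> lists (dom C) \<and> \<psi> \<in> fms c m \<and> (\<exists>k. kdiv A m k \<psi> c)"
   "\<forall>y\<in>Z. \<exists>(\<psi>, c)\<in>\<Phi>. holds C \<psi> (c @ y)" using assms(2) unfolding forkset_def by (elim exE conjE) (rule that)
 show ?thesis unfolding forkset_def
 proof (intro exI[of _ "\<Psi> \<union> \<Phi>"] conjI)
  show "finite (\<Psi> \<union> \<Phi>)" using 1 2 by simp
  show "\<forall>(\<psi>, c)\<in>\<Psi> \<union> \<Phi>. c \<in> lists (dom C) \<and> \<psi> \<in> fms c m \<and> (\<exists>k. kdiv A m k \<psi> c)"
   using 1(2) 2(2) by (simp only: ball_Un)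
  show "\<forall>y\<in>Y \<union> Z. \<exists>(\<psi>, c)\<in>\<Psi> \<union> \<Phi>. holds C \<psi> (c @ y)"
   using 1(3) 2(3) by (simp only: ball_Un bex_Un) blast
 qed
qed

lemma forkset_empty: "forkset A m {}"
 unfolding forkset_def by (intro exI[of _ "{}"]) simp

lemma forkset_UN: "finite I \<Longrightarrow> (\<And>i. i \<in> I \<Longrightarrow> forkset A m (Y i)) \<Longrightarrow> forkset A m (\<Union>i\<in>I. Y i)"
 by (induction I rule: finite_induct) (auto intro: forkset_empty forkset_Un)

lemma forkset_base: "forkset A' m Y \<Longrightarrow> A \<subseteq> A' \<Longrightarrow> forkset A m Y"
 unfolding forkset_def
proof (elim exE conjE)
 fix \<Psi> assume "A \<subseteq> A'" "finite \<Psi>"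
  "\<forall>(\<psi>, c)\<in>\<Psi>. c \<in> lists (dom C) \<and> \<psi> \<in> fms c m \<and> (\<exists>k. kdiv A' m k \<psi> c)"
  "\<forall>y\<in>Y. \<exists>(\<psi>, c)\<in>\<Psi>. holds C \<psi> (c @ y)"
 thus "\<exists>\<Psi>. finite \<Psi> \<and>
   (\<forall>(\<psi>, c)\<in>\<Psi>. c \<in> lists (dom C) \<and> \<psi> \<in> fms c m \<and> (\<exists>k. kdiv A m k \<psi> c)) \<and>
   (\<forall>y\<in>Y. \<exists>(\<psi>, c)\<in>\<Psi>. holds C \<psi> (c @ y))"
 proof (intro exI[of _ \<Psi>] conjI)
  show "\<forall>(\<psi>, c)\<in>\<Psi>. c \<in> lists (dom C) \<and> \<psi> \<in> fms c m \<and> (\<exists>k. kdiv A m k \<psi> c)"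
  proof clarify
   fix \<psi> c assume "(\<psi>, c) \<in> \<Psi>"
   then obtain k where "c \<in> lists (dom C)" "\<psi> \<in> fms c m" "kdiv A' m k \<psi> c"
    using \<open>\<forall>(\<psi>, c)\<in>\<Psi>. c \<in> lists (dom C) \<and> \<psi> \<in> fms c m \<and> (\<exists>k. kdiv A' m k \<psi> c)\<close>
    by blast
   thus "c \<in> lists (dom C) \<and> \<psi> \<in> fms c m \<and> (\<exists>k. kdiv A m k \<psi> c)"
    using kdiv_base \<open>A \<subseteq> A'\<close> by blast
  qed
 qed
qed

lemma kdiv_forkset:
 assumes "kdiv A m k \<phi> b" "b \<in> lists (dom C)" "\<phi> \<in> fms b m"
 shows "fork A m \<phi> b"
 unfolding forkset_def using assms by (intro exI[of _ "{(\<phi>, b)}"]) (auto simp: sols_def)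

lemma forkset_finite_cover:
 assumes "\<And>\<psi> c. (\<psi>, c) \<in> \<Psi> \<Longrightarrow> c \<in> lists (dom C) \<and> \<psi> \<in> fms c m \<and> (\<exists>k. kdiv A m k \<psi> c)"
  "finite \<Psi>" "\<And>y. y \<in> Y \<Longrightarrow> \<exists>(\<psi>, c)\<in>\<Psi>. holds C \<psi> (c @ y)"
 shows "forkset A m Y"
 unfolding forkset_def using assms by (intro exI[of _ \<Psi>]) auto

text \<open>The map on tuples may permute, repeat and drop coordinates and insert constants from
  \<open>A\<close>. Each covering formula is composed with it; the inserted constants
  \<open>cs\<close> become parameters, which automorphisms over \<open>A\<close> do not move, so the
  degree of inconsistency survives.\<close>

lemma forkset_pullback:
 assumes "forkset A n Z" "set ks \<subseteq> {..<m} <+> A" "length ks = n" "inC A"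
 shows "forkset A m {y\<in>tup m. map (case_sum (nth y) id) ks \<in> Z}"
proof -
 obtain \<Psi> where 1: "finite \<Psi>"
   "\<forall>(\<psi>, c)\<in>\<Psi>. c \<in> lists (dom C) \<and> \<psi> \<in> fms c n \<and> (\<exists>k. kdiv A n k \<psi> c)"
   "\<forall>y\<in>Z. \<exists>(\<psi>, c)\<in>\<Psi>. holds C \<psi> (c @ y)" using assms(1) unfolding forkset_def by (elim exE conjE) (rule that)
 have "finite {a. Inr a \<in> set ks}"
  by (rule finite_surj[of "set ks" _ projr]) force+
 then obtain cs where cs: "set cs = {a. Inr a \<in> set ks}" using finite_list by blast
 have csA: "cs \<in> lists A" using cs assms(2) by (auto simp: lists_eq_set Plus_def)
 have csC: "cs \<in> lists (dom C)" using csA assms(4) by (auto simp: lists_eq_set)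
 have "\<exists>\<psi>'. \<psi>' \<in> fmlas L (length c + length cs + m) \<and>
   (\<forall>c'\<in>tup (length c). \<forall>y\<in>tup m. holds C \<psi>' (c' @ cs @ y) \<longleftrightarrow> holds C \<psi> (c' @ map (case_sum (nth y) id) ks))"
  if "\<psi> \<in> fms c n" for \<psi> and c :: "'u list"
 proof -
  \<comment> \<open>Names: \<open>Inl\<close> for the parameters of \<open>\<psi>\<close>,
    \<open>Inr \<circ> Inr\<close> for the inserted constants, \<open>Inr \<circ> Inl\<close> for
    the new variables.\<close>
  let ?V = "map Inl [0..<length c] @ map (Inr \<circ> Inr) cs @ map (Inr \<circ> Inl) [0..<m]"
  let ?W = "map Inl [0..<length c] @ map Inr ks"
  have "set ?W \<subseteq> set ?V"
  proof -
   have "Inr ` set ks \<subseteq> set ?V"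
   proof
    fix x assume "x \<in> (Inr ` set ks :: (nat + nat + 'u) set)"
    then obtain k where k: "x = Inr k" "k \<in> set ks" by auto
    thus "x \<in> set ?V" using assms(2) by (cases k) (auto simp: cs Plus_def)
   qed
   thus ?thesis by auto
  qed
  moreover have "\<psi> \<in> fmlas L (length ?W)" using that assms(3) by simp
  ultimately have "dfn L (set ?V) (\<lambda>(M :: ('f, 'r, 'u) struct) a. holds M \<psi> (map a ?W))"
   by (intro dfn_holds)
  then obtain \<psi>' where \<psi>': "\<psi>' \<in> fmlas L (length ?V)"
   "\<And>(M :: ('f, 'r, 'u) struct) a. holds M \<psi> (map a ?W) \<longleftrightarrow> holds M \<psi>' (map a ?V)"
   by (rule dfn_to_fm) (rule that)
  have "holds C \<psi>' (c' @ cs @ y) \<longleftrightarrow> holds C \<psi> (c' @ map (case_sum (nth y) id) ks)"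
   if "c' \<in> tup (length c)" "y \<in> tup m" for c' y
  proof -
   let ?a = "case_sum (nth c') (case_sum (nth y) id)"
   have 1: "map (nth c') [0..<length c] = c'" "map (nth y) [0..<m] = y"
    using that map_nth[of c'] map_nth[of y] by (auto simp: tuples_def)
   have "map ?a ?V = c' @ cs @ y" by (simp add: 1 comp_def)
   moreover have "map ?a ?W = c' @ map (case_sum (nth y) id) ks" by (simp add: 1 case_sum_o_inj)
   ultimately show ?thesis using \<psi>'(2)[of C ?a] by (simp only:)
  qed
  moreover have "\<psi>' \<in> fmlas L (length c + length cs + m)" using \<psi>'(1) by (simp add: add.assoc)
  ultimately show ?thesis by blast
 qed
 hence "\<forall>\<psi> (c :: 'u list). \<exists>\<psi>'. \<psi> \<in> fms c n \<longrightarrow> \<psi>' \<in> fmlas L (length c + length cs + m) \<and>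
   (\<forall>c'\<in>tup (length c). \<forall>y\<in>tup m. holds C \<psi>' (c' @ cs @ y) \<longleftrightarrow> holds C \<psi> (c' @ map (case_sum (nth y) id) ks))"
  by blast
 then obtain F where "\<forall>\<psi> (c :: 'u list). \<psi> \<in> fms c n \<longrightarrow> F \<psi> c \<in> fmlas L (length c + length cs + m) \<and>
   (\<forall>c'\<in>tup (length c). \<forall>y\<in>tup m. holds C (F \<psi> c) (c' @ cs @ y) \<longleftrightarrow> holds C \<psi> (c' @ map (case_sum (nth y) id) ks))"
  unfolding choice_iff by (elim exE) (rule that)
 hence F: "\<And>\<psi> (c :: 'u list). \<psi> \<in> fms c n \<Longrightarrow> F \<psi> c \<in> fmlas L (length c + length cs + m)"
  "\<And>\<psi> (c :: 'u list) c' y. \<psi> \<in> fms c n \<Longrightarrow> c' \<in> tup (length c) \<Longrightarrow> y \<in> tup m \<Longrightarrow>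
    holds C (F \<psi> c) (c' @ cs @ y) \<longleftrightarrow> holds C \<psi> (c' @ map (case_sum (nth y) id) ks)"
  by blast+
 have tupks: "map (case_sum (nth y) id) ks \<in> tup n" if "y \<in> tup m" for y
 proof -
  have "case_sum (nth y) id k \<in> dom C" if "k \<in> set ks" for k
  proof (cases k)
   case (Inl i)
   hence "i < length y" using that assms(2) \<open>y \<in> tup m\<close> by (auto simp: tuples_def Plus_def)
   hence "y ! i \<in> set y" by simp
   thus ?thesis using \<open>y \<in> tup m\<close> Inl by (auto simp: tuples_def)
  next
   case (Inr a)
   thus ?thesis using that assms(2,4) by (auto simp: Plus_def)
  qed
  thus ?thesis using assms(3) by (auto simp: tuples_def)
 qed
 show ?thesis
 proof (rule forkset_finite_cover[where \<Psi> = "(\<lambda>(\<psi>, c). (F \<psi> c, c @ cs)) ` \<Psi>"])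
  show "finite ((\<lambda>(\<psi>, c). (F \<psi> c, c @ cs)) ` \<Psi>)" using 1(1) by simp
  fix \<psi>' c' assume "(\<psi>', c') \<in> (\<lambda>(\<psi>, c). (F \<psi> c, c @ cs)) ` \<Psi>"
  then obtain \<psi> c where *: "(\<psi>, c) \<in> \<Psi>" "\<psi>' = F \<psi> c" "c' = c @ cs" by auto
  have c: "c \<in> lists (dom C)" "\<psi> \<in> fms c n" "\<exists>k. kdiv A n k \<psi> c" using 1(2) *(1) by auto
  obtain k h where h: "\<And>i. h i \<in> auts A" "kinc n \<psi> k (\<lambda>i. map (h i) c)"
   using c(3) unfolding kdiv_def by blast
  have hc: "map (h i) c \<in> tup (length c)" for i
   using auts_dom_lists[OF h(1) c(1)] by (auto simp: tuples_def lists_eq_set)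
  have "kinc m (F \<psi> c) k (\<lambda>i. map (h i) (c @ cs))" unfolding kinc_def
  proof (intro allI impI notI)
   fix S :: "nat set" assume S: "finite S \<and> card S = k"
    and "\<exists>y\<in>tup m. \<forall>i\<in>S. holds C (F \<psi> c) (map (h i) (c @ cs) @ y)"
   then obtain y where y: "y \<in> tup m" "\<forall>i\<in>S. holds C (F \<psi> c) (map (h i) (c @ cs) @ y)" by blast
   have "holds C \<psi> (map (h i) c @ map (case_sum (nth y) id) ks)" if "i \<in> S" for i
   proof -
    have "map (h i) cs = cs" using auts_fix[OF h(1) csA] .
    hence "holds C (F \<psi> c) (map (h i) c @ cs @ y)" using y(2) that by fastforce
    thus ?thesis using F(2)[OF c(2) hc y(1)] by blast
   qed
   thus False using kincD[OF h(2) _ _ tupks[OF y(1)]] S by blast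
  qed
  hence "kdiv A m k \<psi>' c'" unfolding kdiv_def using h(1) * by blast
  thus "c' \<in> lists (dom C) \<and> \<psi>' \<in> fms c' m \<and> (\<exists>k. kdiv A m k \<psi>' c')"
   using * F(1)[OF c(2)] csC c(1) by auto
 next
  fix y assume "y \<in> {y\<in>tup m. map (case_sum (nth y) id) ks \<in> Z}"
  hence y: "y \<in> tup m" "map (case_sum (nth y) id) ks \<in> Z" by auto
  obtain \<psi> c where *: "(\<psi>, c) \<in> \<Psi>" "holds C \<psi> (c @ map (case_sum (nth y) id) ks)" using 1(3) y(2) by blast
  have c: "c \<in> tup (length c)" "\<psi> \<in> fms c n" using 1(2) *(1) by (auto simp: tuples_def lists_eq_set)
  have "holds C (F \<psi> c) ((c @ cs) @ y)" using F(2)[OF c(2,1) y(1)] *(2) by simp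
  thus "\<exists>(\<psi>, c)\<in>(\<lambda>(\<psi>, c). (F \<psi> c, c @ cs)) ` \<Psi>. holds C \<psi> (c @ y)"
   using *(1) by (intro bexI[of _ "(F \<psi> c, c @ cs)"]) force+
 qed
qed

subsection \<open>A rank that simplicity makes finite\<close>

text \<open>A local rank: \<open>D m Y \<sigma>\<close> says that \<open>Y\<close> has rank at least
  the word \<open>\<sigma>\<close>. A letter (\<phi>, p, k) asks for infinitely many k-inconsistent
  instances of \<open>\<phi>\<close>, each of which leaves a part of \<open>Y\<close> whose rank is
  at least the rest of the word. The instances need not be conjugate, so the rank does not refer to
  a base.\<close>

fun D :: "nat \<Rightarrow> 'u list set \<Rightarrow> (('f, 'r) fm \<times> nat \<times> nat) list \<Rightarrow> bool" where
 "D m Y [] \<longleftrightarrow> Y \<noteq> {}"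
| "D m Y ((\<phi>, p, k) # \<sigma>) \<longleftrightarrow> (\<exists>s. (\<forall>i. s i \<in> tup p) \<and> kinc m \<phi> k s \<and>
   (\<forall>i :: nat. D m (Y \<inter> {y. holds C \<phi> (s i @ y)}) \<sigma>))"

lemma D_ConsI:
 assumes "\<And>i. s i \<in> tup p" "kinc m \<phi> k s" "\<And>i :: nat. D m (Y \<inter> {y. holds C \<phi> (s i @ y)}) \<sigma>"
 shows "D m Y ((\<phi>, p, k) # \<sigma>)"
 unfolding D.simps using assms by (intro exI[of _ s]) simp

lemma D_mono: "D m Y \<sigma> \<Longrightarrow> Y \<subseteq> Z \<Longrightarrow> D m Z \<sigma>"
proof (induction \<sigma> arbitrary: Y Z)
 case (Cons x \<sigma>)
 obtain \<phi> p k where x: "x = (\<phi>, p, k)" by (cases x)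
 obtain s where s: "\<forall>i. s i \<in> tup p" "kinc m \<phi> k s" "\<forall>i :: nat. D m (Y \<inter> {y. holds C \<phi> (s i @ y)}) \<sigma>"
  using Cons.prems(1) unfolding x by auto
 have "D m (Z \<inter> {y. holds C \<phi> (s i @ y)}) \<sigma>" for i
  by (rule Cons.IH[OF spec[OF s(3), of i]]) (use Cons.prems(2) in auto)
 thus ?case unfolding x using s by auto
qed auto

text \<open>One of the two parts inherits the rank for infinitely many instances, and a subsequence
  of a k-inconsistent sequence is k-inconsistent.\<close>

lemma D_Un: "D m (Y \<union> Z) \<sigma> \<Longrightarrow> D m Y \<sigma> \<or> D m Z \<sigma>"
proof (induction \<sigma> arbitrary: Y Z)
 case (Cons x \<sigma>)
 obtain \<phi> p k where x: "x = (\<phi>, p, k)" by (cases x)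
 obtain s where s: "\<forall>i. s i \<in> tup p" "kinc m \<phi> k s" "\<forall>i :: nat. D m ((Y \<union> Z) \<inter> {y. holds C \<phi> (s i @ y)}) \<sigma>"
  using Cons.prems unfolding x by auto
 let ?W = "\<lambda>V. {i. D m (V \<inter> {y. holds C \<phi> (s i @ y)}) \<sigma>}"
 have *: "D m V (x # \<sigma>)" if inf: "infinite (?W V)" for V
 proof -
  obtain r :: "nat \<Rightarrow> nat" where r: "strict_mono r" "\<And>n. r n \<in> ?W V"
   using infinite_enumerate[OF inf] by blast
  have "kinc m \<phi> k (\<lambda>i. s (r i))" using kinc_subseq[OF s(2)] r(1) strict_mono_imp_inj_on by blast
  thus ?thesis unfolding x using s(1) r(2) by auto
 qed
 have "D m (Y \<inter> {y. holds C \<phi> (s i @ y)}) \<sigma> \<or> D m (Z \<inter> {y. holds C \<phi> (s i @ y)}) \<sigma>" for i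
  using Cons.IH[of "Y \<inter> {y. holds C \<phi> (s i @ y)}"] s(3) by (simp add: Int_Un_distrib2)
 hence "UNIV = ?W Y \<union> ?W Z" by auto
 hence "infinite (?W Y) \<or> infinite (?W Z)" using finite_Un[of "?W Y" "?W Z"] by auto
 thus ?case using * by blast
qed auto

lemma D_UN: "finite I \<Longrightarrow> D m (\<Union>i\<in>I. Y i) \<sigma> \<Longrightarrow> \<exists>i\<in>I. D m (Y i) \<sigma>"
proof (induction I rule: finite_induct)
 case empty
 have False if "D m {} \<sigma>" for \<sigma>
  using that by (induction \<sigma>) auto
 thus ?case using empty by auto
next
 case (insert i I)
 hence "D m (Y i) \<sigma> \<or> D m (\<Union>i\<in>I. Y i) \<sigma>" by (intro D_Un) simp
 thus ?case using insert by auto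
qed

lemma D_aut:
 assumes "h \<in> auts {}"
 shows "Y \<subseteq> tup m \<Longrightarrow> (\<forall>(\<phi>, p, k)\<in>set \<sigma>. \<phi> \<in> fmlas L (p + m)) \<Longrightarrow> D m Y \<sigma> \<Longrightarrow> D m (map h ` Y) \<sigma>"
proof (induction \<sigma> arbitrary: Y)
 case (Cons x \<sigma>)
 obtain \<phi> p k where x: "x = (\<phi>, p, k)" by (cases x)
 have \<phi>: "\<phi> \<in> fmlas L (p + m)" using Cons.prems(2) unfolding x by auto
 obtain g where g: "g \<in> auts {}" "\<And>x. x \<in> dom C \<Longrightarrow> g (h x) = x" "\<And>x. x \<in> dom C \<Longrightarrow> h (g x) = x"
  using auts_inv[OF assms] by auto
 obtain s where s: "\<forall>i. s i \<in> tup p" "kinc m \<phi> k s" "\<forall>i :: nat. D m (Y \<inter> {y. holds C \<phi> (s i @ y)}) \<sigma>"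
  using Cons.prems(3) unfolding x by auto
 have eq: "holds C \<phi> (map h (s i) @ map h y) \<longleftrightarrow> holds C \<phi> (s i @ y)" if "y \<in> tup m" for i y
 proof -
  have "length (s i @ y) = p + m" "s i @ y \<in> lists (dom C)"
   using that s(1) by (auto simp: tuples_def lists_eq_set)
  thus ?thesis using aut_holds[OF assms, of \<phi> "s i @ y"] \<phi> by simp
 qed
 have "kinc m \<phi> k (\<lambda>i. map h (s i))" unfolding kinc_def
 proof (intro allI impI notI)
  fix S :: "nat set" assume S: "finite S \<and> card S = k" and "\<exists>y\<in>tup m. \<forall>i\<in>S. holds C \<phi> (map h (s i) @ y)"
  then obtain y where y: "y \<in> tup m" "\<forall>i\<in>S. holds C \<phi> (map h (s i) @ y)" by blast
  have y': "map g y \<in> tup m" "map h (map g y) = y"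
   using y(1) g auts_tup[OF g(1)] by (auto simp: tuples_def intro!: map_idI)
  hence "\<forall>i\<in>S. holds C \<phi> (s i @ map g y)" using y(2) eq[OF y'(1)] by simp
  thus False using kincD[OF s(2) _ _ y'(1)] S by blast
 qed
 moreover have "D m (map h ` Y \<inter> {y. holds C \<phi> (map h (s i) @ y)}) \<sigma>" for i
 proof -
  have "D m (map h ` (Y \<inter> {y. holds C \<phi> (s i @ y)})) \<sigma>"
   by (rule Cons.IH) (use Cons.prems s(3) in auto)
  moreover have "map h ` (Y \<inter> {y. holds C \<phi> (s i @ y)}) = map h ` Y \<inter> {y. holds C \<phi> (map h (s i) @ y)}"
   using Cons.prems(1) eq by blast
  ultimately show ?thesis by simp
 qed
 moreover have "\<forall>i. map h (s i) \<in> tup p" using s(1) auts_tup[OF assms] by blast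
 ultimately show ?case unfolding x by auto
qed auto

text \<open>To skip a letter, keep its instance number 0 and forget the restriction to it.\<close>

lemma D_filter: "D m Y \<sigma> \<Longrightarrow> D m Y (filter P \<sigma>)"
proof (induction \<sigma> arbitrary: Y)
 case (Cons x \<sigma>)
 obtain \<phi> p k where x: "x = (\<phi>, p, k)" by (cases x)
 obtain s where s: "\<forall>i. s i \<in> tup p" "kinc m \<phi> k s" "\<forall>i :: nat. D m (Y \<inter> {y. holds C \<phi> (s i @ y)}) \<sigma>"
  using Cons.prems unfolding x by auto
 have *: "D m (Y \<inter> {y. holds C \<phi> (s i @ y)}) (filter P \<sigma>)" for i
  by (rule Cons.IH) (use s(3) in blast)
 show ?case
 proof (cases "P x")
  case True
  thus ?thesis using * s(1,2) unfolding x by auto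
 next
  case False
  thus ?thesis using D_mono[OF *[of 0], of Y] by simp
 qed
qed auto

lemma D_drop: "D m Y (x # \<sigma>) \<Longrightarrow> D m Y \<sigma>"
 using D_mono[of m _ \<sigma> Y] by (cases x) auto

lemma D_replicate: "D m Y (replicate N x) \<Longrightarrow> N' \<le> N \<Longrightarrow> D m Y (replicate N' x)"
proof (induction N)
 case (Suc N)
 thus ?case using D_drop[of m Y x "replicate N x"] by (cases "N' = Suc N") auto
qed simp

text \<open>The rank unfolds into a tree: the children of a node are the instances chosen after it.
  The tuple at the root is arbitrary, since the conditions on branches start at level 1.\<close>

lemma D_tree:
 "D m Y (replicate N (\<phi>, p, k)) \<Longrightarrow> \<exists>b. (\<forall>\<nu>. b \<nu> \<in> tup p) \<and>
   (\<forall>\<nu>. length \<nu> < N \<longrightarrow> kinc m \<phi> k (\<lambda>i. b (\<nu> @ [i]))) \<and>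
   (\<forall>\<nu>. length \<nu> = N \<longrightarrow> (\<exists>y\<in>Y. \<forall>j\<in>{1..N}. holds C \<phi> (b (take j \<nu>) @ y)))"
proof (induction N arbitrary: Y)
 case 0
 obtain u where "u \<in> tup p" using tup_nonempty by blast
 thus ?case using 0 by (intro exI[of _ "\<lambda>_. u"]) auto
next
 case (Suc N)
 obtain s where s: "\<forall>i. s i \<in> tup p" "kinc m \<phi> k s"
  "\<forall>i :: nat. D m (Y \<inter> {y. holds C \<phi> (s i @ y)}) (replicate N (\<phi>, p, k))"
  using Suc.prems by auto
 have "\<forall>i. \<exists>b. (\<forall>\<nu>. b \<nu> \<in> tup p) \<and>
   (\<forall>\<nu>. length \<nu> < N \<longrightarrow> kinc m \<phi> k (\<lambda>i. b (\<nu> @ [i]))) \<and>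
   (\<forall>\<nu>. length \<nu> = N \<longrightarrow> (\<exists>y\<in>Y \<inter> {y. holds C \<phi> (s i @ y)}. \<forall>j\<in>{1..N}. holds C \<phi> (b (take j \<nu>) @ y)))"
  using Suc.IH s(3) by blast
 then obtain b where b: "\<And>i \<nu>. b i \<nu> \<in> tup p"
   "\<And>i \<nu>. length \<nu> < N \<Longrightarrow> kinc m \<phi> k (\<lambda>j. b i (\<nu> @ [j]))"
   "\<And>i \<nu>. length \<nu> = N \<Longrightarrow> \<exists>y\<in>Y \<inter> {y. holds C \<phi> (s i @ y)}. \<forall>j\<in>{1..N}. holds C \<phi> (b i (take j \<nu>) @ y)"
  by metis
 define b' where "b' \<nu> = (case \<nu> of [] \<Rightarrow> s 0 | i # \<nu>' \<Rightarrow> if \<nu>' = [] then s i else b i \<nu>')" for \<nu>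
 show ?case
 proof (intro exI[of _ b'] conjI allI impI)
  show "b' \<nu> \<in> tup p" for \<nu> using s(1) b(1) by (auto simp: b'_def split: list.split)
  fix \<nu> :: "nat list" assume "length \<nu> < Suc N"
  thus "kinc m \<phi> k (\<lambda>i. b' (\<nu> @ [i]))"
   using s(2) b(2) by (cases \<nu>) (auto simp: b'_def)
 next
  fix \<nu> :: "nat list" assume "length \<nu> = Suc N"
  then obtain i \<nu>' where \<nu>: "\<nu> = i # \<nu>'" "length \<nu>' = N" by (cases \<nu>) auto
  obtain y where y: "y \<in> Y" "holds C \<phi> (s i @ y)" "\<forall>j\<in>{1..N}. holds C \<phi> (b i (take j \<nu>') @ y)"
   using b(3)[OF \<nu>(2), of i] by auto
  have "holds C \<phi> (b' (take j \<nu>) @ y)" if j: "j \<in> {1..Suc N}" for j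
  proof (cases "j = 1")
   case True thus ?thesis using y(2) \<nu> by (simp add: b'_def)
  next
   case False
   then obtain j' where j': "j = Suc j'" "j' \<in> {1..N}" using j by (cases j) auto
   hence "take j' \<nu>' \<noteq> []" using \<nu>(2) by auto
   hence "b' (take j \<nu>) = b i (take j' \<nu>')" using \<nu>(1) j'(1) by (simp add: b'_def)
   thus ?thesis using y(3) j'(2) by simp
  qed
  thus "\<exists>y\<in>Y. \<forall>j\<in>{1..Suc N}. holds C \<phi> (b' (take j \<nu>) @ y)" using y(1) by blast
 qed
qed

text \<open>Trees of every finite height yield, by compactness, a tree of infinite height, which is
  the tree property.\<close>

lemma D_finite:
 assumes \<phi>: "\<phi> \<in> fmlas L (p + m)"
 shows "\<exists>N. \<not> D m (tup m) (replicate N (\<phi>, p, k))"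
proof (rule ccontr)
 assume "\<not> ?thesis"
 hence all: "\<And>N. D m (tup m) (replicate N (\<phi>, p, k))" by blast
 \<comment> \<open>The variable (\<nu>, i) is coordinate \<open>i\<close> of the tuple at node
   \<open>\<nu>\<close>. Below, \<open>Inl\<close> conditions express k-inconsistency among the
   children of a node and \<open>Inr\<close> conditions the consistency of the path to a
   node.\<close>
 define bl where "bl \<nu> = map (Pair \<nu>) [0..<p]" for \<nu> :: "nat list"
 have bl: "length (bl \<nu>) = p" for \<nu> by (simp add: bl_def)
 let ?J = "Inl ` {(\<nu>, S). finite S \<and> card S = k} \<union> range Inr :: (nat list \<times> nat set + nat list) set"
 define E where "E j M a = (case j of
   Inl (\<nu>, S) \<Rightarrow> \<not> (\<exists>y\<in>tuples M m. \<forall>i\<in>S. holds M \<phi> (map a (bl (\<nu> @ [i])) @ y))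
  | Inr \<nu> \<Rightarrow> \<exists>y\<in>tuples M m. \<forall>j\<in>{1..length \<nu>}. holds M \<phi> (map a (bl (take j \<nu>)) @ y))"
  for j and M :: "('f, 'r, 'u) struct" and a
 have "\<exists>a. a ` UNIV \<subseteq> dom C \<and> (\<forall>x\<in>{}. a x = undefined x) \<and> (\<forall>j\<in>?J. E j C a)"
 proof (rule assignment_C)
  show "small (UNIV :: (nat list \<times> nat) set)" by (rule small_countable)
  fix j assume "j \<in> ?J"
  then consider \<nu> S where "j = Inl (\<nu>, S)" "finite S" | \<nu> where "j = Inr \<nu>" by auto
  thus "dfn L UNIV (E j)"
  proof cases
   case 1
   show ?thesis unfolding E_def 1 sum.case prod.case
    by (intro dfn_Neg dfn_ex_holds) (use 1 \<phi> bl in auto)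
  next
   case 2
   show ?thesis unfolding E_def 2 sum.case
    by (intro dfn_ex_holds) (use \<phi> bl in auto)
  qed
 next
  fix J0 assume J0: "J0 \<subseteq> ?J" "finite J0"
  define N where "N = Suc (Max (insert 0 ((\<lambda>j. case j of Inl (\<nu>, S) \<Rightarrow> length \<nu> | Inr \<nu> \<Rightarrow> length \<nu>) ` J0)))"
  have N: "(case j of Inl (\<nu>, S) \<Rightarrow> length \<nu> | Inr \<nu> \<Rightarrow> length \<nu>) < N" if "j \<in> J0" for j
   unfolding N_def less_Suc_eq_le using J0 that by (intro Max_ge) auto
  obtain b where b0: "\<forall>\<nu>. b \<nu> \<in> tup p"
   "\<forall>\<nu>. length \<nu> < N \<longrightarrow> kinc m \<phi> k (\<lambda>i. b (\<nu> @ [i]))"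
   "\<forall>\<nu>. length \<nu> = N \<longrightarrow> (\<exists>y\<in>tup m. \<forall>j\<in>{1..N}. holds C \<phi> (b (take j \<nu>) @ y))"
   using D_tree[OF all[of N]] by (elim exE conjE) (rule that)
  note b = b0[rule_format]
  obtain u where u: "u \<in> dom C" using dom_nonempty by blast
  define a where "a = (\<lambda>(\<nu>, i). if i < p then b \<nu> ! i else u)"
  have abl: "map a (bl \<nu>) = b \<nu>" for \<nu>
   using b(1)[of \<nu>] by (intro nth_equalityI) (auto simp: a_def bl_def tuples_def)
  have "E j C a" if j: "j \<in> J0" for j
  proof (cases j)
   case (Inl x)
   obtain \<nu> S where x: "x = (\<nu>, S)" by (cases x)
   have "kinc m \<phi> k (\<lambda>i. b (\<nu> @ [i]))" using N[OF j] Inl x by (intro b(2)) simp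
   moreover have "finite S \<and> card S = k" using j J0(1) Inl x by auto
   ultimately show ?thesis unfolding Inl x E_def sum.case prod.case abl kinc_def by blast
  next
   case (Inr \<nu>)
   have len: "length \<nu> < N" using N[OF j] Inr by simp
   obtain y where y: "y \<in> tup m" "\<forall>j\<in>{1..N}. holds C \<phi> (b (take j (\<nu> @ replicate (N - length \<nu>) 0)) @ y)"
    using b(3)[of "\<nu> @ replicate (N - length \<nu>) 0"] len by auto
   have "holds C \<phi> (b (take j \<nu>) @ y)" if "j \<in> {1..length \<nu>}" for j
    using bspec[OF y(2), of j] that len by simp
   thus ?thesis unfolding Inr E_def sum.case abl using y(1) by blast
  qed
  moreover have "inC (a ` UNIV)"
   using b(1) u nth_mem by (fastforce simp: a_def tuples_def)
  ultimately show "\<exists>a. a ` UNIV \<subseteq> dom C \<and> (\<forall>x\<in>{}. a x = undefined x) \<and> (\<forall>j\<in>J0. E j C a)" by blast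
 qed simp
 then obtain a where a0: "inC (range a)" "\<forall>j\<in>?J. E j C a" by (elim exE conjE) (rule that)
 note a = a0(1) bspec[OF a0(2)]
 \<comment> \<open>The tree property also constrains the root, whereas the tuple at
   \<open>[]\<close> is arbitrary here. The subtree above the child 0 has no unconstrained
   node.\<close>
 define b where "b \<nu> = map a (bl (0 # \<nu>))" for \<nu>
 have b: "b \<nu> \<in> tup p" for \<nu> using a(1) by (auto simp: b_def bl_def tuples_def)
 have "tree_property C p m \<phi>" unfolding tree_property_def
 proof (intro exI[of _ k] exI[of _ b] conjI allI impI notI)
  show "b \<nu> \<in> tup p" for \<nu> by (rule b)
  fix \<nu> :: "nat list" and S :: "nat set"
  assume "finite S \<and> card S = k" "\<exists>x\<in>tup m. \<forall>i\<in>S. holds C \<phi> (b (\<nu> @ [i]) @ x)"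
  moreover have "E (Inl (0 # \<nu>, S)) C a" using \<open>finite S \<and> card S = k\<close> by (intro a(2)) auto
  ultimately show False unfolding E_def b_def by simp blast
 next
  fix \<eta> :: "nat \<Rightarrow> nat"
  let ?n = "\<lambda>j. map \<eta> [0..<j]"
  let ?\<Phi> = "range (\<lambda>j. (\<phi>, b (?n j)))"
  have "\<exists>y\<in>tup m. \<forall>(\<phi>, c)\<in>?\<Phi>. holds C \<phi> (c @ y)"
  proof (rule sat_tuple)
   show "inC (range a)" by fact
   show "small (range a)" by (intro small_image small_countable)
   show "?\<Phi> \<subseteq> {(\<phi>, c). c \<in> lists (range a) \<and> \<phi> \<in> fms c m}"
    using \<phi> bl by (auto simp: b_def lists_eq_set)
   fix \<Phi>0 assume "\<Phi>0 \<subseteq> ?\<Phi>" "finite \<Phi>0"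
   then obtain J where J: "finite J" "\<Phi>0 = (\<lambda>j. (\<phi>, b (?n j))) ` J"
    using finite_subset_image[of \<Phi>0 "\<lambda>j. (\<phi>, b (?n j))" UNIV] by blast
   define N where "N = Max (insert 0 J)"
   have N: "j \<le> N" if "j \<in> J" for j unfolding N_def using J(1) that by (intro Max_ge) auto
   have "E (Inr (0 # ?n N)) C a" by (intro a(2)) auto
   then obtain y where y: "y \<in> tup m"
    "\<forall>j\<in>{1..length (0 # ?n N)}. holds C \<phi> (map a (bl (take j (0 # ?n N))) @ y)"
    unfolding E_def by auto
   have "holds C \<phi> (b (?n j) @ y)" if "j \<in> J" for j
   proof -
    have "take (Suc j) (0 # ?n N) = 0 # ?n j" using N[OF that] by (simp add: take_map)
    thus ?thesis using bspec[OF y(2), of "Suc j"] N[OF that] by (simp add: b_def)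
   qed
   thus "\<exists>y\<in>tup m. \<forall>(\<phi>, c)\<in>\<Phi>0. holds C \<phi> (c @ y)" unfolding J(2) using y(1) by auto
  qed
  thus "\<exists>x\<in>tup m. \<forall>j. holds C \<phi> (b (?n j) @ x)" by auto
 qed
 thus False using simple \<phi> unfolding simple_theory_def by blast
qed

subsection \<open>Existence of nonforking extensions\<close>

lemma sols_tup: "sols m \<phi> b \<subseteq> tup m"
 by (auto simp: sols_def)

text \<open>Suppose that finitely many dividing formulas cover the solution set \<open>?Y\<close>.
  As \<open>?Y\<close> is invariant over \<open>A\<close>, a covering formula that meets
  \<open>?Y\<close> in a set of rank at least \<open>\<sigma>\<close> can be moved by the
  automorphisms witnessing its division, so \<open>?Y\<close> has rank at least
  \<open>\<sigma>\<close> prolonged by that formula. Thus the rank admits arbitrarily long words in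
  a finite alphabet, and some letter exceeds its bound from \<open>D_finite\<close>.\<close>

lemma existence:
 assumes "inC A" "a \<in> lists A" "\<phi> \<in> fms a m" "sols m \<phi> a \<noteq> {}"
 shows "\<not> fork A m \<phi> a"
proof
 let ?Y = "sols m \<phi> a"
 assume "forkset A m ?Y"
 then obtain \<Psi> where \<Psi>: "finite \<Psi>"
   "\<forall>(\<psi>, c)\<in>\<Psi>. c \<in> lists (dom C) \<and> \<psi> \<in> fms c m \<and> (\<exists>k. kdiv A m k \<psi> c)"
   "\<forall>y\<in>?Y. \<exists>(\<psi>, c)\<in>\<Psi>. holds C \<psi> (c @ y)" unfolding forkset_def by (elim exE conjE) (rule that)
 define \<tau> where "\<tau> x = (fst x, length (snd x), SOME k. kdiv A m k (fst x) (snd x))"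
  for x :: "('f, 'r) fm \<times> 'u list"
 have kd: "c \<in> lists (dom C)" "\<psi> \<in> fms c m" "kdiv A m (SOME k. kdiv A m k \<psi> c) \<psi> c"
  if "(\<psi>, c) \<in> \<Psi>" for \<psi> c
  using bspec[OF \<Psi>(2) that] by (auto intro: someI_ex)
 have fm: "\<forall>(\<phi>, p, k)\<in>\<tau> ` \<Psi>. \<phi> \<in> fmlas L (p + m)" using kd(2) by (auto simp: \<tau>_def)
 have step: "\<exists>x\<in>\<Psi>. D m ?Y (\<tau> x # \<sigma>)" if \<sigma>: "D m ?Y \<sigma>" "set \<sigma> \<subseteq> \<tau> ` \<Psi>" for \<sigma>
 proof -
  have "?Y \<subseteq> (\<Union>x\<in>\<Psi>. ?Y \<inter> {y. holds C (fst x) (snd x @ y)})" using \<Psi>(3) by fastforce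
  hence "D m (\<Union>x\<in>\<Psi>. ?Y \<inter> {y. holds C (fst x) (snd x @ y)}) \<sigma>" using D_mono \<sigma>(1) by blast
  then obtain x where x: "x \<in> \<Psi>" "D m (?Y \<inter> {y. holds C (fst x) (snd x @ y)}) \<sigma>"
   using D_UN[OF \<Psi>(1)] by blast
  obtain \<psi> c where x_eq[simp]: "x = (\<psi>, c)" by (cases x)
  let ?k = "SOME k. kdiv A m k \<psi> c"
  have c: "c \<in> lists (dom C)" "\<psi> \<in> fms c m" "kdiv A m ?k \<psi> c" using kd[of \<psi> c] x by auto
  then obtain h where h: "\<And>i. h i \<in> auts A" "kinc m \<psi> ?k (\<lambda>i. map (h i) c)"
   unfolding kdiv_def by blast
  have "D m (?Y \<inter> {y. holds C \<psi> (map (h i) c @ y)}) \<sigma>" for i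
  proof (rule D_mono)
   show "D m (map (h i) ` (?Y \<inter> {y. holds C \<psi> (c @ y)})) \<sigma>"
   proof (rule D_aut[OF auts_empty[OF h(1)]])
    show "\<forall>(\<phi>, p, k)\<in>set \<sigma>. \<phi> \<in> fmlas L (p + m)" 
     by (rule ballI) (rule bspec[OF fm], rule subsetD[OF \<sigma>(2)])
   qed (use x(2) in \<open>auto simp: sols_def\<close>)
   show "map (h i) ` (?Y \<inter> {y. holds C \<psi> (c @ y)}) \<subseteq> ?Y \<inter> {y. holds C \<psi> (map (h i) c @ y)}"
   proof
    fix z assume "z \<in> map (h i) ` (?Y \<inter> {y. holds C \<psi> (c @ y)})"
    then obtain y where y: "z = map (h i) y" "y \<in> tup m" "holds C \<phi> (a @ y)" "holds C \<psi> (c @ y)"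
     by (auto simp: sols_def)
    have "a @ y \<in> lists (dom C)" "length (a @ y) = length a + m"
     "c @ y \<in> lists (dom C)" "length (c @ y) = length c + m"
     using y(2) assms(1,2) c(1) by (auto simp: tuples_def lists_eq_set)
    hence "holds C \<phi> (map (h i) (a @ y))" "holds C \<psi> (map (h i) (c @ y))"
     using aut_holds[OF h(1)] y(3,4) assms(3) c(2) by metis+
    thus "z \<in> ?Y \<inter> {y. holds C \<psi> (map (h i) c @ y)}"
     using y(1) auts_tup[OF h(1) y(2)] auts_fix[OF h(1) assms(2)] by (auto simp: sols_def)
   qed
  qed
  moreover have "map (h i) c \<in> tup (length c)" for i
   using auts_dom_lists[OF h(1) c(1)] by (auto simp: tuples_def lists_eq_set)
  ultimately have "D m ?Y (\<tau> x # \<sigma>)" using h(2) by (simp only: \<tau>_def x_eq fst_conv snd_conv) (rule D_ConsI)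
  thus ?thesis using x(1) by blast
 qed
 have all: "\<exists>\<sigma>. length \<sigma> = n \<and> set \<sigma> \<subseteq> \<tau> ` \<Psi> \<and> D m ?Y \<sigma>" for n
 proof (induction n)
  case 0 thus ?case using assms(4) by simp
 next
  case (Suc n)
  then obtain \<sigma> where \<sigma>: "length \<sigma> = n" "set \<sigma> \<subseteq> \<tau> ` \<Psi>" "D m ?Y \<sigma>" by blast
  then obtain x where "x \<in> \<Psi>" "D m ?Y (\<tau> x # \<sigma>)" using step by blast
  thus ?case using \<sigma> by (intro exI[of _ "\<tau> x # \<sigma>"]) auto
 qed
 have "\<forall>t\<in>\<tau> ` \<Psi>. \<exists>N. \<not> D m (tup m) (replicate N t)"
  using fm D_finite by fastforce
 from bchoice[OF this] obtain N where N: "\<forall>t\<in>\<tau> ` \<Psi>. \<not> D m (tup m) (replicate (N t) t)" ..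
 \<comment> \<open>A word longer than the sum of all bounds contains some letter \<open>t\<close> at
   least \<open>N t\<close> times.\<close>
 obtain \<sigma> where \<sigma>: "length \<sigma> = Suc (\<Sum>t\<in>\<tau> ` \<Psi>. N t)" "set \<sigma> \<subseteq> \<tau> ` \<Psi>" "D m ?Y \<sigma>" using all by blast
 have "sum (count_list \<sigma>) (\<tau> ` \<Psi>) = length \<sigma>" using \<sigma>(2) \<Psi>(1) by (intro sum_count_set) auto
 hence "\<exists>t\<in>\<tau> ` \<Psi>. N t \<le> count_list \<sigma> t"
  using \<sigma>(1) sum_mono[of "\<tau> ` \<Psi>" "count_list \<sigma>" N] by force
 then obtain t where t: "t \<in> \<tau> ` \<Psi>" "N t \<le> count_list \<sigma> t" by blast
 have "D m ?Y (filter ((=) t) \<sigma>)" using D_filter \<sigma>(3) by blast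
 moreover have "filter ((=) t) \<sigma> = replicate (count_list \<sigma> t) t"
  using replicate_length_same[of "filter ((=) t) \<sigma>" t] by (simp add: count_list_eq_length_filter)
 ultimately have "D m (tup m) (replicate (N t) t)"
  using D_replicate t(2) D_mono sols_tup by metis
 thus False using N t(1) by blast
qed

subsection \<open>Independence\<close>

text \<open>The counterpart of \<open>independent\<close> for sets instead of indexed
  tuples.\<close>

definition ind :: "'u set \<Rightarrow> 'u set \<Rightarrow> 'u set \<Rightarrow> bool" where
 "ind X A B \<longleftrightarrow> (\<forall>xs\<in>lists X. \<forall>b\<in>lists (A \<union> B). \<forall>\<phi>\<in>fmlas L (length b + length xs).
   holds C \<phi> (b @ xs) \<longrightarrow> \<not> fork A (length xs) \<phi> b)"

lemma ind_mono: "ind X A B \<Longrightarrow> X' \<subseteq> X \<Longrightarrow> B' \<subseteq> A \<union> B \<Longrightarrow> ind X' A B'"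
proof -
 assume *: "ind X A B" "X' \<subseteq> X" "B' \<subseteq> A \<union> B"
 hence "lists X' \<subseteq> lists X" "lists (A \<union> B') \<subseteq> lists (A \<union> B)" by (auto intro!: lists_mono)
 thus ?thesis using *(1) unfolding ind_def by blast
qed

text \<open>A formula that forks over the larger base also forks over the smaller one.\<close>

lemma ind_base:
 assumes "ind X A B" "A \<subseteq> A'" "A' \<subseteq> A \<union> B"
 shows "ind X A' B"
proof -
 have "lists (A' \<union> B) \<subseteq> lists (A \<union> B)" using assms by (intro lists_mono) auto
 thus ?thesis using assms(1) forkset_base[OF _ assms(2)] unfolding ind_def by blast
qed

text \<open>Finite character: a single formula involves finitely many elements of \<open>X\<close>
  and \<open>B\<close>.\<close>

lemma ind_finiteI:
 assumes "\<And>X0 B0. finite X0 \<Longrightarrow> X0 \<subseteq> X \<Longrightarrow> finite B0 \<Longrightarrow> B0 \<subseteq> B \<Longrightarrow> ind X0 A B0"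
 shows "ind X A B"
 unfolding ind_def
proof (intro ballI impI)
 fix xs b \<phi> assume *: "xs \<in> lists X" "b \<in> lists (A \<union> B)" "\<phi> \<in> fmlas L (length b + length xs)"
  "holds C \<phi> (b @ xs)"
 have "ind (set xs) A (set b \<inter> B)" using * by (intro assms) (auto simp: lists_eq_set)
 moreover have "xs \<in> lists (set xs)" "b \<in> lists (A \<union> (set b \<inter> B))" using *(1,2) by (auto simp: lists_eq_set)
 ultimately show "\<not> fork A (length xs) \<phi> b" using *(3,4) unfolding ind_def by blast
qed

lemma fm_params:
 assumes "\<phi> \<in> fmlas L (length ks)" "set ks \<subseteq> {..<m} <+> P"
 shows "\<exists>c\<in>lists P. \<exists>\<chi>\<in>fms c m. \<forall>y. length y = m \<longrightarrow>
  (holds C \<chi> (c @ y) \<longleftrightarrow> holds C \<phi> (map (case_sum (nth y) id) ks))"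
proof -
 have "finite {a. Inr a \<in> set ks}"
  by (rule finite_surj[of "set ks" _ projr]) force+
 then obtain cs where cs: "set cs = {a. Inr a \<in> set ks}" using finite_list by blast
 let ?ks = "map Inr cs @ map Inl [0..<m]"
 have "set ks \<subseteq> set ?ks" using assms(2) by (auto simp: cs)
 hence "dfn L (set ?ks) (\<lambda>M a. holds (M :: ('f, 'r, 'u) struct) \<phi> (map a ks))"
  by (intro dfn_holds assms(1))
 then obtain \<chi> where \<chi>: "\<chi> \<in> fmlas L (length ?ks)"
  "\<And>M :: ('f, 'r, 'u) struct. \<And>a. holds M \<phi> (map a ks) \<longleftrightarrow> holds M \<chi> (map a ?ks)"
  by (rule dfn_to_fm) (rule that)
 have "holds C \<chi> (cs @ y) \<longleftrightarrow> holds C \<phi> (map (case_sum (nth y) id) ks)" if "length y = m" for y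
 proof -
  have "map (case_sum (nth y) id) ?ks = cs @ y" using map_nth[of y] that by (simp add: comp_def)
  thus ?thesis using \<chi>(2)[of C "case_sum (nth y) id"] by simp
 qed
 moreover have "cs \<in> lists P" using cs assms(2) by (auto simp: lists_eq_set)
 moreover have "\<chi> \<in> fms cs m" using \<chi>(1) by simp
 ultimately show ?thesis by blast
qed

lemma fm_conj:
 assumes "finite \<Phi>" "\<And>\<phi> c. (\<phi>, c) \<in> \<Phi> \<Longrightarrow> c \<in> lists P \<and> \<phi> \<in> fms c m"
 shows "\<exists>c\<in>lists P. \<exists>\<chi>\<in>fms c m. \<forall>y. length y = m \<longrightarrow>
  (holds C \<chi> (c @ y) \<longleftrightarrow> (\<forall>(\<phi>, c)\<in>\<Phi>. holds C \<phi> (c @ y)))"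
proof -
 have "finite (\<Union>x\<in>\<Phi>. set (snd x))" using assms(1) by simp
 from finite_list[OF this] obtain cs where cs: "set cs = (\<Union>x\<in>\<Phi>. set (snd x))" ..
 let ?ks = "map Inr cs @ map Inl [0..<m]"
 have "dfn L (set ?ks) (\<lambda>M a. \<forall>x\<in>\<Phi>. holds (M :: ('f, 'r, 'u) struct) (fst x) (map a (map Inr (snd x) @ map Inl [0..<m])))"
 proof (intro dfn_ball assms(1))
  fix x assume x: "x \<in> \<Phi>"
  have "fst x \<in> fmlas L (length (snd x) + m)" using assms(2)[of "fst x" "snd x"] x by simp
  thus "dfn L (set ?ks) (\<lambda>M a. holds (M :: ('f, 'r, 'u) struct) (fst x) (map a (map Inr (snd x) @ map Inl [0..<m])))"
   using x cs by (intro dfn_holds) auto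
 qed
 then obtain \<chi> where \<chi>: "\<chi> \<in> fmlas L (length ?ks)"
  "\<And>M :: ('f, 'r, 'u) struct. \<And>a. (\<forall>x\<in>\<Phi>. holds M (fst x) (map a (map Inr (snd x) @ map Inl [0..<m])))
    \<longleftrightarrow> holds M \<chi> (map a ?ks)"
  by (rule dfn_to_fm) (rule that)
 have "holds C \<chi> (cs @ y) \<longleftrightarrow> (\<forall>(\<phi>, c)\<in>\<Phi>. holds C \<phi> (c @ y))" if "length y = m" for y
 proof -
  have eq: "map (case_sum (nth y) id) (map Inr c @ map Inl [0..<m]) = c @ y" for c
   using map_nth[of y] that by (simp add: comp_def)
  have "(\<forall>x\<in>\<Phi>. holds C (fst x) (snd x @ y)) \<longleftrightarrow> holds C \<chi> (cs @ y)"
   using \<chi>(2)[of C "case_sum (nth y) id"] unfolding eq .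
  thus ?thesis by (auto simp: split_beta)
 qed
 moreover have "cs \<in> lists P" using cs assms(2) by (force simp: lists_eq_set)
 moreover have "\<chi> \<in> fms cs m" using \<chi>(1) by simp
 ultimately show ?thesis by blast
qed

text \<open>It suffices to test formulas in the tuple \<open>y\<close> itself. A formula about
  another arrangement of its entries and of elements of \<open>A\<close> becomes such a formula by
  substitution, and forking is pulled back along the substitution.\<close>

lemma ind_core:
 assumes A: "inC A" and y: "y \<in> tup m"
  and nf: "\<And>c \<chi>. c \<in> lists (A \<union> B) \<Longrightarrow> \<chi> \<in> fms c m \<Longrightarrow> holds C \<chi> (c @ y) \<Longrightarrow>
   \<not> fork A m \<chi> c"
 shows "ind (set y \<union> A) A B"
 unfolding ind_def
proof (intro ballI impI notI)
 fix xs b \<phi> assume *: "xs \<in> lists (set y \<union> A)" "b \<in> lists (A \<union> B)" "\<phi> \<in> fmlas L (length b + length xs)"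
  "holds C \<phi> (b @ xs)" and f: "fork A (length xs) \<phi> b"
 have "\<forall>x\<in>set xs. \<exists>k. k \<in> {..<m} <+> A \<and> case_sum (nth y) id k = x"
 proof
  fix x assume "x \<in> set xs"
  hence "x \<in> set y \<union> A" using *(1) by (auto simp: lists_eq_set)
  hence "x \<in> A \<or> (\<exists>i<m. y ! i = x)" using y by (auto simp: in_set_conv_nth tuples_def)
  thus "\<exists>k. k \<in> {..<m} <+> A \<and> case_sum (nth y) id k = x"
  proof
   assume "x \<in> A" thus ?thesis by (intro exI[of _ "Inr x"]) (simp add: InrI)
  next
   assume "\<exists>i<m. y ! i = x" 
   then obtain i where "i < m" "y ! i = x" by blast
   thus ?thesis by (intro exI[of _ "Inl i"]) (simp add: InlI)
  qed
 qed
 from bchoice[OF this] obtain k where k: "\<And>x. x \<in> set xs \<Longrightarrow> k x \<in> {..<m} <+> A"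
  "\<And>x. x \<in> set xs \<Longrightarrow> case_sum (nth y) id (k x) = x" by blast
 let ?ks = "map k xs"
 have ks: "set ?ks \<subseteq> {..<m} <+> A" "map (case_sum (nth y) id) ?ks = xs"
  using k by (auto intro!: map_idI)
 have "set (map Inr b @ ?ks) \<subseteq> {..<m} <+> (A \<union> B)" using ks(1) *(2) by (auto simp: lists_eq_set Plus_def)
 moreover have "\<phi> \<in> fmlas L (length (map Inr b @ ?ks))" using *(3) by simp
 ultimately obtain c \<chi> where c: "c \<in> lists (A \<union> B)" "\<chi> \<in> fms c m"
  "\<And>y. length y = m \<Longrightarrow> holds C \<chi> (c @ y) \<longleftrightarrow> holds C \<phi> (map (case_sum (nth y) id) (map Inr b @ ?ks))"
  using fm_params by metis
 have eq: "map (case_sum (nth y') id) (map Inr b @ ?ks) = b @ map (case_sum (nth y') id) ?ks" for y'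
  by (simp add: comp_def)
 have "length y = m" using y by (simp add: tuples_def)
 hence "holds C \<chi> (c @ y)" using c(3)[of y] *(4) unfolding eq ks(2) by blast
 moreover have "fork A m \<chi> c"
 proof (rule forkset_mono[OF forkset_pullback[OF f ks(1) _ A]])
  show "sols m \<chi> c \<subseteq> {y \<in> tup m. map (case_sum ((!) y) id) ?ks \<in> sols (length xs) \<phi> b}"
  proof
   fix y' assume y': "y' \<in> sols m \<chi> c"
   hence "y' \<in> tup m" "length y' = m" "holds C \<chi> (c @ y')" by (auto simp: sols_def tuples_def)
   moreover have "map (case_sum (nth y') id) ?ks \<in> tup (length xs)"
   proof -
    have "case_sum (nth y') id (k x) \<in> dom C" if "x \<in> set xs" for x
    proof (cases "k x")
     case (Inl i)
     hence "y' ! i \<in> set y'" using k(1)[OF that] \<open>length y' = m\<close> by auto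
     thus ?thesis using Inl \<open>y' \<in> tup m\<close> by (auto simp: tuples_def)
    next
     case (Inr a)
     thus ?thesis using k(1)[OF that] A by auto
    qed
    thus ?thesis by (auto simp: tuples_def)
   qed
   ultimately show "y' \<in> {y \<in> tup m. map (case_sum ((!) y) id) ?ks \<in> sols (length xs) \<phi> b}"
    using c(3)[of y'] unfolding eq sols_def by blast
  qed
 qed simp
 ultimately show False using nf[OF c(1,2)] by blast
qed

lemma ind_addA:
 assumes "ind X A B" "inC A" "inC X"
 shows "ind (X \<union> A) A B"
proof (rule ind_finiteI)
 fix X0 B0 assume *: "finite X0" "X0 \<subseteq> X \<union> A" "finite B0" "B0 \<subseteq> B"
 have "finite (X0 \<inter> X)" using * by simp
 then obtain y where y: "set y = X0 \<inter> X" using finite_list by blast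
 have "ind (set y \<union> A) A B"
 proof (rule ind_core[OF assms(2)])
  show "y \<in> tup (length y)" using y assms(3) by (auto simp: tuples_def)
  fix c \<chi> assume "c \<in> lists (A \<union> B)" "\<chi> \<in> fmlas L (length c + length y)" "holds C \<chi> (c @ y)"
  moreover have "y \<in> lists X" using y by (auto simp: lists_eq_set)
  ultimately show "\<not> fork A (length y) \<chi> c" using assms(1) unfolding ind_def by blast
 qed
 thus "ind X0 A B0" by (rule ind_mono) (use * y in auto)
qed

lemma ind_empty:
 assumes "inC A" "inC X"
 shows "ind X A {}"
 unfolding ind_def
proof (intro ballI impI)
 fix xs b \<phi> assume *: "xs \<in> lists X" "b \<in> lists (A \<union> {})" "\<phi> \<in> fmlas L (length b + length xs)" "holds C \<phi> (b @ xs)"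
 have "xs \<in> sols (length xs) \<phi> b" using * assms by (auto simp: sols_def tuples_def lists_eq_set)
 thus "\<not> fork A (length xs) \<phi> b" using * assms(1) by (intro existence) auto
qed

text \<open>Add the negations of all formulas over \<open>A \<union> B\<close> that fork over
  \<open>A\<close>. Finitely many forking formulas cannot cover a set that does not fork, so the
  enlarged set is finitely satisfiable.\<close>

lemma nonforking_realization:
 assumes A: "inC A" "small A" and B: "inC B" "small B"
  and \<Phi>: "\<Phi> \<subseteq> {(\<phi>, c). c \<in> lists (A \<union> B) \<and> \<phi> \<in> fms c m}"
  and nf: "\<And>\<Phi>0. \<Phi>0 \<subseteq> \<Phi> \<Longrightarrow> finite \<Phi>0 \<Longrightarrow> \<not> forkset A m {y\<in>tup m. \<forall>(\<phi>, c)\<in>\<Phi>0. holds C \<phi> (c @ y)}"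
 shows "\<exists>y\<in>tup m. (\<forall>(\<phi>, c)\<in>\<Phi>. holds C \<phi> (c @ y)) \<and> ind (set y \<union> A) A B"
proof -
 define F where "F = {(\<chi>, c). c \<in> lists (A \<union> B) \<and> \<chi> \<in> fms c m \<and> fork A m \<chi> c}"
 let ?N = "(\<lambda>(\<chi>, c). (Neg \<chi>, c)) ` F"
 have "\<exists>y\<in>tup m. \<forall>(\<phi>, c)\<in>\<Phi> \<union> ?N. holds C \<phi> (c @ y)"
 proof (rule sat_tuple[of "A \<union> B"])
  show "inC (A \<union> B)" using A B by blast
  show "small (A \<union> B)" using A B small_Un by blast
  show "\<Phi> \<union> ?N \<subseteq> {(\<phi>, c). c \<in> lists (A \<union> B) \<and> \<phi> \<in> fms c m}"
   using \<Phi> by (auto simp: F_def fmlas_Neg)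
  fix \<Phi>0 assume \<Phi>0: "\<Phi>0 \<subseteq> \<Phi> \<union> ?N" "finite \<Phi>0"
  have "\<Phi>0 - \<Phi> \<subseteq> ?N" "finite (\<Phi>0 - \<Phi>)" using \<Phi>0 by auto
  then obtain F0 where F0: "F0 \<subseteq> F" "finite F0" "\<Phi>0 - \<Phi> = (\<lambda>(\<chi>, c). (Neg \<chi>, c)) ` F0"
   using finite_subset_image[of "\<Phi>0 - \<Phi>" "\<lambda>(\<chi>, c). (Neg \<chi>, c)" F] by blast
  let ?Y = "{y\<in>tup m. \<forall>(\<phi>, c)\<in>\<Phi>0 \<inter> \<Phi>. holds C \<phi> (c @ y)}"
  have "\<not> forkset A m ?Y" using \<Phi>0 by (intro nf) auto
  moreover have "forkset A m (\<Union>x\<in>F0. sols m (fst x) (snd x))"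
   using F0(1,2) by (intro forkset_UN) (auto simp: F_def)
  ultimately have "\<not> ?Y \<subseteq> (\<Union>x\<in>F0. sols m (fst x) (snd x))" using forkset_mono by blast
  then obtain y where y: "y \<in> ?Y" "y \<notin> (\<Union>x\<in>F0. sols m (fst x) (snd x))" by blast
  have "holds C \<phi> (c @ y)" if "(\<phi>, c) \<in> \<Phi>0" for \<phi> c
  proof (cases "(\<phi>, c) \<in> \<Phi>")
   case True thus ?thesis using y(1) that by auto
  next
   case False
   hence "(\<phi>, c) \<in> (\<lambda>(\<chi>, c). (Neg \<chi>, c)) ` F0" using that F0(3) by blast
   then obtain \<chi> where "\<phi> = Neg \<chi>" "(\<chi>, c) \<in> F0" by auto
   thus ?thesis using y by (force simp: sols_def holds_Neg)
  qed
  thus "\<exists>y\<in>tup m. \<forall>(\<phi>, c)\<in>\<Phi>0. holds C \<phi> (c @ y)" using y(1) by blast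
 qed
 then obtain y where y: "y \<in> tup m" "\<forall>(\<phi>, c)\<in>\<Phi> \<union> ?N. holds C \<phi> (c @ y)" by blast
 have "ind (set y \<union> A) A B"
 proof (rule ind_core[OF A(1) y(1)], rule notI)
  fix c \<chi> assume c: "c \<in> lists (A \<union> B)" "\<chi> \<in> fms c m" "holds C \<chi> (c @ y)" "fork A m \<chi> c"
  hence "(\<chi>, c) \<in> F" by (simp add: F_def)
  hence "(Neg \<chi>, c) \<in> \<Phi> \<union> ?N" by force
  thus False using bspec[OF y(2), of "(Neg \<chi>, c)"] c(3) by (simp add: holds_Neg)
 qed
 thus ?thesis using y by (intro bexI[of _ y]) auto
qed

text \<open>One inclusion is enough, because a type contains each formula or its negation.\<close>

lemma tp_eqI:
 assumes "length y = length x" "\<And>\<phi> c. c \<in> lists A \<Longrightarrow> \<phi> \<in> fmlas L (length c + length x) \<Longrightarrow>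
   holds C \<phi> (c @ x) \<Longrightarrow> holds C \<phi> (c @ y)"
 shows "tp L C A y = tp L C A x"
proof -
 have "holds C \<phi> (y @ c)" if c: "c \<in> lists A" "\<phi> \<in> fmlas L (length x + length c)" "holds C \<phi> (x @ c)" for \<phi> c
 proof -
  let ?ks = "map Inl [0..<length x] @ map Inr c"
  have "set ?ks \<subseteq> {..<length x} <+> A" using c(1) by (auto simp: lists_eq_set)
  moreover have "\<phi> \<in> fmlas L (length ?ks)" using c(2) by simp
  ultimately obtain c' \<chi> where c': "c' \<in> lists A" "\<chi> \<in> fmlas L (length c' + length x)"
   "\<And>y. length y = length x \<Longrightarrow> holds C \<chi> (c' @ y) \<longleftrightarrow> holds C \<phi> (map (case_sum (nth y) id) ?ks)"
   using fm_params by metis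
  have eq: "map (case_sum (nth y) id) ?ks = y @ c" if "length y = length x" for y
   using map_nth[of y] that by (simp add: comp_def)
  show ?thesis using assms(2)[OF c'(1,2)] c'(3)[of x] c'(3)[of y] eq[of x] eq[of y] assms(1) c(3) by simp
 qed
 moreover from this have "holds C \<phi> (x @ c)" if "c \<in> lists A" "\<phi> \<in> fmlas L (length x + length c)" "holds C \<phi> (y @ c)" for \<phi> c
  using that by (metis fmlas_Neg holds_Neg)
 ultimately show ?thesis unfolding tp_def using assms(1) by auto
qed

text \<open>The type of \<open>X\<close> over \<open>A \<union> B\<close> does not fork over
  \<open>A\<close>, so it has a realization independent from the larger set; by homogeneity the
  realization is an image of \<open>X\<close>.\<close>

lemma ind_extend:
 assumes A: "inC A" "small A" and B: "inC B" "small B" and B': "inC B'" "small B'"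
  and X: "finite X" "inC X" and ind: "ind X A B"
 shows "\<exists>h\<in>auts (A \<union> B). ind (h ` X) A (B \<union> B')"
proof -
 obtain x where x: "set x = X" using X finite_list by blast
 let ?\<Phi> = "{(\<phi>, c). c \<in> lists (A \<union> B) \<and> \<phi> \<in> fmlas L (length c + length x) \<and> holds C \<phi> (c @ x)}"
 have xX: "x \<in> lists X" "x \<in> tup (length x)" using x X by (auto simp: lists_eq_set tuples_def)
 have "\<exists>y\<in>tup (length x). (\<forall>(\<phi>, c)\<in>?\<Phi>. holds C \<phi> (c @ y)) \<and> ind (set y \<union> A) A (B \<union> B')"
 proof (rule nonforking_realization[OF A])
  show "inC (B \<union> B')" "small (B \<union> B')" using B B' small_Un by auto
  show "?\<Phi> \<subseteq> {(\<phi>, c). c \<in> lists (A \<union> (B \<union> B')) \<and> \<phi> \<in> fmlas L (length c + length x)}"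
   by (auto simp: lists_eq_set)
  fix \<Phi>0 assume \<Phi>0: "\<Phi>0 \<subseteq> ?\<Phi>" "finite \<Phi>0"
  obtain c \<chi> where c: "c \<in> lists (A \<union> B)" "\<chi> \<in> fmlas L (length c + length x)"
   "\<And>y. length y = length x \<Longrightarrow> holds C \<chi> (c @ y) \<longleftrightarrow> (\<forall>(\<phi>, c)\<in>\<Phi>0. holds C \<phi> (c @ y))"
   using fm_conj[OF \<Phi>0(2), of "A \<union> B" "length x"] \<Phi>0(1) by blast
  have "holds C \<chi> (c @ x)" using c(3)[of x] \<Phi>0(1) by auto
  hence "\<not> fork A (length x) \<chi> c" using ind c(1,2) xX(1) unfolding ind_def by blast
  moreover have "sols (length x) \<chi> c = {y\<in>tup (length x). \<forall>(\<phi>, c)\<in>\<Phi>0. holds C \<phi> (c @ y)}"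
   unfolding sols_def by (rule Collect_cong) (auto simp: c(3) tuples_def)
  ultimately show "\<not> forkset A (length x) {y\<in>tup (length x). \<forall>(\<phi>, c)\<in>\<Phi>0. holds C \<phi> (c @ y)}" by simp
 qed
 then obtain y where y: "y \<in> tup (length x)" "\<forall>(\<phi>, c)\<in>?\<Phi>. holds C \<phi> (c @ y)" "ind (set y \<union> A) A (B \<union> B')"
  by (elim bexE conjE) (rule that)
 have "tp L C (A \<union> B) y = tp L C (A \<union> B) x"
  by (rule tp_eqI) (use y(1,2) in \<open>auto simp: tuples_def\<close>)
 moreover have "x \<in> lists (dom C)" "y \<in> lists (dom C)" "length y = length x"
  using xX(2) y(1) by (auto simp: tuples_def lists_eq_set)
 moreover have "inC (A \<union> B)" "small (A \<union> B)" using A B small_Un by auto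
 ultimately obtain h where h: "h \<in> auts (A \<union> B)" "map h x = y" using tp_aut by metis
 have "ind (h ` X) A (B \<union> B')"
  by (rule ind_mono[OF y(3)]) (use h(2) x in auto)
 thus ?thesis using h(1) by blast
qed

text \<open>A substitute for Morley sequences: each image of \<open>X\<close> is independent from
  its predecessors and from \<open>B\<close>, but the sequence need not be indiscernible.\<close>

lemma ind_sequence:
 assumes A: "inC A" "small A" and B: "inC B" "small B"
  and X: "finite X" "inC X" and ind: "ind X A B"
 obtains h :: "nat \<Rightarrow> 'u \<Rightarrow> 'u" where "\<And>i. h i \<in> auts (A \<union> B)" "\<And>i. ind (h i ` X) A (B \<union> (\<Union>j<i. h j ` X))"
proof -
 define P where "P f i r \<longleftrightarrow> r \<in> auts (A \<union> B) \<and> ind (r ` X) A (B \<union> (\<Union>j<i. f j ` X))"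
  for f :: "nat \<Rightarrow> 'u \<Rightarrow> 'u" and i r
 have "\<exists>h. \<forall>i. P h i (h i)"
 proof (rule dependent_wf_choice[OF wf_less])
  fix f g :: "nat \<Rightarrow> 'u \<Rightarrow> 'u" and i r assume "\<And>j. (j, i) \<in> {(x, y). x < y} \<Longrightarrow> f j = g j"
  thus "P f i r = P g i r" by (simp add: P_def)
 next
  fix i f assume "\<And>j. (j, i) \<in> {(x, y). x < y} \<Longrightarrow> P f j (f j)"
  hence f: "\<And>j. j < i \<Longrightarrow> f j \<in> auts (A \<union> B)" by (simp add: P_def)
  have "(\<Union>j<i. f j ` X) \<subseteq> dom C" using auts_dom[OF f] X(2) by blast
  moreover have "small (\<Union>j<i. f j ` X)" using X(1) by (intro small_finite) simp
  ultimately show "\<exists>r. P f i r" unfolding P_def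
   using ind_extend[OF A B _ _ X ind] by blast
 qed
 thus ?thesis using that unfolding P_def by blast
qed

subsection \<open>Independent sequences refute dividing\<close>

text \<open>Compactness provides a k-inconsistent sequence \<open>t\<close> and one tuple
  \<open>w\<close> such that each \<open>t i\<close> together with \<open>w\<close> has the type of
  \<open>b\<close> and \<open>a\<close> over \<open>A\<close>; an automorphism moving
  \<open>w\<close> to \<open>a\<close> then yields conjugates of \<open>b\<close> over
  \<open>A\<close> and \<open>a\<close>. The system is finitely satisfiable because a formula true
  of \<open>a\<close> over \<open>A\<close> and \<open>b\<close> does not divide over
  \<open>A\<close> to any degree \<open>K\<close>: some \<open>K\<close> of the given conjugates of
  \<open>b\<close> admit a common solution.\<close>

lemma kdiv_extend_base:
 assumes A: "inC A" "small A" and b: "b \<in> tup p" and a: "a \<in> tup q" and \<phi>: "\<phi> \<in> fmlas L (p + m)"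
  and kd: "kdiv A m k \<phi> b" and ind: "ind (set a) A (set b)"
 shows "kdiv (A \<union> set a) m k \<phi> b"
proof -
 obtain h where h: "\<And>i. h i \<in> auts A" "kinc m \<phi> k (\<lambda>i. map (h i) b)"
  using kd unfolding kdiv_def by blast
 define s where "s i = map (h i) b" for i
 have s: "s i \<in> tup p" for i using auts_tup[OF h(1) b] by (simp add: s_def)
 \<comment> \<open>Block 0 names the coordinates of \<open>w\<close>, block \<open>Suc i\<close>
   those of the \<open>i\<close>th member of the sequence.\<close>
 define V where "V i n = map (\<lambda>j. Inl (i, j) :: nat \<times> nat + 'u) [0..<n]" for i n
 have V: "length (V i n) = n" for i n by (simp add: V_def)
 let ?X = "range Inl \<union> Inr ` A :: (nat \<times> nat + 'u) set"
 let ?\<Phi> = "{(\<chi>, c). c \<in> lists A \<and> \<chi> \<in> fmlas L (length c + (p + q)) \<and> holds C \<chi> (c @ (b @ a))}"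
 let ?J = "Inl ` {S. finite S \<and> card S = k} \<union> Inr ` (UNIV \<times> ?\<Phi>) :: (nat set + nat \<times> ('f, 'r) fm \<times> 'u list) set"
 define E where "E j M e = (case j of
   Inl S \<Rightarrow> \<not> (\<exists>y\<in>tuples M m. \<forall>i\<in>S. holds M \<phi> (map e (V (Suc i) p) @ y))
  | Inr (i, \<chi>, c) \<Rightarrow> holds M \<chi> (map e (map Inr c @ V (Suc i) p @ V 0 q)))"
  for j and M :: "('f, 'r, 'u) struct" and e
 have "\<exists>e. e ` ?X \<subseteq> dom C \<and> (\<forall>x\<in>Inr ` A. e x = projr x) \<and> (\<forall>j\<in>?J. E j C e)"
 proof (rule assignment_C)
  show "small ?X" by (intro small_Un small_image small_countable A)
  fix j assume "j \<in> ?J"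
  then consider S where "j = Inl S" "finite S"
   | i \<chi> c where "j = Inr (i, \<chi>, c)" "c \<in> lists A" "\<chi> \<in> fmlas L (length c + (p + q))" by auto
  thus "dfn L ?X (E j)"
  proof cases
   case 1
   show ?thesis unfolding E_def 1 sum.case
    by (intro dfn_Neg dfn_ex_holds) (use 1 \<phi> V in \<open>auto simp: V_def\<close>)
  next
   case 2
   show ?thesis unfolding E_def 2 sum.case prod.case
    by (intro dfn_holds) (use 2 V in \<open>auto simp: V_def lists_eq_set\<close>)
  qed
 next
  fix J0 assume J0: "J0 \<subseteq> ?J" "finite J0"
  define \<Phi>0 where "\<Phi>0 = {x. \<exists>i. Inr (i, x) \<in> J0}"
  have "\<Phi>0 \<subseteq> (\<lambda>j. snd (projr j)) ` J0" unfolding \<Phi>0_def by force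
  hence fin0: "finite \<Phi>0" using J0(2) finite_surj by blast
  have sub0: "\<Phi>0 \<subseteq> ?\<Phi>" using J0(1) unfolding \<Phi>0_def by auto
  obtain c \<chi> where c: "c \<in> lists A" "\<chi> \<in> fmlas L (length c + (p + q))"
   "\<And>y. length y = p + q \<Longrightarrow> holds C \<chi> (c @ y) \<longleftrightarrow> (\<forall>(\<phi>, c)\<in>\<Phi>0. holds C \<phi> (c @ y))"
   using fm_conj[OF fin0, of A "p + q"] sub0 by blast
  have len: "length (b @ a) = p + q" using a b by (simp add: tuples_def)
  have hold: "holds C \<chi> ((c @ b) @ a)" using c(3)[OF len] sub0 by auto
  \<comment> \<open>The indices that the finite subsystem mentions. The degree \<open>K\<close> is
    chosen above all of them, so that the subsystem can be interpreted by any \<open>K\<close>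
    members of the given sequence.\<close>
  define KK where "KK = (\<Union>j\<in>J0. case j of Inl S \<Rightarrow> S | Inr (i, x) \<Rightarrow> {i})"
  have "finite KK" unfolding KK_def using J0 by (intro finite_UN_I) (auto split: sum.splits)
  then obtain K where "\<forall>n\<in>KK. n < K" unfolding finite_nat_set_iff_bounded by (elim exE) (rule that)
  hence K: "KK \<subseteq> {..<K}" by blast
  have "\<not> kdiv A q K \<chi> (c @ b)"
  proof
   assume *: "kdiv A q K \<chi> (c @ b)"
   have "c @ b \<in> lists (dom C)" using c(1) A(1) b by (auto simp: lists_eq_set tuples_def)
   hence "fork A q \<chi> (c @ b)"
    using * c(2) b by (intro kdiv_forkset[OF *]) (auto simp: tuples_def add.assoc)
   moreover have "c @ b \<in> lists (A \<union> set b)" "a \<in> lists (set a)" "length a = q"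
    "\<chi> \<in> fmlas L (length (c @ b) + length a)"
    using c(1,2) a b by (auto simp: lists_eq_set tuples_def add.assoc)
   ultimately show False using ind hold unfolding ind_def by blast
  qed
  hence "\<not> kinc q \<chi> K (\<lambda>i. map (h i) (c @ b))" unfolding kdiv_def using h(1) by blast
  then obtain S y where S: "finite S" "card S = K" "y \<in> tup q" "\<forall>i\<in>S. holds C \<chi> (map (h i) (c @ b) @ y)"
   unfolding kinc_def by blast
  obtain r where r: "bij_betw r {..<K} S" using S(1,2) ex_bij_betw_nat_finite[OF S(1)] by (auto simp: atLeast0LessThan)
  obtain u where u: "u \<in> dom C" using dom_nonempty by blast
  define e where "e = (\<lambda>x. case x of Inl (i, j) \<Rightarrow>
    (if i = 0 then (if j < q then y ! j else u) else if j < p then s (r (i - 1)) ! j else u) | Inr x \<Rightarrow> x)"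
  have eV: "map e (V (Suc i) p) = s (r i)" "map e (V 0 q) = y" for i
   using s[of "r i"] S(3) by (auto intro!: nth_equalityI simp: e_def V_def tuples_def)
  have ein: "map e (map Inr c) = c" for c by (auto intro!: map_idI simp: e_def)
  have "E j C e" if j: "j \<in> J0" for j
  proof (cases j)
   case (Inl S')
   have S': "finite S'" "card S' = k" using j J0(1) Inl by auto
   have "S' \<subseteq> KK" using j Inl unfolding KK_def by force
   hence "S' \<subseteq> {..<K}" using K by blast
   hence "card (r ` S') = k" using S'(2) r by (metis bij_betw_def card_image inj_on_subset)
   hence "\<not> (\<exists>y\<in>tup m. \<forall>i\<in>r ` S'. holds C \<phi> (s i @ y))"
    using h(2) S'(1) unfolding kinc_def s_def by blast
   thus ?thesis unfolding Inl E_def sum.case eV by blast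
  next
   case (Inr x)
   obtain i \<psi> d where x: "x = (i, \<psi>, d)" by (cases x)
   have "i \<in> KK" using j Inr x unfolding KK_def by force
   hence "r i \<in> S" using K r by (auto simp: bij_betw_def)
   hence "holds C \<chi> (map (h (r i)) (c @ b) @ y)" using S(4) by blast
   hence "holds C \<chi> (c @ (s (r i) @ y))" using auts_fix[OF h(1) c(1)] by (simp add: s_def)
   moreover have "length (s (r i) @ y) = p + q" using s S(3) by (simp add: tuples_def)
   ultimately have "\<forall>(\<phi>, c)\<in>\<Phi>0. holds C \<phi> (c @ (s (r i) @ y))" using c(3) by blast
   moreover have "(\<psi>, d) \<in> \<Phi>0" using j Inr x by (auto simp: \<Phi>0_def)
   ultimately show ?thesis unfolding Inr x E_def sum.case prod.case map_append eV ein by auto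
  qed
  moreover have "inC (e ` ?X)"
  proof -
   have "y ! j \<in> dom C" if "j < q" for j using S(3) that nth_mem[of j y] by (auto simp: tuples_def)
   moreover have "s (r (i - 1)) ! j \<in> dom C" if "j < p" for i j
    using s[of "r (i - 1)"] that nth_mem[of j "s (r (i - 1))"] by (auto simp: tuples_def)
   ultimately have "e (Inl (i, j)) \<in> dom C" for i j using u by (simp add: e_def)
   moreover have "e (Inr x) = x" for x by (simp add: e_def)
   ultimately show ?thesis using A(1) by auto
  qed
  ultimately show "\<exists>e. e ` ?X \<subseteq> dom C \<and> (\<forall>x\<in>Inr ` A. e x = projr x) \<and> (\<forall>j\<in>J0. E j C e)"
   by (intro exI[of _ e]) (auto simp: e_def)
 qed auto
 then obtain e where e: "inC (e ` ?X)" "\<forall>x\<in>Inr ` A. e x = projr x" "\<forall>j\<in>?J. E j C e"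
  by (elim exE conjE) (rule that)
 define w where "w = map e (V 0 q)"
 define t where "t i = map e (V (Suc i) p)" for i
 have w: "w \<in> tup q" and t: "t i \<in> tup p" for i
  using e(1) by (auto simp: w_def t_def V_def tuples_def)
 have tw: "tp L C A (t i @ w) = tp L C A (b @ a)" for i
 proof (rule tp_eqI)
  show "length (t i @ w) = length (b @ a)" using w t a b by (simp add: tuples_def)
  fix \<chi> c assume c: "c \<in> lists A" "\<chi> \<in> fmlas L (length c + length (b @ a))" "holds C \<chi> (c @ b @ a)"
  have "(\<chi>, c) \<in> ?\<Phi>" using c a b by (simp add: tuples_def)
  hence "E (Inr (i, \<chi>, c)) C e" using e(3) by blast
  moreover have "map e (map Inr c) = c" using e(2) c(1) by (auto intro!: map_idI simp: lists_eq_set)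
  ultimately show "holds C \<chi> (c @ t i @ w)"
   unfolding E_def sum.case prod.case map_append w_def t_def by simp
 qed
 have inc: "kinc m \<phi> k t" unfolding kinc_def
 proof (intro allI impI)
  fix S :: "nat set" assume "finite S \<and> card S = k"
  hence "Inl S \<in> ?J" by blast
  hence "E (Inl S) C e" using e(3) by blast
  thus "\<not> (\<exists>y\<in>tup m. \<forall>i\<in>S. holds C \<phi> (t i @ y))" unfolding E_def sum.case t_def .
 qed
 have L: "length (t i @ w) = length (b @ a)" "t i @ w \<in> lists (dom C)" "b @ a \<in> lists (dom C)" for i
  using w t[of i] a b by (auto simp: tuples_def lists_eq_set)
 obtain g where g: "g \<in> auts A" "map g (t 0 @ w) = b @ a"
  using tp_aut[OF A L(2,3) tw[symmetric] L(1)[symmetric]] by blast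
 have gw: "map g w = a" using g(2) w t[of 0] a b by (auto simp: tuples_def)
 have gt: "map g (t i) @ a \<in> lists (dom C)" "tp L C A (map g (t i) @ a) = tp L C A (b @ a)" for i
 proof -
  have eq: "map g (t i) @ a = map g (t i @ w)" using gw by simp
  show "map g (t i) @ a \<in> lists (dom C)" unfolding eq by (rule auts_dom_lists[OF g(1) L(2)])
  show "tp L C A (map g (t i) @ a) = tp L C A (b @ a)"
   unfolding eq using aut_tp[OF g(1) A(1) L(2)] tw by simp
 qed
 have "\<exists>f. f \<in> auts A \<and> map f (b @ a) = map g (t i) @ a" for i
 proof -
  have "length (map g (t i) @ a) = length (b @ a)" using t[of i] b by (simp add: tuples_def)
  thus ?thesis using tp_aut[OF A L(3) gt[of i]] by blast
 qed
 then obtain f where f: "\<And>i. f i \<in> auts A" "\<And>i. map (f i) (b @ a) = map g (t i) @ a" by metis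
 have fb: "map (f i) b = map g (t i)" "map (f i) a = a" for i
  using f(2)[of i] t[of i] b by (auto simp: tuples_def)
 have "f i \<in> auts (A \<union> set a)" for i
 proof -
  have "map (f i) a = map (\<lambda>x. x) a" using fb(2)[of i] by simp
  hence "\<forall>x\<in>set a. f i x = x" unfolding map_eq_conv .
  thus ?thesis using f(1)[of i] by (auto simp: auts_def)
 qed
 moreover have "kinc m \<phi> k (\<lambda>i. map (f i) b)"
  unfolding fb using kinc_aut[OF inc auts_empty[OF g(1)] t \<phi>] .
 ultimately show ?thesis unfolding kdiv_def by blast
qed

text \<open>By \<open>kdiv_extend_base\<close>, each \<open>\<phi>(a i)\<close> still divides, to
  the same degree, over \<open>A\<close> and the later tuples. Given a common solution, the tuples
  are set free one after another, starting with \<open>a 0\<close>: the automorphisms that move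
  \<open>a j\<close> fix all later tuples, so each step prolongs the rank by one letter. After
  \<open>N\<close> steps this contradicts the bound.\<close>

lemma kim:
 assumes A: "inC A" "small A" and \<phi>: "\<phi> \<in> fmlas L (p + m)"
  and N: "\<not> D m (tup m) (replicate N (\<phi>, p, k))"
  and a: "\<And>i. i < N \<Longrightarrow> a i \<in> tup p" "\<And>i. i < N \<Longrightarrow> kdiv A m k \<phi> (a i)"
   "\<And>i. i < N \<Longrightarrow> ind (set (a i)) A (\<Union>j<i. set (a j))"
 shows "\<not> (\<exists>y\<in>tup m. \<forall>i<N. holds C \<phi> (a i @ y))"
proof
 assume "\<exists>y\<in>tup m. \<forall>i<N. holds C \<phi> (a i @ y)"
 then obtain y where y: "y \<in> tup m" "\<forall>i<N. holds C \<phi> (a i @ y)" by blast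
 have adom: "inC (set (a i))" if "i < N" for i using a(1)[OF that] by (simp add: tuples_def)
 have kd: "\<forall>i<j. kdiv (A \<union> (\<Union>l\<in>{i<..<j}. set (a l))) m k \<phi> (a i)" if "j \<le> N" for j
  using that
 proof (induction j)
  case (Suc j)
  show ?case
  proof (intro allI impI)
   fix i assume "i < Suc j"
   then consider "i = j" | "i < j" by linarith
   thus "kdiv (A \<union> (\<Union>l\<in>{i<..<Suc j}. set (a l))) m k \<phi> (a i)"
   proof cases
    case 1
    hence "{i<..<Suc j} = {}" by auto
    thus ?thesis using a(2)[of j] Suc.prems 1 by simp
   next
    case 2
    let ?A = "A \<union> (\<Union>l\<in>{i<..<j}. set (a l))"
    have "kdiv (?A \<union> set (a j)) m k \<phi> (a i)"
    proof (rule kdiv_extend_base)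
     have "inC (set (a l))" if "l \<in> {i<..<j}" for l using adom that Suc.prems by simp
     thus "inC ?A" using A(1) by blast
     show "small ?A" by (intro small_Un A small_finite) simp
     show "a i \<in> tup p" "a j \<in> tup p" using a(1) 2 Suc.prems by auto
     show "kdiv ?A m k \<phi> (a i)" using Suc 2 by simp
     have "ind (set (a j)) ?A (\<Union>l<j. set (a l))"
      by (rule ind_base[OF a(3)]) (use Suc.prems 2 in auto)
     thus "ind (set (a j)) ?A (set (a i))" by (rule ind_mono) (use 2 in auto)
    qed (rule \<phi>)
    moreover have "{i<..<Suc j} = insert j {i<..<j}" using 2 by auto
    ultimately show ?thesis by (simp add: Un_ac)
   qed
  qed
 qed simp
 let ?Y = "\<lambda>j. {y\<in>tup m. \<forall>l. j \<le> l \<and> l < N \<longrightarrow> holds C \<phi> (a l @ y)}"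
 have "D m (?Y j) (replicate j (\<phi>, p, k))" if "j \<le> N" for j
  using that
 proof (induction j)
  case 0 thus ?case using y by auto
 next
  case (Suc j)
  let ?A = "A \<union> (\<Union>l\<in>{j<..<N}. set (a l))"
  have "kdiv ?A m k \<phi> (a j)" using kd[of N] Suc.prems by simp
  then obtain h where h: "\<And>i. h i \<in> auts ?A" "kinc m \<phi> k (\<lambda>i. map (h i) (a j))"
   unfolding kdiv_def by blast
  have aj: "a j \<in> tup p" using a(1) Suc.prems by simp
  have "D m (?Y (Suc j) \<inter> {y. holds C \<phi> (map (h i) (a j) @ y)}) (replicate j (\<phi>, p, k))" for i
  proof (rule D_mono)
   show "D m (map (h i) ` ?Y j) (replicate j (\<phi>, p, k))"
    using Suc \<phi> by (intro D_aut auts_empty[OF h(1)]) auto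
   show "map (h i) ` ?Y j \<subseteq> ?Y (Suc j) \<inter> {y. holds C \<phi> (map (h i) (a j) @ y)}"
   proof
    fix z assume "z \<in> map (h i) ` ?Y j"
    then obtain y where y: "z = map (h i) y" "y \<in> tup m" "\<And>l. j \<le> l \<Longrightarrow> l < N \<Longrightarrow> holds C \<phi> (a l @ y)" by auto
    have hold: "holds C \<phi> (map (h i) (a l) @ z)" if "j \<le> l" "l < N" for l
    proof -
     have "a l @ y \<in> lists (dom C)" "length (a l @ y) = p + m"
      using a(1)[OF that(2)] y(2) by (auto simp: tuples_def lists_eq_set)
     thus ?thesis using aut_holds[OF h(1), of \<phi> "a l @ y" i] \<phi> y(1) y(3)[OF that] by simp
    qed
    have "holds C \<phi> (a l @ z)" if "Suc j \<le> l" "l < N" for l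
    proof -
     have "a l \<in> lists ?A" using that by (auto simp: lists_eq_set)
     hence "map (h i) (a l) = a l" by (rule auts_fix[OF h(1)])
     thus ?thesis using hold[of l] that by simp
    qed
    thus "z \<in> ?Y (Suc j) \<inter> {y. holds C \<phi> (map (h i) (a j) @ y)}"
     using y(1) auts_tup[OF h(1) y(2)] hold[of j] Suc.prems by auto
   qed
  qed
  thus ?case unfolding replicate_Suc by (intro D_ConsI[OF auts_tup[OF h(1) aj] h(2)])
 qed
 from this[of N] have "D m (?Y N) (replicate N (\<phi>, p, k))" by simp
 hence "D m (tup m) (replicate N (\<phi>, p, k))" by (rule D_mono) auto
 thus False using N by blast
qed

text \<open>Independence from predecessors passes to subsequences taken in increasing order.\<close>

lemma kim_subset:
 fixes a :: "nat \<Rightarrow> 'u list"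
 assumes A: "inC A" "small A" and \<phi>: "\<phi> \<in> fmlas L (p + m)"
  and N: "\<not> D m (tup m) (replicate N (\<phi>, p, k))"
  and a: "\<And>i. a i \<in> tup p" "\<And>i. kdiv A m k \<phi> (a i)" "\<And>i. ind (set (a i)) A (\<Union>j<i. set (a j))"
  and S: "finite S" "N \<le> card S" "y \<in> tup m" "\<And>i. i \<in> S \<Longrightarrow> holds C \<phi> (a i @ y)"
 shows False
proof -
 let ?r = "nth (sorted_list_of_set S)"
 have r: "?r i < ?r j" if "i < j" "j < card S" for i j
  using sorted_wrt_nth_less[OF strict_sorted_list_of_set[of S] that(1)] that S(1) by simp
 have rS: "?r i \<in> S" if "i < N" for i
  using nth_mem[of i "sorted_list_of_set S"] that S(1,2) by simp
 have "\<not> (\<exists>y\<in>tup m. \<forall>i<N. holds C \<phi> (a (?r i) @ y))"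
 proof (rule kim[OF A \<phi> N])
  fix i assume i: "i < N"
  show "a (?r i) \<in> tup p" "kdiv A m k \<phi> (a (?r i))" using a by auto
  have "(\<Union>j<i. set (a (?r j))) \<subseteq> (\<Union>j<?r i. set (a j))"
   using r i S(2) by fastforce
  thus "ind (set (a (?r i))) A (\<Union>j<i. set (a (?r j)))"
   by (intro ind_mono[OF a(3)]) auto
 qed
 thus False using S(3,4) rS by blast
qed

subsection \<open>Forking calculus in simple theories\<close>

text \<open>In simple theories forking is dividing. Along an independent sequence of conjugates of
  all parameters at once, non-division provides many conjugates of \<open>\<phi>(b)\<close> with a
  common solution \<open>y\<close>. Each of them puts \<open>y\<close> into a conjugate of one of
  the dividing formulas of the cover, and a formula that is met often enough contradicts
  \<open>kim_subset\<close>.\<close>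

lemma forkset_kdiv:
 assumes A: "inC A" "small A" and b: "b \<in> lists (dom C)" and \<phi>: "\<phi> \<in> fms b m"
  and f: "fork A m \<phi> b"
 shows "\<exists>k. kdiv A m k \<phi> b"
proof (rule ccontr)
 assume no: "\<not> ?thesis"
 obtain \<Psi> where \<Psi>: "finite \<Psi>"
   "\<forall>(\<psi>, c)\<in>\<Psi>. c \<in> lists (dom C) \<and> \<psi> \<in> fms c m \<and> (\<exists>k. kdiv A m k \<psi> c)"
   "\<forall>y\<in>sols m \<phi> b. \<exists>(\<psi>, c)\<in>\<Psi>. holds C \<psi> (c @ y)"
  using f unfolding forkset_def by (elim exE conjE) (rule that)
 have pc: "snd x \<in> lists (dom C)" "fst x \<in> fmlas L (length (snd x) + m)" "\<exists>k. kdiv A m k (fst x) (snd x)"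
  if "x \<in> \<Psi>" for x
  using bspec[OF \<Psi>(2) that] by (auto simp: split_beta)
 define X where "X = set b \<union> (\<Union>x\<in>\<Psi>. set (snd x))"
 have X: "finite X" "inC X" using \<Psi>(1) b pc(1) by (auto simp: X_def lists_eq_set)
 have "ind X A {}" using ind_empty A(1) X(2) by blast
 then obtain h :: "nat \<Rightarrow> 'u \<Rightarrow> 'u" where h: "\<And>i. h i \<in> auts A" "\<And>i. ind (h i ` X) A (\<Union>j<i. h j ` X)"
  using ind_sequence[OF A _ _ X, of "{}"] small_finite[of "{}"] by auto
 have "\<exists>k. kdiv A m k (fst x) (snd x)" if "x \<in> \<Psi>" for x using pc(3) that .
 hence "\<forall>x\<in>\<Psi>. \<exists>k. kdiv A m k (fst x) (snd x)" by blast
 from bchoice[OF this] obtain k where k: "\<forall>x\<in>\<Psi>. kdiv A m (k x) (fst x) (snd x)" ..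
 have "\<forall>x\<in>\<Psi>. \<exists>N. \<not> D m (tup m) (replicate N (fst x, length (snd x), k x))"
  using D_finite pc(2) by blast
 from bchoice[OF this] obtain N where N: "\<forall>x\<in>\<Psi>. \<not> D m (tup m) (replicate (N x) (fst x, length (snd x), k x))" ..
 \<comment> \<open>Large enough for the pigeonhole principle: among \<open>K\<close> indices, some
   covering formula \<open>x\<close> is used at least \<open>N x\<close> times.\<close>
 define K where "K = Suc (\<Sum>x\<in>\<Psi>. N x)"
 have "\<not> kinc m \<phi> K (\<lambda>i. map (h i) b)" using no h(1) unfolding kdiv_def by blast
 then obtain S y where S: "finite S" "card S = K" "y \<in> tup m" "\<forall>i\<in>S. holds C \<phi> (map (h i) b @ y)"
  unfolding kinc_def by blast
 define R where "R x = {i\<in>S. holds C (fst x) (map (h i) (snd x) @ y)}" for x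
 have "i \<in> (\<Union>x\<in>\<Psi>. R x)" if i: "i \<in> S" for i
 proof -
  obtain g where g: "g \<in> auts A" "\<And>x. x \<in> dom C \<Longrightarrow> g (h i x) = x" "\<And>x. x \<in> dom C \<Longrightarrow> h i (g x) = x"
   by (rule auts_inv[OF h(1)[of i] A(1)]) (rule that)
  have y': "map g y \<in> tup m" "map (h i) (map g y) = y"
   using S(3) g auts_tup[OF g(1)] by (auto simp: tuples_def intro!: map_idI)
  have eq: "map (h i) c @ y = map (h i) (c @ map g y)" for c using y'(2) by simp
  have "b @ map g y \<in> lists (dom C)" "length (b @ map g y) = length b + m"
   using b y'(1) by (auto simp: tuples_def lists_eq_set)
  hence "holds C \<phi> (b @ map g y)"
   using bspec[OF S(4) i] aut_holds[OF h(1), of \<phi> "b @ map g y" i] \<phi> unfolding eq by simp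
  then obtain x where x: "x \<in> \<Psi>" "holds C (fst x) (snd x @ map g y)"
   using \<Psi>(3) y'(1) by (fastforce simp: sols_def)
  have "snd x @ map g y \<in> lists (dom C)" "length (snd x @ map g y) = length (snd x) + m"
   using pc(1)[OF x(1)] y'(1) by (auto simp: tuples_def lists_eq_set)
  hence "holds C (fst x) (map (h i) (snd x) @ y)"
   unfolding eq using x aut_holds[OF h(1), of "fst x" "snd x @ map g y" i] pc(2) by simp
  thus ?thesis using x(1) i by (auto simp: R_def)
 qed
 hence "S \<subseteq> (\<Union>x\<in>\<Psi>. R x)" by blast
 moreover have "finite (R x)" for x using S(1) by (simp add: R_def)
 ultimately have "K \<le> (\<Sum>x\<in>\<Psi>. card (R x))"
  using S(2) card_UN_le[OF \<Psi>(1), of R] card_mono[of "\<Union>x\<in>\<Psi>. R x" S] \<Psi>(1) by fastforce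
 hence "\<exists>x\<in>\<Psi>. N x \<le> card (R x)"
  using sum_mono[of \<Psi> "\<lambda>x. card (R x)" N] unfolding K_def by force
 then obtain x where x: "x \<in> \<Psi>" "N x \<le> card (R x)" by blast
 have hx: "map (h i) (snd x) \<in> tup (length (snd x))" for i
  using auts_dom_lists[OF h(1) pc(1)[OF x(1)]] by (auto simp: tuples_def lists_eq_set)
 show False
 proof (rule kim_subset[OF A pc(2)[OF x(1)] bspec[OF N x(1)], of "\<lambda>i. map (h i) (snd x)" "R x" y])
  show "map (h i) (snd x) \<in> tup (length (snd x))" for i by (rule hx)
  have "h i ` A = A" for i using h(1)[of i] by (auto simp: auts_def)
  thus "kdiv A m (k x) (fst x) (map (h i) (snd x))" for i
   using kdiv_aut[OF bspec[OF k x(1)] auts_empty[OF h(1)] A(1) pc(1,2)[OF x(1)], of i] by simp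
  have "set (snd x) \<subseteq> X" using x(1) by (auto simp: X_def)
  thus "ind (set (map (h i) (snd x))) A (\<Union>j<i. set (map (h j) (snd x)))" for i
   by (intro ind_mono[OF h(2)]) auto
 qed (use x S R_def in auto)
qed

text \<open>If the formula \<open>\<phi>\<close> with parameters \<open>c\<close>, true of
  \<open>b\<close>, divided over \<open>A\<close>, then \<open>b\<close> would solve all its
  conjugates along an independent sequence of conjugates of \<open>c\<close> over \<open>A\<close>
  and \<open>b\<close>. Such a sequence exists because \<open>X\<close> is independent from
  \<open>b\<close>.\<close>

lemma ind_sym:
 assumes A: "inC A" "small A" and X: "inC X" and B: "inC B" and ind: "ind X A B"
 shows "ind B A X"
 unfolding ind_def
proof (intro ballI impI notI)
 fix b c \<phi> assume b: "b \<in> lists B" and c: "c \<in> lists (A \<union> X)" and \<phi>: "\<phi> \<in> fmlas L (length c + length b)"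
  and hold: "holds C \<phi> (c @ b)" and f: "fork A (length b) \<phi> c"
 let ?m = "length b"
 have cC: "c \<in> lists (dom C)" and bC: "b \<in> tup ?m" using b c A(1) X B by (auto simp: lists_eq_set tuples_def)
 obtain k where k: "kdiv A ?m k \<phi> c" using forkset_kdiv[OF A cC \<phi> f] by blast
 let ?X = "set c \<inter> X"
 have X0: "finite ?X" "inC ?X" using X by auto
 have "ind ?X A (set b)" by (rule ind_mono[OF ind]) (use b in \<open>auto simp: lists_eq_set\<close>)
 moreover have "inC (set b)" "small (set b)" using bC small_finite by (auto simp: tuples_def)
 ultimately obtain h :: "nat \<Rightarrow> 'u \<Rightarrow> 'u" where h: "\<And>i. h i \<in> auts (A \<union> set b)"
  "\<And>i. ind (h i ` ?X) A (set b \<union> (\<Union>j<i. h j ` ?X))"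
  using ind_sequence[OF A _ _ X0] by metis
 have hA: "h i \<in> auts A" for i using h(1) auts_mono by blast
 obtain N where N: "\<not> D ?m (tup ?m) (replicate N (\<phi>, length c, k))" using D_finite[OF \<phi>] by blast
 have setc: "set (map (h i) c) \<subseteq> h i ` ?X \<union> A" for i
  using c hA[of i] by (auto simp: lists_eq_set auts_def)
 show False
 proof (rule kim_subset[OF A \<phi> N, of "\<lambda>i. map (h i) c" "{..<N}" b])
  show "map (h i) c \<in> tup (length c)" for i
   using auts_dom_lists[OF h(1) cC] by (auto simp: tuples_def lists_eq_set)
  have "h i ` A = A" for i using hA[of i] by (auto simp: auts_def)
  thus "kdiv A ?m k \<phi> (map (h i) c)" for i
   using kdiv_aut[OF k auts_empty[OF h(1)] A(1) cC \<phi>, of i] by simp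
  show "ind (set (map (h i) c)) A (\<Union>j<i. set (map (h j) c))" for i
  proof (rule ind_mono[OF ind_addA[OF h(2)[of i] A(1)]])
   show "inC (h i ` ?X)" using auts_dom[OF h(1)] X0(2) by blast
   show "set (map (h i) c) \<subseteq> h i ` ?X \<union> A" by (rule setc)
   show "(\<Union>j<i. set (map (h j) c)) \<subseteq> A \<union> (set b \<union> (\<Union>j<i. h j ` ?X))" using setc by blast
  qed
  show "holds C \<phi> (map (h i) c @ b)" for i
  proof -
   have "map (h i) b = b" by (rule auts_fix[OF h(1)]) (auto simp: lists_eq_set)
   hence "map (h i) c @ b = map (h i) (c @ b)" by simp
   moreover have "c @ b \<in> lists (dom C)" "\<phi> \<in> fmlas L (length (c @ b))" using cC bC \<phi> by (auto simp: tuples_def lists_eq_set)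
   ultimately show ?thesis using aut_holds[OF h(1)] hold by metis
  qed
 qed (use bC in auto)
qed

text \<open>By symmetry there is an independent sequence of conjugates of \<open>c\<close> over
  \<open>A \<union> B\<close>. As \<open>\<phi>\<close> does not divide over
  \<open>A \<union> B\<close>, in particular not to the degree \<open>N\<close> of the rank bound,
  some \<open>N\<close> of these conjugates have a common solution, which refutes division over
  \<open>A\<close>.\<close>

lemma ind_left_trans:
 assumes A: "inC A" "small A" and B: "inC B" "small B" and X: "inC X" and E: "inC E"
  and ind1: "ind B A X" and ind2: "ind E (A \<union> B) X"
 shows "ind (B \<union> E) A X"
 unfolding ind_def
proof (intro ballI impI notI)
 fix b c \<phi> assume b: "b \<in> lists (B \<union> E)" and c: "c \<in> lists (A \<union> X)" and \<phi>: "\<phi> \<in> fmlas L (length c + length b)"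
  and hold: "holds C \<phi> (c @ b)" and f: "fork A (length b) \<phi> c"
 let ?m = "length b"
 have AB: "inC (A \<union> B)" "small (A \<union> B)" using A B small_Un by auto
 have cC: "c \<in> lists (dom C)" and bC: "b \<in> tup ?m" using b c A(1) X B E by (auto simp: lists_eq_set tuples_def)
 obtain k where k: "kdiv A ?m k \<phi> c" using forkset_kdiv[OF A cC \<phi> f] by blast
 let ?X = "set c \<inter> X"
 have X0: "finite ?X" "inC ?X" using X by auto
 have "ind X A B" by (rule ind_sym[OF A B(1) X ind1])
 hence "ind ?X A B" by (rule ind_mono) auto
 then obtain h :: "nat \<Rightarrow> 'u \<Rightarrow> 'u" where h: "\<And>i. h i \<in> auts (A \<union> B)"
  "\<And>i. ind (h i ` ?X) A (B \<union> (\<Union>j<i. h j ` ?X))"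
  using ind_sequence[OF A B X0] by metis
 have hA: "h i \<in> auts A" for i using h(1) auts_mono by blast
 obtain N where N: "\<not> D ?m (tup ?m) (replicate N (\<phi>, length c, k))" using D_finite[OF \<phi>] by blast
 have setc: "set (map (h i) c) \<subseteq> h i ` ?X \<union> A" for i
  using c hA[of i] by (auto simp: lists_eq_set auts_def)
 have "ind (E \<union> (A \<union> B)) (A \<union> B) X" by (rule ind_addA[OF ind2 AB(1) E])
 moreover have "b \<in> lists (E \<union> (A \<union> B))" "c \<in> lists (A \<union> B \<union> X)" using b c by (auto simp: lists_eq_set)
 ultimately have "\<not> fork (A \<union> B) ?m \<phi> c" using hold \<phi> unfolding ind_def by blast
 hence "\<not> kdiv (A \<union> B) ?m N \<phi> c" using kdiv_forkset[OF _ cC \<phi>] by blast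
 then obtain S y where S: "finite S" "card S = N" "y \<in> tup ?m" "\<forall>i\<in>S. holds C \<phi> (map (h i) c @ y)"
  using h(1) unfolding kdiv_def kinc_def by metis
 show False
 proof (rule kim_subset[OF A \<phi> N, of "\<lambda>i. map (h i) c" S y])
  show "map (h i) c \<in> tup (length c)" for i
   using auts_dom_lists[OF h(1) cC] by (auto simp: tuples_def lists_eq_set)
  have "h i ` A = A" for i using hA[of i] by (auto simp: auts_def)
  thus "kdiv A ?m k \<phi> (map (h i) c)" for i
   using kdiv_aut[OF k auts_empty[OF h(1)] A(1) cC \<phi>, of i] by simp
  show "ind (set (map (h i) c)) A (\<Union>j<i. set (map (h j) c))" for i
  proof (rule ind_mono[OF ind_addA[OF h(2)[of i] A(1)]])
   show "inC (h i ` ?X)" using auts_dom[OF h(1)] X0(2) by blast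
   show "set (map (h i) c) \<subseteq> h i ` ?X \<union> A" by (rule setc)
   show "(\<Union>j<i. set (map (h j) c)) \<subseteq> A \<union> (B \<union> (\<Union>j<i. h j ` ?X))" using setc by blast
  qed
 qed (use S in auto)
qed

lemma ind_trans:
 assumes A: "inC A" "small A" and B: "inC B" "small B" and X: "inC X" and E: "inC E"
  and ind1: "ind X A B" and ind2: "ind X (A \<union> B) E"
 shows "ind X A (B \<union> E)"
proof (rule ind_sym[OF A _ X])
 have AB: "inC (A \<union> B)" "small (A \<union> B)" using A B small_Un by auto
 show "ind (B \<union> E) A X"
  by (rule ind_left_trans[OF A B X E ind_sym[OF A X B(1) ind1] ind_sym[OF AB X E ind2]])
qed (use B E in blast)

lemma fm_reparam:
 assumes "c \<in> lists (set e)" "\<chi> \<in> fms c m"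
 shows "\<exists>\<chi>'\<in>fms e m. \<forall>y. length y = m \<longrightarrow> (holds C \<chi>' (e @ y) \<longleftrightarrow> holds C \<chi> (c @ y))"
proof -
 have "\<forall>x\<in>set c. \<exists>i<length e. e ! i = x" using assms(1) by (auto simp: lists_eq_set in_set_conv_nth)
 from bchoice[OF this] obtain f where f: "\<forall>x\<in>set c. f x < length e \<and> e ! f x = x" ..
 let ?ks = "map (\<lambda>x. Inl (f x)) c @ map Inr [0..<m]" and ?es = "map Inl [0..<length e] @ map Inr [0..<m]"
 have "dfn L (set ?es) (\<lambda>(M :: ('f, 'r, 'u) struct) a. holds M \<chi> (map a ?ks))"
  using assms(2) f by (intro dfn_holds) auto
 then obtain \<chi>' where \<chi>': "\<chi>' \<in> fmlas L (length ?es)"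
  "\<And>M :: ('f, 'r, 'u) struct. \<And>a. holds M \<chi> (map a ?ks) \<longleftrightarrow> holds M \<chi>' (map a ?es)"
  by (rule dfn_to_fm) (rule that)
 have "holds C \<chi>' (e @ y) \<longleftrightarrow> holds C \<chi> (c @ y)" if "length y = m" for y
 proof -
  let ?a = "case_sum (nth e) (nth y)"
  have "map ?a ?es = e @ y" using that map_nth[of e] map_nth[of y] by (simp add: comp_def)
  moreover have "map ?a ?ks = c @ y"
   using that map_nth[of y] f by (simp add: comp_def) (auto intro!: map_idI)
  ultimately show ?thesis using \<chi>'(2)[of C ?a] by simp
 qed
 moreover have "\<chi>' \<in> fms e m" using \<chi>'(1) by simp
 ultimately show ?thesis by blast
qed

text \<open>Otherwise some solution \<open>y\<close> of \<open>\<phi>\<close> with parameters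
  \<open>e\<close> and \<open>b\<close> avoids all formulas over \<open>e\<close> that fork over
  \<open>A\<close> and is independent from \<open>b\<close> over \<open>e\<close>. It is then
  independent from \<open>e\<close> over \<open>A\<close>, hence from \<open>e\<close> and
  \<open>b\<close> together by transitivity, although this instance of \<open>\<phi>\<close> forks
  over \<open>A\<close>.\<close>

lemma forkset_shift:
 assumes e: "e \<in> lists (dom C)" and A: "A \<subseteq> set e" and b: "b \<in> lists (dom C)"
  and \<phi>: "\<phi> \<in> fmlas L (length (e @ b) + m)" and f: "fork A m \<phi> (e @ b)"
 shows "\<exists>\<chi>\<in>fms e m. fork A m \<chi> e \<and> forkset (set e) m (sols m \<phi> (e @ b) - sols m \<chi> e)"
proof (rule ccontr)
 assume no: "\<not> ?thesis"
 let ?B = "set e"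
 have B: "inC ?B" "small ?B" using e small_finite by (auto simp: lists_eq_set)
 have AC: "inC A" "small A" using A B small_subset by auto
 have bC: "inC (set b)" "small (set b)" using b small_finite by (auto simp: lists_eq_set)
 define F where "F = {(\<chi>, c). c \<in> lists ?B \<and> \<chi> \<in> fms c m \<and> fork A m \<chi> c}"
 let ?\<Phi> = "insert (\<phi>, e @ b) ((\<lambda>(\<chi>, c). (Neg \<chi>, c)) ` F)"
 have "\<exists>y\<in>tup m. (\<forall>(\<phi>, c)\<in>?\<Phi>. holds C \<phi> (c @ y)) \<and> ind (set y \<union> ?B) ?B (set b)"
 proof (rule nonforking_realization[OF B bC])
  show "?\<Phi> \<subseteq> {(\<phi>, c). c \<in> lists (?B \<union> set b) \<and> \<phi> \<in> fms c m}"
   using \<phi> by (auto simp: F_def fmlas_Neg lists_eq_set)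
  fix \<Phi>0 assume \<Phi>0: "\<Phi>0 \<subseteq> ?\<Phi>" "finite \<Phi>0"
  have "\<Phi>0 - {(\<phi>, e @ b)} \<subseteq> (\<lambda>(\<chi>, c). (Neg \<chi>, c)) ` F" "finite (\<Phi>0 - {(\<phi>, e @ b)})" using \<Phi>0 by auto
  then obtain F0 where F0: "F0 \<subseteq> F" "finite F0" "\<Phi>0 - {(\<phi>, e @ b)} = (\<lambda>(\<chi>, c). (Neg \<chi>, c)) ` F0"
   using finite_subset_image[of "\<Phi>0 - {(\<phi>, e @ b)}" "\<lambda>(\<chi>, c). (Neg \<chi>, c)" F] by blast
  have fin: "finite ((\<lambda>(\<chi>, c). (Neg \<chi>, c)) ` F0)" using F0(2) by simp
  have hyp: "c \<in> lists ?B \<and> \<chi> \<in> fms c m" if "(\<chi>, c) \<in> (\<lambda>(\<chi>, c). (Neg \<chi>, c)) ` F0" for \<chi> c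
   using that F0(1) by (auto simp: F_def fmlas_Neg)
  obtain c \<chi>0 where c0: "c \<in> lists ?B" "\<chi>0 \<in> fms c m"
   "\<forall>y. length y = m \<longrightarrow> (holds C \<chi>0 (c @ y) \<longleftrightarrow> (\<forall>(\<chi>, c)\<in>(\<lambda>(\<chi>, c). (Neg \<chi>, c)) ` F0. holds C \<chi> (c @ y)))"
  proof -
   have "\<exists>c\<in>lists ?B. \<exists>\<chi>0\<in>fms c m. \<forall>y. length y = m \<longrightarrow>
    (holds C \<chi>0 (c @ y) \<longleftrightarrow> (\<forall>(\<chi>, c)\<in>(\<lambda>(\<chi>, c). (Neg \<chi>, c)) ` F0. holds C \<chi> (c @ y)))"
    by (intro fm_conj fin hyp)
   thus ?thesis by (elim bexE) (rule that)
  qed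
  note c = c0(1,2) c0(3)[rule_format]
  \<comment> \<open>\<open>\<chi>\<close> is the disjunction of the finitely many forking formulas
    in \<open>F0\<close>, rewritten with the parameter tuple \<open>e\<close>.\<close>
  have "Neg \<chi>0 \<in> fms c m" using c(2) by (simp add: fmlas_Neg)
  then obtain \<chi> where \<chi>: "\<chi> \<in> fms e m"
   "\<And>y. length y = m \<Longrightarrow> holds C \<chi> (e @ y) \<longleftrightarrow> holds C (Neg \<chi>0) (c @ y)"
   using fm_reparam[OF c(1)] by metis
  have eq: "holds C \<chi> (e @ y) \<longleftrightarrow> (\<exists>(\<chi>, c)\<in>F0. holds C \<chi> (c @ y))" if "length y = m" for y
   unfolding \<chi>(2)[OF that] holds_Neg c(3)[OF that] by (simp add: split_beta holds_Neg)
  have "sols m \<chi> e \<subseteq> (\<Union>x\<in>F0. sols m (fst x) (snd x))"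
   using eq by (force simp: sols_def tuples_def)
  moreover have "forkset A m (\<Union>x\<in>F0. sols m (fst x) (snd x))"
   using F0(1,2) by (intro forkset_UN) (auto simp: F_def)
  ultimately have "fork A m \<chi> e" using forkset_mono by blast
  hence nf: "\<not> forkset ?B m (sols m \<phi> (e @ b) - sols m \<chi> e)" using no \<chi>(1) by blast
  show "\<not> forkset ?B m {y\<in>tup m. \<forall>(\<phi>, c)\<in>\<Phi>0. holds C \<phi> (c @ y)}"
  proof
   assume *: "forkset ?B m {y\<in>tup m. \<forall>(\<phi>, c)\<in>\<Phi>0. holds C \<phi> (c @ y)}"
   have "sols m \<phi> (e @ b) - sols m \<chi> e \<subseteq> {y\<in>tup m. \<forall>(\<phi>, c)\<in>\<Phi>0. holds C \<phi> (c @ y)}"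
   proof
    fix y assume y: "y \<in> sols m \<phi> (e @ b) - sols m \<chi> e"
    hence y': "y \<in> tup m" "length y = m" "holds C \<phi> ((e @ b) @ y)" "\<not> holds C \<chi> (e @ y)"
     by (auto simp: sols_def tuples_def)
    have "holds C \<psi> (d @ y)" if "(\<psi>, d) \<in> \<Phi>0" for \<psi> d
    proof (cases "(\<psi>, d) = (\<phi>, e @ b)")
     case True thus ?thesis using y'(3) by simp
    next
     case False
     hence "(\<psi>, d) \<in> (\<lambda>(\<chi>, c). (Neg \<chi>, c)) ` F0" using that F0(3) by blast
     then obtain \<chi>1 where "\<psi> = Neg \<chi>1" "(\<chi>1, d) \<in> F0" by auto
     thus ?thesis using y'(4) eq[OF y'(2)] by (auto simp: holds_Neg)
    qed
    thus "y \<in> {y\<in>tup m. \<forall>(\<phi>, c)\<in>\<Phi>0. holds C \<phi> (c @ y)}" using y'(1) by blast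
   qed
   thus False using * nf forkset_mono by blast
  qed
 qed
 then obtain y where y: "y \<in> tup m" "\<forall>(\<phi>, c)\<in>?\<Phi>. holds C \<phi> (c @ y)" "ind (set y \<union> ?B) ?B (set b)"
  by (elim bexE conjE) (rule that)
 have "ind (set y \<union> A) A ?B"
 proof (rule ind_core[OF AC(1) y(1)], rule notI)
  fix c \<chi> assume c: "c \<in> lists (A \<union> ?B)" "\<chi> \<in> fms c m" "holds C \<chi> (c @ y)" "fork A m \<chi> c"
  have "A \<union> ?B = ?B" using A by blast
  hence "(\<chi>, c) \<in> F" using c by (simp add: F_def)
  hence "(Neg \<chi>, c) \<in> ?\<Phi>" by force
  thus False using bspec[OF y(2), of "(Neg \<chi>, c)"] c(3) by (simp add: holds_Neg)
 qed
 hence "ind (set y) A ?B" by (rule ind_mono) auto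
 moreover have "A \<union> ?B = ?B" using A by blast
 hence "ind (set y) (A \<union> ?B) (set b)" using ind_mono[OF y(3), of "set y" "set b"] by simp
 ultimately have "ind (set y) A (?B \<union> set b)"
  using ind_trans[OF AC B _ bC(1)] y(1) by (simp add: tuples_def)
 moreover have "y \<in> lists (set y)" "e @ b \<in> lists (A \<union> (?B \<union> set b))" "length y = m"
  using y(1) by (auto simp: lists_eq_set tuples_def)
 moreover have "holds C \<phi> ((e @ b) @ y)" using y(2) by blast
 ultimately show False using f \<phi> unfolding ind_def by blast
qed

text \<open>The converse of the shift: the remainder forks over the larger base \<open>B\<close>,
  hence over \<open>A\<close>, and forking sets are closed under unions.\<close>

lemma forkset_unshift:
 assumes "forkset A m Z" "forkset B m (Y - Z)" "A \<subseteq> B"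
 shows "forkset A m Y"
 by (rule forkset_mono[OF forkset_Un[OF assms(1) forkset_base[OF assms(2,3)]]]) auto

section \<open>Adding algebraic elements to the base of forking\<close>

lemma acl_orbit:
 assumes "x \<in> acl L C A" "inC A"
 obtains F where "finite F" "\<And>h. h \<in> auts A \<Longrightarrow> h x \<in> F"
proof -
 obtain c \<phi> where c: "x \<in> dom C" "c \<in> lists A" "\<phi> \<in> fmlas L (Suc (length c))" "holds C \<phi> (x # c)"
  "finite {b\<in>dom C. holds C \<phi> (b # c)}" using assms unfolding acl_def by blast
 have "h x \<in> {b\<in>dom C. holds C \<phi> (b # c)}" if h: "h \<in> auts A" for h
 proof -
  have "x # c \<in> lists (dom C)" "\<phi> \<in> fmlas L (length (x # c))" using c assms(2) by (auto simp: lists_eq_set)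
  hence "holds C \<phi> (map h (x # c))" using aut_holds[OF h] c(4) by blast
  thus ?thesis using auts_fix[OF h c(2)] auts_dom[OF h c(1)] by simp
 qed
 thus ?thesis using that c(5) by blast
qed

text \<open>Automorphisms over \<open>A\<close> take \<open>a\<close> to finitely many tuples only.
  Infinitely many members of the dividing sequence agree on \<open>a\<close>, and composition with
  the inverse of one of them makes them fix \<open>a\<close>.\<close>

lemma kdiv_acl:
 assumes A: "inC A" and a: "set a \<subseteq> acl L C A" and b: "b \<in> lists (dom C)"
  and \<phi>: "\<phi> \<in> fms b m" and kd: "kdiv A m k \<phi> b"
 shows "kdiv (A \<union> set a) m k \<phi> b"
proof -
 obtain h where h: "\<And>i. h i \<in> auts A" "kinc m \<phi> k (\<lambda>i. map (h i) b)"
  using kd unfolding kdiv_def by blast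
 have "\<forall>x\<in>set a. \<exists>F. finite F \<and> (\<forall>h\<in>auts A. h x \<in> F)"
  using a acl_orbit[OF _ A] by (metis subsetD)
 from bchoice[OF this] obtain F where F: "\<forall>x\<in>set a. finite (F x) \<and> (\<forall>h\<in>auts A. h x \<in> F x)" ..
 let ?T = "{xs. set xs \<subseteq> (\<Union>x\<in>set a. F x) \<and> length xs = length a}"
 have "finite ?T" using F by (intro finite_lists_length_eq) auto
 moreover have "range (\<lambda>i. map (h i) a) \<subseteq> ?T" using F h(1) by fastforce
 ultimately have "finite (range (\<lambda>i. map (h i) a))" using finite_subset by blast
 then obtain i0 where "infinite {i\<in>UNIV. map (h i) a = map (h i0) a}"
  using pigeonhole_infinite[of "UNIV :: nat set" "\<lambda>i. map (h i) a"] by auto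
 then obtain r :: "nat \<Rightarrow> nat" where r: "strict_mono r" "\<And>n. r n \<in> {i\<in>UNIV. map (h i) a = map (h i0) a}"
  using infinite_enumerate by blast
 obtain g where g: "g \<in> auts A" "\<And>x. x \<in> dom C \<Longrightarrow> g (h i0 x) = x" using auts_inv[OF h(1) A] by metis
 have aC: "inC (set a)" using a by (auto simp: acl_def)
 have "g \<circ> h (r n) \<in> auts (A \<union> set a)" for n
 proof -
  have "(g \<circ> h (r n)) x = x" if "x \<in> set a" for x
  proof -
   have "h (r n) x = h i0 x" using r(2)[of n] that by auto
   thus ?thesis using g(2) aC that by auto
  qed
  thus ?thesis using auts_comp[OF g(1) h(1), of "r n"] by (auto simp: auts_def)
 qed
 moreover have "kinc m \<phi> k (\<lambda>n. map (g \<circ> h (r n)) b)"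
 proof -
  have "inj r" using r(1) strict_mono_imp_inj_on by blast
  hence "kinc m \<phi> k (\<lambda>n. map (h (r n)) b)" using kinc_subseq[OF h(2)] by blast
  moreover have "map (h i) b \<in> tup (length b)" for i
   using auts_dom_lists[OF h(1) b] by (auto simp: tuples_def lists_eq_set)
  ultimately have "kinc m \<phi> k (\<lambda>n. map g (map (h (r n)) b))"
   using kinc_aut[OF _ auts_empty[OF g(1)] _ \<phi>] by blast
  thus ?thesis by simp
 qed
 ultimately show ?thesis unfolding kdiv_def by (intro exI[of _ "\<lambda>n. g \<circ> h (r n)"]) blast
qed

text \<open>This admits the free variable \<open>x\<close> to the later bases of forking along a
  maximal sequence.\<close>

lemma forkset_acl:
 assumes "inC A" "set a \<subseteq> acl L C A" "forkset A m Y"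
 shows "forkset (A \<union> set a) m Y"
proof -
 obtain \<Psi> where \<Psi>: "finite \<Psi>"
   "\<forall>(\<psi>, c)\<in>\<Psi>. c \<in> lists (dom C) \<and> \<psi> \<in> fms c m \<and> (\<exists>k. kdiv A m k \<psi> c)"
   "\<forall>y\<in>Y. \<exists>(\<psi>, c)\<in>\<Psi>. holds C \<psi> (c @ y)"
  using assms(3) unfolding forkset_def by (elim exE conjE) (rule that)
 show ?thesis
 proof (rule forkset_finite_cover)
  fix \<psi> c assume "(\<psi>, c) \<in> \<Psi>"
  then obtain k where "c \<in> lists (dom C)" "\<psi> \<in> fms c m" "kdiv A m k \<psi> c" using \<Psi>(2) by blast
  thus "c \<in> lists (dom C) \<and> \<psi> \<in> fms c m \<and> (\<exists>k. kdiv (A \<union> set a) m k \<psi> c)"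
   using kdiv_acl[OF assms(1,2)] by blast
 next
  show "\<exists>(\<psi>, c)\<in>\<Psi>. holds C \<psi> (c @ y)" if "y \<in> Y" for y using bspec[OF \<Psi>(3) that] .
 qed (rule \<Psi>(1))
qed

lemma ind_independent:
 assumes "inC A" "small A"
 shows "independent L C I a A B \<longleftrightarrow> ind (a ` I) A B"
proof
 assume *: "independent L C I a A B"
 show "ind (a ` I) A B" unfolding ind_def
 proof (intro ballI impI)
  fix xs b \<phi> assume xs: "xs \<in> lists (a ` I)" and b: "b \<in> lists (A \<union> B)" and \<phi>: "\<phi> \<in> fmlas L (length b + length xs)"
   and hold: "holds C \<phi> (b @ xs)"
  have "\<forall>x\<in>set xs. \<exists>i\<in>I. a i = x" using xs by (auto simp: lists_eq_set)
  then obtain f where f: "\<forall>x\<in>set xs. f x \<in> I \<and> a (f x) = x" by metis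
  hence "map f xs \<in> lists I" "map a (map f xs) = xs" by (auto intro!: map_idI)
  hence "\<not> forks L C A (length (map f xs)) \<phi> b"
   using *[unfolded independent_def, rule_format, of "map f xs" b \<phi>] b \<phi> hold by simp
  thus "\<not> fork A (length xs) \<phi> b" using forks_forkset[OF assms] by simp
 qed
next
 assume *: "ind (a ` I) A B"
 show "independent L C I a A B" unfolding independent_def
 proof (intro ballI impI)
  fix js b \<phi> assume "js \<in> lists I" "b \<in> lists (A \<union> B)" "\<phi> \<in> fmlas L (length b + length js)" "holds C \<phi> (b @ map a js)"
  thus "\<not> forks L C A (length js) \<phi> b"
   using *[unfolded ind_def, rule_format, of "map a js" b \<phi>] forks_forkset[OF assms] by (simp add: lists_eq_set image_mono)
 qed
qed

subsection \<open>Stable formulas\<close>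

definition orderless :: "nat \<Rightarrow> nat \<Rightarrow> ('f, 'r) fm \<Rightarrow> nat \<Rightarrow> bool" where
 "orderless p m \<phi> N \<longleftrightarrow> \<not> (\<exists>a b. (\<forall>i<N. a i \<in> tup p \<and> b i \<in> tup m) \<and>
   (\<forall>i<N. \<forall>j<N. holds C \<phi> (a i @ b j) \<longleftrightarrow> i < j))"

lemma tup_nth: "xs \<in> tup n \<Longrightarrow> j < n \<Longrightarrow> xs ! j \<in> dom C"
 using nth_mem[of j xs] by (auto simp: tuples_def)

text \<open>By compactness, arbitrarily long finite orders would yield an infinite one.\<close>

lemma stable_bound:
 assumes \<phi>: "\<phi> \<in> fmlas L (p + m)" and st: "stable_formula C p m \<phi>"
 shows "\<exists>N. orderless p m \<phi> N"
proof (rule ccontr)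
 assume "\<not> ?thesis"
 hence all: "\<exists>a b. (\<forall>i<N. a i \<in> tup p \<and> b i \<in> tup m) \<and> (\<forall>i<N. \<forall>j<N. holds C \<phi> (a i @ b j) \<longleftrightarrow> i < j)" for N :: nat
  unfolding orderless_def by simp
 define V where "V s i n = map (\<lambda>j. (s, i, j)) [0..<n]" for s :: bool and i n :: nat
 define E where "E q M e \<longleftrightarrow> (holds M \<phi> (map e (V True (fst q) p @ V False (snd q) m)) \<longleftrightarrow> fst q < snd q)"
  for q :: "nat \<times> nat" and M :: "('f, 'r, 'u) struct" and e
 have "\<exists>e. e ` UNIV \<subseteq> dom C \<and> (\<forall>x\<in>{}. e x = undefined x) \<and> (\<forall>j\<in>UNIV. E j C e)"
 proof (rule assignment_C)
  show "small (UNIV :: (bool \<times> nat \<times> nat) set)" by (rule small_countable)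
  show "dfn L UNIV (E q)" for q
   unfolding E_def by (intro dfn_Iff dfn_const dfn_holds) (use \<phi> in \<open>auto simp: V_def\<close>)
  fix J0 :: "(nat \<times> nat) set" assume "finite J0"
  hence "finite (fst ` J0 \<union> snd ` J0)" by simp
  then obtain N where N0: "\<forall>n\<in>fst ` J0 \<union> snd ` J0. n < N" unfolding finite_nat_set_iff_bounded by (elim exE) (rule that)
  obtain a b where ab: "\<forall>i<N. a i \<in> tup p \<and> b i \<in> tup m" "\<forall>i<N. \<forall>j<N. holds C \<phi> (a i @ b j) \<longleftrightarrow> i < j"
   using all[of N] by (elim exE conjE) (rule that)
  obtain u where u: "u \<in> dom C" using dom_nonempty by blast
  define e where "e = (\<lambda>(s, i, j). if i < N \<and> j < (if s then p else m) then (if s then a i else b i) ! j else u)"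
  have eV: "map e (V True i p) = a i" "map e (V False i m) = b i" if "i < N" for i
   using ab(1) that by (auto intro!: nth_equalityI simp: e_def V_def tuples_def)
  have "E q C e" if "q \<in> J0" for q
   using N0 that ab(2) by (auto simp: E_def eV)
  moreover have "e x \<in> dom C" for x
  proof (cases x)
   case (fields s i j)
   have "a i ! j \<in> dom C" if "i < N" "j < p" using ab(1) that tup_nth by blast
   moreover have "b i ! j \<in> dom C" if "i < N" "j < m" using ab(1) that tup_nth by blast
   ultimately show ?thesis using u fields by (auto simp: e_def)
  qed
  ultimately show "\<exists>e. e ` UNIV \<subseteq> dom C \<and> (\<forall>x\<in>{}. e x = undefined x) \<and> (\<forall>j\<in>J0. E j C e)"
   by (intro exI[of _ e]) auto
 qed simp
 then obtain e where e: "inC (range e)" "\<forall>j\<in>UNIV. E j C e" by (elim exE conjE) (rule that)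
 have 1: "\<forall>i. map e (V True i p) \<in> tup p \<and> map e (V False i m) \<in> tup m"
  using e(1) by (auto simp: V_def tuples_def)
 have 2: "\<forall>i j. holds C \<phi> (map e (V True i p) @ map e (V False j m)) \<longleftrightarrow> i < j"
 proof (intro allI)
  fix i j
  have "E (i, j) C e" using e(2) by (rule bspec) (rule UNIV_I)
  thus "holds C \<phi> (map e (V True i p) @ map e (V False j m)) \<longleftrightarrow> i < j"
   unfolding E_def by (simp only: map_append fst_conv snd_conv)
 qed
 have "\<not> stable_formula C p m \<phi>" unfolding stable_formula_def not_not
  by (rule exI[of _ "\<lambda>i. map e (V True i p)"], rule exI[of _ "\<lambda>i. map e (V False i m)"], rule conjI[OF 1 2])
 thus False using st by blast
qed

text \<open>Ramsey's theorem for \<open>r\<close>-subsets either lowers the degree of inconsistency to \<open>r\<close> or, all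
 \<open>r\<close>-subsets being consistent and all larger ones not, produces the order property of length \<open>r\<close>.\<close>

lemma kinc_stable:
 fixes N :: nat
 assumes \<phi>: "\<phi> \<in> fmlas L (p + m)"
  and N: "orderless p m \<phi> N"
 shows "kinc m \<phi> k s \<Longrightarrow> (\<And>i. s i \<in> tup p) \<Longrightarrow> \<exists>f. strict_mono f \<and> kinc m \<phi> N (\<lambda>i. s (f i))"
proof (induction k arbitrary: s)
 case 0
 hence "kinc m \<phi> N s" using kinc_mono by blast
 thus ?case by (intro exI[of _ id]) (simp add: strict_mono_def)
next
 case (Suc r)
 show ?case
 proof (cases "Suc r \<le> N")
  case True
  hence "kinc m \<phi> N s" using kinc_mono Suc.prems(1) by blast
  thus ?thesis by (intro exI[of _ id]) (simp add: strict_mono_def)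
 next
  case False
  hence r: "N \<le> r" by simp
  \<comment> \<open>Color 1 marks the sets whose instances have a common solution.\<close>
  define col where "col R = (if \<exists>y\<in>tup m. \<forall>i\<in>R. holds C \<phi> (s i @ y) then 1 else 0 :: nat)" for R
  have "\<exists>H t. H \<subseteq> UNIV \<and> infinite H \<and> t < 2 \<and> (\<forall>R. R \<subseteq> H \<and> finite R \<and> card R = r \<longrightarrow> col R = t)"
   by (rule Ramsey) (auto simp: col_def)
  then obtain H t where H: "infinite H" "t < 2" "\<forall>R. R \<subseteq> H \<and> finite R \<and> card R = r \<longrightarrow> col R = t"
   by (elim exE conjE) (rule that)
  obtain f :: "nat \<Rightarrow> nat" where f: "strict_mono f" "\<And>n. f n \<in> H" using infinite_enumerate[OF H(1)] by blast
  have inj: "inj f" using f(1) strict_mono_imp_inj_on by blast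
  have colf: "col (f ` R) = t" if "finite R" "card R = r" for R
  proof -
   have "f ` R \<subseteq> H" "finite (f ` R)" using f(2) that(1) by auto
   moreover have "card (f ` R) = r" using that inj by (simp add: card_image inj_on_subset)
   ultimately show ?thesis using H(3) by blast
  qed
  show ?thesis
  proof (cases "t = 0")
   case True
   have "kinc m \<phi> r (\<lambda>i. s (f i))" unfolding kinc_def
   proof (intro allI impI notI)
    fix R :: "nat set" assume R: "finite R \<and> card R = r" and "\<exists>y\<in>tup m. \<forall>i\<in>R. holds C \<phi> (s (f i) @ y)"
    hence "col (f ` R) = 1" by (auto simp: col_def)
    thus False using colf R True by simp
   qed
   then obtain g where "strict_mono g" "kinc m \<phi> N (\<lambda>i. s (f (g i)))"
    using Suc.IH[of "\<lambda>i. s (f i)"] Suc.prems(2) by auto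
   moreover have "strict_mono (\<lambda>i. f (g i))" using f(1) \<open>strict_mono g\<close> by (simp add: strict_mono_def)
   ultimately show ?thesis by blast
  next
   case False
   \<comment> \<open>\<open>R j\<close> has \<open>r\<close> elements and meets
     \<open>{..<N}\<close> exactly in \<open>{..<j}\<close>. A common solution of the instances in
     \<open>R j\<close> satisfies no further instance, since \<open>Suc r\<close> of them are
     inconsistent; hence these solutions order the first \<open>N\<close> instances.\<close>
   define R where "R j = {..<j} \<union> {N..<N + (r - j)}" for j
   have R: "finite (R j)" "card (R j) = r" if "j \<le> N" for j
   proof -
    have "card ({..<j} \<union> {N..<N + (r - j)}) = j + (r - j)"
     by (subst card_Un_disjoint) (use that in auto)
    thus "card (R j) = r" using that r by (simp add: R_def)
   qed (simp add: R_def)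
   have "\<exists>y\<in>tup m. \<forall>i\<in>R j. holds C \<phi> (s (f i) @ y)" if "j \<le> N" for j
   proof -
    have "col (f ` R j) \<noteq> 0" using colf[OF R[OF that]] False by simp
    thus ?thesis by (auto simp: col_def split: if_splits)
   qed
   hence "\<forall>j\<in>{..N}. \<exists>y. y \<in> tup m \<and> (\<forall>i\<in>R j. holds C \<phi> (s (f i) @ y))" by (metis atMost_iff)
   from bchoice[OF this] obtain y where y: "\<forall>j\<in>{..N}. y j \<in> tup m \<and> (\<forall>i\<in>R j. holds C \<phi> (s (f i) @ y j))" ..
   have "holds C \<phi> (s (f i) @ y j) \<longleftrightarrow> i < j" if "i < N" "j < N" for i j
   proof
    assume "i < j"
    hence "i \<in> R j" by (simp add: R_def)
    thus "holds C \<phi> (s (f i) @ y j)" using y that by auto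
   next
    assume h: "holds C \<phi> (s (f i) @ y j)"
    show "i < j"
    proof (rule ccontr)
     assume "\<not> i < j"
     hence "i \<notin> R j" using that by (auto simp: R_def)
     hence "card (insert i (R j)) = Suc r" using R[of j] that by simp
     hence "card (f ` insert i (R j)) = Suc r"
      using card_image[OF inj_on_subset[OF inj]] by (metis subset_UNIV)
     moreover have "\<forall>l\<in>f ` insert i (R j). holds C \<phi> (s l @ y j)" using y h that by auto
     ultimately show False
      using kincD[OF Suc.prems(1), of "f ` insert i (R j)" "y j"] R[of j] y that by auto
    qed
   qed
   hence "\<exists>a b. (\<forall>i<N. a i \<in> tup p \<and> b i \<in> tup m) \<and> (\<forall>i<N. \<forall>j<N. holds C \<phi> (a i @ b j) \<longleftrightarrow> i < j)"
    using Suc.prems(2) y by (intro exI[of _ "\<lambda>i. s (f i)"] exI[of _ y]) auto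
   thus ?thesis using N unfolding orderless_def by blast
  qed
 qed
qed

text \<open>A length of orders that \<open>\<phi>\<close> does not admit serves as the degree of
  inconsistency, uniformly in the base and in the parameters.\<close>

lemma stable_kdiv:
 assumes \<phi>: "\<phi> \<in> fmlas L (p + m)" and st: "stable_formula C p m \<phi>"
 obtains N :: nat where "\<And>A b. A \<subseteq> dom C \<Longrightarrow> small A \<Longrightarrow> b \<in> tup p \<Longrightarrow> fork A m \<phi> b \<longleftrightarrow> kdiv A m N \<phi> b"
proof -
 obtain N where N: "orderless p m \<phi> N" using stable_bound[OF \<phi> st] ..
 have "fork A m \<phi> b \<longleftrightarrow> kdiv A m N \<phi> b" if A: "inC A" "small A" and b: "b \<in> tup p" for A b
 proof
  have b': "b \<in> lists (dom C)" "\<phi> \<in> fms b m" using b \<phi> by (auto simp: tuples_def lists_eq_set)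
  assume "fork A m \<phi> b"
  then obtain k where "kdiv A m k \<phi> b" using forkset_kdiv[OF A b'] by blast
  then obtain h where h: "\<And>i. h i \<in> auts A" "kinc m \<phi> k (\<lambda>i. map (h i) b)" unfolding kdiv_def by blast
  then obtain f where f: "kinc m \<phi> N (\<lambda>i. map (h (f i)) b)"
   using kinc_stable[OF \<phi> N h(2)] auts_tup[OF h(1) b] by blast
  thus "kdiv A m N \<phi> b" unfolding kdiv_def using h(1) by (intro exI[of _ "\<lambda>i. h (f i)"]) blast
 next
  assume "kdiv A m N \<phi> b"
  thus "fork A m \<phi> b" using b \<phi> by (intro kdiv_forkset) (auto simp: tuples_def lists_eq_set)
 qed
 thus ?thesis using that by blast
qed

end

section \<open>Cardinal bounds for lists and closing formulas by quantifiers\<close>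

lemma card_lists_bound:
 assumes A: "|A| \<le>o r" and r: "Cinfinite r"
 shows "|lists A| \<le>o r"
proof -
 have "|{xs\<in>lists A. length xs = n}| \<le>o r" for n
 proof (induction n)
  case 0
  have "{xs\<in>lists A. length xs = 0} = {[]}" by auto
  thus ?case using r by (metis card_of_singl_ordLeq Card_order_singl_ordLeq cinfinite_not_czero czeroI)
 next
  case (Suc n)
  have "{xs\<in>lists A. length xs = Suc n} \<subseteq> (\<lambda>(x, xs). x # xs) ` (A \<times> {xs\<in>lists A. length xs = n})"
  proof
   fix xs assume "xs \<in> {xs\<in>lists A. length xs = Suc n}"
   then obtain x ys where "xs = x # ys" "x \<in> A" "ys \<in> lists A" "length ys = n" by (cases xs) auto
   thus "xs \<in> (\<lambda>(x, xs). x # xs) ` (A \<times> {xs\<in>lists A. length xs = n})" by force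
  qed
  hence "|{xs\<in>lists A. length xs = Suc n}| \<le>o |A \<times> {xs\<in>lists A. length xs = n}|"
   by (rule ordLeq_transitive[OF card_of_mono1 card_of_image])
  also have "|A \<times> {xs\<in>lists A. length xs = n}| \<le>o r"
   using card_of_Times_ordLeq_infinite_Field[of r A "{xs\<in>lists A. length xs = n}"] A Suc r
   by (simp add: cinfinite_def)
  finally show ?case .
 qed
 moreover have "|UNIV :: nat set| \<le>o r"
  using r natLeq_ordLeq_cinfinite card_of_nat ordIso_ordLeq_trans by blast
 moreover have "lists A = (\<Union>n. {xs\<in>lists A. length xs = n})" by auto
 ultimately show ?thesis using UNION_Cinfinite_bound[of "UNIV :: nat set" r "\<lambda>n. {xs\<in>lists A. length xs = n}"] r
  by simp
qed

lemma card_Times_bound: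
 assumes "|A| \<le>o r" "|B| \<le>o r" "Cinfinite r"
 shows "|A \<times> B| \<le>o r"
 using card_of_Times_ordLeq_infinite_Field[of r A B] assms by (simp add: cinfinite_def)

text \<open>Closing a formula by a block of quantifiers is injective once the length of the block is
  known. This reduces counting formulas to counting sentences, each of which belongs to
  \<open>T\<close> itself or has its negation there.\<close>

primrec exs :: "nat \<Rightarrow> ('f, 'r) fm \<Rightarrow> ('f, 'r) fm" where
 "exs 0 \<phi> = \<phi>"
| "exs (Suc n) \<phi> = Ex n (exs n \<phi>)"

lemma fv_exs: "fv (exs n \<phi>) = fv \<phi> - {..<n}"
proof (induction n)
 case (Suc n)
 have "fv \<phi> - {..<n} - {n} = fv \<phi> - {..<Suc n}" by (simp add: lessThan_Suc) blast
 thus ?case using Suc by simp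
qed simp

lemma wff_exs: "wff L (exs n \<phi>) = wff L \<phi>"
 by (induction n) auto

lemma exs_inj: "exs n \<phi> = exs n \<psi> \<Longrightarrow> \<phi> = \<psi>"
 by (induction n) auto

context monster
begin

subsection \<open>Cardinalities\<close>

lemma Cinf_T: "Cinfinite |T|"
 using infinite_T by (simp add: cinfinite_def Field_card_of card_of_card_order_on)

lemma Cinf_PowT: "Cinfinite |Pow T|"
 using infinite_T by (simp add: cinfinite_def Field_card_of card_of_card_order_on)

lemma T_le_PowT: "|T| \<le>o |Pow T|"
 using card_of_Pow ordLess_imp_ordLeq by blast

lemma card_wff: "|{\<phi>. wff L \<phi>}| \<le>o |T|"
proof -
 have "|Neg -` T| \<le>o |T|" using card_of_ordLeq[of "Neg -` T" T] by (intro card_of_ordLeq[THEN iffD1] exI[of _ Neg]) (auto simp: inj_on_def)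
 hence "|T \<union> Neg -` T| \<le>o |T|" using Un_Cinfinite_bound[OF _ _ Cinf_T] card_of_mono1[of T T] by blast
 moreover have "sentences L \<subseteq> T \<union> Neg -` T"
  using complete unfolding complete_theory_def by auto
 ultimately have sent: "|sentences L| \<le>o |T|" using card_of_mono1 ordLeq_transitive by blast
 define b where "b \<phi> = Suc (Max (insert 0 (fv \<phi>)))" for \<phi> :: "('f, 'r) fm"
 have b: "fv \<phi> \<subseteq> {..<b \<phi>}" for \<phi>
 proof
  fix v assume "v \<in> fv \<phi>"
  hence "v \<le> Max (insert 0 (fv \<phi>))" by (intro Max_ge) (auto simp: finite_fv)
  thus "v \<in> {..<b \<phi>}" by (simp add: b_def)
 qed
 have "inj_on (\<lambda>\<phi>. (b \<phi>, exs (b \<phi>) \<phi>)) {\<phi>. wff L \<phi>}" by (auto intro!: inj_onI dest: exs_inj)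
 moreover have "(\<lambda>\<phi>. (b \<phi>, exs (b \<phi>) \<phi>)) ` {\<phi>. wff L \<phi>} \<subseteq> UNIV \<times> sentences L"
 proof -
  show ?thesis by (auto simp: sentences_def fmlas_def wff_exs fv_exs dest: subsetD[OF b])
 qed
 ultimately have "|{\<phi>. wff L \<phi>}| \<le>o |(UNIV :: nat set) \<times> sentences L|"
  using card_of_ordLeq by blast
 moreover have "|(UNIV :: nat set) \<times> sentences L| \<le>o |T|"
  using card_Times_bound[OF _ sent Cinf_T] infinite_T infinite_iff_card_of_nat by blast
 ultimately show ?thesis using ordLeq_transitive by blast
qed

lemma card_instances:
 assumes "|I| \<le>o |T|" "|A| \<le>o |T|"
 shows "|instances L I A| \<le>o |T|"
proof -
 have "instances L I A \<subseteq> {\<phi>. wff L \<phi>} \<times> (lists I \<times> lists A)"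
  by (auto simp: instances_def fmlas_def)
 hence "|instances L I A| \<le>o |{\<phi>. wff L \<phi>} \<times> (lists I \<times> lists A)|" by (rule card_of_mono1)
 moreover have "|{\<phi>. wff L \<phi>} \<times> (lists I \<times> lists A)| \<le>o |T|"
  by (intro card_Times_bound card_wff card_lists_bound assms Cinf_T)
 ultimately show ?thesis using ordLeq_transitive by blast
qed

text \<open>A nonempty subset of size at most |T| is the image of a function from \<open>T\<close>
  to \<open>M\<close>, and the power of 2^|T| with exponent |T| is again 2^|T|.\<close>

lemma card_subsets:
 assumes M: "|M| \<le>o |Pow T|"
 shows "|{A. A \<subseteq> M \<and> |A| \<le>o |T| }| \<le>o |Pow T|"
proof -
 have surj: "{A. A \<subseteq> M \<and> |A| \<le>o |T| } \<subseteq> insert {} ((\<lambda>f. f ` T) ` Func T M)"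
 proof
  fix A assume A: "A \<in> {A. A \<subseteq> M \<and> |A| \<le>o |T| }"
  show "A \<in> insert {} ((\<lambda>f. f ` T) ` Func T M)"
  proof (cases "A = {}")
   case False
   then obtain f where f: "f ` T = A" using A card_of_ordLeq2[of A T] by auto
   define g where "g x = (if x \<in> T then f x else undefined)" for x
   have "g \<in> Func T M" "g ` T = A" using f A by (auto simp: Func_def g_def)
   thus ?thesis by blast
  qed simp
 qed
 have "|Func T M| \<le>o |Pow T|"
 proof -
  have "|Func T M| = |M| ^c |T|" by (simp add: cexp_def Field_card_of)
  moreover have "|M| ^c |T| \<le>o |Pow T| ^c |T|"
   by (rule cexp_mono1[OF M]) (rule card_of_Card_order)
  moreover have "|Pow T| ^c |T| \<le>o |Pow T|"
  proof -
   have PF: "|Pow T| =o ctwo ^c |T|"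
   proof -
    have "|Pow T| =o |Func T (UNIV :: bool set)|" by (rule card_of_Pow_Func)
    thus ?thesis by (simp add: cexp_def ctwo_def Field_card_of)
   qed
   have "|Pow T| ^c |T| =o (ctwo ^c |T| ) ^c |T|"
    by (rule cexp_cong1[OF PF card_of_Card_order])
   also have "(ctwo ^c |T| ) ^c |T| =o ctwo ^c ( |T| *c |T| )"
    by (rule cexp_cprod[OF Card_order_ctwo])
   also have "ctwo ^c ( |T| *c |T| ) =o ctwo ^c |T|"
    by (rule cexp_cong2[OF cprod_infinite[OF Cinf_T] Card_order_ctwo Card_order_cprod])
   also have "ctwo ^c |T| =o |Pow T|" using PF ordIso_symmetric by blast
   finally show ?thesis by (rule ordIso_imp_ordLeq)
  qed
  ultimately show ?thesis using ordLeq_transitive by metis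
 qed
 hence "|(\<lambda>f. f ` T) ` Func T M| \<le>o |Pow T|" using card_of_image ordLeq_transitive by blast
 moreover have "|{{} :: 'z set}| \<le>o |Pow T|" by (rule card_of_singl_ordLeq) blast
 ultimately have "|insert {} ((\<lambda>f. f ` T) ` Func T M)| \<le>o |Pow T|"
  using Un_Cinfinite_bound[OF _ _ Cinf_PowT, of "{{}}" "(\<lambda>f. f ` T) ` Func T M"] by simp
 thus ?thesis using card_of_mono1[OF surj] ordLeq_transitive by blast
qed

lemma card_Pow_le:
 assumes "|B| \<le>o |T|"
 shows "|Pow B| \<le>o |Pow T|"
proof -
 obtain f where f: "inj_on f B" "f ` B \<subseteq> T" using assms card_of_ordLeq[of B T] by blast
 have "inj_on (image f) (Pow B)" using f(1) by (rule inj_on_image_Pow)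
 moreover have "image f ` Pow B \<subseteq> Pow T" using f(2) by blast
 ultimately show ?thesis using card_of_ordLeq by blast
qed

subsection \<open>Free realizations of infinite types\<close>

text \<open>The empty tuple is independent from everything, and elements of the base may be added to
  it.\<close>

lemma ind_self: "A \<subseteq> dom C \<Longrightarrow> ind A A B"
proof -
 assume A: "inC A"
 obtain \<tau> where \<tau>: "\<tau> \<in> fmlas L 0" "\<And>(M :: ('f, 'r, 'u) struct) xs. length xs = 0 \<Longrightarrow> holds M \<tau> xs \<longleftrightarrow> True"
  using fm_exists[OF dfn_const[of L "{..<0}" True]] by blast
 have "ind {} A B" unfolding ind_def
 proof (intro ballI impI)
  fix xs b \<phi> assume *: "xs \<in> lists {}" "b \<in> lists (A \<union> B)" "\<phi> \<in> fmlas L (length b + length xs)" "holds C \<phi> (b @ xs)"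
  have xs: "xs = []" using *(1) by simp
  have "\<not> fork A 0 \<tau> []"
   by (rule existence[OF A]) (use \<tau> in \<open>auto simp: sols_def tuples_def\<close>)
  moreover have "sols 0 \<tau> [] = sols 0 \<phi> b" using \<tau> *(4) xs by (auto simp: sols_def tuples_def)
  ultimately show "\<not> fork A (length xs) \<phi> b" using xs by simp
 qed
 hence "ind ({} \<union> A) A B" by (rule ind_addA[OF _ A]) simp
 thus ?thesis by simp
qed

text \<open>Independence of an infinite family only forbids forking formulas about finitely many of
  its members. It is added to the system as a set of negated formulas and settled by
  compactness.\<close>

lemma free_assignment:
 fixes I :: "'z set" and R :: "'j \<Rightarrow> ('f, 'r, 'u) struct \<Rightarrow> ('z + 'u \<Rightarrow> 'u) \<Rightarrow> bool"
 assumes A: "inC A" and B: "inC B" and sm: "small (A \<union> B)" and I: "small I"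
  and R: "\<And>j. j \<in> J \<Longrightarrow> dfn L (Inl ` I \<union> Inr ` (A \<union> B)) (R j)"
  and fin: "\<And>J0 I0. J0 \<subseteq> J \<Longrightarrow> finite J0 \<Longrightarrow> I0 \<subseteq> I \<Longrightarrow> finite I0 \<Longrightarrow>
   \<exists>a. a ` I \<subseteq> dom C \<and> ind (a ` I0) A B \<and> (\<forall>j\<in>J0. R j C (case_sum a id))"
 shows "\<exists>a. a ` I \<subseteq> dom C \<and> ind (a ` I) A B \<and> (\<forall>j\<in>J. R j C (case_sum a id))"
proof -
 let ?X = "Inl ` I \<union> Inr ` (A \<union> B) :: ('z + 'u) set"
 let ?F = "{(\<chi>, c, js). c \<in> lists (A \<union> B) \<and> js \<in> lists I \<and> \<chi> \<in> fmlas L (length c + length js) \<and> fork A (length js) \<chi> c}"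
 define E where "E j = (case j of Inl j \<Rightarrow> R j | Inr (\<chi>, c, js) \<Rightarrow> (\<lambda>M e. \<not> holds M \<chi> (map e (map Inr c @ map Inl js))))"
  for j :: "'j + ('f, 'r) fm \<times> 'u list \<times> 'z list"
 have "\<exists>e. e ` ?X \<subseteq> dom C \<and> (\<forall>x\<in>Inr ` (A \<union> B). e x = projr x) \<and> (\<forall>j\<in>Inl ` J \<union> Inr ` ?F. E j C e)"
 proof (rule assignment_C)
  show "small ?X" using small_Un[OF small_image[OF I] small_image[OF sm]] .
  fix j assume "j \<in> Inl ` J \<union> Inr ` ?F"
  then consider k where "j = Inl k" "k \<in> J" | \<chi> c js where "j = Inr (\<chi>, c, js)" "(\<chi>, c, js) \<in> ?F" by blast
  thus "dfn L ?X (E j)"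
  proof cases
   case 1
   thus ?thesis using R[OF 1(2)] by (simp add: E_def)
  next
   case 2
   have "set (map Inr c @ map Inl js) \<subseteq> ?X" using 2(2) by (auto simp: lists_eq_set)
   thus ?thesis unfolding 2(1) E_def sum.case prod.case by (intro dfn_Neg dfn_holds) (use 2(2) in auto)
  qed
 next
  fix J0 assume J0: "J0 \<subseteq> Inl ` J \<union> Inr ` ?F" "finite J0"
  \<comment> \<open>The finitely many variables that occur in the forbidden forking formulas of
    \<open>J0\<close>.\<close>
  let ?I0 = "\<Union>j\<in>J0. case j of Inl _ \<Rightarrow> {} | Inr (\<chi>, c, js) \<Rightarrow> set js"
  have f: "finite (Inl -` J0)" "finite ?I0"
   by (rule finite_vimageI[OF J0(2)], simp) (rule finite_UN_I[OF J0(2)], auto split: sum.splits)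
  have "Inl -` J0 \<subseteq> J" "?I0 \<subseteq> I" using J0(1) by (fastforce simp: lists_eq_set split: sum.splits)+
  from fin[OF this(1) f(1) this(2) f(2)] obtain a where
   a: "inC (a ` I)" "ind (a ` ?I0) A B" "\<forall>j\<in>Inl -` J0. R j C (case_sum a id)" by (elim exE conjE) (rule that)
  have "E j C (case_sum a id)" if j: "j \<in> J0" for j
  proof (cases j)
   case (Inl k)
   thus ?thesis using a(3) j by (simp add: E_def)
  next
   case (Inr w)
   obtain \<chi> c js where w: "w = (\<chi>, c, js)" by (cases w)
   have F: "(\<chi>, c, js) \<in> ?F" using J0(1) j Inr w by auto
   have "set js \<subseteq> ?I0" using j Inr w by force
   hence "map a js \<in> lists (a ` ?I0)" unfolding lists_eq_set set_map mem_Collect_eq by (rule image_mono)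
   hence "\<not> holds C \<chi> (c @ map a js)" using a(2) F unfolding ind_def by fastforce
   thus ?thesis unfolding Inr w E_def sum.case prod.case by (simp add: comp_def)
  qed
  moreover have "inC (case_sum a id ` ?X)" using a(1) A B by auto
  ultimately show "\<exists>e. e ` ?X \<subseteq> dom C \<and> (\<forall>x\<in>Inr ` (A \<union> B). e x = projr x) \<and> (\<forall>j\<in>J0. E j C e)"
   by (intro exI[of _ "case_sum a id"]) auto
 qed auto
 then obtain e where e: "inC (e ` ?X)" "\<forall>x\<in>Inr ` (A \<union> B). e x = projr x" "\<forall>j\<in>Inl ` J \<union> Inr ` ?F. E j C e"
  by (elim exE conjE) (rule that)
 define a where "a = (\<lambda>i. e (Inl i))"
 have "R j C (case_sum a id)" if j: "j \<in> J" for j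
 proof -
  have "R j C e" using e(3) j by (force simp: E_def)
  moreover have "R j C (case_sum a id) \<longleftrightarrow> R j C e" by (rule dfn_cong[OF R[OF j]]) (use e(2) in \<open>auto simp: a_def\<close>)
  ultimately show ?thesis by simp
 qed
 moreover have "ind (a ` I) A B" unfolding ind_def
 proof (intro ballI impI notI)
  fix xs c \<chi> assume xs: "xs \<in> lists (a ` I)" and c: "c \<in> lists (A \<union> B)" "\<chi> \<in> fms c (length xs)"
   and hold: "holds C \<chi> (c @ xs)" "fork A (length xs) \<chi> c"
  obtain js where js: "js \<in> lists I" "xs = map a js" using xs unfolding lists_image by blast
  have "E (Inr (\<chi>, c, js)) C e" using e(3) c hold(2) js by force
  moreover have "map (\<lambda>x. e (Inr x)) c = c" using c(1) e(2) by (intro map_idI) (auto simp: lists_eq_set)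
  ultimately show False using hold(1) unfolding E_def sum.case prod.case by (simp add: comp_def js(2) a_def)
 qed
 moreover have "inC (a ` I)" using e(1) by (auto simp: a_def)
 ultimately show ?thesis by blast
qed

text \<open>A realization of a finite part of \<open>q\<close> can be moved by an automorphism over
  \<open>A\<close> so that finitely many of its coordinates become independent from
  \<open>B\<close>; compactness does the rest.\<close>

lemma realize_free:
 fixes I :: "'z set"
 assumes A: "inC A" "small A" and B: "inC B" "small B" and I: "small I"
  and q: "q \<subseteq> instances L I A"
  and fin: "\<And>q0. finite q0 \<Longrightarrow> q0 \<subseteq> q \<Longrightarrow> \<exists>a. realizes C I a q0"
 shows "\<exists>a. realizes C I a q \<and> ind (a ` I) A B"
proof -
 define R where "R x M e \<longleftrightarrow> (case x of (\<phi>, js, c) \<Rightarrow> holds M \<phi> (map e (map Inl js @ map Inr c)))"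
  for x :: "('f, 'r) fm \<times> 'z list \<times> 'u list" and M :: "('f, 'r, 'u) struct" and e :: "'z + 'u \<Rightarrow> 'u"
 have inst: "js \<in> lists I" "c \<in> lists A" "\<phi> \<in> fmlas L (length js + length c)" if "(\<phi>, js, c) \<in> q" for \<phi> js c
  using subsetD[OF q that] by (simp_all add: instances_def)
 have R: "R (\<phi>, js, c) C (case_sum a id) \<longleftrightarrow> holds C \<phi> (map a js @ c)" for \<phi> js c a
  by (simp add: R_def comp_def)
 have "\<exists>a. a ` I \<subseteq> dom C \<and> ind (a ` I) A B \<and> (\<forall>x\<in>q. R x C (case_sum a id))"
 proof (rule free_assignment[OF A(1) B(1) small_Un[OF A(2) B(2)] I])
  fix x assume x: "x \<in> q"
  obtain \<phi> js c where xe: "x = (\<phi>, js, c)" by (cases x)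
  note i = inst[OF x[unfolded xe]]
  have "set (map Inl js @ map Inr c) \<subseteq> Inl ` I \<union> Inr ` (A \<union> B)" using i by (auto simp: lists_eq_set)
  thus "dfn L (Inl ` I \<union> Inr ` (A \<union> B)) (R x)" unfolding xe R_def prod.case by (intro dfn_holds) (use i in auto)
 next
  fix J0 I0 assume J0: "J0 \<subseteq> q" "finite J0" and I0: "I0 \<subseteq> I" "finite I0"
  obtain a where a: "realizes C I a J0" using fin J0 by blast
  have aC: "inC (a ` I)" using a by (auto simp: realizes_def)
  have X: "finite (a ` I0)" "inC (a ` I0)" using I0 aC by auto
  have emp: "small ({} :: 'u set)" by (rule small_finite) simp
  obtain h where h: "h \<in> auts A" "ind (h ` (a ` I0)) A B"
   using ind_extend[OF A _ emp B X ind_empty[OF A(1) X(2)]] by auto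
  have "R x C (case_sum (h \<circ> a) id)" if x: "x \<in> J0" for x
  proof -
   obtain \<phi> js c where xe: "x = (\<phi>, js, c)" by (cases x)
   note i = inst[OF subsetD[OF J0(1) x[unfolded xe]]]
   have "holds C \<phi> (map a js @ c)" using a x xe by (auto simp: realizes_def)
   moreover have "inC (set (map a js))" using i(1) aC by (auto simp: lists_eq_set)
   hence "map a js @ c \<in> lists (dom C)" using i(2) A(1) by (auto simp: lists_eq_set)
   ultimately have "holds C \<phi> (map h (map a js @ c))" using aut_holds[OF h(1), of \<phi> "map a js @ c"] i(3) by simp
   thus ?thesis unfolding xe R using auts_fix[OF h(1) i(2)] by (simp add: comp_def)
  qed
  moreover have "inC ((h \<circ> a) ` I)" using aC auts_dom[OF h(1)] by auto
  moreover have "ind ((h \<circ> a) ` I0) A B" using h(2) by (simp add: image_comp)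
  ultimately show "\<exists>a. a ` I \<subseteq> dom C \<and> ind (a ` I0) A B \<and> (\<forall>j\<in>J0. R j C (case_sum a id))" by blast
 qed
 then obtain a where a: "inC (a ` I)" "ind (a ` I) A B" "\<forall>x\<in>q. R x C (case_sum a id)" by (elim exE conjE) (rule that)
 have "realizes C I a q" unfolding realizes_def using a(1,3) R by fastforce
 thus ?thesis using a(2) by blast
qed

text \<open>One step towards a dense \<open>P\<close>. Each formula over \<open>M\<close> that does
  not fork over \<open>P\<close> has a solution independent from \<open>M\<close> and from the
  solutions found before. By left transitivity, finitely many solutions together are independent
  from \<open>M\<close> over \<open>P\<close>, and compactness treats all formulas at once.\<close>

lemma free_P_step:
 assumes P: "P \<subseteq> M" and M: "inC M" "|M| \<le>o |Pow T|"
 shows "\<exists>P'. P \<subseteq> P' \<and> P' \<subseteq> dom C \<and> |P'| \<le>o |Pow T| \<and> ind P' P M \<and>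
  (\<forall>m. \<forall>b\<in>lists M. \<forall>\<phi>\<in>fms b m. \<not> fork P m \<phi> b \<longrightarrow>
    (\<exists>y\<in>lists P'. length y = m \<and> holds C \<phi> (b @ y)))"
proof -
 have sM: "small M" using small_le[OF M(2) small_PowT] .
 have PC: "inC P" "small P" using P M(1) small_subset[OF P sM] by auto
 define K where "K = {(\<phi>, b, m). b \<in> lists M \<and> \<phi> \<in> fms b m \<and> \<not> fork P m \<phi> b}"
 have K: "b \<in> lists M" "\<phi> \<in> fms b m" "\<not> fork P m \<phi> b" if "(\<phi>, b, m) \<in> K" for \<phi> b m
  using that by (auto simp: K_def)
 have cnat: "|UNIV :: nat set| \<le>o |Pow T|" using infinite_T infinite_iff_card_of_nat T_le_PowT ordLeq_transitive by blast
 have cK: "|K| \<le>o |Pow T|"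
 proof -
  have "K \<subseteq> {\<phi>. wff L \<phi>} \<times> (lists M \<times> (UNIV :: nat set))" by (auto simp: K_def fmlas_def)
  moreover have "|{\<phi>. wff L \<phi>} \<times> (lists M \<times> (UNIV :: nat set))| \<le>o |Pow T|"
  proof (intro card_Times_bound card_lists_bound M Cinf_PowT)
   show "|{\<phi>. wff L \<phi>}| \<le>o |Pow T|" using card_wff T_le_PowT ordLeq_transitive by blast
   show "|UNIV :: nat set| \<le>o |Pow T|" by (rule cnat)
  qed
  ultimately show ?thesis using card_of_mono1 ordLeq_transitive by blast
 qed
 have finK: "\<exists>y. (\<forall>x\<in>K0. y x \<in> tup (snd (snd x)) \<and> holds C (fst x) (fst (snd x) @ y x)) \<and> ind (\<Union>x\<in>K0. set (y x)) P M"
  if "finite K0" "K0 \<subseteq> K" for K0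
  using that
 proof (induction K0 rule: finite_induct)
  case empty
  have "ind {} P M" by (rule ind_mono[OF ind_self[OF PC(1)]]) auto
  thus ?case by simp
 next
  case (insert x K0)
  then obtain y where y: "\<And>x. x \<in> K0 \<Longrightarrow> y x \<in> tup (snd (snd x)) \<and> holds C (fst x) (fst (snd x) @ y x)"
   "ind (\<Union>x\<in>K0. set (y x)) P M" by auto
  obtain \<phi> b m where x: "x = (\<phi>, b, m)" by (cases x)
  have bx: "b \<in> lists M" "\<phi> \<in> fms b m" "\<not> fork P m \<phi> b"
   using K[of \<phi> b m] insert.prems x by auto
  let ?U = "\<Union>x\<in>K0. set (y x)"
  have U: "inC ?U" "finite ?U" using y(1) insert.hyps(1) by (auto simp: tuples_def)
  have "\<exists>z\<in>tup m. (\<forall>(\<phi>, c)\<in>{(\<phi>, b)}. holds C \<phi> (c @ z)) \<and> ind (set z \<union> P) P (M \<union> ?U)"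
  proof (rule nonforking_realization[OF PC])
   show "inC (M \<union> ?U)" using M U by blast
   show "small (M \<union> ?U)" by (intro small_Un sM small_finite U)
   show "{(\<phi>, b)} \<subseteq> {(\<phi>, c). c \<in> lists (P \<union> (M \<union> ?U)) \<and> \<phi> \<in> fms c m}"
    using bx by (auto simp: lists_eq_set)
   fix \<Phi>0 assume "\<Phi>0 \<subseteq> {(\<phi>, b)}"
   hence "sols m \<phi> b \<subseteq> {y\<in>tup m. \<forall>(\<phi>, c)\<in>\<Phi>0. holds C \<phi> (c @ y)}" by (auto simp: sols_def)
   thus "\<not> forkset P m {y\<in>tup m. \<forall>(\<phi>, c)\<in>\<Phi>0. holds C \<phi> (c @ y)}" using bx(3) forkset_mono by blast
  qed
  then obtain z where z: "z \<in> tup m" "holds C \<phi> (b @ z)" "ind (set z \<union> P) P (M \<union> ?U)" by auto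
  have "ind (set z) (P \<union> ?U) M"
   by (rule ind_mono[OF ind_base[OF z(3), of "P \<union> ?U"]]) auto
  hence "ind (?U \<union> set z) P M"
   using z(1) by (intro ind_left_trans[OF PC U(1) small_finite[OF U(2)] M(1) _ y(2)]) (simp_all add: tuples_def)
  moreover have "(\<Union>x'\<in>insert x K0. set ((y(x := z)) x')) = ?U \<union> set z"
  proof -
   have "(\<Union>x'\<in>K0. set ((y(x := z)) x')) = ?U" by (rule SUP_cong) (use insert.hyps(2) in auto)
   thus ?thesis by (simp only: UN_insert fun_upd_same Un_commute)
  qed
  ultimately show ?case using z(1,2) y(1) x insert.hyps(2)
   by (intro exI[of _ "y(x := z)"]) auto
 qed
 \<comment> \<open>The variable (x, i) is coordinate \<open>i\<close> of the solution of the formula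
   coded by \<open>x\<close>.\<close>
 define V where "V = {(x, i). x \<in> K \<and> i < snd (snd x)}"
 define R where "R x M e \<longleftrightarrow> holds M (fst x) (map e (map Inr (fst (snd x)) @ map (\<lambda>i. Inl (x, i)) [0..<snd (snd x)]))"
  for x :: "('f, 'r) fm \<times> 'u list \<times> nat" and M :: "('f, 'r, 'u) struct" and e
 have cV: "|V| \<le>o |Pow T|"
 proof (rule ordLeq_transitive[OF card_of_mono1])
  show "V \<subseteq> K \<times> (UNIV :: nat set)" by (auto simp: V_def)
  show "|K \<times> (UNIV :: nat set)| \<le>o |Pow T|" by (rule card_Times_bound[OF cK cnat Cinf_PowT])
 qed
 have PM: "P \<union> M = M" using P by blast
 have "\<exists>a. a ` V \<subseteq> dom C \<and> ind (a ` V) P M \<and> (\<forall>x\<in>K. R x C (case_sum a id))"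
 proof (rule free_assignment[OF PC(1) M(1)], unfold PM)
  show "small M" "small V" by (rule sM, rule small_le[OF cV small_PowT])
  fix x assume x: "x \<in> K"
  obtain \<phi> b m where xe: "x = (\<phi>, b, m)" by (cases x)
  show "dfn L (Inl ` V \<union> Inr ` M) (R x)" unfolding R_def
   by (intro dfn_holds) (use K[of \<phi> b m] x xe in \<open>auto simp: lists_eq_set V_def\<close>)
 next
  fix J0 I0 assume J0: "J0 \<subseteq> K" "finite J0" and I0: "I0 \<subseteq> V" "finite I0"
  let ?K0 = "J0 \<union> fst ` I0"
  have "finite ?K0" "?K0 \<subseteq> K" using J0 I0 by (auto simp: V_def)
  then obtain y where y: "\<And>x. x \<in> ?K0 \<Longrightarrow> y x \<in> tup (snd (snd x)) \<and> holds C (fst x) (fst (snd x) @ y x)"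
   "ind (\<Union>x\<in>?K0. set (y x)) P M" using finK[of ?K0] by blast
  obtain u where u: "u \<in> dom C" using dom_nonempty by blast
  define a where "a = (\<lambda>(x, i). if x \<in> ?K0 \<and> i < snd (snd x) then y x ! i else u)"
  have yC: "y x ! i \<in> set (y x)" "y x ! i \<in> dom C" if "x \<in> ?K0" "i < snd (snd x)" for x i
   using y(1)[OF that(1)] that(2) nth_mem[of i "y x"] by (auto simp: tuples_def)
  have "a v \<in> dom C" for v using u yC(2) by (cases v) (auto simp: a_def)
  moreover have "a ` I0 \<subseteq> (\<Union>x\<in>?K0. set (y x))"
  proof (rule image_subsetI)
   fix v assume v: "v \<in> I0"
   obtain x i where ve: "v = (x, i)" by (cases v)
   have x: "x \<in> ?K0" "i < snd (snd x)" using v I0(1) unfolding ve by (force simp: V_def)+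
   thus "a v \<in> (\<Union>x\<in>?K0. set (y x))" using yC(1)[OF x] by (auto simp: ve a_def)
  qed
  hence "ind (a ` I0) P M" by (rule ind_mono[OF y(2)]) simp
  moreover have "R x C (case_sum a id)" if "x \<in> J0" for x
  proof -
   have "map (\<lambda>i. a (x, i)) [0..<snd (snd x)] = y x"
    using y(1)[of x] that by (intro nth_equalityI) (auto simp: a_def tuples_def)
   thus ?thesis using y(1)[of x] that by (simp add: R_def comp_def)
  qed
  ultimately show "\<exists>a. a ` V \<subseteq> dom C \<and> ind (a ` I0) P M \<and> (\<forall>j\<in>J0. R j C (case_sum a id))" by blast
 qed
 then obtain a where a: "inC (a ` V)" "ind (a ` V) P M" "\<forall>x\<in>K. R x C (case_sum a id)" by (elim exE conjE) (rule that)
 have "ind (a ` V \<union> P) P M" by (rule ind_addA[OF a(2) PC(1) a(1)])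
 moreover have "|a ` V \<union> P| \<le>o |Pow T|"
  by (rule Un_Cinfinite_bound[OF ordLeq_transitive[OF card_of_image cV] ordLeq_transitive[OF card_of_mono1[OF P] M(2)] Cinf_PowT])
 moreover have "\<exists>y\<in>lists (a ` V \<union> P). length y = m \<and> holds C \<phi> (b @ y)"
  if "b \<in> lists M" "\<phi> \<in> fms b m" "\<not> fork P m \<phi> b" for b \<phi> m
 proof -
  have K1: "(\<phi>, b, m) \<in> K" using that by (simp add: K_def)
  let ?y = "map (\<lambda>i. a ((\<phi>, b, m), i)) [0..<m]"
  have "holds C \<phi> (b @ ?y)" using bspec[OF a(3) K1] by (simp add: R_def comp_def)
  moreover have "?y \<in> lists (a ` V \<union> P)" using K1 by (auto simp: V_def)
  ultimately show ?thesis by (intro bexI[of _ ?y]) auto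
 qed
 ultimately show ?thesis using a(1) PC(1) by (intro exI[of _ "a ` V \<union> P"]) auto
qed

text \<open>Freeness of the new \<open>P\<close> from the old \<open>M\<close> over the old
  \<open>P\<close> is what preserves, at later stages, the independence obtained at this one. The
  set \<open>T\<close> itself serves as an index set of |T| variables.\<close>

definition free_step :: "'u set \<times> 'u set \<Rightarrow> 'u set \<times> 'u set \<Rightarrow> bool" where
 "free_step s s' \<longleftrightarrow> fst s \<subseteq> fst s' \<and> snd s \<subseteq> snd s' \<and> ind (snd s') (snd s) (fst s) \<and>
   (\<forall>m. \<forall>b\<in>lists (fst s). \<forall>\<phi>\<in>fms b m. \<not> fork (snd s) m \<phi> b \<longrightarrow>
    (\<exists>y\<in>lists (snd s'). length y = m \<and> holds C \<phi> (b @ y))) \<and>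
   (\<forall>A\<subseteq>fst s. |A| \<le>o |T| \<longrightarrow> (\<forall>q\<subseteq>instances L T A.
    (\<forall>q0. finite q0 \<and> q0 \<subseteq> q \<longrightarrow> (\<exists>a. realizes C T a q0)) \<longrightarrow>
    (\<exists>a. a ` T \<subseteq> fst s' \<and> realizes C T a q \<and> ind (a ` T) A (snd s'))))"

definition small_pair :: "'u set \<times> 'u set \<Rightarrow> bool" where
 "small_pair s \<longleftrightarrow> snd s \<subseteq> fst s \<and> fst s \<subseteq> dom C \<and> |fst s| \<le>o |Pow T|"

text \<open>The order matters: \<open>P'\<close> is fixed before the types are realized, so that the
  realizations can be independent from all of \<open>P'\<close>. There are at most 2^|T| pairs of a
  set \<open>A\<close> and a partial type \<open>q\<close> over it, so the new pair is not larger
  than the old bound.\<close>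

lemma free_step_exists:
 assumes "small_pair s"
 shows "\<exists>s'. small_pair s' \<and> free_step s s'"
proof -
 obtain M P where s: "s = (M, P)" by (cases s)
 have M: "P \<subseteq> M" "inC M" "|M| \<le>o |Pow T|" using assms by (auto simp: small_pair_def s)
 obtain P' where P': "P \<subseteq> P'" "inC P'" "|P'| \<le>o |Pow T|" "ind P' P M"
  "\<forall>m. \<forall>b\<in>lists M. \<forall>\<phi>\<in>fms b m. \<not> fork P m \<phi> b \<longrightarrow>
    (\<exists>y\<in>lists P'. length y = m \<and> holds C \<phi> (b @ y))"
  using free_P_step[OF M] by blast
 define S where "S = {(A, q). A \<subseteq> M \<and> |A| \<le>o |T| \<and> q \<subseteq> instances L T A \<and>
   (\<forall>q0. finite q0 \<and> q0 \<subseteq> q \<longrightarrow> (\<exists>a. realizes C T a q0))}"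
 have "\<exists>a. realizes C T a (snd x) \<and> ind (a ` T) (fst x) P'" if "x \<in> S" for x
 proof -
  have x: "fst x \<subseteq> M" "|fst x| \<le>o |T|" "snd x \<subseteq> instances L T (fst x)"
   "\<And>q0. finite q0 \<Longrightarrow> q0 \<subseteq> snd x \<Longrightarrow> \<exists>a. realizes C T a q0" using that by (auto simp: S_def)
  show ?thesis
  proof (rule realize_free[OF _ _ _ _ small_T x(3,4)])
   show "inC (fst x)" using x(1) M(2) by blast
   show "small (fst x)" using small_le[OF x(2) small_T] .
   show "small P'" using small_le[OF P'(3) small_PowT] .
  qed (rule P'(2))
 qed
 hence "\<forall>x\<in>S. \<exists>a. realizes C T a (snd x) \<and> ind (a ` T) (fst x) P'" by blast
 from bchoice[OF this] obtain a where a: "\<forall>x\<in>S. realizes C T (a x) (snd x) \<and> ind (a x ` T) (fst x) P'" ..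
 let ?N = "\<Union>x\<in>S. a x ` T"
 have "|?N| \<le>o |Pow T|"
 proof (rule UNION_Cinfinite_bound[OF _ _ Cinf_PowT])
  have "S \<subseteq> (SIGMA A:{A. A \<subseteq> M \<and> |A| \<le>o |T| }. Pow (instances L T A))" by (auto simp: S_def)
  hence "|S| \<le>o |SIGMA A:{A. A \<subseteq> M \<and> |A| \<le>o |T| }. Pow (instances L T A)|" by (rule card_of_mono1)
  moreover have "|SIGMA A:{A. A \<subseteq> M \<and> |A| \<le>o |T| }. Pow (instances L T A)| \<le>o |Pow T|"
  proof (rule card_of_Sigma_ordLeq_infinite)
   show "infinite (Pow T)" using infinite_T by simp
   show "|{A. A \<subseteq> M \<and> |A| \<le>o |T| }| \<le>o |Pow T|" by (rule card_subsets[OF M(3)])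
   show "\<forall>A\<in>{A. A \<subseteq> M \<and> |A| \<le>o |T| }. |Pow (instances L T A)| \<le>o |Pow T|"
    using card_Pow_le card_instances card_of_mono1[of T T] by blast
  qed
  ultimately show "|S| \<le>o |Pow T|" using ordLeq_transitive by blast
  show "\<forall>x\<in>S. |a x ` T| \<le>o |Pow T|" using card_of_image T_le_PowT ordLeq_transitive by blast
 qed
 hence "|M \<union> P' \<union> ?N| \<le>o |Pow T|"
  using Un_Cinfinite_bound[OF _ _ Cinf_PowT] M(3) P'(3) by blast
 moreover have "inC ?N" using a by (fastforce simp: realizes_def)
 ultimately have "small_pair (M \<union> P' \<union> ?N, P')" using M P' by (auto simp: small_pair_def)
 moreover have "free_step s (M \<union> P' \<union> ?N, P')" unfolding free_step_def s fst_conv snd_conv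
 proof (intro conjI)
  show "\<forall>A\<subseteq>M. |A| \<le>o |T| \<longrightarrow> (\<forall>q\<subseteq>instances L T A.
    (\<forall>q0. finite q0 \<and> q0 \<subseteq> q \<longrightarrow> (\<exists>a. realizes C T a q0)) \<longrightarrow>
    (\<exists>a. a ` T \<subseteq> M \<union> P' \<union> ?N \<and> realizes C T a q \<and> ind (a ` T) A P'))"
  proof (intro allI impI)
   fix A q assume "A \<subseteq> M" "|A| \<le>o |T|" "q \<subseteq> instances L T A"
    "\<forall>q0. finite q0 \<and> q0 \<subseteq> q \<longrightarrow> (\<exists>a. realizes C T a q0)"
   hence x: "(A, q) \<in> S" by (simp add: S_def)
   hence "realizes C T (a (A, q)) q" "ind (a (A, q) ` T) A P'" using a by auto
   moreover have "a (A, q) ` T \<subseteq> M \<union> P' \<union> ?N" using x by blast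
   ultimately show "\<exists>a. a ` T \<subseteq> M \<union> P' \<union> ?N \<and> realizes C T a q \<and> ind (a ` T) A P'" by blast
  qed
 qed (use P' in auto)
 ultimately show ?thesis by blast
qed

end

lemma sat_dom_update: "val (M\<lparr>dom := N\<rparr>) e t = val M e t"
 by (induction t) (auto cong: map_cong)

lemma finite_le_Cinfinite:
 assumes "finite A" "Cinfinite r"
 shows "|A| \<le>o r"
proof -
 have "Cfinite |A|" using assms(1) by (simp add: cfinite_def Field_card_of card_of_card_order_on)
 thus ?thesis using Cfinite_ordLess_Cinfinite assms(2) ordLess_imp_ordLeq by blast
qed

lemma elem_submodel_sat:
 assumes M: "is_struct L M" and N: "N \<subseteq> dom M" "N \<noteq> {}"
  and eq: "\<And>\<phi> e. wff L \<phi> \<Longrightarrow> range e \<subseteq> N \<Longrightarrow> sat (M\<lparr>dom := N\<rparr>) e \<phi> \<longleftrightarrow> sat M e \<phi>"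
 shows "elem_submodel L N M"
proof -
 let ?N = "M\<lparr>dom := N\<rparr>"
 obtain u where u: "u \<in> N" using N(2) by blast
 \<comment> \<open>Beyond the end of a list, \<open>nth\<close> may leave \<open>N\<close>;
   \<open>ev\<close> continues the list with a default value in \<open>N\<close>.\<close>
 define ev where "ev xs i = (if i < length xs then xs ! i else u)" for xs i
 have ev: "range (ev xs) \<subseteq> N" if "set xs \<subseteq> N" for xs
  using u that by (auto simp: ev_def subset_iff)
 have "fint M f xs \<in> N" if f: "f \<in> funs L" and xs: "xs \<in> tuples ?N (farity L f)" for f xs
 proof -
  let ?n = "length xs"
  \<comment> \<open>Closure of \<open>N\<close> under a function symbol is read off from the formula
    saying that the value exists.\<close>
  let ?\<phi> = "Ex ?n (Eq (Var ?n) (Fn f (map Var [0..<?n])))"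
  have xN: "?n = farity L f" "set xs \<subseteq> N" using xs by (simp_all add: tuples_def)
  have "map (\<lambda>i. ((ev xs)(?n := y)) i) [0..<?n] = xs" for y by (rule nth_equalityI) (simp_all add: ev_def)
  hence v: "sat K ((ev xs)(?n := y)) (Eq (Var ?n) (Fn f (map Var [0..<?n]))) \<longleftrightarrow> y = fint K f xs"
   for K :: "('a, 'b, 'c) struct" and y by (simp add: comp_def)
  have "fint M f xs \<in> dom M" using M f xN N(1) by (auto simp: is_struct_def tuples_def)
  hence "sat M (ev xs) ?\<phi>" unfolding sat.simps(5) v by blast
  moreover have "wff L ?\<phi>" using f xN(1) by simp
  ultimately have "sat ?N (ev xs) ?\<phi>" using eq ev[OF xN(2)] by blast
  thus ?thesis unfolding sat.simps(5) v by simp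
 qed
 hence "is_struct L ?N" using N(2) by (simp add: is_struct_def)
 moreover have "holds ?N \<phi> xs \<longleftrightarrow> holds M \<phi> xs" if \<phi>: "\<phi> \<in> fmlas L n" and xs: "xs \<in> tuples ?N n" for n \<phi> xs
 proof -
  have "holds K \<phi> xs \<longleftrightarrow> sat K (ev xs) \<phi>" for K :: "('a, 'b, 'c) struct"
   unfolding holds_def by (rule sat_cong) (use \<phi> xs in \<open>auto simp: fmlas_def tuples_def ev_def\<close>)
  thus ?thesis using eq[of \<phi> "ev xs"] ev[of xs] \<phi> xs by (simp add: fmlas_def tuples_def)
 qed
 ultimately show ?thesis using N(1) unfolding elem_submodel_def by blast
qed

context monster
begin

subsection \<open>Dense pairs with the extension property\<close>

text \<open>The Tarski-Vaught test. The quantified formula has arbitrary free variables, so it is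
  first rewritten with its parameters in a list.\<close>

lemma elem_submodelI:
 assumes N: "inC N" "N \<noteq> {}"
  and tv: "\<And>b \<phi> u. b \<in> lists N \<Longrightarrow> \<phi> \<in> fms b 1 \<Longrightarrow> u \<in> dom C \<Longrightarrow> holds C \<phi> (b @ [u]) \<Longrightarrow>
   \<exists>u\<in>N. holds C \<phi> (b @ [u])"
 shows "elem_submodel L N C"
proof -
 have tv_sat: "\<exists>u\<in>N. sat C (e(v := u)) \<phi>"
  if wff: "wff L \<phi>" and e: "\<And>w. w \<in> fv \<phi> - {v} \<Longrightarrow> e w \<in> N" and u: "u \<in> dom C" "sat C (e(v := u)) \<phi>" for \<phi> e v u
 proof -
  have "finite (fv \<phi> - {v})" by (simp add: finite_fv)
  from finite_list[OF this] obtain vs where vs: "set vs = fv \<phi> - {v}" ..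
  have "dfn L (set (vs @ [v])) (\<lambda>(M :: ('f, 'r, 'u) struct) a. sat M a \<phi>)"
   by (rule dfnI[where \<phi> = \<phi> and v = "\<lambda>i. i"]) (use wff vs in auto)
  then obtain \<psi> where \<psi>: "\<psi> \<in> fmlas L (length (vs @ [v]))"
   "\<And>(M :: ('f, 'r, 'u) struct) a. sat M a \<phi> \<longleftrightarrow> holds M \<psi> (map a (vs @ [v]))"
   by (rule dfn_to_fm) (rule that)
  have eq: "sat C (e(v := u)) \<phi> \<longleftrightarrow> holds C \<psi> (map e vs @ [u])" for u
  proof -
   have "map (e(v := u)) vs = map e vs" using vs by auto
   thus ?thesis unfolding \<psi>(2) by (simp only: map_append list.map fun_upd_same)
  qed
  have "map e vs \<in> lists N" using vs e by (auto simp: lists_eq_set)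
  thus ?thesis using tv[of "map e vs" \<psi> u] \<psi>(1) u eq by auto
 qed
 show ?thesis
 proof (rule elem_submodel_sat[OF struct_C N])
  fix \<phi> and e :: "nat \<Rightarrow> 'u" assume "wff L \<phi>" "range e \<subseteq> N"
  thus "sat (C\<lparr>dom := N\<rparr>) e \<phi> \<longleftrightarrow> sat C e \<phi>"
  proof (induction \<phi> arbitrary: e)
   case (Ex v \<phi>)
   have "sat (C\<lparr>dom := N\<rparr>) (e(v := u)) \<phi> \<longleftrightarrow> sat C (e(v := u)) \<phi>" if "u \<in> N" for u
    by (rule Ex.IH) (use Ex.prems that in auto)
   hence "sat (C\<lparr>dom := N\<rparr>) e (Ex v \<phi>) \<longleftrightarrow> (\<exists>u\<in>N. sat C (e(v := u)) \<phi>)" by simp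
   also have "\<dots> \<longleftrightarrow> (\<exists>u\<in>dom C. sat C (e(v := u)) \<phi>)"
    using N(1) tv_sat[of \<phi> v e] Ex.prems(1) rangeI[THEN subsetD[OF Ex.prems(2)]] by auto
   finally show ?case by simp
  qed (simp_all add: sat_dom_update cong: map_cong)
 qed
qed

lemma is_pairI:
 assumes M: "elem_submodel L M C" and P: "elem_submodel L P C" and PM: "P \<subseteq> M"
 shows "is_pair L C M P"
 unfolding is_pair_def
proof (intro conjI M)
 have tu: "xs \<in> tuples (C\<lparr>dom := M\<rparr>) n" if "xs \<in> tuples (C\<lparr>dom := P\<rparr>) n" for xs n
  using PM that by (auto simp: tuples_def)
 have eq: "(C\<lparr>dom := M\<rparr>)\<lparr>dom := P\<rparr> = C\<lparr>dom := P\<rparr>" by simp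
 show "elem_submodel L P (C\<lparr>dom := M\<rparr>)" unfolding elem_submodel_def eq
 proof (intro conjI allI ballI)
  show "P \<subseteq> dom (C\<lparr>dom := M\<rparr>)" using PM by simp
  show "is_struct L (C\<lparr>dom := P\<rparr>)" using P by (simp add: elem_submodel_def)
  fix n \<phi> xs assume "\<phi> \<in> fmlas L n" "xs \<in> tuples (C\<lparr>dom := P\<rparr>) n"
  hence "holds (C\<lparr>dom := P\<rparr>) \<phi> xs \<longleftrightarrow> holds C \<phi> xs" "holds (C\<lparr>dom := M\<rparr>) \<phi> xs \<longleftrightarrow> holds C \<phi> xs"
   using M P tu unfolding elem_submodel_def by blast+
  thus "holds (C\<lparr>dom := P\<rparr>) \<phi> xs \<longleftrightarrow> holds (C\<lparr>dom := M\<rparr>) \<phi> xs" by simp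
 qed
qed

text \<open>The chain has the length of the successor cardinal of |T|, which is regular: each
  \<open>A\<close> of size at most |T| lies in some stage, and a later stage realizes the types over
  it.\<close>

lemma free_chain:
 assumes E: "finite E" "inC E"
 shows "\<exists>M P. E \<subseteq> P \<and> P \<subseteq> M \<and> M \<subseteq> dom C \<and>
  (\<forall>A\<subseteq>M. |A| \<le>o |T| \<longrightarrow> (\<forall>q\<subseteq>instances L T A.
    (\<forall>q0. finite q0 \<and> q0 \<subseteq> q \<longrightarrow> (\<exists>a. realizes C T a q0)) \<longrightarrow>
    (\<exists>a. a ` T \<subseteq> M \<and> realizes C T a q \<and> ind (a ` T) A P))) \<and>
  (\<forall>B m. \<forall>b\<in>lists M. \<forall>\<phi>\<in>fms b m. finite B \<and> B \<subseteq> P \<and> \<not> fork B m \<phi> b \<longrightarrow>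
    (\<exists>y\<in>lists P. length y = m \<and> holds C \<phi> (b @ y)))"
proof -
 let ?W = "cardSuc |T|"
 let ?R = "?W - Id"
 have CT: "Card_order |T|" by (rule card_of_Card_order)
 have W: "Card_order ?W" "Well_order ?W" using cardSuc_Card_order[OF CT] cardSuc_Well_order[OF CT] by auto
 have wf: "wf ?R" using W(2) by (simp add: well_order_on_def)
 have infW: "infinite (Field ?W)" using Cinfinite_cardSuc[OF Cinf_T] by (simp add: cinfinite_def)
 have total: "(x, y) \<in> ?W \<or> (y, x) \<in> ?W" if "x \<in> Field ?W" "y \<in> Field ?W" for x y
  using W(2) that by (cases "x = y")
   (auto simp: well_order_on_def linear_order_on_def partial_order_on_def preorder_on_def total_on_def refl_on_def)
 have refl: "(x, x) \<in> ?W" if "x \<in> Field ?W" for x using total that by blast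
 have trans: "(x, z) \<in> ?W" if "(x, y) \<in> ?W" "(y, z) \<in> ?W" for x y z
  using W(2) that by (auto simp: well_order_on_def linear_order_on_def partial_order_on_def preorder_on_def dest: transD)
 have anti: "x = y" if "(x, y) \<in> ?W" "(y, x) \<in> ?W" for x y
  using W(2) that by (auto simp: well_order_on_def linear_order_on_def partial_order_on_def dest: antisymD)
 have fld: "x \<in> Field ?W" "y \<in> Field ?W" if "(x, y) \<in> ?W" for x y using that by (auto simp: Field_def)
 \<comment> \<open>\<open>t f x\<close> is the union of the stages before \<open>x\<close>. The set
   \<open>E\<close> is put into both components and thereby starts the chain.\<close>
 define t where "t f x = (E \<union> (\<Union>y\<in>{y. (y, x) \<in> ?R}. fst (f y)), E \<union> (\<Union>y\<in>{y. (y, x) \<in> ?R}. snd (f y)))"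
  for f :: "('f, 'r) fm set \<Rightarrow> 'u set \<times> 'u set" and x
 have "\<exists>f. \<forall>x. small_pair (t f x) \<longrightarrow> small_pair (f x) \<and> free_step (t f x) (f x)"
 proof (rule dependent_wf_choice[OF wf])
  fix f g :: "('f, 'r) fm set \<Rightarrow> 'u set \<times> 'u set" and x r
  assume fg: "\<And>z. (z, x) \<in> ?R \<Longrightarrow> f z = g z"
  have "(\<Union>y\<in>{y. (y, x) \<in> ?R}. fst (f y)) = (\<Union>y\<in>{y. (y, x) \<in> ?R}. fst (g y))"
   "(\<Union>y\<in>{y. (y, x) \<in> ?R}. snd (f y)) = (\<Union>y\<in>{y. (y, x) \<in> ?R}. snd (g y))"
   by (rule SUP_cong; use fg in simp)+
  hence "t f x = t g x" unfolding t_def by simp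
  thus "(small_pair (t f x) \<longrightarrow> small_pair r \<and> free_step (t f x) r) =
   (small_pair (t g x) \<longrightarrow> small_pair r \<and> free_step (t g x) r)" by simp
 next
  show "\<exists>r. small_pair (t f x) \<longrightarrow> small_pair r \<and> free_step (t f x) r" for f x
   using free_step_exists by blast
 qed
 then obtain f where f: "\<And>x. small_pair (t f x) \<Longrightarrow> small_pair (f x) \<and> free_step (t f x) (f x)" by blast
 define le where "le s s' \<longleftrightarrow> fst s \<subseteq> fst s' \<and> snd s \<subseteq> snd s' \<and> ind (snd s') (snd s) (fst s)" for s s' :: "'u set \<times> 'u set"
 have cof: "\<exists>z. (y, z) \<in> ?W \<and> z \<in> Z \<and> X0 \<subseteq> g z"
  if "finite X0" "X0 \<subseteq> (\<Union>z\<in>Z. g z)" "y \<in> Z" "Z \<subseteq> Field ?W"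
   and mono: "\<And>u v. u \<in> Z \<Longrightarrow> v \<in> Z \<Longrightarrow> (u, v) \<in> ?W \<Longrightarrow> g u \<subseteq> g v" for X0 :: "'u set" and g Z y
  using that(1,2)
 proof (induction X0 rule: finite_induct)
  case empty
  thus ?case using refl that(3,4) by blast
 next
  case (insert x X0)
  then obtain z where z: "(y, z) \<in> ?W" "z \<in> Z" "X0 \<subseteq> g z" by auto
  obtain w where w: "w \<in> Z" "x \<in> g w" using insert.prems by auto
  show ?case
  proof (cases "(z, w) \<in> ?W")
   case True
   thus ?thesis using z w mono[OF z(2) w(1)] trans by blast
  next
   case False
   hence "(w, z) \<in> ?W" using total z w that(4) by blast
   thus ?thesis using z w mono[OF w(1) z(2)] by blast
  qed
 qed
 have inv: "x \<in> Field ?W \<Longrightarrow> small_pair (t f x) \<and> small_pair (f x) \<and> free_step (t f x) (f x) \<and>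
  (\<forall>y. (y, x) \<in> ?W \<longrightarrow> le (f y) (f x))" for x
 proof (induction x rule: wf_induct_rule[OF wf])
  case (1 x)
  let ?U = "{y. (y, x) \<in> ?R}"
  have U: "?U \<subseteq> Field ?W" using fld by blast
  have IH: "small_pair (f y)" "free_step (t f y) (f y)" "\<And>z. (z, y) \<in> ?W \<Longrightarrow> le (f z) (f y)" if "y \<in> ?U" for y
   using 1(1)[of y] that U by auto
  \<comment> \<open>Proper initial segments have size at most |T|, so the union of the stages before
    \<open>x\<close> keeps size at most 2^|T|.\<close>
  have "|?U| <o ?W"
  proof -
   have "?U = underS ?W x" by (auto simp: underS_def)
   thus ?thesis using card_of_underS[OF W(1) 1(2)] by simp
  qed
  hence "|?U| \<le>o |T|" using cardSuc_ordLeq_ordLess[OF CT card_of_Card_order] by blast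
  hence cU: "|?U| \<le>o |Pow T|" using T_le_PowT ordLeq_transitive by blast
  have st: "small_pair (t f x)" unfolding small_pair_def
  proof (intro conjI)
   show "snd (t f x) \<subseteq> fst (t f x)" using IH(1) unfolding t_def small_pair_def by fastforce
   show "inC (fst (t f x))" using IH(1) E unfolding t_def small_pair_def by fastforce
   have "|E| \<le>o |Pow T|"
    by (rule finite_le_Cinfinite[OF E(1) Cinf_PowT])
   moreover have "|\<Union>y\<in>?U. fst (f y)| \<le>o |Pow T|"
    by (rule UNION_Cinfinite_bound[OF cU _ Cinf_PowT]) (use IH(1) in \<open>auto simp: small_pair_def\<close>)
   ultimately show "|fst (t f x)| \<le>o |Pow T|"
    unfolding t_def fst_conv by (rule Un_Cinfinite_bound[OF _ _ Cinf_PowT])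
  qed
  have fx: "small_pair (f x)" "free_step (t f x) (f x)" using f[OF st] by auto
  \<comment> \<open>The part of the new \<open>P\<close> that comes from earlier stages is settled
    by finite character, the last step by its freeness, and left transitivity joins the two.\<close>
  have "le (f y) (f x)" if y: "(y, x) \<in> ?W" for y
  proof (cases "y = x")
   case True
   have "inC (snd (f x))" using fx(1) by (auto simp: small_pair_def)
   thus ?thesis unfolding True le_def using ind_self by blast
  next
   case False
   hence yU: "y \<in> ?U" using y by simp
   have sub: "fst (f y) \<subseteq> fst (t f x)" "snd (f y) \<subseteq> snd (t f x)" using yU by (auto simp: t_def)
   have "ind (snd (t f x)) (snd (f y)) (fst (f y))"
   proof (rule ind_finiteI)
    fix X0 B0 assume X0: "finite X0" "X0 \<subseteq> snd (t f x)" and B0: "B0 \<subseteq> fst (f y)"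
    have Ey: "E \<subseteq> snd (f y)" using IH(2)[OF yU] unfolding free_step_def t_def by auto
    have "snd (t f x) \<subseteq> (\<Union>z\<in>?U. snd (f z))" unfolding t_def snd_conv using Ey yU by blast
    hence "X0 \<subseteq> (\<Union>z\<in>?U. snd (f z))" using X0(2) by blast
    then obtain z where z: "(y, z) \<in> ?W" "z \<in> ?U" "X0 \<subseteq> snd (f z)"
     using cof[OF X0(1) _ yU U, of "\<lambda>z. snd (f z)"] IH(3) unfolding le_def by blast
    have "ind (snd (f z)) (snd (f y)) (fst (f y))" using IH(3)[OF z(2,1)] unfolding le_def by blast
    thus "ind X0 (snd (f y)) B0" by (rule ind_mono) (use z B0 in auto)
   qed
   moreover have "ind (snd (f x)) (snd (f y) \<union> snd (t f x)) (fst (f y))"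
   proof -
    have "ind (snd (f x)) (snd (t f x)) (fst (t f x))" using fx(2) by (simp add: free_step_def)
    hence "ind (snd (f x)) (snd (t f x)) (fst (f y))" by (rule ind_mono) (use sub in auto)
    moreover have "snd (f y) \<union> snd (t f x) = snd (t f x)" using sub by blast
    ultimately show ?thesis by simp
   qed
   ultimately have "ind (snd (t f x) \<union> snd (f x)) (snd (f y)) (fst (f y))"
   proof (rule ind_left_trans[rotated 6])
    have sd: "small_pair s \<Longrightarrow> fst s \<subseteq> dom C \<and> snd s \<subseteq> dom C \<and> small (snd s)" for s
     unfolding small_pair_def using small_subset small_le small_PowT by blast
    show "inC (snd (f y))" "small (snd (f y))" "inC (fst (f y))" using sd[OF IH(1)[OF yU]] by auto
    show "inC (snd (t f x))" "small (snd (t f x))" using sd[OF st] by auto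
    show "inC (snd (f x))" using sd[OF fx(1)] by auto
   qed
   hence "ind (snd (f x)) (snd (f y)) (fst (f y))" by (rule ind_mono) auto
   moreover have "fst (f y) \<subseteq> fst (f x)" "snd (f y) \<subseteq> snd (f x)" using sub fx(2) unfolding free_step_def by auto
   ultimately show ?thesis by (simp add: le_def)
  qed
  thus ?case using st fx by blast
 qed
 define M where "M = (\<Union>x\<in>Field ?W. fst (f x))"
 define P where "P = (\<Union>x\<in>Field ?W. snd (f x))"
 have le: "le (f y) (f x)" if "(y, x) \<in> ?W" for x y using inv fld(2)[OF that] that by blast
 have sp: "small_pair (f x)" if "x \<in> Field ?W" for x using inv that by blast
 have sd: "inC (fst (f x))" "snd (f x) \<subseteq> fst (f x)" "small (snd (f x))" if "x \<in> Field ?W" for x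
  using sp[OF that] unfolding small_pair_def using small_subset small_le small_PowT by blast+
 have MC: "inC M" using sd by (auto simp: M_def)
 have PM: "P \<subseteq> M" unfolding M_def P_def using sd(2) by (intro UN_mono) auto
 have next_stage: "\<exists>x'\<in>Field ?W. fst (f x) \<subseteq> fst (t f x') \<and> snd (f x) \<subseteq> snd (t f x')" if x: "x \<in> Field ?W" for x
 proof -
  obtain x' where "x' \<in> Field ?W" "x \<noteq> x'" "(x, x') \<in> ?W"
   using infinite_Card_order_limit[OF W(1) infW x] by blast
  thus ?thesis by (intro bexI[of _ x']) (auto simp: t_def)
 qed
 have indP: "ind P (snd (f x)) (fst (f x))" if x: "x \<in> Field ?W" for x
 proof (rule ind_finiteI)
  fix X0 B0 assume X0: "finite X0" "X0 \<subseteq> P" and B0: "B0 \<subseteq> fst (f x)"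
  obtain z where z: "(x, z) \<in> ?W" "X0 \<subseteq> snd (f z)"
   using cof[OF X0(1) X0(2)[unfolded P_def] x] le unfolding le_def by blast
  have "ind (snd (f z)) (snd (f x)) (fst (f x))" using le[OF z(1)] unfolding le_def by blast
  thus "ind X0 (snd (f x)) B0" by (rule ind_mono) (use z B0 in auto)
 qed
 have stage: "\<exists>x\<in>Field ?W. A \<subseteq> fst (f x)" if A: "A \<subseteq> M" "|A| \<le>o |T|" for A
 proof (rule cardSuc_UNION[OF CT])
  show "infinite (Field |T| )" using infinite_T by (simp add: Field_card_of)
  show "relChain ?W (\<lambda>x. fst (f x))" unfolding relChain_def using le unfolding le_def by blast
 qed (use A M_def in auto)
 obtain x0 where x0: "x0 \<in> Field ?W" using infW by (metis finite.emptyI all_not_in_conv)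
 have EP: "E \<subseteq> P"
 proof -
  have "E \<subseteq> snd (t f x0)" by (auto simp: t_def)
  also have "\<dots> \<subseteq> snd (f x0)" using inv[OF x0] by (simp add: free_step_def)
  finally show ?thesis using x0 by (auto simp: P_def)
 qed
 have real: "\<exists>a. a ` T \<subseteq> M \<and> realizes C T a q \<and> ind (a ` T) A P"
  if A: "A \<subseteq> M" "|A| \<le>o |T|" and q: "q \<subseteq> instances L T A"
   "\<forall>q0. finite q0 \<and> q0 \<subseteq> q \<longrightarrow> (\<exists>a. realizes C T a q0)" for A q
 proof -
  obtain x where x: "x \<in> Field ?W" "A \<subseteq> fst (f x)" using stage[OF A] by blast
  obtain x' where x': "x' \<in> Field ?W" "fst (f x) \<subseteq> fst (t f x')" using next_stage[OF x(1)] by blast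
  have step: "free_step (t f x') (f x')" using inv[OF x'(1)] by blast
  have At: "A \<subseteq> fst (t f x')" using x(2) x'(2) by blast
  obtain a where a: "a ` T \<subseteq> fst (f x')" "realizes C T a q" "ind (a ` T) A (snd (f x'))"
   using step At A(2) q unfolding free_step_def by meson
  let ?P = "snd (f x')" and ?X = "a ` T"
  have PC: "inC ?P" "small ?P" using sd[OF x'(1)] by auto
  have AC: "inC A" "small A" using A MC small_le[OF A(2) small_T] by auto
  have XC: "inC ?X" using a(1) sd[OF x'(1)] by blast
  have PCC: "inC P" using PM MC by blast
  have APC: "inC (A \<union> ?P)" "small (A \<union> ?P)" using AC PC small_Un by auto
  have "fst (t f x') \<subseteq> fst (f x')" using step by (simp only: free_step_def)
  hence "A \<subseteq> fst (f x')" using At by (rule order_trans[rotated])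
  \<comment> \<open>The rest of \<open>P\<close> is free over \<open>?P\<close> from the stage that
    already contains \<open>?X\<close> and \<open>A\<close>. Symmetry and transitivity extend the
    independence of \<open>?X\<close> from \<open>?P\<close> to all of \<open>P\<close>.\<close>
  hence "ind P ?P (?X \<union> A)" using a(1) by (intro ind_mono[OF indP[OF x'(1)]]) auto
  hence "ind P (A \<union> ?P) (?X \<union> A)" by (rule ind_base) auto
  hence "ind P (A \<union> ?P) ?X" by (rule ind_mono) auto
  hence "ind ?X (A \<union> ?P) P" by (rule ind_sym[OF APC PCC XC])
  hence "ind ?X A (?P \<union> P)" by (rule ind_trans[OF AC PC XC PCC a(3)])
  hence "ind ?X A P" by (rule ind_mono) auto
  moreover have "?X \<subseteq> M" using a(1) x'(1) by (auto simp: M_def)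
  ultimately show ?thesis using a(2) by blast
 qed
 have dens: "\<exists>y\<in>lists P. length y = m \<and> holds C \<phi> (b @ y)"
  if b: "b \<in> lists M" "\<phi> \<in> fms b m" and B: "finite B" "B \<subseteq> P" "\<not> fork B m \<phi> b" for B m b \<phi>
 proof -
  \<comment> \<open>A stage that contains \<open>b\<close>, then a later one whose \<open>P\<close>
    contains \<open>B\<close>; the step after them realizes \<open>\<phi>\<close>, because forking
    over its larger base would imply forking over \<open>B\<close>.\<close>
  have "set b \<subseteq> (\<Union>x\<in>Field ?W. fst (f x))" using b(1) by (auto simp: M_def lists_eq_set)
  then obtain x1 where x1: "x1 \<in> Field ?W" "set b \<subseteq> fst (f x1)"
   using cof[OF finite_set, of b "\<lambda>x. fst (f x)" "Field ?W" x0] x0 le unfolding le_def by blast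
  obtain x2 where x2: "(x1, x2) \<in> ?W" "B \<subseteq> snd (f x2)"
   using cof[OF B(1) B(2)[unfolded P_def] x1(1)] le unfolding le_def by blast
  have x2F: "x2 \<in> Field ?W" using fld x2(1) by blast
  obtain x' where x': "x' \<in> Field ?W" "fst (f x2) \<subseteq> fst (t f x')" "snd (f x2) \<subseteq> snd (t f x')"
   using next_stage[OF x2F] by blast
  have "b \<in> lists (fst (t f x'))" using x1(2) le[OF x2(1)] x'(2) by (auto simp: le_def lists_eq_set)
  moreover have "\<not> fork (snd (t f x')) m \<phi> b" using B(3) forkset_base x2(2) x'(3) by (meson order_trans)
  moreover have "free_step (t f x') (f x')" using inv[OF x'(1)] by blast
  ultimately obtain y where "y \<in> lists (snd (f x'))" "length y = m" "holds C \<phi> (b @ y)"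
   using b(2) unfolding free_step_def by blast
  moreover have "snd (f x') \<subseteq> P" using x'(1) by (auto simp: P_def)
  ultimately show ?thesis by (auto simp: lists_eq_set)
 qed
 show ?thesis
 proof (rule exI[of _ M], rule exI[of _ P], intro conjI allI impI ballI EP PM MC)
  fix A q assume "A \<subseteq> M" "|A| \<le>o |T|" "q \<subseteq> instances L T A"
   "\<forall>q0. finite q0 \<and> q0 \<subseteq> q \<longrightarrow> (\<exists>a. realizes C T a q0)"
  thus "\<exists>a. a ` T \<subseteq> M \<and> realizes C T a q \<and> ind (a ` T) A P" by (rule real)
 next
  fix B m b \<phi> assume "b \<in> lists M" "\<phi> \<in> fms b m"
   "finite B \<and> B \<subseteq> P \<and> \<not> fork B m \<phi> b"
  thus "\<exists>y\<in>lists P. length y = m \<and> holds C \<phi> (b @ y)" by (elim conjE) (rule dens)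
 qed
qed

text \<open>Both components pass the Tarski-Vaught test: a consistent formula over \<open>P\<close>
  does not fork over its own parameters and so is realized in \<open>P\<close>, and a consistent
  formula over \<open>M\<close> is a small partial type, which the chain realizes in
  \<open>M\<close>.\<close>

lemma dense_pair:
 assumes E: "finite E" "inC E"
 shows "\<exists>M P. E \<subseteq> P \<and> is_pair L C M P \<and> extension_property L T C M P \<and>
  (\<forall>m. \<forall>b\<in>lists M. \<forall>\<phi>\<in>fms b m. \<not> fork E m \<phi> b \<longrightarrow>
    (\<exists>y\<in>lists P. length y = m \<and> holds C \<phi> (b @ y)))"
proof -
 obtain M P where MP: "E \<subseteq> P" "P \<subseteq> M" "inC M"
  and real: "\<forall>A\<subseteq>M. |A| \<le>o |T| \<longrightarrow> (\<forall>q\<subseteq>instances L T A.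
    (\<forall>q0. finite q0 \<and> q0 \<subseteq> q \<longrightarrow> (\<exists>a. realizes C T a q0)) \<longrightarrow>
    (\<exists>a. a ` T \<subseteq> M \<and> realizes C T a q \<and> ind (a ` T) A P))"
  and dens: "\<forall>B m. \<forall>b\<in>lists M. \<forall>\<phi>\<in>fms b m. finite B \<and> B \<subseteq> P \<and> \<not> fork B m \<phi> b \<longrightarrow>
    (\<exists>y\<in>lists P. length y = m \<and> holds C \<phi> (b @ y))"
  using free_chain[OF E] by (elim exE conjE) (rule that)
 have dens': "\<exists>y\<in>lists P. length y = m \<and> holds C \<phi> (b @ y)"
  if "b \<in> lists M" "\<phi> \<in> fms b m" "finite B" "B \<subseteq> P" "\<not> fork B m \<phi> b" for B m b \<phi>
  using dens that by blast
 have PC: "elem_submodel L P C"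
 proof (rule elem_submodelI)
  show "inC P" using MP by blast
  have tv: "\<exists>u\<in>P. holds C \<phi> (b @ [u])"
   if tvp: "b \<in> lists P" "\<phi> \<in> fms b 1" "u \<in> dom C" "holds C \<phi> (b @ [u])" for b \<phi> u
  proof -
   have bP: "set b \<subseteq> P" "b \<in> lists (set b)" "b \<in> lists M" using tvp(1) MP(2) by (auto simp: lists_eq_set)
   have "[u] \<in> sols 1 \<phi> b" using tvp by (simp add: sols_def tuples_def)
   hence "\<not> fork (set b) 1 \<phi> b"
    using tvp bP MP by (intro existence) (auto simp: lists_eq_set)
   then obtain y where "y \<in> lists P" "length y = 1" "holds C \<phi> (b @ y)"
    using dens'[OF bP(3) tvp(2) finite_set bP(1)] by blast
   thus ?thesis by (auto simp: length_Suc_conv)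
  qed
  thus "\<And>b \<phi> u. b \<in> lists P \<Longrightarrow> \<phi> \<in> fms b 1 \<Longrightarrow> u \<in> dom C \<Longrightarrow> holds C \<phi> (b @ [u]) \<Longrightarrow>
   \<exists>u\<in>P. holds C \<phi> (b @ [u])" .
  obtain \<tau> where \<tau>: "\<tau> \<in> fmlas L 1" "\<And>(M :: ('f, 'r, 'u) struct) xs. length xs = 1 \<Longrightarrow> holds M \<tau> xs \<longleftrightarrow> True"
   using fm_exists[OF dfn_const[of L "{..<1}" True]] by blast
  obtain u where "u \<in> dom C" using dom_nonempty by blast
  thus "P \<noteq> {}" using tv[of "[]" \<tau> u] \<tau> by auto
 qed
 obtain t0 where t0: "t0 \<in> T" using infinite_T by (metis finite.emptyI all_not_in_conv)
 have MC: "elem_submodel L M C"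
 proof (rule elem_submodelI[OF MP(3)])
  show "M \<noteq> {}" using PC MP(2) unfolding elem_submodel_def is_struct_def by auto
  fix b \<phi> u assume b: "b \<in> lists M" "\<phi> \<in> fms b 1" "u \<in> dom C" "holds C \<phi> (b @ [u])"
  let ?n = "length b"
  \<comment> \<open>\<open>instances\<close> puts variables before parameters, the Tarski-Vaught
    test parameters first; \<open>\<phi>\<close> is rewritten with its last variable moved to the
    front.\<close>
  have "dfn L {..<1 + ?n} (\<lambda>(M :: ('f, 'r, 'u) struct) a. holds M \<phi> (map a ([1..<1 + ?n] @ [0])))"
  proof (rule dfn_holds)
   have "length ([1..<1 + ?n] @ [0]) = ?n + 1" by (simp del: upt_Suc)
   thus "\<phi> \<in> fmlas L (length ([1..<1 + ?n] @ [0]))" using b(2) by metis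
  qed auto
  then obtain \<psi> where \<psi>: "\<psi> \<in> fmlas L (1 + ?n)"
   "\<And>(M :: ('f, 'r, 'u) struct) ys. length ys = 1 + ?n \<Longrightarrow> holds M \<psi> ys \<longleftrightarrow> holds M \<phi> (map (nth ys) ([1..<1 + ?n] @ [0]))"
   by (rule fm_exists) (rule that)
  have eq: "holds C \<psi> (w # b) \<longleftrightarrow> holds C \<phi> (b @ [w])" for w
  proof -
   have "map (nth (w # b)) [1..<1 + ?n] = b" by (auto intro!: nth_equalityI simp del: upt_Suc)
   thus ?thesis using \<psi>(2)[of "w # b" C] by simp
  qed
  let ?q = "{(\<psi>, [t0], b)}"
  have "|set b| \<le>o |T|" by (rule finite_le_Cinfinite[OF finite_set Cinf_T])
  moreover have "?q \<subseteq> instances L T (set b)" using t0 \<psi>(1) by (auto simp: instances_def)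
  moreover have "\<exists>a. realizes C T a q0" if "q0 \<subseteq> ?q" for q0
   using that b(3,4) eq by (intro exI[of _ "\<lambda>_. u"]) (auto simp: realizes_def)
  moreover have "set b \<subseteq> M" using b(1) by (auto simp: lists_eq_set)
  ultimately obtain a where "a ` T \<subseteq> M" "realizes C T a ?q" using real by meson
  thus "\<exists>u\<in>M. holds C \<phi> (b @ [u])" using t0 eq by (intro bexI[of _ "a t0"]) (auto simp: realizes_def)
 qed
 have pair: "is_pair L C M P" by (rule is_pairI[OF MC PC MP(2)])
 have Mholds: "holds (C\<lparr>dom := M\<rparr>) \<phi> xs \<longleftrightarrow> holds C \<phi> xs" if "\<phi> \<in> fmlas L (length xs)" "xs \<in> lists M" for \<phi> xs
  using MC that unfolding elem_submodel_def by (auto simp: tuples_def lists_eq_set)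
 have "extension_property L T C M P" unfolding extension_property_def
 proof (intro allI impI)
  fix A and I :: "('f, 'r) fm set" and p
  assume A: "A \<subseteq> M" "|A| \<le>o |T|" and p: "|I| \<le>o |T| \<and> complete_type L (C\<lparr>dom := M\<rparr>) I A p"
  \<comment> \<open>The chain treats types in variables indexed by \<open>T\<close>; a type in
    variables from \<open>I\<close> is carried there by an injection.\<close>
  obtain g where g: "inj_on g I" "g ` I \<subseteq> T" using p card_of_ordLeq[of I T] by blast
  have pi: "p \<subseteq> instances L I A" and pf: "\<And>q. finite q \<Longrightarrow> q \<subseteq> p \<Longrightarrow> \<exists>a. realizes (C\<lparr>dom := M\<rparr>) I a q"
   using p unfolding complete_type_def by auto
  define G where "G = (\<lambda>(\<phi> :: ('f, 'r) fm, js, c :: 'u list). (\<phi>, map g js, c))"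
  have inst: "js \<in> lists I" "c \<in> lists A" "c \<in> lists M" "\<phi> \<in> fmlas L (length js + length c)" if "(\<phi>, js, c) \<in> p" for \<phi> js c
   using pi that A(1) by (auto simp: instances_def lists_eq_set)
  have "G ` p \<subseteq> instances L T A"
  proof
   fix x assume "x \<in> G ` p"
   then obtain \<phi> js c where x: "x = (\<phi>, map g js, c)" "(\<phi>, js, c) \<in> p" by (auto simp: G_def)
   moreover have "map g js \<in> lists T" using inst(1)[OF x(2)] g(2) by (simp add: lists_eq_set) blast
   ultimately show "x \<in> instances L T A" using inst[OF x(2)] by (simp add: instances_def)
  qed
  moreover have "\<exists>a. realizes C T a q0" if q0: "finite q0" "q0 \<subseteq> G ` p" for q0
  proof -
   obtain q1 where q1: "finite q1" "q1 \<subseteq> p" "q0 = G ` q1" using finite_subset_image[OF q0] by blast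
   then obtain a where a: "realizes (C\<lparr>dom := M\<rparr>) I a q1" using pf by blast
   obtain u where u: "u \<in> dom C" using dom_nonempty by blast
   define a' where "a' x = (if x \<in> g ` I then a (inv_into I g x) else u)" for x
   have aM: "a i \<in> M" if "i \<in> I" for i using a that by (auto simp: realizes_def)
   have ag: "map a' (map g js) = map a js" if "js \<in> lists I" for js
    using that by (auto simp: a'_def lists_eq_set inv_into_f_f[OF g(1)] subset_iff)
   have "realizes C T a' q0" unfolding realizes_def
   proof (intro conjI ballI)
    show "a' x \<in> dom C" for x
     using u aM MP(3) by (auto simp: a'_def inv_into_into)
    fix x assume "x \<in> q0"
    then obtain \<phi> js c where x: "x = (\<phi>, map g js, c)" "(\<phi>, js, c) \<in> q1" using q1(3) by (auto simp: G_def)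
    note i = inst[OF subsetD[OF q1(2) x(2)]]
    have "holds (C\<lparr>dom := M\<rparr>) \<phi> (map a js @ c)" using a x(2) by (auto simp: realizes_def)
    moreover have "map a js @ c \<in> lists M" using i aM by (auto simp: lists_eq_set)
    ultimately have "holds C \<phi> (map a js @ c)" using Mholds i by simp
    thus "case x of (\<phi>, js, c) \<Rightarrow> holds C \<phi> (map a' js @ c)" unfolding x(1) prod.case ag[OF i(1)] .
   qed
   thus ?thesis by blast
  qed
  ultimately obtain a where a: "a ` T \<subseteq> M" "realizes C T a (G ` p)" "ind (a ` T) A P"
   using real A by meson
  have r: "realizes (C\<lparr>dom := M\<rparr>) I (a \<circ> g) p" unfolding realizes_def
  proof (intro conjI ballI)
   show "(a \<circ> g) i \<in> dom (C\<lparr>dom := M\<rparr>)" if "i \<in> I" for i using a(1) g(2) that by auto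
   fix x assume x: "x \<in> p"
   obtain \<phi> js c where xe: "x = (\<phi>, js, c)" by (cases x)
   note i = inst[OF x[unfolded xe]]
   have "(\<phi>, map g js, c) \<in> G ` p" using x xe by (force simp: G_def)
   hence "holds C \<phi> (map a (map g js) @ c)" using a(2) by (auto simp: realizes_def)
   moreover have "set (map a (map g js)) \<subseteq> a ` T" using i(1) g(2) unfolding set_map lists_eq_set mem_Collect_eq by blast
   hence "map a (map g js) @ c \<in> lists M" using i(3) a(1) by (simp add: lists_eq_set subset_trans)
   ultimately have "holds (C\<lparr>dom := M\<rparr>) \<phi> (map a (map g js) @ c)" using Mholds i by simp
   thus "case x of (\<phi>, js, c) \<Rightarrow> holds (C\<lparr>dom := M\<rparr>) \<phi> (map (a \<circ> g) js @ c)" unfolding xe by simp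
  qed
  have "ind ((a \<circ> g) ` I) A P" by (rule ind_mono[OF a(3)]) (use g(2) in auto)
  hence "independent L C I (a \<circ> g) A P"
   using ind_independent A MP(3) small_le[OF A(2) small_T] by (meson order_trans)
  with r show "\<exists>a. realizes (C\<lparr>dom := M\<rparr>) I a p \<and> independent L C I a A P" by (intro exI[of _ "a \<circ> g"] conjI)
 qed
 thus ?thesis
  using MP(1) pair dens'[OF _ _ E(1) MP(1)] by (rule_tac exI[of _ M], rule_tac exI[of _ P], intro conjI allI ballI impI)
qed

end

section \<open>Saturated pairs\<close>

fun lift :: "('f, 'r) fm \<Rightarrow> ('f, 'r option) fm" where
 "lift (Eq s t) = Eq s t"
| "lift (Rel r ts) = Rel (Some r) ts"
| "lift (Neg \<phi>) = Neg (lift \<phi>)"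
| "lift (And \<phi> \<psi>) = And (lift \<phi>) (lift \<psi>)"
| "lift (Ex v \<phi>) = Ex v (lift \<phi>)"

lemma dom_pair [simp]: "dom (pair_struct C M P) = M"
 by (simp add: pair_struct_def)

lemma val_pair: "val (pair_struct C M P) e t = val C e t"
 by (induction t) (auto simp: pair_struct_def cong: map_cong)

lemma sat_lift: "sat (pair_struct C M P) e (lift \<phi>) \<longleftrightarrow> sat (C\<lparr>dom := M\<rparr>) e \<phi>"
proof (induction \<phi> arbitrary: e)
 case (Rel r ts)
 have "map (val (pair_struct C M P) e) ts = map (val (C\<lparr>dom := M\<rparr>) e) ts"
  by (simp add: val_pair sat_dom_update)
 thus ?case by (simp add: pair_struct_def del: map_eq_conv)
qed (simp_all add: val_pair sat_dom_update)

lemma sat_P: "sat (pair_struct C M P) e (Rel None [t]) \<longleftrightarrow> val C e t \<in> P"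
 by (simp add: val_pair) (simp add: pair_struct_def)

lemma wft_pair: "wft (pair_lang L) t \<longleftrightarrow> wft L t"
 by (induction t) (auto simp: pair_lang_def)

lemma Some_pair_lang: "Some r \<in> rels (pair_lang L) \<longleftrightarrow> r \<in> rels L" "rarity (pair_lang L) (Some r) = rarity L r"
 by (auto simp: pair_lang_def)

lemma wff_lift: "wff (pair_lang L) (lift \<phi>) \<longleftrightarrow> wff L \<phi>"
 by (induction \<phi>) (simp_all add: wft_pair Some_pair_lang)

lemma wff_P: "wff (pair_lang L) (Rel None [t]) \<longleftrightarrow> wft L t"
 by (simp add: wft_pair) (simp add: pair_lang_def)

lemma fv_lift: "fv (lift \<phi>) = fv \<phi>"
 by (induction \<phi>) auto

text \<open>This translation only serves to count the formulas of pairs.\<close>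

fun unpair :: "('f, 'r option) fm \<Rightarrow> ('f, 'r) fm" where
 "unpair (Eq s t) = Eq s t"
| "unpair (Rel (Some r) ts) = Rel r ts"
| "unpair (Rel None ts) = Ex 0 (Eq (hd ts) (hd ts))"
| "unpair (Neg \<phi>) = Neg (unpair \<phi>)"
| "unpair (And \<phi> \<psi>) = And (unpair \<phi>) (unpair \<psi>)"
| "unpair (Ex v \<phi>) = Ex (Suc v) (unpair \<phi>)"

lemma wff_pair_None: "wff (pair_lang L) (Rel None ts) \<Longrightarrow> \<exists>t. ts = [t] \<and> wft L t"
 by (auto simp: wft_pair) (auto simp: pair_lang_def length_Suc_conv)

lemma wff_unpair: "wff (pair_lang L) \<phi> \<Longrightarrow> wff L (unpair \<phi>)"
proof (induction \<phi> rule: unpair.induct)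
 case (3 ts)
 thus ?case using wff_pair_None by fastforce
qed (auto simp: wft_pair, auto simp: pair_lang_def)

lemma unpair_inj: "wff (pair_lang L) \<phi> \<Longrightarrow> wff (pair_lang L) \<psi> \<Longrightarrow> unpair \<phi> = unpair \<psi> \<Longrightarrow> \<phi> = \<psi>"
proof (induction \<phi> arbitrary: \<psi> rule: unpair.induct)
 case (1 s t) thus ?case by (cases \<psi> rule: unpair.cases) auto
next
 case (2 r ts) thus ?case by (cases \<psi> rule: unpair.cases) auto
next
 case (3 ts)
 then obtain t where t: "ts = [t]" using wff_pair_None by blast
 show ?case
 proof (cases \<psi> rule: unpair.cases)
  case (3 us)
  then obtain u where "us = [u]" using \<open>wff (pair_lang L) \<psi>\<close> wff_pair_None by blast
  thus ?thesis using 3 t \<open>unpair (Rel None ts) = unpair \<psi>\<close> by simp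
 qed (use \<open>unpair (Rel None ts) = unpair \<psi>\<close> in auto)
next
 case (4 \<phi>) thus ?case by (cases \<psi> rule: unpair.cases) auto
next
 case (5 \<phi>1 \<phi>2) thus ?case by (cases \<psi> rule: unpair.cases) auto
next
 case (6 v \<phi>) thus ?case by (cases \<psi> rule: unpair.cases) auto
qed

lemma elem_sat:
 assumes "elem_submodel L N M" "wff L \<phi>" "\<And>i. i \<in> fv \<phi> \<Longrightarrow> e i \<in> N"
 shows "sat (M\<lparr>dom := N\<rparr>) e \<phi> \<longleftrightarrow> sat M e \<phi>"
proof -
 from finite_list[OF finite_fv] obtain vs where vs: "set vs = fv \<phi>" ..
 have "dfn L (set vs) (\<lambda>(M :: ('a, 'b, 'c) struct) a. sat M a \<phi>)"
  by (rule dfnI[where \<phi> = \<phi> and v = "\<lambda>i. i"]) (use assms(2) vs in auto)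
 then obtain \<psi> where \<psi>: "\<psi> \<in> fmlas L (length vs)"
  "\<And>(M :: ('a, 'b, 'c) struct) a. sat M a \<phi> \<longleftrightarrow> holds M \<psi> (map a vs)"
  by (rule dfn_to_fm) (rule that)
 have "map e vs \<in> tuples (M\<lparr>dom := N\<rparr>) (length vs)" using vs assms(3) by (auto simp: tuples_def)
 thus ?thesis unfolding \<psi>(2) using assms(1) \<psi>(1) unfolding elem_submodel_def by blast
qed

text \<open>Truth in \<open>P\<close>, expressed in the language of pairs. It serves to pass
  elementarity of \<open>P\<close> on to the pair constructed below.\<close>

fun relativize :: "('f, 'r) fm \<Rightarrow> ('f, 'r option) fm" where
 "relativize (Eq s t) = Eq s t"
| "relativize (Rel r ts) = Rel (Some r) ts"
| "relativize (Neg \<phi>) = Neg (relativize \<phi>)"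
| "relativize (And \<phi> \<psi>) = And (relativize \<phi>) (relativize \<psi>)"
| "relativize (Ex v \<phi>) = Ex v (And (Rel None [Var v]) (relativize \<phi>))"

lemma sat_relativize: "P \<subseteq> M \<Longrightarrow> sat (pair_struct C M P) e (relativize \<phi>) \<longleftrightarrow> sat (C\<lparr>dom := P\<rparr>) e \<phi>"
proof (induction \<phi> arbitrary: e)
 case (Rel r ts)
 have "map (val (pair_struct C M P) e) ts = map (val (C\<lparr>dom := P\<rparr>) e) ts"
  by (simp add: val_pair sat_dom_update)
 thus ?case by (simp add: pair_struct_def del: map_eq_conv)
next
 case (Ex v \<phi>)
 thus ?case by (auto simp: sat_P simp del: sat.simps(2))
qed (simp_all add: val_pair sat_dom_update)

lemma wff_relativize: "wff (pair_lang L) (relativize \<phi>) \<longleftrightarrow> wff L \<phi>"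
 by (induction \<phi>) (simp_all add: wft_pair Some_pair_lang wff_P del: wff.simps(2), simp add: wft_pair Some_pair_lang)

context monster
begin

abbreviation pl :: "('f, 'r option) lang" where "pl \<equiv> pair_lang L"

lemma card_wff_pair: "|{\<phi>. wff pl \<phi>}| \<le>o |T|"
proof -
 have "inj_on unpair {\<phi>. wff pl \<phi>}" using unpair_inj by (auto intro!: inj_onI)
 moreover have "unpair ` {\<phi>. wff pl \<phi>} \<subseteq> {\<phi>. wff L \<phi>}" using wff_unpair by auto
 ultimately have "|{\<phi>. wff pl \<phi>}| \<le>o |{\<phi>. wff L \<phi>}|" using card_of_ordLeq by blast
 thus ?thesis using card_wff ordLeq_transitive by blast
qed

lemma is_pairD:
 assumes "is_pair L C M P"
 shows "inC M" "P \<subseteq> M" "P \<noteq> {}" "elem_submodel L M C" "elem_submodel L P (C\<lparr>dom := M\<rparr>)"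
 using assms unfolding is_pair_def elem_submodel_def is_struct_def by auto

lemma pair_sat_lift:
 assumes "is_pair L C M P" "wff L \<phi>" "\<And>i. i \<in> fv \<phi> \<Longrightarrow> e i \<in> M"
 shows "sat (pair_struct C M P) e (lift \<phi>) \<longleftrightarrow> sat C e \<phi>"
 unfolding sat_lift by (rule elem_sat[OF is_pairD(4)[OF assms(1)] assms(2,3)])

lemma saturated_pair:
 fixes \<K> :: "('u set \<times> 'u set \<times> 'u list) set"
 assumes pairs: "\<And>M P e. (M, P, e) \<in> \<K> \<Longrightarrow> is_pair L C M P \<and> e \<in> lists M \<and> length e = p"
  and \<Sigma>: "\<Sigma> \<subseteq> fmlas pl p"
  and fin: "\<And>\<Sigma>0. \<Sigma>0 \<subseteq> \<Sigma> \<Longrightarrow> finite \<Sigma>0 \<Longrightarrow> \<exists>(M, P, e)\<in>\<K>. \<forall>\<sigma>\<in>\<Sigma>0. holds (pair_struct C M P) \<sigma> e"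
 shows "\<exists>M P e. is_pair L C M P \<and> saturated (cardSuc |T| ) pl (pair_struct C M P) \<and>
  e \<in> lists M \<and> length e = p \<and> (\<forall>\<sigma>\<in>\<Sigma>. holds (pair_struct C M P) \<sigma> e)"
proof -
 let ?X = "Pow T"
 define \<P> where "\<P> = {(M, P). \<exists>e. (M, P, e) \<in> \<K>}"
 have \<P>: "is_pair L C M P" if "(M, P) \<in> \<P>" for M P using that pairs by (auto simp: \<P>_def)
 have infX: "infinite ?X" using infinite_T by simp
 obtain xs where xs: "distinct xs" "length xs = p" "set xs \<subseteq> ?X"
  using infinite_arbitrarily_large[OF infX, of p] by (metis distinct_card finite_distinct_list)
 define mdl where "mdl a M P \<Gamma> \<longleftrightarrow> a ` ?X \<subseteq> M \<and> (\<forall>(\<phi>, v)\<in>\<Gamma>. sat (pair_struct C M P) (\<lambda>i. a (v i)) \<phi>)"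
  for a :: "('f, 'r) fm set \<Rightarrow> 'u" and M P \<Gamma>
 have mdlD: "sat (pair_struct C M P) (\<lambda>i. a (v i)) \<phi>" if "mdl a M P \<Gamma>" "(\<phi>, v) \<in> \<Gamma>" for a M P \<Gamma> \<phi> v
  using that unfolding mdl_def by blast
 have mdl_mono: "mdl a M P \<Gamma>'" if "mdl a M P \<Gamma>" "\<Gamma>' \<subseteq> \<Gamma>" for a M P \<Gamma> \<Gamma>' using that unfolding mdl_def by blast
 define fs where "fs \<Gamma> \<longleftrightarrow> (\<forall>\<Gamma>0. \<Gamma>0 \<subseteq> \<Gamma> \<and> finite \<Gamma>0 \<longrightarrow> (\<exists>(M, P)\<in>\<P>. \<exists>a. mdl a M P \<Gamma>0))" for \<Gamma>
 have fsD: "\<exists>M P a. (M, P) \<in> \<P> \<and> mdl a M P \<Gamma>0" if "fs \<Gamma>" "\<Gamma>0 \<subseteq> \<Gamma>" "finite \<Gamma>0" for \<Gamma> \<Gamma>0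
  using that unfolding fs_def by blast
 have fs_mono: "fs \<Gamma>'" if "fs \<Gamma>" "\<Gamma>' \<subseteq> \<Gamma>" for \<Gamma> \<Gamma>' using that unfolding fs_def by (meson order_trans)
 define G where "G = {(\<phi> :: ('f, 'r option) fm, v :: nat \<Rightarrow> ('f, 'r) fm set). wff pl \<phi> \<and> range v \<subseteq> ?X}"
 \<comment> \<open>The free variables of \<open>\<Sigma>\<close> become the constants
   \<open>xs\<close>; all variables from \<open>p\<close> on receive the default constant
   \<open>{}\<close>.\<close>
 define vx where "vx i = (if i < p then xs ! i else {})" for i
 have vx: "range vx \<subseteq> ?X"
 proof (rule image_subsetI)
  show "vx i \<in> ?X" for i
   using subsetD[OF xs(3) nth_mem[of i xs]] xs(2) by (cases "i < p") (simp_all add: vx_def)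
 qed
 define \<Gamma>i where "\<Gamma>i = (\<lambda>\<sigma>. (\<sigma>, vx)) ` \<Sigma>"
 have \<Gamma>i: "fs \<Gamma>i" unfolding fs_def
 proof (intro allI impI)
  fix \<Gamma>0 assume "\<Gamma>0 \<subseteq> \<Gamma>i \<and> finite \<Gamma>0"
  then obtain \<Sigma>0 where \<Sigma>0: "\<Sigma>0 \<subseteq> \<Sigma>" "finite \<Sigma>0" "\<Gamma>0 = (\<lambda>\<sigma>. (\<sigma>, vx)) ` \<Sigma>0"
   using finite_subset_image[of \<Gamma>0 "\<lambda>\<sigma>. (\<sigma>, vx)" \<Sigma>] unfolding \<Gamma>i_def by blast
  obtain M P e where K: "(M, P, e) \<in> \<K>" "\<forall>\<sigma>\<in>\<Sigma>0. holds (pair_struct C M P) \<sigma> e" using fin[OF \<Sigma>0(1,2)] by blast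
  have e: "is_pair L C M P" "e \<in> lists M" "length e = p" using pairs[OF K(1)] by auto
  obtain u where u: "u \<in> M" using is_pairD[OF e(1)] by blast
  define a where "a x = (if x \<in> set xs then e ! (THE i. i < p \<and> xs ! i = x) else u)" for x
  have axs: "a (xs ! i) = e ! i" if "i < p" for i
  proof -
   have "(THE j. j < p \<and> xs ! j = xs ! i) = i"
   proof (rule the_equality)
    show "j = i" if j: "j < p \<and> xs ! j = xs ! i" for j
     using nth_eq_iff_index_eq[OF xs(1)] j \<open>i < p\<close> xs(2) by blast
   qed (use that in simp)
   thus ?thesis using that xs by (simp add: a_def)
  qed
  have "a x \<in> M" for x
  proof (cases "x \<in> set xs")
   case True
   then obtain i where "i < p" "xs ! i = x" using xs by (auto simp: in_set_conv_nth)
   hence "a x = e ! i" using axs by auto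
   thus ?thesis using e \<open>i < p\<close> by (auto simp: lists_eq_set)
  qed (simp add: a_def u)
  moreover have "sat (pair_struct C M P) (\<lambda>i. a (vx i)) \<sigma>" if "\<sigma> \<in> \<Sigma>0" for \<sigma>
  proof -
   have "fv \<sigma> \<subseteq> {..<p}" using that \<Sigma>0(1) \<Sigma> by (auto simp: fmlas_def)
   hence "sat (pair_struct C M P) (\<lambda>i. a (vx i)) \<sigma> \<longleftrightarrow> sat (pair_struct C M P) (nth e) \<sigma>"
    by (intro sat_cong) (auto simp: vx_def axs)
   thus ?thesis using K(2) that by (simp add: holds_def)
  qed
  ultimately have "mdl a M P \<Gamma>0" unfolding mdl_def \<Sigma>0(3) by auto
  moreover have "(M, P) \<in> \<P>" using K(1) by (auto simp: \<P>_def)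
  ultimately show "\<exists>(M, P)\<in>\<P>. \<exists>a. mdl a M P \<Gamma>0" by blast
 qed
 \<comment> \<open>Variable 0 goes to \<open>x\<close>, the next ones to the parameters
   \<open>c\<close>, and all further ones to \<open>x\<close> again, so that no other constant ever
   appears.\<close>
 define asg where "asg x c i = (if i < Suc (length c) then (x # c) ! i else x)"
  for x :: "('f, 'r) fm set" and c i
 have asg_set: "asg x c i \<in> insert x (set c)" for x c i
 proof (cases "i < Suc (length c)")
  case True
  hence "(x # c) ! i \<in> set (x # c)" by (intro nth_mem) simp
  thus ?thesis using True by (simp add: asg_def)
 qed (simp add: asg_def)
 have asg_holds: "sat K (\<lambda>i. a (asg x c i)) \<phi> \<longleftrightarrow> holds K \<phi> (a x # map a c)"
  if "\<phi> \<in> fmlas pl (Suc (length c))" for K :: "('f, 'r option, 'u) struct" and a x c \<phi>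
  unfolding holds_def
 proof (rule sat_cong)
  fix i assume "i \<in> fv \<phi>"
  hence "i < Suc (length c)" using that by (auto simp: fmlas_def)
  thus "a (asg x c i) = (a x # map a c) ! i" by (cases i) (auto simp: asg_def)
 qed
 let ?Q = "\<lambda>A. {(\<phi>, c). c \<in> lists A \<and> \<phi> \<in> fmlas pl (Suc (length c))} :: (('f, 'r option) fm \<times> ('f, 'r) fm set list) set"
 define S where "S = (SIGMA A:{A. A \<subseteq> ?X \<and> |A| \<le>o |T| }. Pow (?Q A))"
 have cQ: "|?Q A| \<le>o |T|" if "|A| \<le>o |T|" for A
 proof -
  have "?Q A \<subseteq> {\<phi>. wff pl \<phi>} \<times> lists A" by (auto simp: fmlas_def)
  hence "|?Q A| \<le>o |{\<phi>. wff pl \<phi>} \<times> lists A|" by (rule card_of_mono1)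
  moreover have "|{\<phi>. wff pl \<phi>} \<times> lists A| \<le>o |T|"
   by (intro card_Times_bound card_wff_pair card_lists_bound that Cinf_T)
  ultimately show ?thesis by (rule ordLeq_transitive)
 qed
 have cS: "|S| \<le>o |Pow T|" unfolding S_def
 proof (rule card_of_Sigma_ordLeq_infinite[OF infX])
  show "|{A. A \<subseteq> ?X \<and> |A| \<le>o |T| }| \<le>o |Pow T|" by (rule card_subsets) (rule card_of_mono1, simp)
  show "\<forall>A\<in>{A. A \<subseteq> ?X \<and> |A| \<le>o |T| }. |Pow (?Q A)| \<le>o |Pow T|" using card_Pow_le cQ by blast
 qed
 let ?W = "|S|"
 let ?R = "?W - Id"
 have CW: "Card_order ?W" by (rule card_of_Card_order)
 have FW: "Field ?W = S" by (rule Field_card_of)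
 have WW: "Well_order ?W" by (rule card_of_Well_order)
 have wf: "wf ?R" using WW by (simp add: well_order_on_def)
 have total: "(x, y) \<in> ?W \<or> (y, x) \<in> ?W" if "x \<in> S" "y \<in> S" for x y
  using WW that unfolding FW by (cases "x = y")
   (auto simp: well_order_on_def linear_order_on_def partial_order_on_def preorder_on_def total_on_def refl_on_def)
 have trans: "(x, z) \<in> ?W" if "(x, y) \<in> ?W" "(y, z) \<in> ?W" for x y z
  using WW that by (auto simp: well_order_on_def linear_order_on_def partial_order_on_def preorder_on_def dest: transD)
 define U where "U t = {s. (s, t) \<in> ?R}" for t
 have US: "U t \<subseteq> S" for t using FW by (auto simp: U_def Field_def)
 have cA: "|fst t| \<le>o |T|" "fst t \<subseteq> ?X" if "t \<in> S" for t using that by (auto simp: S_def)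
 define ax where "ax t x = (\<lambda>(\<phi>, c). (\<phi>, asg x c)) ` snd t"
  for t :: "('f, 'r) fm set set \<times> (('f, 'r option) fm \<times> ('f, 'r) fm set list) set" and x
 \<comment> \<open>What a new witness has to avoid: the constants of \<open>\<Sigma>\<close>, the
   default \<open>{}\<close>, the parameters of this and of all earlier requirements, and the
   earlier witnesses.\<close>
 define used where "used f t = set xs \<union> {{}} \<union> (\<Union>s\<in>insert t (U t). fst s) \<union> (\<lambda>s. fst (f s)) ` U t"
  for f :: "_ \<Rightarrow> ('f, 'r) fm set \<times> bool" and t
 define pre where "pre f t = \<Gamma>i \<union> (\<Union>s\<in>{s\<in>U t. snd (f s)}. ax s (fst (f s)))"
  for f :: "_ \<Rightarrow> ('f, 'r) fm set \<times> bool" and t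
 have fresh: "\<exists>x\<in>?X. x \<notin> used f t" if t: "t \<in> S" for f t
 proof -
  \<comment> \<open>To be applied with |T| or with |U t| for \<open>r\<close>, whichever is larger;
    both are below 2^|T|.\<close>
  have bound: "|used f t| \<le>o r" if r: "Cinfinite r" "|T| \<le>o r" "|U t| \<le>o r" for r :: "'z rel"
  proof -
   have 1: "|set xs \<union> {{}}| \<le>o r" by (rule finite_le_Cinfinite[OF _ r(1)]) simp
   have 2: "|\<Union>s\<in>insert t (U t). fst s| \<le>o r"
   proof (rule UNION_Cinfinite_bound[OF _ _ r(1)])
    have "|{t}| \<le>o r" by (rule finite_le_Cinfinite[OF _ r(1)]) simp
    thus "|insert t (U t)| \<le>o r" using Un_Cinfinite_bound[OF _ r(3) r(1), of "{t}"] by simp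
    show "\<forall>s\<in>insert t (U t). |fst s| \<le>o r" using cA(1) US t r(2) ordLeq_transitive by blast
   qed
   have 3: "|(\<lambda>s. fst (f s)) ` U t| \<le>o r" by (rule ordLeq_transitive[OF card_of_image r(3)])
   show ?thesis unfolding used_def
    by (rule Un_Cinfinite_bound[OF Un_Cinfinite_bound[OF 1 2 r(1)] 3 r(1)])
  qed
  have "U t = underS ?W t" by (auto simp: U_def underS_def)
  hence "|U t| <o ?W" using card_of_underS[OF CW, of t] FW t by simp
  hence Ul: "|U t| <o |Pow T|" using cS ordLess_ordLeq_trans by blast
  have "|used f t| <o |Pow T|"
  proof (cases "|U t| \<le>o |T|")
   case True
   have "|used f t| \<le>o |T|" using bound[OF Cinf_T _ True] card_of_mono1[of T T] by blast
   thus ?thesis using card_of_Pow ordLeq_ordLess_trans by blast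
  next
   case False
   hence TU: "|T| \<le>o |U t|" using ordLeq_total[OF card_of_Well_order card_of_Well_order, of T "U t"] by metis
   hence "Cinfinite |U t|" using cinfinite_mono[OF TU] Cinf_T card_of_Card_order by blast
   hence "|used f t| \<le>o |U t|" using bound[OF _ TU] card_of_mono1[of "U t" "U t"] by blast
   thus ?thesis using Ul ordLeq_ordLess_trans by blast
  qed
  hence "\<not> |?X| \<le>o |used f t|" using not_ordLess_ordLeq by blast
  hence "\<not> ?X \<subseteq> used f t" using card_of_mono1 by blast
  thus ?thesis by blast
 qed
 \<comment> \<open>The first component of \<open>f t\<close> is the witness for \<open>t\<close>;
   the second records whether the requirement was consistent with everything accepted before
   it.\<close>
 have "\<exists>f. \<forall>t. t \<in> S \<longrightarrow> fst (f t) \<in> ?X \<and> fst (f t) \<notin> used f t \<and> snd (f t) = fs (pre f t \<union> ax t (fst (f t)))"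
 proof (rule dependent_wf_choice[OF wf])
  fix f g :: "_ \<Rightarrow> ('f, 'r) fm set \<times> bool" and t r
  assume fg: "\<And>z. (z, t) \<in> ?R \<Longrightarrow> f z = g z"
  hence eq: "f s = g s" if "s \<in> U t" for s using that by (simp add: U_def)
  have "(\<lambda>s. fst (f s)) ` U t = (\<lambda>s. fst (g s)) ` U t" using eq by (intro image_cong) auto
  hence u: "used f t = used g t" by (simp add: used_def)
  have "(\<Union>s\<in>{s\<in>U t. snd (f s)}. ax s (fst (f s))) = (\<Union>s\<in>{s\<in>U t. snd (g s)}. ax s (fst (g s)))"
   using eq by (intro SUP_cong) auto
  hence "pre f t = pre g t" by (simp add: pre_def)
  thus "(t \<in> S \<longrightarrow> fst r \<in> ?X \<and> fst r \<notin> used f t \<and> snd r = fs (pre f t \<union> ax t (fst r))) =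
   (t \<in> S \<longrightarrow> fst r \<in> ?X \<and> fst r \<notin> used g t \<and> snd r = fs (pre g t \<union> ax t (fst r)))" using u by simp
 next
  fix t f
  show "\<exists>r. t \<in> S \<longrightarrow> fst r \<in> ?X \<and> fst r \<notin> used f t \<and> snd r = fs (pre f t \<union> ax t (fst r))"
  proof (cases "t \<in> S")
   case True
   then obtain x where "x \<in> ?X" "x \<notin> used f t" using fresh by blast
   thus ?thesis by (intro exI[of _ "(x, fs (pre f t \<union> ax t x))"]) simp
  qed simp
 qed
 then obtain f where f: "\<forall>t. t \<in> S \<longrightarrow> fst (f t) \<in> ?X \<and> fst (f t) \<notin> used f t \<and> snd (f t) = fs (pre f t \<union> ax t (fst (f t)))" ..
 define acc where "acc = {t\<in>S. snd (f t)}"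
 define \<Gamma> where "\<Gamma> = \<Gamma>i \<union> (\<Union>t\<in>acc. ax t (fst (f t)))"
 \<comment> \<open>Among finitely many accepted requirements one is the last, and its test for
   consistency covered the others.\<close>
 have fin_acc: "fs (\<Gamma>i \<union> (\<Union>t\<in>F. ax t (fst (f t))))" if "finite F" "F \<subseteq> acc" for F
 proof (cases "F = {}")
  case False
  have "\<exists>t\<in>F. \<forall>s\<in>F. (s, t) \<in> ?W" using that(1) False that(2)
  proof (induction F rule: finite_ne_induct)
   case (singleton x)
   thus ?case using total[of x x] by (auto simp: acc_def)
  next
   case (insert x F)
   then obtain t where t: "t \<in> F" "\<forall>s\<in>F. (s, t) \<in> ?W" by auto
   have "x \<in> S" "t \<in> S" using insert.prems t(1) by (auto simp: acc_def)
   thus ?case using total[of x t] total[of x x] t trans by (cases "(x, t) \<in> ?W") blast+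
  qed
  then obtain t where t: "t \<in> F" "\<forall>s\<in>F. (s, t) \<in> ?W" by blast
  have "fs (pre f t \<union> ax t (fst (f t)))" using f t(1) that(2) unfolding acc_def by blast
  have axs: "ax s (fst (f s)) \<subseteq> pre f t \<union> ax t (fst (f t))" if "s \<in> F" for s
  proof (cases "s = t")
   case False
   hence "s \<in> {s\<in>U t. snd (f s)}" using that t(2) \<open>F \<subseteq> acc\<close> by (auto simp: U_def acc_def)
   thus ?thesis unfolding pre_def by blast
  qed simp
  have "\<Gamma>i \<subseteq> pre f t" by (simp add: pre_def)
  hence "\<Gamma>i \<union> (\<Union>s\<in>F. ax s (fst (f s))) \<subseteq> pre f t \<union> ax t (fst (f t))"
   by (intro Un_least UN_least) (erule le_supI1, erule axs)
  thus ?thesis by (rule fs_mono[OF \<open>fs (pre f t \<union> ax t (fst (f t)))\<close>])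
 qed (simp add: \<Gamma>i)
 have \<Gamma>fs: "fs \<Gamma>" unfolding fs_def
 proof (intro allI impI)
  fix \<Gamma>0 assume \<Gamma>0: "\<Gamma>0 \<subseteq> \<Gamma> \<and> finite \<Gamma>0"
  have "finite \<Gamma>0 \<Longrightarrow> \<Gamma>0 \<subseteq> \<Gamma> \<Longrightarrow> \<exists>F. finite F \<and> F \<subseteq> acc \<and> \<Gamma>0 \<subseteq> \<Gamma>i \<union> (\<Union>t\<in>F. ax t (fst (f t)))"
  proof (induction \<Gamma>0 rule: finite_induct)
   case empty thus ?case by blast
  next
   case (insert x \<Gamma>0)
   then obtain F where F: "finite F" "F \<subseteq> acc" "\<Gamma>0 \<subseteq> \<Gamma>i \<union> (\<Union>t\<in>F. ax t (fst (f t)))" by auto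
   show ?case
   proof (cases "x \<in> \<Gamma>i")
    case True thus ?thesis using F by (intro exI[of _ F]) auto
   next
    case False
    then obtain t where "t \<in> acc" "x \<in> ax t (fst (f t))" using insert.prems by (auto simp: \<Gamma>_def)
    thus ?thesis using F by (intro exI[of _ "insert t F"]) auto
   qed
  qed
  then obtain F where "finite F" "F \<subseteq> acc" "\<Gamma>0 \<subseteq> \<Gamma>i \<union> (\<Union>t\<in>F. ax t (fst (f t)))" using \<Gamma>0 by blast
  thus "\<exists>(M, P)\<in>\<P>. \<exists>a. mdl a M P \<Gamma>0" using fin_acc \<Gamma>0 unfolding fs_def by blast
 qed
 have asgX: "range (asg x c) \<subseteq> ?X" if "x \<in> ?X" "set c \<subseteq> ?X" for x c using asg_set that by blast
 have axG: "ax t x \<subseteq> G" if "t \<in> S" "x \<in> ?X" for t x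
 proof
  fix y assume "y \<in> ax t x"
  then obtain \<phi> c where y: "y = (\<phi>, asg x c)" "(\<phi>, c) \<in> snd t" by (auto simp: ax_def)
  have "(\<phi>, c) \<in> ?Q (fst t)" using that(1) y(2) by (auto simp: S_def)
  hence "wff pl \<phi>" "set c \<subseteq> ?X" using cA(2)[OF that(1)] by (auto simp: fmlas_def lists_eq_set)
  thus "y \<in> G" using asgX[OF that(2)] y(1) by (simp add: G_def)
 qed
 have \<Gamma>G: "\<Gamma> \<subseteq> G"
 proof -
  have "\<Gamma>i \<subseteq> G" using \<Sigma> vx by (auto simp: \<Gamma>i_def G_def fmlas_def)
  moreover have "ax t (fst (f t)) \<subseteq> G" if "t \<in> acc" for t
  proof (rule axG)
   show tS: "t \<in> S" using that by (simp add: acc_def)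
   show "fst (f t) \<in> ?X" by (rule conjunct1[OF f[rule_format, OF tS]])
  qed
  ultimately show ?thesis by (auto simp: \<Gamma>_def)
 qed
 let ?Z = "{H. \<Gamma> \<subseteq> H \<and> H \<subseteq> G \<and> fs H}"
 have "\<exists>H\<in>?Z. \<forall>H'\<in>?Z. H \<subseteq> H' \<longrightarrow> H' = H"
 proof (rule subset_Zorn_nonempty)
  show "?Z \<noteq> {}" using \<Gamma>fs \<Gamma>G by blast
  fix \<C> assume ne: "\<C> \<noteq> {}" and ch: "subset.chain ?Z \<C>"
  have "fs (\<Union>\<C>)" unfolding fs_def
  proof (intro allI impI)
   fix \<Gamma>0 assume "\<Gamma>0 \<subseteq> \<Union>\<C> \<and> finite \<Gamma>0"
   then obtain H where "H \<in> \<C>" "\<Gamma>0 \<subseteq> H"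
    using finite_subset_Union_chain[of \<Gamma>0 \<C>] ne ch by (auto simp: subset_chain_def)
   moreover have "fs H" using ch \<open>H \<in> \<C>\<close> by (auto simp: subset_chain_def)
   ultimately show "\<exists>(M, P)\<in>\<P>. \<exists>a. mdl a M P \<Gamma>0" using \<open>\<Gamma>0 \<subseteq> \<Union>\<C> \<and> finite \<Gamma>0\<close> unfolding fs_def by blast
  qed
  moreover have "\<forall>H\<in>\<C>. \<Gamma> \<subseteq> H \<and> H \<subseteq> G" using ch by (auto simp: subset_chain_def)
  ultimately show "\<Union>\<C> \<in> ?Z" using ne by blast
 qed
 then obtain H where H0: "H \<in> ?Z" and max: "\<forall>H'\<in>?Z. H \<subseteq> H' \<longrightarrow> H' = H" by (elim bexE) (rule that)
 have H: "\<Gamma> \<subseteq> H" "H \<subseteq> G" "fs H" using H0 by simp_all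
 have notin: "\<exists>\<Gamma>0. \<Gamma>0 \<subseteq> H \<and> finite \<Gamma>0 \<and> \<not> (\<exists>(M, P)\<in>\<P>. \<exists>a. mdl a M P (insert y \<Gamma>0))" if "y \<in> G" "y \<notin> H" for y
 proof -
  have "\<not> fs (insert y H)"
  proof
   assume "fs (insert y H)"
   hence "insert y H \<in> ?Z" using H that(1) by auto
   hence "insert y H = H" using max by (meson subset_insertI)
   thus False using that(2) by auto
  qed
  then obtain \<Gamma>1 where \<Gamma>1: "\<Gamma>1 \<subseteq> insert y H" "finite \<Gamma>1" "\<not> (\<exists>(M, P)\<in>\<P>. \<exists>a. mdl a M P \<Gamma>1)"
   unfolding fs_def by blast
  have "\<Gamma>1 \<subseteq> insert y (\<Gamma>1 - {y})" by blast
  hence "\<not> (\<exists>(M, P)\<in>\<P>. \<exists>a. mdl a M P (insert y (\<Gamma>1 - {y})))" using \<Gamma>1(3) mdl_mono by blast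
  thus ?thesis using \<Gamma>1(1,2) by (intro exI[of _ "\<Gamma>1 - {y}"]) auto
 qed
 \<comment> \<open>Maximality makes \<open>H\<close> closed under consequences of its finite parts
   in the pairs of \<open>\<P>\<close>.\<close>
 have clos: "(\<phi>, v) \<in> H" if c: "(\<phi>, v) \<in> G" "\<Gamma>0 \<subseteq> H" "finite \<Gamma>0"
   "\<And>M P a. (M, P) \<in> \<P> \<Longrightarrow> mdl a M P \<Gamma>0 \<Longrightarrow> sat (pair_struct C M P) (\<lambda>i. a (v i)) \<phi>" for \<phi> v \<Gamma>0
 proof (rule ccontr)
  assume "(\<phi>, v) \<notin> H"
  then obtain \<Gamma>1 where \<Gamma>1: "\<Gamma>1 \<subseteq> H" "finite \<Gamma>1" "\<not> (\<exists>(M, P)\<in>\<P>. \<exists>a. mdl a M P (insert (\<phi>, v) \<Gamma>1))"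
   using notin[OF c(1)] by blast
  obtain M P a where m: "(M, P) \<in> \<P>" "mdl a M P (\<Gamma>0 \<union> \<Gamma>1)" using fsD[OF H(3), of "\<Gamma>0 \<union> \<Gamma>1"] c(2,3) \<Gamma>1 by auto
  have "mdl a M P \<Gamma>0" "mdl a M P \<Gamma>1" using mdl_mono[OF m(2)] by auto
  hence "mdl a M P (insert (\<phi>, v) \<Gamma>1)" using c(4)[OF m(1)] unfolding mdl_def by auto
  thus False using \<Gamma>1(3) m(1) by blast
 qed
 have neg: "(Neg \<phi>, v) \<in> H \<longleftrightarrow> (\<phi>, v) \<notin> H" if c: "(\<phi>, v) \<in> G" for \<phi> v
 proof
  assume "(Neg \<phi>, v) \<in> H"
  show "(\<phi>, v) \<notin> H"
  proof
   assume "(\<phi>, v) \<in> H"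
   then obtain M P a where "mdl a M P {(\<phi>, v), (Neg \<phi>, v)}" using fsD[OF H(3), of "{(\<phi>, v), (Neg \<phi>, v)}"] \<open>(Neg \<phi>, v) \<in> H\<close> by auto
   thus False by (auto simp: mdl_def)
  qed
 next
  assume "(\<phi>, v) \<notin> H"
  then obtain \<Gamma>1 where \<Gamma>1: "\<Gamma>1 \<subseteq> H" "finite \<Gamma>1" "\<not> (\<exists>(M, P)\<in>\<P>. \<exists>a. mdl a M P (insert (\<phi>, v) \<Gamma>1))"
   using notin[OF c] by blast
  show "(Neg \<phi>, v) \<in> H"
  proof (rule clos[OF _ \<Gamma>1(1,2)])
   show "(Neg \<phi>, v) \<in> G" using c by (simp add: G_def)
   fix M P a assume m: "(M, P) \<in> \<P>" "mdl a M P \<Gamma>1"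
   hence "\<not> mdl a M P (insert (\<phi>, v) \<Gamma>1)" using \<Gamma>1(3) by blast
   thus "sat (pair_struct C M P) (\<lambda>i. a (v i)) (Neg \<phi>)" using m(2) by (auto simp: mdl_def)
  qed
 qed
 \<comment> \<open>A requirement that is consistent with \<open>H\<close> was also consistent with
   the smaller set \<open>pre\<close>, its constant being fresh; hence it was accepted.\<close>
 have realize: "\<exists>x\<in>?X. \<forall>(\<phi>, c)\<in>q. (\<phi>, asg x c) \<in> H"
  if A: "A \<subseteq> ?X" "|A| \<le>o |T|" "q \<subseteq> ?Q A" and
   q: "\<And>\<Gamma>0 q0. \<Gamma>0 \<subseteq> H \<Longrightarrow> finite \<Gamma>0 \<Longrightarrow> q0 \<subseteq> q \<Longrightarrow> finite q0 \<Longrightarrow>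
    \<exists>M P a u. (M, P) \<in> \<P> \<and> mdl a M P \<Gamma>0 \<and> u \<in> M \<and> (\<forall>(\<phi>, c)\<in>q0. holds (pair_struct C M P) \<phi> (u # map a c))" for A q
 proof -
  let ?t = "(A, q)"
  have t: "?t \<in> S" using A by (simp add: S_def)
  define x where "x = fst (f ?t)"
  have x: "x \<in> ?X" "x \<notin> used f ?t" using f t by (auto simp: x_def)
  have "fs (pre f ?t \<union> ax ?t x)" unfolding fs_def
  proof (intro allI impI)
   fix \<Gamma>0 assume \<Gamma>0: "\<Gamma>0 \<subseteq> pre f ?t \<union> ax ?t x \<and> finite \<Gamma>0"
   have preH: "pre f ?t \<subseteq> H"
   proof -
    have "{s\<in>U ?t. snd (f s)} \<subseteq> acc" using US by (auto simp: acc_def)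
    hence "pre f ?t \<subseteq> \<Gamma>" unfolding pre_def \<Gamma>_def by blast
    thus ?thesis using H(1) by blast
   qed
   have "\<Gamma>0 - pre f ?t \<subseteq> (\<lambda>(\<phi>, c). (\<phi>, asg x c)) ` q" "finite (\<Gamma>0 - pre f ?t)" using \<Gamma>0 by (auto simp: ax_def)
   then obtain q0 where q0: "q0 \<subseteq> q" "finite q0" "\<Gamma>0 - pre f ?t = (\<lambda>(\<phi>, c). (\<phi>, asg x c)) ` q0"
    using finite_subset_image[of "\<Gamma>0 - pre f ?t" "\<lambda>(\<phi>, c). (\<phi>, asg x c)" q] by blast
   obtain M P a u where m: "(M, P) \<in> \<P>" "mdl a M P (\<Gamma>0 \<inter> pre f ?t)" "u \<in> M"
    "\<forall>(\<phi>, c)\<in>q0. holds (pair_struct C M P) \<phi> (u # map a c)"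
    using q[of "\<Gamma>0 \<inter> pre f ?t" q0] \<Gamma>0 preH q0 by (metis finite_Int inf.coboundedI2)
   \<comment> \<open>Reinterpreting the fresh constant \<open>x\<close> affects neither the earlier
     formulas nor the parameters of \<open>q\<close>.\<close>
   let ?a = "a(x := u)"
   have vfresh: "x \<notin> range v" if "(\<phi>, v) \<in> pre f ?t" for \<phi> v
   proof
    assume xv: "x \<in> range v"
    have "(\<phi>, v) \<in> \<Gamma>i \<or> (\<exists>s\<in>U ?t. (\<phi>, v) \<in> ax s (fst (f s)))" using that by (auto simp: pre_def)
    thus False
    proof
     assume "(\<phi>, v) \<in> \<Gamma>i"
     hence "x \<in> range vx" using xv by (auto simp: \<Gamma>i_def)
     hence "x \<in> set xs \<union> {{}}" using xs(2) by (auto simp: vx_def split: if_splits)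
     thus False using x(2) by (auto simp: used_def)
    next
     assume "\<exists>s\<in>U ?t. (\<phi>, v) \<in> ax s (fst (f s))"
     then obtain s c where s: "s \<in> U ?t" "v = asg (fst (f s)) c" "(\<phi>, c) \<in> snd s" by (auto simp: ax_def)
     have "s \<in> S" using s(1) US by blast
     hence "(\<phi>, c) \<in> ?Q (fst s)" using s(3) by (auto simp: S_def)
     hence "set c \<subseteq> fst s" by (auto simp: lists_eq_set)
     moreover have "x \<in> insert (fst (f s)) (set c)" using xv asg_set unfolding s(2) by blast
     ultimately have "x \<in> used f ?t" using s(1) unfolding used_def by blast
     thus False using x(2) by blast
    qed
   qed
   have "mdl ?a M P \<Gamma>0" unfolding mdl_def
   proof (intro conjI ballI)
    show "?a ` ?X \<subseteq> M" using m(2,3) by (auto simp: mdl_def)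
    fix y assume y: "y \<in> \<Gamma>0"
    obtain \<phi> v where ye: "y = (\<phi>, v)" by (cases y)
    show "case y of (\<phi>, v) \<Rightarrow> sat (pair_struct C M P) (\<lambda>i. ?a (v i)) \<phi>"
    proof (cases "y \<in> pre f ?t")
     case True
     have "(\<lambda>i. ?a (v i)) = (\<lambda>i. a (v i))" using vfresh True ye by (auto simp: fun_eq_iff)
     thus ?thesis using mdlD[OF m(2), of \<phi> v] True y ye by simp
    next
     case False
     hence "y \<in> (\<lambda>(\<phi>, c). (\<phi>, asg x c)) ` q0" using y q0(3) by blast
     then obtain c where c: "v = asg x c" "(\<phi>, c) \<in> q0" using ye by auto
     have cA': "c \<in> lists A" "\<phi> \<in> fmlas pl (Suc (length c))" using c(2) q0(1) A(3) by auto
     have "x \<notin> A" using x(2) by (auto simp: used_def)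
     hence "map ?a c = map a c" using cA'(1) by (intro map_cong) (auto simp: lists_eq_set)
     hence "holds (pair_struct C M P) \<phi> (?a x # map ?a c)" using m(4) c(2) by (simp only: fun_upd_same) blast
     thus ?thesis unfolding ye prod.case c(1) asg_holds[OF cA'(2)] .
    qed
   qed
   thus "\<exists>(M, P)\<in>\<P>. \<exists>a. mdl a M P \<Gamma>0" using m(1) by blast
  qed
  hence "?t \<in> acc" using f t unfolding acc_def x_def by blast
  hence "ax ?t x \<subseteq> H" using H(1) unfolding \<Gamma>_def x_def by blast
  thus ?thesis using x(1) by (intro bexI[of _ x]) (auto simp: ax_def)
 qed
 \<comment> \<open>An existential formula in \<open>H\<close> is a requirement consisting of a
   single formula, so witnesses come from the same construction.\<close>
 have henkin: "\<exists>x\<in>?X. (\<phi>, v(w := x)) \<in> H" if ex: "(Ex w \<phi>, v) \<in> H" for w \<phi> v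
 proof -
  have G: "wff pl \<phi>" "range v \<subseteq> ?X" using ex H(2) by (auto simp: G_def)
  have "finite (fv \<phi> - {w})" by (simp add: finite_fv)
  from finite_list[OF this] obtain vs where vs: "set vs = fv \<phi> - {w}" ..
  have "dfn pl (set (w # vs)) (\<lambda>(M :: ('f, 'r option, 'u) struct) a. sat M a \<phi>)"
   by (rule dfnI[where \<phi> = \<phi> and v = "\<lambda>i. i"]) (use G vs in auto)
  then obtain \<psi> where \<psi>: "\<psi> \<in> fmlas pl (length (w # vs))"
   "\<And>(M :: ('f, 'r option, 'u) struct) a. sat M a \<phi> \<longleftrightarrow> holds M \<psi> (map a (w # vs))"
   by (rule dfn_to_fm) (rule that)
  let ?c = "map v vs"
  have \<psi>': "\<psi> \<in> fmlas pl (Suc (length ?c))" using \<psi>(1) by simp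
  have eq: "sat M (e(w := u)) \<phi> \<longleftrightarrow> holds M \<psi> (u # map e vs)" for M :: "('f, 'r option, 'u) struct" and e u
  proof -
   have "map (e(w := u)) vs = map e vs" using vs by auto
   thus ?thesis unfolding \<psi>(2) by (simp only: list.map fun_upd_same)
  qed
  have "\<exists>x\<in>?X. \<forall>(\<phi>, c)\<in>{(\<psi>, ?c)}. (\<phi>, asg x c) \<in> H"
  proof (rule realize)
   show "set ?c \<subseteq> ?X" using G(2) by auto
   show "|set ?c| \<le>o |T|" by (rule finite_le_Cinfinite[OF finite_set Cinf_T])
   show "{(\<psi>, ?c)} \<subseteq> ?Q (set ?c)" using \<psi>' by (auto simp: lists_eq_set)
   fix \<Gamma>0 q0 assume \<Gamma>0: "\<Gamma>0 \<subseteq> H" "finite \<Gamma>0" and q0: "q0 \<subseteq> {(\<psi>, ?c)}"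
   obtain M P a where m: "(M, P) \<in> \<P>" "mdl a M P (insert (Ex w \<phi>, v) \<Gamma>0)"
    using fsD[OF H(3), of "insert (Ex w \<phi>, v) \<Gamma>0"] \<Gamma>0 ex by auto
   have "sat (pair_struct C M P) (\<lambda>i. a (v i)) (Ex w \<phi>)" by (rule mdlD[OF m(2)]) simp
   then obtain u where u: "u \<in> M" "sat (pair_struct C M P) ((\<lambda>i. a (v i))(w := u)) \<phi>" by auto
   have "holds (pair_struct C M P) \<psi> (u # map a ?c)" using u(2) unfolding eq by (simp add: comp_def)
   thus "\<exists>M P a u. (M, P) \<in> \<P> \<and> mdl a M P \<Gamma>0 \<and> u \<in> M \<and> (\<forall>(\<phi>, c)\<in>q0. holds (pair_struct C M P) \<phi> (u # map a c))"
    using m(1) mdl_mono[OF m(2), of \<Gamma>0] u(1) q0 by (intro exI[of _ M] exI[of _ P] exI[of _ a] exI[of _ u]) auto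
  qed
  then obtain x where x: "x \<in> ?X" "(\<psi>, asg x ?c) \<in> H" by auto
  have "(\<phi>, v(w := x)) \<in> H"
  proof (rule clos[of _ _ "{(\<psi>, asg x ?c)}"])
   show "(\<phi>, v(w := x)) \<in> G" using G x(1) by (auto simp: G_def)
   fix M P a assume m: "(M, P) \<in> \<P>" "mdl a M P {(\<psi>, asg x ?c)}"
   have "holds (pair_struct C M P) \<psi> (a x # map a ?c)" using mdlD[OF m(2)] asg_holds[OF \<psi>'] by blast
   hence "sat (pair_struct C M P) ((\<lambda>i. a (v i))(w := a x)) \<phi>" unfolding eq by (simp add: comp_def)
   moreover have "(\<lambda>i. a (v i))(w := a x) = (\<lambda>i. a ((v(w := x)) i))" by (auto simp: fun_eq_iff)
   ultimately show "sat (pair_struct C M P) (\<lambda>i. a ((v(w := x)) i)) \<phi>" by simp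
  qed (use x in auto)
  thus ?thesis using x(1) by blast
 qed
 let ?J = "{(\<phi>, v). (lift \<phi>, v) \<in> H}"
 define EJ where "EJ j M a \<longleftrightarrow> (case j of (\<phi>, v) \<Rightarrow> sat M (\<lambda>i. a (v i)) \<phi>)"
  for j :: "('f, 'r) fm \<times> (nat \<Rightarrow> ('f, 'r) fm set)" and M :: "('f, 'r, 'u) struct" and a
 have JG: "wff L \<phi>" "range v \<subseteq> ?X" if "(lift \<phi>, v) \<in> H" for \<phi> v using that H(2) by (auto simp: G_def wff_lift)
 \<comment> \<open>Saturation of \<open>C\<close> interprets all constants so that the formulas of
   \<open>L\<close> in \<open>H\<close> become true; this is where \<open>\<kappa>\<close> exceeds
   the number 2^|T| of constants.\<close>
 have "\<exists>a. a ` ?X \<subseteq> dom C \<and> (\<forall>x\<in>{}. a x = undefined x) \<and> (\<forall>j\<in>?J. EJ j C a)"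
 proof (rule assignment_C[OF small_PowT])
  fix j assume "j \<in> ?J"
  then obtain \<phi> v where j: "j = (\<phi>, v)" "(lift \<phi>, v) \<in> H" by auto
  show "dfn L ?X (EJ j)"
   by (rule dfnI[where \<phi> = \<phi> and v = v]) (use JG[OF j(2)] in \<open>auto simp: EJ_def j(1)\<close>)
 next
  fix J0 assume J0: "J0 \<subseteq> ?J" "finite J0"
  let ?\<Gamma>0 = "(\<lambda>(\<phi>, v). (lift \<phi>, v)) ` J0"
  have "?\<Gamma>0 \<subseteq> H" "finite ?\<Gamma>0" using J0 by auto
  from fsD[OF H(3) this] obtain M P a where m: "(M, P) \<in> \<P>" "mdl a M P ?\<Gamma>0" by (elim exE conjE) (rule that)
  have aM: "a ` ?X \<subseteq> M" using m(2) by (simp add: mdl_def)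
  have "EJ j C a" if "j \<in> J0" for j
  proof -
   obtain \<phi> v where j: "j = (\<phi>, v)" by (cases j)
   have jH: "(lift \<phi>, v) \<in> H" using J0(1) that j by auto
   have "(lift \<phi>, v) \<in> ?\<Gamma>0" using that j by force
   hence "sat (pair_struct C M P) (\<lambda>i. a (v i)) (lift \<phi>)" by (rule mdlD[OF m(2)])
   moreover have "a (v i) \<in> M" for i
    by (rule subsetD[OF aM imageI]) (rule subsetD[OF JG(2)[OF jH] rangeI])
   ultimately show ?thesis using pair_sat_lift[OF \<P>[OF m(1)] JG(1)[OF jH]] by (simp add: EJ_def j)
  qed
  moreover have "inC (a ` ?X)" using aM is_pairD(1)[OF \<P>[OF m(1)]] by blast
  ultimately show "\<exists>a. a ` ?X \<subseteq> dom C \<and> (\<forall>x\<in>{}. a x = undefined x) \<and> (\<forall>j\<in>J0. EJ j C a)" by blast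
 qed simp
 then obtain a where a: "inC (a ` ?X)" "\<forall>j\<in>?J. EJ j C a" by (elim exE conjE) (rule that)
 have LT: "sat C (\<lambda>i. a (v i)) \<phi> \<longleftrightarrow> (lift \<phi>, v) \<in> H" if "wff L \<phi>" "range v \<subseteq> ?X" for \<phi> v
 proof
  assume "(lift \<phi>, v) \<in> H"
  thus "sat C (\<lambda>i. a (v i)) \<phi>" using a(2) by (auto simp: EJ_def)
 next
  assume s: "sat C (\<lambda>i. a (v i)) \<phi>"
  show "(lift \<phi>, v) \<in> H"
  proof (rule ccontr)
   assume "(lift \<phi>, v) \<notin> H"
   hence "(lift (Neg \<phi>), v) \<in> H" using neg[of "lift \<phi>" v] that by (simp add: G_def wff_lift)
   hence "(Neg \<phi>, v) \<in> ?J" by simp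
   hence "EJ (Neg \<phi>, v) C a" using a(2) by blast
   thus False using s by (simp add: EJ_def)
  qed
 qed
 have eqv: "(\<phi>, v) \<in> H \<longleftrightarrow> (\<psi>, w) \<in> H"
  if e: "(\<phi>, v) \<in> G" "(\<psi>, w) \<in> G" "\<And>M P a. (M, P) \<in> \<P> \<Longrightarrow> a ` ?X \<subseteq> M \<Longrightarrow>
   sat (pair_struct C M P) (\<lambda>i. a (v i)) \<phi> \<longleftrightarrow> sat (pair_struct C M P) (\<lambda>i. a (w i)) \<psi>" for \<phi> v \<psi> w
 proof
  assume "(\<phi>, v) \<in> H"
  thus "(\<psi>, w) \<in> H"
   by (intro clos[OF e(2), of "{(\<phi>, v)}"]) (simp_all add: mdl_def e(3)[THEN iffD1])
 next
  assume "(\<psi>, w) \<in> H"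
  thus "(\<phi>, v) \<in> H"
   by (intro clos[OF e(1), of "{(\<psi>, w)}"]) (simp_all add: mdl_def e(3)[THEN iffD2])
 qed
 have hAnd: "(And \<phi> \<psi>, v) \<in> H \<longleftrightarrow> (\<phi>, v) \<in> H \<and> (\<psi>, v) \<in> H" if "(And \<phi> \<psi>, v) \<in> G" for \<phi> \<psi> v
 proof
  assume "(And \<phi> \<psi>, v) \<in> H"
  thus "(\<phi>, v) \<in> H \<and> (\<psi>, v) \<in> H"
   by (intro conjI; intro clos[of _ _ "{(And \<phi> \<psi>, v)}"]) (use that in \<open>simp_all add: G_def mdl_def\<close>)
 next
  assume "(\<phi>, v) \<in> H \<and> (\<psi>, v) \<in> H"
  thus "(And \<phi> \<psi>, v) \<in> H"
   by (intro clos[OF that, of "{(\<phi>, v), (\<psi>, v)}"]) (simp_all add: mdl_def)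
 qed
 have upd: "(\<lambda>i. b ((v(w := x)) i)) = (\<lambda>i. b (v i))(w := b x)"
  for b :: "('f, 'r) fm set \<Rightarrow> 'u" and v :: "nat \<Rightarrow> ('f, 'r) fm set" and w x
  by (auto simp: fun_eq_iff)
 have hEx: "(Ex w \<phi>, v) \<in> H \<longleftrightarrow> (\<exists>x\<in>?X. (\<phi>, v(w := x)) \<in> H)" if "(Ex w \<phi>, v) \<in> G" for w \<phi> v
 proof
  assume "\<exists>x\<in>?X. (\<phi>, v(w := x)) \<in> H"
  then obtain x where x: "x \<in> ?X" "(\<phi>, v(w := x)) \<in> H" by blast
  show "(Ex w \<phi>, v) \<in> H"
  proof (rule clos[OF that, of "{(\<phi>, v(w := x))}"])
   fix M P b assume m: "mdl b M P {(\<phi>, v(w := x))}"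
   have "b x \<in> M" using m x(1) unfolding mdl_def by blast
   moreover have "sat (pair_struct C M P) (\<lambda>i. b ((v(w := x)) i)) \<phi>" by (rule mdlD[OF m singletonI])
   ultimately show "sat (pair_struct C M P) (\<lambda>i. b (v i)) (Ex w \<phi>)" unfolding sat.simps(5) dom_pair upd by blast
  qed (use x in auto)
 qed (rule henkin)
 have rupd: "range (v(w := x)) \<subseteq> ?X" if "range v \<subseteq> ?X" "x \<in> ?X" for v :: "nat \<Rightarrow> ('f, 'r) fm set" and w x
  using that by auto
 define M where "M = a ` ?X"
 define P where "P = a ` {x\<in>?X. (Rel None [Var 0], \<lambda>_. x) \<in> H}"
 let ?M = "pair_struct C M P"
 have PM: "P \<subseteq> M" by (auto simp: M_def P_def)
 have MC: "inC M" using a(1) by (simp add: M_def)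
 have truth: "sat ?M (\<lambda>i. a (v i)) \<phi> \<longleftrightarrow> (\<phi>, v) \<in> H" if "wff pl \<phi>" "range v \<subseteq> ?X" for \<phi> v
  using that
 proof (induction \<phi> arbitrary: v)
  case (Eq s t)
  hence "wff L (Eq s t)" by (simp add: wft_pair)
  from LT[OF this Eq.prems(2)] show ?case by (simp add: val_pair)
 next
  case (Rel r ts)
  show ?case
  proof (cases r)
   case (Some r')
   have "wff L (Rel r' ts)" using Rel.prems(1) unfolding Some by (simp add: wft_pair) (auto simp: pair_lang_def)
   note LT[OF this Rel.prems(2)]
   moreover have "map (val ?M (\<lambda>i. a (v i))) ts = map (val C (\<lambda>i. a (v i))) ts" by (simp add: val_pair)
   moreover have "rint ?M (Some r') = rint C r'" by (simp add: pair_struct_def)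
   ultimately show ?thesis unfolding Some by (simp del: map_eq_conv)
  next
   case None
   obtain t where t: "ts = [t]" "wft L t" using wff_pair_None Rel.prems(1) unfolding None by blast
   \<comment> \<open>\<open>P\<close> is defined by means of constants only. For a term
     \<open>t\<close>, the formula \<open>P(t)\<close> is replaced by the existence of some
     \<open>w\<close> with \<open>w = t\<close> and \<open>P(w)\<close>, for which \<open>H\<close>
     provides a constant.\<close>
   obtain w where w: "w \<notin> fvt t" using ex_new_if_finite[OF _ finite_fvt[of t]] infinite_UNIV_nat by blast
   let ?Pw = "Rel None [Var w] :: ('f, 'r option) fm"
   let ?e = "And (lift (Eq (Var w) t)) ?Pw"
   have wP: "wff pl (Rel None [Var i])" for i unfolding wff_P by simp
   have Eqw: "wff L (Eq (Var w) t)" using t(2) by simp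
   have we: "wff pl ?e" using wP wff_lift[of L "Eq (Var w) t"] Eqw by simp
   have valw: "val K (e(w := u)) t = val K e t" for K :: "('f, 'r, 'u) struct" and e u
    by (rule val_cong) (use w in auto)
   have "(Rel None [t], v) \<in> H \<longleftrightarrow> (Ex w ?e, v) \<in> H"
   proof (rule eqv)
    show "(Rel None [t], v) \<in> G" using Rel.prems None t(1) by (simp add: G_def)
    show "(Ex w ?e, v) \<in> G" using we Rel.prems(2) by (simp add: G_def)
    fix M P b assume "(M, P) \<in> \<P>"
    hence "P \<subseteq> M" using is_pairD(2)[OF \<P>] by blast
    thus "sat (pair_struct C M P) (\<lambda>i. b (v i)) (Rel None [t]) \<longleftrightarrow> sat (pair_struct C M P) (\<lambda>i. b (v i)) (Ex w ?e)"
     by (auto simp: sat_P val_pair valw simp del: sat.simps(2))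
   qed
   also have "\<dots> \<longleftrightarrow> (\<exists>x\<in>?X. (lift (Eq (Var w) t), v(w := x)) \<in> H \<and> (?Pw, v(w := x)) \<in> H)"
    using we Rel.prems(2) rupd hAnd by (subst hEx) (auto simp: G_def)
   also have "\<dots> \<longleftrightarrow> (\<exists>x\<in>?X. a x = val C (\<lambda>i. a (v i)) t \<and> (Rel None [Var 0], \<lambda>_. x) \<in> H)"
   proof (rule bex_cong[OF refl])
    fix x assume x: "x \<in> ?X"
    note r = rupd[OF Rel.prems(2) x, of w]
    have "(lift (Eq (Var w) t), v(w := x)) \<in> H \<longleftrightarrow> a x = val C (\<lambda>i. a (v i)) t"
     unfolding LT[OF Eqw r, symmetric] upd by (simp add: valw)
    moreover have "(?Pw, v(w := x)) \<in> H \<longleftrightarrow> (Rel None [Var 0], \<lambda>_. x) \<in> H"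
     by (rule eqv) (use wP r x in \<open>simp_all add: G_def sat_P image_subset_iff del: wff.simps(2) sat.simps(2)\<close>)
    ultimately show "(lift (Eq (Var w) t), v(w := x)) \<in> H \<and> (?Pw, v(w := x)) \<in> H \<longleftrightarrow>
     a x = val C (\<lambda>i. a (v i)) t \<and> (Rel None [Var 0], \<lambda>_. x) \<in> H" by simp
   qed
   also have "\<dots> \<longleftrightarrow> val C (\<lambda>i. a (v i)) t \<in> P" unfolding P_def by (auto simp: image_iff)
   finally show ?thesis unfolding None t(1) sat_P by simp
  qed
 next
  case (Neg \<phi>)
  have "(\<phi>, v) \<in> G" using Neg.prems by (simp add: G_def)
  thus ?case using Neg neg by simp
 next
  case (And \<phi> \<psi>)
  thus ?case using hAnd[of \<phi> \<psi> v] by (simp add: G_def)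
 next
  case (Ex w \<phi>)
  have "sat ?M (\<lambda>i. a (v i)) (Ex w \<phi>) \<longleftrightarrow> (\<exists>x\<in>?X. sat ?M (\<lambda>i. a ((v(w := x)) i)) \<phi>)" unfolding upd by (simp add: M_def)
  also have "\<dots> \<longleftrightarrow> (\<exists>x\<in>?X. (\<phi>, v(w := x)) \<in> H)"
   by (rule bex_cong[OF refl], rule Ex.IH) (use Ex.prems rupd in simp_all)
  also have "\<dots> \<longleftrightarrow> (Ex w \<phi>, v) \<in> H" using hEx[of w \<phi> v] Ex.prems by (simp add: G_def)
  finally show ?case .
 qed
 define g where "g u = (SOME x. x \<in> ?X \<and> a x = u)" for u
 have g: "g u \<in> ?X" "a (g u) = u" if "u \<in> M" for u
  using someI_ex[of "\<lambda>x. x \<in> ?X \<and> a x = u"] that by (auto simp: M_def g_def)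
 have vgu: "range (\<lambda>i. g (e i)) \<subseteq> ?X" "(\<lambda>i. a (g (e i))) = e" if "range e \<subseteq> M" for e :: "nat \<Rightarrow> 'u"
  using g that by (auto simp: fun_eq_iff image_subset_iff)
 have M_elem: "elem_submodel L M C"
 proof (rule elem_submodel_sat[OF struct_C MC])
  show "M \<noteq> {}" by (auto simp: M_def)
  fix \<phi> and e :: "nat \<Rightarrow> 'u" assume \<phi>: "wff L \<phi>" and e: "range e \<subseteq> M"
  show "sat (C\<lparr>dom := M\<rparr>) e \<phi> \<longleftrightarrow> sat C e \<phi>"
   using LT[OF \<phi> vgu(1)[OF e]] truth[of "lift \<phi>", OF _ vgu(1)[OF e]] \<phi>
   unfolding vgu(2)[OF e] sat_lift wff_lift by blast
 qed
 have PinH: "(Rel None [Var 0], \<lambda>_. x) \<in> H" if "x \<in> ?X" "a x \<in> P" for x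
  using truth[of "Rel None [Var 0]" "\<lambda>_. x"] that unfolding sat_P by (simp add: pair_lang_def)
 have P_elem: "elem_submodel L P C"
 proof (rule elem_submodel_sat[OF struct_C])
  show "inC P" using PM MC by blast
  have G0: "(Ex 0 (Rel None [Var 0]), \<lambda>_. {}) \<in> G" by (simp add: G_def) (simp add: pair_lang_def)
  hence "(Ex 0 (Rel None [Var 0]), \<lambda>_. {}) \<in> H"
  proof (rule clos[of _ _ "{}"])
   fix M P b assume m: "(M, P) \<in> \<P>"
   obtain u where "u \<in> P" "u \<in> M" using is_pairD(2,3)[OF \<P>[OF m]] by blast
   thus "sat (pair_struct C M P) (\<lambda>i. b {}) (Ex 0 (Rel None [Var 0]))"
    unfolding sat.simps(5) dom_pair sat_P by (intro bexI[of _ u]) auto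
  qed auto
  hence "sat ?M (\<lambda>i. a {}) (Ex 0 (Rel None [Var 0]))" using truth[of _ "\<lambda>_. {}"] G0 by (simp add: G_def del: sat.simps)
  thus "P \<noteq> {}" unfolding sat.simps(5) sat_P by auto
  fix \<phi> and e :: "nat \<Rightarrow> 'u" assume \<phi>: "wff L \<phi>" and e: "range e \<subseteq> P"
  let ?v = "\<lambda>i. g (e i)"
  have eM: "range e \<subseteq> M" using e PM by blast
  note v = vgu[OF eM]
  \<comment> \<open>In a pair of \<open>\<P>\<close> satisfying \<open>?\<Gamma>0\<close> the
    parameters lie in its \<open>P\<close>, so there \<open>\<phi>\<close> has the same truth value
    relativized to \<open>P\<close> as in the whole model.\<close>
  let ?\<Gamma>0 = "(\<lambda>i. (Rel None [Var 0], \<lambda>_. ?v i)) ` fv \<phi>"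
  have "a (?v i) \<in> P" for i using e fun_cong[OF v(2), of i] by auto
  hence \<Gamma>0: "?\<Gamma>0 \<subseteq> H" "finite ?\<Gamma>0" using PinH[OF subsetD[OF v(1) rangeI]] by (auto simp: finite_fv)
  have rl: "sat (pair_struct C M' P') (\<lambda>i. c (?v i)) (relativize \<phi>) \<longleftrightarrow> sat (pair_struct C M' P') (\<lambda>i. c (?v i)) (lift \<phi>)"
   if m: "(M', P') \<in> \<P>" "mdl c M' P' ?\<Gamma>0" for M' P' c
  proof -
   have "c (?v i) \<in> P'" if "i \<in> fv \<phi>" for i
    using mdlD[OF m(2) imageI[OF that]] unfolding sat_P by simp
   hence "sat ((C\<lparr>dom := M'\<rparr>)\<lparr>dom := P'\<rparr>) (\<lambda>i. c (?v i)) \<phi> \<longleftrightarrow> sat (C\<lparr>dom := M'\<rparr>) (\<lambda>i. c (?v i)) \<phi>"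
    by (rule elem_sat[OF is_pairD(5)[OF \<P>[OF m(1)]] \<phi>])
   thus ?thesis unfolding sat_lift sat_relativize[OF is_pairD(2)[OF \<P>[OF m(1)]]] by simp
  qed
  have G: "(relativize \<phi>, ?v) \<in> G" "(lift \<phi>, ?v) \<in> G" using \<phi> v(1) by (simp_all add: G_def wff_lift wff_relativize)
  have "(relativize \<phi>, ?v) \<in> H \<longleftrightarrow> (lift \<phi>, ?v) \<in> H"
  proof
   assume "(relativize \<phi>, ?v) \<in> H"
   thus "(lift \<phi>, ?v) \<in> H"
    by (intro clos[OF G(2), of "insert (relativize \<phi>, ?v) ?\<Gamma>0"]) (use \<Gamma>0 rl in \<open>auto simp: mdl_def\<close>)
  next
   assume "(lift \<phi>, ?v) \<in> H"
   thus "(relativize \<phi>, ?v) \<in> H"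
    by (intro clos[OF G(1), of "insert (lift \<phi>, ?v) ?\<Gamma>0"]) (use \<Gamma>0 rl in \<open>auto simp: mdl_def\<close>)
  qed
  thus "sat (C\<lparr>dom := P\<rparr>) e \<phi> \<longleftrightarrow> sat C e \<phi>"
   using LT[OF \<phi> v(1)] truth[of "relativize \<phi>", OF _ v(1)] \<phi>
   unfolding v(2) sat_relativize[OF PM] wff_relativize by blast
 qed
 have pair: "is_pair L C M P" by (rule is_pairI[OF M_elem P_elem PM])
 have TT: "Card_order |T|" by (rule card_of_Card_order)
 have sat1: "saturated1 (cardSuc |T| ) pl ?M" unfolding saturated1_def dom_pair
 proof (intro allI impI)
  fix A q assume A: "A \<subseteq> M" "|A| <o cardSuc |T|" and q: "q \<subseteq> {(\<phi>, c). c \<in> lists A \<and> \<phi> \<in> fmlas pl (Suc (length c))}"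
   and fq: "\<forall>q0\<subseteq>q. finite q0 \<longrightarrow> (\<exists>u\<in>M. \<forall>(\<phi>, c)\<in>q0. holds ?M \<phi> (u # c))"
  have cA': "|A| \<le>o |T|" using A(2) cardSuc_ordLeq_ordLess[OF TT card_of_Card_order] by blast
  have qD: "c \<in> lists A" "\<phi> \<in> fmlas pl (Suc (length c))" "map a (map g c) = c" if "(\<phi>, c) \<in> q" for \<phi> c
  proof -
   show c: "c \<in> lists A" "\<phi> \<in> fmlas pl (Suc (length c))" using subsetD[OF q that] by auto
   have "a (g u) = u" if "u \<in> set c" for u by (rule g(2)) (use c(1) A(1) that in \<open>auto simp: lists_eq_set\<close>)
   thus "map a (map g c) = c" by (simp add: map_idI)
  qed
  let ?q = "(\<lambda>(\<phi>, c). (\<phi>, map g c)) ` q"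
  have gAX: "g ` A \<subseteq> ?X" using g(1) A(1) by blast
  have tr: "(\<phi>, asg x (map g c)) \<in> H \<longleftrightarrow> holds ?M \<phi> (a x # c)" if "(\<phi>, c) \<in> q" "x \<in> ?X" for \<phi> c x
  proof -
   have "set (map g c) \<subseteq> ?X" using gAX qD(1)[OF that(1)] by (auto simp: lists_eq_set)
   hence "range (asg x (map g c)) \<subseteq> ?X" using asgX that(2) by blast
   moreover have "wff pl \<phi>" using qD(2)[OF that(1)] by (simp add: fmlas_def)
   moreover have "\<phi> \<in> fmlas pl (Suc (length (map g c)))" using qD(2)[OF that(1)] by simp
   ultimately show ?thesis using truth asg_holds qD(3)[OF that(1)] by metis
  qed
  \<comment> \<open>A finite part of the type has a solution \<open>u\<close> in the constructed
    pair, and the name \<open>g u\<close> shows that this part is consistent with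
    \<open>H\<close>.\<close>
  have "\<exists>x\<in>?X. \<forall>(\<phi>, c)\<in>?q. (\<phi>, asg x c) \<in> H"
  proof (rule realize)
   show "g ` A \<subseteq> ?X" by (rule gAX)
   show "|g ` A| \<le>o |T|" by (rule ordLeq_transitive[OF card_of_image cA'])
   show "?q \<subseteq> ?Q (g ` A)"
   proof
    fix y assume "y \<in> ?q"
    then obtain \<phi> c where y: "y = (\<phi>, map g c)" "(\<phi>, c) \<in> q" by auto
    show "y \<in> ?Q (g ` A)" using qD(1,2)[OF y(2)] unfolding y(1) lists_image by simp
   qed
   fix \<Gamma>0 q0 assume \<Gamma>0: "\<Gamma>0 \<subseteq> H" "finite \<Gamma>0" and q0: "q0 \<subseteq> ?q" "finite q0"
   obtain q1 where q1: "q1 \<subseteq> q" "finite q1" "q0 = (\<lambda>(\<phi>, c). (\<phi>, map g c)) ` q1"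
    using finite_subset_image[OF q0(2,1)] by blast
   obtain u where u: "u \<in> M" "\<forall>(\<phi>, c)\<in>q1. holds ?M \<phi> (u # c)" using fq q1 by blast
   let ?x = "g u"
   let ?\<Delta> = "(\<lambda>(\<phi>, c). (\<phi>, asg ?x (map g c))) ` q1"
   have "?\<Delta> \<subseteq> H" using u g[OF u(1)] tr q1(1) by fastforce
   then obtain M' P' b where m: "(M', P') \<in> \<P>" "mdl b M' P' (\<Gamma>0 \<union> ?\<Delta>)"
    using fsD[OF H(3), of "\<Gamma>0 \<union> ?\<Delta>"] \<Gamma>0 q1(2) by auto
   have "holds (pair_struct C M' P') \<phi> (b ?x # map b (map g c))" if "(\<phi>, c) \<in> q1" for \<phi> c
   proof -
    have "(\<phi>, asg ?x (map g c)) \<in> \<Gamma>0 \<union> ?\<Delta>" using that by force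
    hence "sat (pair_struct C M' P') (\<lambda>i. b (asg ?x (map g c) i)) \<phi>" by (rule mdlD[OF m(2)])
    moreover have "\<phi> \<in> fmlas pl (Suc (length (map g c)))" using qD(2) that q1(1) by auto
    ultimately show ?thesis using asg_holds by blast
   qed
   moreover have "b ?x \<in> M'" using m(2) g(1)[OF u(1)] unfolding mdl_def by blast
   ultimately show "\<exists>M P a u. (M, P) \<in> \<P> \<and> mdl a M P \<Gamma>0 \<and> u \<in> M \<and> (\<forall>(\<phi>, c)\<in>q0. holds (pair_struct C M P) \<phi> (u # map a c))"
    using m(1) mdl_mono[OF m(2), of \<Gamma>0] unfolding q1(3)
    by (intro exI[of _ M'] exI[of _ P'] exI[of _ b] exI[of _ "b ?x"]) auto
  qed
  then obtain x where x: "x \<in> ?X" "\<forall>(\<phi>, c)\<in>?q. (\<phi>, asg x c) \<in> H" by blast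
  have "holds ?M \<phi> (a x # c)" if "(\<phi>, c) \<in> q" for \<phi> c using tr[OF that x(1)] x(2) that by auto
  thus "\<exists>u\<in>M. \<forall>(\<phi>, c)\<in>q. holds ?M \<phi> (u # c)" using x(1) by (intro bexI[of _ "a x"]) (auto simp: M_def)
 qed
 \<comment> \<open>Types in several variables are reduced to the case of one variable.\<close>
 have "saturated (cardSuc |T| ) pl ?M" unfolding saturated_def dom_pair
 proof (intro allI impI)
  fix A n q assume A: "A \<subseteq> M" "|A| <o cardSuc |T|" and q: "complete_type pl ?M {..<n::nat} A q"
  have qi: "q \<subseteq> instances pl {..<n} A" and qf: "\<And>q0. finite q0 \<Longrightarrow> q0 \<subseteq> q \<Longrightarrow> \<exists>b. realizes ?M {..<n} b q0"
   using q unfolding complete_type_def by auto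
  let ?Y = "Inl ` {..<n} \<union> Inr ` A :: (nat + 'u) set"
  have cA': "|A| \<le>o |T|" using A(2) cardSuc_ordLeq_ordLess[OF TT card_of_Card_order] by blast
  have "|?Y| \<le>o |T|"
  proof (rule Un_Cinfinite_bound[OF _ _ Cinf_T])
   show "|Inl ` {..<n} :: (nat + 'u) set| \<le>o |T|" by (rule finite_le_Cinfinite[OF _ Cinf_T]) simp
   show "|Inr ` A :: (nat + 'u) set| \<le>o |T|" by (rule ordLeq_transitive[OF card_of_image cA'])
  qed
  hence cY: "|?Y| <o cardSuc |T|" using cardSuc_ordLeq_ordLess[OF TT card_of_Card_order] by blast
  define D' where "D' j K b \<longleftrightarrow> (case j of (\<phi>, js, c) \<Rightarrow> holds K \<phi> (map b (map Inl js @ map Inr c)))"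
   for j :: "('f, 'r option) fm \<times> nat list \<times> 'u list" and K :: "('f, 'r option, 'u) struct" and b :: "nat + 'u \<Rightarrow> 'u"
  have "\<exists>b. b ` ?Y \<subseteq> dom ?M \<and> (\<forall>x\<in>Inr ` A. b x = projr x) \<and> (\<forall>j\<in>q. D' j ?M b)"
  proof (rule saturated_assignment[OF sat1 cY])
   fix j assume "j \<in> q"
   hence "j \<in> instances pl {..<n} A" using qi by blast
   then obtain \<phi> js c where j: "j = (\<phi>, js, c)" "js \<in> lists {..<n}" "c \<in> lists A" "\<phi> \<in> fmlas pl (length js + length c)"
    unfolding instances_def by (elim CollectE case_prodE conjE) (rule that, simp)
   have "set (map Inl js @ map Inr c) \<subseteq> ?Y" using j by (auto simp: lists_eq_set)
   thus "dfn pl ?Y (D' j)" unfolding j(1) D'_def prod.case by (intro dfn_holds) (use j in auto)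
  next
   fix q0 assume "q0 \<subseteq> q" "finite q0"
   then obtain b where b: "realizes ?M {..<n} b q0" using qf by blast
   have "D' j ?M (case_sum b id)" if "j \<in> q0" for j
    using b that by (auto simp: D'_def realizes_def case_sum_o_inj)
   moreover have "case_sum b id ` ?Y \<subseteq> dom ?M" using b A(1) by (auto simp: realizes_def)
   ultimately show "\<exists>b. b ` ?Y \<subseteq> dom ?M \<and> (\<forall>x\<in>Inr ` A. b x = projr x) \<and> (\<forall>j\<in>q0. D' j ?M b)"
    by (intro exI[of _ "case_sum b id"]) auto
  qed auto
  then obtain b where b: "b ` ?Y \<subseteq> dom ?M" "\<forall>x\<in>Inr ` A. b x = projr x" "\<forall>j\<in>q. D' j ?M b" by (elim exE conjE) (rule that)
  have "realizes ?M {..<n} (\<lambda>i. b (Inl i)) q" unfolding realizes_def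
  proof (intro conjI ballI)
   show "b (Inl i) \<in> dom ?M" if "i \<in> {..<n}" for i using b(1) that by blast
   fix j assume j: "j \<in> q"
   obtain \<phi> js c where je: "j = (\<phi>, js, c)" by (cases j)
   have "c \<in> lists A" using qi j je by (auto simp: instances_def)
   hence "map (\<lambda>x. b (Inr x)) c = c" using b(2) by (intro map_idI) (auto simp: lists_eq_set)
   moreover have "D' j ?M b" using b(3) j by blast
   ultimately show "case j of (\<phi>, js, c) \<Rightarrow> holds ?M \<phi> (map (\<lambda>i. b (Inl i)) js @ c)"
    unfolding je D'_def prod.case by (simp add: comp_def)
  qed
  thus "\<exists>b. realizes ?M {..<n} b q" by blast
 qed
 moreover have "holds ?M \<sigma> (map a xs)" if "\<sigma> \<in> \<Sigma>" for \<sigma>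
 proof -
  have "wff pl \<sigma>" "fv \<sigma> \<subseteq> {..<p}" using that \<Sigma> by (auto simp: fmlas_def)
  moreover have "(\<sigma>, vx) \<in> H" using that H(1) by (auto simp: \<Gamma>_def \<Gamma>i_def)
  ultimately have "sat ?M (\<lambda>i. a (vx i)) \<sigma>" using truth vx by blast
  moreover have "sat ?M (\<lambda>i. a (vx i)) \<sigma> \<longleftrightarrow> sat ?M (nth (map a xs)) \<sigma>"
   by (rule sat_cong) (use \<open>fv \<sigma> \<subseteq> {..<p}\<close> xs(2) in \<open>auto simp: vx_def\<close>)
  ultimately show ?thesis by (simp add: holds_def)
 qed
 moreover have "set (map a xs) \<subseteq> M" unfolding set_map M_def by (rule image_mono[OF xs(3)])
 hence "map a xs \<in> lists M" by (simp only: lists_eq_set mem_Collect_eq)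
 ultimately show ?thesis using pair xs(2) by (intro exI[of _ M] exI[of _ P] exI[of _ "map a xs"]) simp
qed

end

section \<open>The set of witnesses of forking is open\<close>

lemma lists_nth: "xs \<in> lists M \<Longrightarrow> i < length xs \<Longrightarrow> xs ! i \<in> M"
 by (simp add: in_listsD)

context monster
begin

text \<open>\<open>\<beta>\<close> replaces the statement that no \<open>a\<close> makes all
  \<open>\<phi> i\<close> fork over \<open>e\<close>. The statement implies \<open>\<beta>\<close>
  in pairs that are dense over \<open>e\<close>, and \<open>\<beta>\<close> implies the statement in
  pairs with the extension property.\<close>

lemma pair_fm:
 assumes \<psi>: "\<psi> \<in> fmlas L (p + q)" and I: "finite I" and \<phi>: "\<And>i. i \<in> I \<Longrightarrow> \<phi> i \<in> fmlas L (p + q + m i)"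
 obtains \<beta> where "\<beta> \<in> fmlas pl p" "\<And>M P e. is_pair L C M P \<Longrightarrow> e \<in> lists M \<Longrightarrow> length e = p \<Longrightarrow>
  holds (pair_struct C M P) \<beta> e \<longleftrightarrow>
   (\<forall>a\<in>lists M. length a = q \<longrightarrow> holds C \<psi> (e @ a) \<longrightarrow>
    (\<exists>i\<in>I. \<exists>y\<in>lists P. length y = m i \<and> holds C (\<phi> i) (e @ a @ y)))"
proof -
 let ?E2 = "\<lambda>i (K :: ('f, 'r option, 'u) struct) (c :: (nat + nat) + nat \<Rightarrow> 'u).
  (\<forall>j\<in>{..<m i}. holds K (Rel None [Var 0]) (map c [Inr j])) \<and>
  holds K (lift (\<phi> i)) (map c (map (Inl \<circ> Inl) [0..<p] @ map (Inl \<circ> Inr) [0..<q] @ map Inr [0..<m i]))"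
 let ?E1 = "\<lambda>(K :: ('f, 'r option, 'u) struct) (c :: nat + nat \<Rightarrow> 'u).
  holds K (lift \<psi>) (map c (map Inl [0..<p] @ map Inr [0..<q])) \<and>
  \<not> (\<exists>i\<in>I. \<exists>y\<in>tuples K (m i). ?E2 i K (case_sum c (nth y)))"
 have lf: "lift \<chi> \<in> fmlas pl n" if "\<chi> \<in> fmlas L n" for \<chi> n using that by (simp add: fmlas_def wff_lift fv_lift)
 have P0: "Rel None [Var 0] \<in> fmlas pl (Suc 0)" unfolding fmlas_def mem_Collect_eq wff_P by simp
 have "dfn pl {..<p} (\<lambda>K a. \<not> (\<exists>y\<in>tuples K q. ?E1 K (case_sum a (nth y))))"
 proof (intro dfn_Neg dfn_ex_tuple dfn_And dfn_bex[OF I])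
  show "dfn pl (Inl ` {..<p} \<union> Inr ` {..<q})
   (\<lambda>K c. holds K (lift \<psi>) (map c (map Inl [0..<p] @ map Inr [0..<q])))"
   by (rule dfn_holds) (use \<psi> lf in auto)
  fix i assume i: "i \<in> I"
  have ph: "lift (\<phi> i) \<in> fmlas pl (length (map (Inl \<circ> Inl) [0..<p] @ map (Inl \<circ> Inr) [0..<q] @ map Inr [0..<m i]))"
   using lf[OF \<phi>[OF i]] by (simp add: add.assoc)
  show "dfn pl (Inl ` (Inl ` {..<p} \<union> Inr ` {..<q}) \<union> Inr ` {..<m i}) (\<lambda>K c. \<forall>j\<in>{..<m i}. holds K (Rel None [Var 0]) (map c [Inr j]))"
   by (intro dfn_ball dfn_holds) (use P0 in auto)
  show "dfn pl (Inl ` (Inl ` {..<p} \<union> Inr ` {..<q}) \<union> Inr ` {..<m i}) (\<lambda>K c.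
   holds K (lift (\<phi> i)) (map c (map (Inl \<circ> Inl) [0..<p] @ map (Inl \<circ> Inr) [0..<q] @ map Inr [0..<m i])))"
   by (rule dfn_holds[OF ph]) auto
 qed
 then obtain \<beta> where \<beta>: "\<beta> \<in> fmlas pl p"
  "\<And>(K :: ('f, 'r option, 'u) struct) xs. length xs = p \<Longrightarrow> holds K \<beta> xs \<longleftrightarrow> \<not> (\<exists>y\<in>tuples K q. ?E1 K (case_sum (nth xs) (nth y)))"
  by (rule fm_exists) (rule that)
 show thesis
 proof (rule that[OF \<beta>(1)])
  fix M P e assume pr: "is_pair L C M P" and e: "e \<in> lists M" "length e = p"
  let ?K = "pair_struct C M P"
  let ?z = "\<lambda>a y. case_sum (case_sum (nth e) (nth a)) (nth y)"
  have hl: "holds ?K (lift \<chi>) xs \<longleftrightarrow> holds C \<chi> xs" if "\<chi> \<in> fmlas L (length xs)" "xs \<in> lists M" for \<chi> xs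
   unfolding holds_def
  proof (rule pair_sat_lift[OF pr])
   show "wff L \<chi>" using that(1) by (simp add: fmlas_def)
   show "xs ! i \<in> M" if "i \<in> fv \<chi>" for i
    using that \<open>\<chi> \<in> fmlas L (length xs)\<close> by (intro lists_nth[OF \<open>xs \<in> lists M\<close>]) (auto simp: fmlas_def)
  qed
  have PM: "P \<subseteq> M" by (rule is_pairD(2)[OF pr])
  have t: "y \<in> tuples ?K n \<longleftrightarrow> y \<in> lists M \<and> length y = n" for y n by (auto simp: tuples_def lists_eq_set)
  have 1: "holds ?K (lift \<psi>) (map (case_sum (nth e) (nth a)) (map Inl [0..<p] @ map Inr [0..<q])) \<longleftrightarrow> holds C \<psi> (e @ a)"
   if a: "a \<in> lists M" "length a = q" for a
  proof -
   have "map (case_sum (nth e) (nth a)) (map Inl [0..<p] @ map Inr [0..<q]) = e @ a"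
    by (simp add: comp_def e(2)[symmetric] a(2)[symmetric] map_nth)
   thus ?thesis using hl[of \<psi> "e @ a"] \<psi> e a by simp
  qed
  have 2: "?E2 i ?K (?z a y) \<longleftrightarrow> y \<in> lists P \<and> holds C (\<phi> i) (e @ a @ y)"
   if i: "i \<in> I" and a: "a \<in> lists M" "length a = q" and y: "y \<in> lists M" "length y = m i" for i a y
  proof -
   have "map (?z a y)
    (map (Inl \<circ> Inl) [0..<p] @ map (Inl \<circ> Inr) [0..<q] @ map Inr [0..<m i]) = e @ a @ y"
    by (simp add: comp_def e(2)[symmetric] a(2)[symmetric] y(2)[symmetric] map_nth)
   moreover have "holds ?K (lift (\<phi> i)) (e @ a @ y) \<longleftrightarrow> holds C (\<phi> i) (e @ a @ y)"
    using hl[of "\<phi> i" "e @ a @ y"] \<phi>[OF i] e a y by (simp add: add.assoc)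
   moreover have "holds ?K (Rel None [Var 0]) [u] \<longleftrightarrow> u \<in> P" for u unfolding holds_def sat_P by simp
   hence "(\<forall>j\<in>{..<m i}. holds ?K (Rel None [Var 0]) (map (?z a y) [Inr j])) \<longleftrightarrow> y \<in> lists P"
    using y(2) by (auto simp: lists_eq_set set_conv_nth)
   ultimately show ?thesis by (simp only:)
  qed
  define X where "X a \<longleftrightarrow> (\<exists>i\<in>I. \<exists>y\<in>lists P. length y = m i \<and> holds C (\<phi> i) (e @ a @ y))" for a
  have B: "(\<exists>i\<in>I. \<exists>y\<in>tuples ?K (m i). ?E2 i ?K (?z a y)) \<longleftrightarrow> X a"
   if a: "a \<in> lists M" "length a = q" for a
   unfolding X_def
  proof (rule bex_cong[OF refl])
   fix i assume i: "i \<in> I"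
   show "(\<exists>y\<in>tuples ?K (m i). ?E2 i ?K (?z a y)) \<longleftrightarrow>
    (\<exists>y\<in>lists P. length y = m i \<and> holds C (\<phi> i) (e @ a @ y))"
   proof
    assume "\<exists>y\<in>tuples ?K (m i). ?E2 i ?K (?z a y)"
    then obtain y where y: "y \<in> tuples ?K (m i)" "?E2 i ?K (?z a y)" by (rule bexE)
    have yM: "y \<in> lists M" "length y = m i" using y(1) t by auto
    from iffD1[OF 2[OF i a yM] y(2)] show "\<exists>y\<in>lists P. length y = m i \<and> holds C (\<phi> i) (e @ a @ y)" using yM(2) by blast
   next
    assume "\<exists>y\<in>lists P. length y = m i \<and> holds C (\<phi> i) (e @ a @ y)"
    then obtain y where y: "y \<in> lists P" "length y = m i" "holds C (\<phi> i) (e @ a @ y)" by blast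
    have yM: "y \<in> lists M" using y(1) PM by (auto simp: lists_eq_set)
    have "?E2 i ?K (?z a y)" by (rule iffD2[OF 2[OF i a yM y(2)]]) (use y in blast)
    thus "\<exists>y\<in>tuples ?K (m i). ?E2 i ?K (?z a y)"
     by (rule bexI) (use t yM y(2) in blast)
   qed
  qed
  have "(\<exists>a\<in>tuples ?K q. ?E1 ?K (case_sum (nth e) (nth a))) \<longleftrightarrow> (\<exists>a\<in>tuples ?K q. holds C \<psi> (e @ a) \<and> \<not> X a)"
  proof (rule bex_cong[OF refl])
   fix a assume "a \<in> tuples ?K q"
   hence a: "a \<in> lists M" "length a = q" using t by auto
   show "?E1 ?K (case_sum (nth e) (nth a)) \<longleftrightarrow> holds C \<psi> (e @ a) \<and> \<not> X a" unfolding 1[OF a] B[OF a] ..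
  qed
  thus "holds ?K \<beta> e \<longleftrightarrow> (\<forall>a\<in>lists M. length a = q \<longrightarrow> holds C \<psi> (e @ a) \<longrightarrow>
    (\<exists>i\<in>I. \<exists>y\<in>lists P. length y = m i \<and> holds C (\<phi> i) (e @ a @ y)))"
   unfolding \<beta>(2)[OF e(2)] X_def[symmetric] using t by blast
 qed
qed

lemma elem_dfn:
 fixes M :: "('a, 'b, 'c) struct"
 assumes "elem_submodel L' N M" "dfn L' X R" "a ` X \<subseteq> N"
 shows "R (M\<lparr>dom := N\<rparr>) a \<longleftrightarrow> R M a"
proof -
 obtain \<phi> v where \<phi>: "wff L' \<phi>" "v ` fv \<phi> \<subseteq> X" "\<And>M a. R M a \<longleftrightarrow> sat M (\<lambda>i. a (v i)) \<phi>"
  using assms(2) by (rule dfnE) (rule that)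
 show ?thesis unfolding \<phi>(3) by (rule elem_sat[OF assms(1) \<phi>(1)]) (use \<phi>(2) assms(3) in auto)
qed

text \<open>The type of \<open>x\<close> over \<open>E\<close> is finitely satisfiable in the
  elementary submodel \<open>M\<close>. The extension property realizes it in \<open>M\<close>
  independently from \<open>P\<close>, and by homogeneity the realization is an image of
  \<open>x\<close>.\<close>

lemma extension_property_tuple:
 assumes pr: "is_pair L C M P" and EP: "extension_property L T C M P"
  and E: "finite E" "E \<subseteq> M" and x: "x \<in> tup q"
 obtains g where "g \<in> auts E" "map g x \<in> lists M" "ind (g ` set x) E P"
proof -
 let ?M = "C\<lparr>dom := M\<rparr>"
 have Mel: "elem_submodel L M C" and MC: "inC M" using is_pairD[OF pr] by auto
 have EC: "inC E" "small E" using E MC small_finite by auto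
 \<comment> \<open>The extension property names its variables by formulas. Coordinate
   \<open>i\<close> is named by the equation of variable \<open>i\<close> with itself, and
   \<open>\<rho>\<close> decodes the name.\<close>
 define \<iota> where "\<iota> i = (Eq (Var i) (Var i) :: ('f, 'r) fm)" for i
 define \<rho> where "\<rho> \<phi> = (case \<phi> of Eq (Var i) _ \<Rightarrow> i | _ \<Rightarrow> 0)" for \<phi> :: "('f, 'r) fm"
 have \<rho>\<iota> [simp]: "\<rho> (\<iota> i) = i" for i by (simp add: \<rho>_def \<iota>_def)
 let ?I = "\<iota> ` {..<q}"
 define Pt where "Pt = {(\<chi>, js, c). (\<chi>, js, c) \<in> instances L ?I E \<and> holds C \<chi> (map (\<lambda>f. x ! \<rho> f) js @ c)}"
 have el: "holds ?M \<phi> xs \<longleftrightarrow> holds C \<phi> xs" if "\<phi> \<in> fmlas L (length xs)" "xs \<in> lists M" for \<phi> xs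
  using Mel that unfolding elem_submodel_def by (auto simp: tuples_def lists_eq_set)
 \<comment> \<open>A finite part of the type amounts to an existential formula over
   \<open>E\<close>, whose truth passes from \<open>C\<close> to \<open>M\<close>.\<close>
 have fin: "\<exists>r. realizes ?M ?I r P0" if P0: "finite P0" "P0 \<subseteq> Pt" for P0
 proof -
  let ?D = "\<lambda>t (K :: ('f, 'r, 'u) struct) z. case t of (\<chi>, js, c) \<Rightarrow> holds K \<chi> (map z (map (\<lambda>f. Inr (\<rho> f)) js @ map Inl c))"
  have P0D: "\<exists>\<chi> js c. t = (\<chi>, js, c) \<and> js \<in> lists ?I \<and> c \<in> lists E \<and> \<chi> \<in> fmlas L (length js + length c) \<and>
   holds C \<chi> (map (\<lambda>f. x ! \<rho> f) js @ c)" if "t \<in> P0" for t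
   using subsetD[OF P0(2) that] by (cases t) (simp add: Pt_def instances_def)
  have "dfn L (Inl ` E \<union> Inr ` {..<q}) (\<lambda>K z. \<forall>t\<in>P0. ?D t K z)"
  proof (rule dfn_ball[OF P0(1)])
   fix t assume "t \<in> P0"
   from P0D[OF this] obtain \<chi> js c where t: "t = (\<chi>, js, c)" "js \<in> lists ?I" "c \<in> lists E" "\<chi> \<in> fmlas L (length js + length c)"
    by (elim exE conjE) (rule that)
   have "set (map (\<lambda>f. Inr (\<rho> f)) js @ map Inl c) \<subseteq> Inl ` E \<union> Inr ` {..<q}" using t(2,3) by (auto simp: lists_eq_set)
   thus "dfn L (Inl ` E \<union> Inr ` {..<q}) (?D t)" unfolding t(1) prod.case by (intro dfn_holds) (use t(4) in simp_all)
  qed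
  hence "dfn L E (\<lambda>K z. \<exists>y\<in>tuples K q. \<forall>t\<in>P0. ?D t K (case_sum z (nth y)))" by (rule dfn_ex_tuple)
  from elem_dfn[OF Mel this, of id] E(2)
  have iff: "(\<exists>y\<in>tuples ?M q. \<forall>t\<in>P0. ?D t ?M (case_sum id (nth y))) \<longleftrightarrow> (\<exists>y\<in>tup q. \<forall>t\<in>P0. ?D t C (case_sum id (nth y)))"
   by simp
  have D: "?D (\<chi>, js, c) K (case_sum id (nth y)) \<longleftrightarrow> holds K \<chi> (map (\<lambda>f. y ! \<rho> f) js @ c)" for \<chi> js c K y
   by (simp add: comp_def)
  have "\<forall>t\<in>P0. ?D t C (case_sum id (nth x))" using P0D D by fastforce
  then obtain y where y: "y \<in> tuples ?M q" "\<forall>t\<in>P0. ?D t ?M (case_sum id (nth y))" using iff x by blast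
  have "y ! i \<in> M" if "i < q" for i using y(1) that by (auto simp: tuples_def)
  hence "realizes ?M ?I (\<lambda>f. y ! \<rho> f) P0" using y(2) D unfolding realizes_def by auto
  thus ?thesis by blast
 qed
 have "complete_type L ?M ?I E Pt" unfolding complete_type_def
 proof (intro conjI allI impI ballI)
  show "Pt \<subseteq> instances L ?I E" by (auto simp: Pt_def)
  show "\<exists>a. realizes ?M ?I a P0" if "finite P0 \<and> P0 \<subseteq> Pt" for P0 using fin that by blast
  fix t assume t: "t \<in> instances L ?I E"
  obtain \<chi> js c where te: "t = (\<chi>, js, c)" by (cases t)
  have "(Neg \<chi>, js, c) \<in> instances L ?I E" using t te by (simp add: instances_def fmlas_Neg)
  thus "case t of (\<chi>, js, c) \<Rightarrow> (\<chi>, js, c) \<in> Pt \<or> (Neg \<chi>, js, c) \<in> Pt"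
   using t te by (auto simp: Pt_def holds_Neg)
 qed
 moreover have "|E| \<le>o |T|" "|?I| \<le>o |T|" by (rule finite_le_Cinfinite[OF _ Cinf_T], use E in simp)+
 ultimately obtain r where r: "realizes ?M ?I r Pt" "independent L C ?I r E P"
  using EP E(2) unfolding extension_property_def by meson
 define x' where "x' = map (\<lambda>i. r (\<iota> i)) [0..<q]"
 have x'M: "x' \<in> lists M" using r(1) by (auto simp: realizes_def x'_def lists_eq_set)
 have lx: "length x = q" "length x' = q" using x by (simp_all add: tuples_def x'_def)
 have xC: "x \<in> lists (dom C)" "x' \<in> lists (dom C)" using x x'M MC by (auto simp: tuples_def lists_eq_set)
 have xx: "map (\<lambda>f. x ! \<rho> f) (map \<iota> [0..<q]) = x" unfolding lx(1)[symmetric] by (simp add: comp_def map_nth)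
 have imp: "holds C \<phi> (x' @ c)" if "c \<in> lists E" "\<phi> \<in> fmlas L (q + length c)" "holds C \<phi> (x @ c)" for \<phi> c
 proof -
  have "(\<phi>, map \<iota> [0..<q], c) \<in> Pt" using that xx by (auto simp: Pt_def instances_def lists_eq_set)
  hence "holds ?M \<phi> (map r (map \<iota> [0..<q]) @ c)" using r(1) unfolding realizes_def by blast
  hence "holds ?M \<phi> (x' @ c)" by (simp add: x'_def comp_def)
  moreover have "x' @ c \<in> lists M" using x'M that(1) E(2) by (auto simp: lists_eq_set)
  ultimately show ?thesis using el[of \<phi> "x' @ c"] that(2) lx by simp
 qed
 have "holds C \<phi> (x' @ c) \<longleftrightarrow> holds C \<phi> (x @ c)" if "c \<in> lists E" "\<phi> \<in> fmlas L (q + length c)" for \<phi> c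
  using imp[OF that] imp[of c "Neg \<phi>"] that by (auto simp: fmlas_Neg holds_Neg)
 hence "tp L C E x' = tp L C E x" unfolding tp_def lx by blast
 then obtain g where g: "g \<in> auts E" "map g x = x'" using tp_aut[OF EC xC] lx by metis
 have "set x' = r ` ?I" by (auto simp: x'_def)
 moreover have "set x' = g ` set x" using g(2) by (metis set_map)
 moreover have "ind (r ` ?I) E P" using r(2) ind_independent[OF EC] by blast
 ultimately show thesis using that[OF g(1)] g(2) x'M by simp
qed

text \<open>Several formulas are treated at once because the forking conditions of a chain share a
  single witness \<open>a\<close>. In the conclusion \<open>\<alpha>\<close> is a neighbourhood of
  the type of \<open>e0\<close> inside the set of good tuples.\<close>

lemma stone_open:
 assumes efo: "extension_property_first_order L T C"
  and \<psi>: "\<psi> \<in> fmlas L (p + q)" and I: "finite I" and \<phi>: "\<And>i. i \<in> I \<Longrightarrow> \<phi> i \<in> fmlas L (p + q + m i)"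
  and e0: "e0 \<in> tup p" and a0: "a0 \<in> tup q" "holds C \<psi> (e0 @ a0)"
  and f0: "\<And>i. i \<in> I \<Longrightarrow> fork (set e0) (m i) (\<phi> i) (e0 @ a0)"
 shows "\<exists>\<alpha>\<in>fmlas L p. holds C \<alpha> e0 \<and> (\<forall>e\<in>tup p. holds C \<alpha> e \<longrightarrow>
  (\<exists>a\<in>tup q. holds C \<psi> (e @ a) \<and> (\<forall>i\<in>I. fork (set e) (m i) (\<phi> i) (e @ a))))"
proof (rule ccontr)
 let ?W = "\<lambda>e. \<exists>a\<in>tup q. holds C \<psi> (e @ a) \<and> (\<forall>i\<in>I. fork (set e) (m i) (\<phi> i) (e @ a))"
 assume neg: "\<not> (\<exists>\<alpha>\<in>fmlas L p. holds C \<alpha> e0 \<and> (\<forall>e\<in>tup p. holds C \<alpha> e \<longrightarrow> ?W e))"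
 have notW: "\<exists>e\<in>tup p. holds C \<alpha> e \<and> \<not> ?W e" if "\<alpha> \<in> fmlas L p" "holds C \<alpha> e0" for \<alpha> using neg that by blast
 obtain \<beta> where \<beta>: "\<beta> \<in> fmlas pl p" "\<And>M P e. is_pair L C M P \<Longrightarrow> e \<in> lists M \<Longrightarrow> length e = p \<Longrightarrow>
  holds (pair_struct C M P) \<beta> e \<longleftrightarrow>
   (\<forall>a\<in>lists M. length a = q \<longrightarrow> holds C \<psi> (e @ a) \<longrightarrow>
    (\<exists>i\<in>I. \<exists>y\<in>lists P. length y = m i \<and> holds C (\<phi> i) (e @ a @ y)))"
  by (rule pair_fm[OF \<psi> I \<phi>]) (assumption, rule that)
 define \<K> where "\<K> = {(M, P, e). is_pair L C M P \<and> extension_property L T C M P \<and> e \<in> lists M \<and> length e = p \<and>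
  holds (pair_struct C M P) \<beta> e}"
 \<comment> \<open>A saturated pair satisfying \<open>\<Sigma>\<close> has the extension property by
   hypothesis and contains a tuple of the type of \<open>e0\<close> for which \<open>\<beta>\<close>
   holds.\<close>
 define \<Sigma> where "\<Sigma> = T_Ext L T C \<union> lift ` {\<alpha>\<in>fmlas L p. holds C \<alpha> e0} \<union> {\<beta>}"
 have lf: "lift \<chi> \<in> fmlas pl p" if "\<chi> \<in> fmlas L p" for \<chi> using that by (simp add: fmlas_def wff_lift fv_lift)
 have hl: "holds (pair_struct C M P) (lift \<alpha>) e \<longleftrightarrow> holds C \<alpha> e"
  if pr: "is_pair L C M P" and e: "e \<in> lists M" "length e = p" and \<alpha>: "\<alpha> \<in> fmlas L p" for M P e \<alpha>
  unfolding holds_def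
 proof (rule pair_sat_lift[OF pr])
  show "wff L \<alpha>" using \<alpha> by (simp add: fmlas_def)
  show "e ! i \<in> M" if "i \<in> fv \<alpha>" for i using \<alpha> that e(2) by (intro lists_nth[OF e(1)]) (auto simp: fmlas_def)
 qed
 have TE: "\<sigma> \<in> fmlas pl 0" if "\<sigma> \<in> T_Ext L T C" for \<sigma> using that by (simp add: T_Ext_def sentences_def)
 have sent: "holds K \<sigma> e \<longleftrightarrow> holds K \<sigma> []" if "\<sigma> \<in> T_Ext L T C" for K :: "('f, 'r option, 'u) struct" and \<sigma> e
  using holds_append[of \<sigma> pl "[]" K e] TE[OF that] by simp
 have "\<exists>M P e. is_pair L C M P \<and> saturated (cardSuc |T| ) pl (pair_struct C M P) \<and>
  e \<in> lists M \<and> length e = p \<and> (\<forall>\<sigma>\<in>\<Sigma>. holds (pair_struct C M P) \<sigma> e)"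
 proof (rule saturated_pair[of \<K>])
  show "is_pair L C M P \<and> e \<in> lists M \<and> length e = p" if "(M, P, e) \<in> \<K>" for M P e using that by (simp add: \<K>_def)
  show "\<Sigma> \<subseteq> fmlas pl p" using lf \<beta>(1) fmlas_mono[OF TE, of _ p] by (auto simp: \<Sigma>_def)
  fix \<Sigma>0 assume \<Sigma>0: "\<Sigma>0 \<subseteq> \<Sigma>" "finite \<Sigma>0"
  let ?S1 = "\<Sigma>0 \<inter> lift ` {\<alpha>\<in>fmlas L p. holds C \<alpha> e0}"
  have "finite ?S1" "?S1 \<subseteq> lift ` {\<alpha>\<in>fmlas L p. holds C \<alpha> e0}" using \<Sigma>0(2) by auto
  then obtain F where F: "F \<subseteq> {\<alpha>\<in>fmlas L p. holds C \<alpha> e0}" "finite F" "?S1 = lift ` F"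
   using finite_subset_image[of ?S1 lift "{\<alpha>\<in>fmlas L p. holds C \<alpha> e0}"] by blast
  have "finite ((\<lambda>\<alpha>. (\<alpha>, [] :: 'u list)) ` F)" using F(2) by simp
  hence "\<exists>c\<in>lists {}. \<exists>\<chi>\<in>fms c p. \<forall>y. length y = p \<longrightarrow>
   (holds C \<chi> (c @ y) \<longleftrightarrow> (\<forall>(\<phi>, c)\<in>(\<lambda>\<alpha>. (\<alpha>, [])) ` F. holds C \<phi> (c @ y)))"
   by (rule fm_conj) (use F(1) in auto)
  then obtain \<chi> where \<chi>: "\<chi> \<in> fmlas L p" "\<forall>y. length y = p \<longrightarrow> (holds C \<chi> y \<longleftrightarrow> (\<forall>\<alpha>\<in>F. holds C \<alpha> y))" by auto
  have "holds C \<chi> e0" using \<chi>(2) e0 F(1) by (auto simp: tuples_def)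
  then obtain e where e: "e \<in> tup p" "holds C \<chi> e" "\<not> ?W e" using notW[OF \<chi>(1)] by blast
  have le: "length e = p" "inC (set e)" using e(1) by (simp_all add: tuples_def)
  \<comment> \<open>Since \<open>e\<close> admits no witness, each \<open>a\<close> leaves some
    \<open>\<phi> i\<close> that does not fork over \<open>e\<close>. Density of the pair over
    \<open>e\<close> realizes it in \<open>P\<close>, which is what \<open>\<beta>\<close>
    says.\<close>
  obtain M P where MP: "set e \<subseteq> P" "is_pair L C M P" "extension_property L T C M P"
   "\<forall>m. \<forall>b\<in>lists M. \<forall>\<phi>\<in>fms b m. \<not> fork (set e) m \<phi> b \<longrightarrow>
    (\<exists>y\<in>lists P. length y = m \<and> holds C \<phi> (b @ y))"
   using dense_pair[OF finite_set le(2)] by (elim exE conjE) (rule that)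
  have PM: "P \<subseteq> M" and MC: "inC M" using is_pairD[OF MP(2)] by auto
  have eM: "e \<in> lists M" using MP(1) PM by (auto simp: lists_eq_set)
  have h\<beta>: "holds (pair_struct C M P) \<beta> e" unfolding \<beta>(2)[OF MP(2) eM le(1)]
  proof (intro ballI impI)
   fix a assume a: "a \<in> lists M" "length a = q" "holds C \<psi> (e @ a)"
   have "a \<in> tup q" using a(1,2) MC by (auto simp: tuples_def lists_eq_set)
   then obtain i where i: "i \<in> I" "\<not> fork (set e) (m i) (\<phi> i) (e @ a)" using e(3) a(3) by blast
   have "e @ a \<in> lists M" "\<phi> i \<in> fmlas L (length (e @ a) + m i)" using eM a \<phi>[OF i(1)] le(1) by auto
   then obtain y where "y \<in> lists P" "length y = m i" "holds C (\<phi> i) ((e @ a) @ y)" using MP(4) i(2) by blast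
   thus "\<exists>i\<in>I. \<exists>y\<in>lists P. length y = m i \<and> holds C (\<phi> i) (e @ a @ y)" using i(1) by (intro bexI[of _ i] bexI[of _ y]) simp_all
  qed
  have K: "(M, P, e) \<in> \<K>" using MP(2,3) eM le(1) h\<beta> by (simp add: \<K>_def)
  have "holds (pair_struct C M P) \<sigma> e" if \<sigma>: "\<sigma> \<in> \<Sigma>0" for \<sigma>
  proof -
   consider "\<sigma> \<in> T_Ext L T C" | "\<sigma> \<in> ?S1" | "\<sigma> = \<beta>" using \<Sigma>0(1) \<sigma> by (auto simp: \<Sigma>_def)
   thus ?thesis
   proof cases
    case 1
    hence "\<sigma> \<in> theory_of pl (pair_struct C M P)" using MP(2,3) unfolding T_Ext_def by blast
    hence "holds (pair_struct C M P) \<sigma> []" by (simp add: theory_of_def)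
    thus ?thesis by (rule iffD2[OF sent[OF 1]])
   next
    case 2
    then obtain \<alpha> where \<alpha>: "\<alpha> \<in> F" "\<sigma> = lift \<alpha>" using F(3) by auto
    have "holds C \<alpha> e" using \<chi>(2) e(2) le(1) \<alpha>(1) by blast
    thus ?thesis using hl[OF MP(2) eM le(1)] \<alpha> F(1) by blast
   next
    case 3 thus ?thesis using h\<beta> by simp
   qed
  qed
  thus "\<exists>(M, P, e)\<in>\<K>. \<forall>\<sigma>\<in>\<Sigma>0. holds (pair_struct C M P) \<sigma> e" using K by blast
 qed
 then obtain M P e where pr: "is_pair L C M P" and sat: "saturated (cardSuc |T| ) pl (pair_struct C M P)"
  and e: "e \<in> lists M" "length e = p" and h: "\<forall>\<sigma>\<in>\<Sigma>. holds (pair_struct C M P) \<sigma> e" by (elim exE conjE) (rule that)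
 have PM: "P \<subseteq> M" and MC: "inC M" using is_pairD[OF pr] by auto
 have "models (pair_struct C M P) (T_Ext L T C)" unfolding models_def
 proof
  fix \<sigma> assume \<sigma>: "\<sigma> \<in> T_Ext L T C"
  hence "holds (pair_struct C M P) \<sigma> e" using h by (simp add: \<Sigma>_def)
  thus "holds (pair_struct C M P) \<sigma> []" using sent[OF \<sigma>] by blast
 qed
 hence EP: "extension_property L T C M P" using efo pr sat unfolding extension_property_first_order_def by blast
 have l0: "length e0 = p" "e0 \<in> lists (dom C)" using e0 by (auto simp: tuples_def lists_eq_set)
 have eC: "e \<in> lists (dom C)" using e(1) MC by (auto simp: lists_eq_set)
 have eS: "inC (set e)" "small (set e)" "set e \<subseteq> M" using eC e(1) small_finite by (auto simp: lists_eq_set)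
 have e0S: "inC (set e0)" "small (set e0)" using l0 small_finite by (auto simp: lists_eq_set)
 have "tp L C {} e = tp L C {} e0"
 proof (rule tp_eqI)
  fix \<phi> c assume c: "c \<in> lists {}" "\<phi> \<in> fmlas L (length c + length e0)" "holds C \<phi> (c @ e0)"
  hence "lift \<phi> \<in> \<Sigma>" "\<phi> \<in> fmlas L p" using l0 by (auto simp: \<Sigma>_def)
  hence "holds C \<phi> e" using h hl[OF pr e] by blast
  thus "holds C \<phi> (c @ e)" using c(1) by simp
 qed (use e l0 in simp)
 \<comment> \<open>\<open>k\<close> carries \<open>e0\<close> to \<open>e\<close> and thus
   \<open>a0\<close> to a witness for \<open>e\<close>; then \<open>g\<close> moves this witness
   into \<open>M\<close>, independently from \<open>P\<close>.\<close>
 then obtain k where k: "k \<in> auts {}" "map k e0 = e" using tp_aut[of "{}" e0 e] l0 eC e(2) small_finite by auto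
 let ?x = "map k a0"
 have la: "length a0 = q" "a0 \<in> lists (dom C)" using a0(1) by (auto simp: tuples_def lists_eq_set)
 have xt: "?x \<in> tup q" by (rule auts_tup[OF k(1) a0(1)])
 obtain g where g: "g \<in> auts (set e)" "map g ?x \<in> lists M" "ind (g ` set ?x) (set e) P"
  by (rule extension_property_tuple[OF pr EP finite_set eS(3) xt]) (rule that)
 define h where "h = g \<circ> k"
 have hA: "h \<in> auts {}" unfolding h_def by (rule auts_comp[OF auts_empty[OF g(1)] k(1)])
 have he: "map h e0 = e"
 proof -
  have "map h e0 = map g (map k e0)" by (simp add: h_def)
  also have "\<dots> = e" unfolding k(2) by (rule auts_fix[OF g(1)]) (simp add: lists_eq_set)
  finally show ?thesis .
 qed
 let ?a = "map h a0"
 have ha: "?a = map g ?x" by (simp add: h_def)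
 have aM: "?a \<in> lists M" "length ?a = q" using g(2) la(1) unfolding ha by simp_all
 have ea: "e @ ?a = map h (e0 @ a0)" using he by simp
 have c0: "e0 @ a0 \<in> lists (dom C)" "length (e0 @ a0) = p + q" using l0 la by simp_all
 have "holds C \<psi> (e @ ?a)" unfolding ea using aut_holds[OF hA _ c0(1)] \<psi> c0(2) a0(2) by simp
 moreover have "holds (pair_struct C M P) \<beta> e" using h by (simp add: \<Sigma>_def)
 \<comment> \<open>A tuple of \<open>P\<close> satisfies a formula over \<open>e\<close> and
   \<open>?a\<close> that forks over \<open>e\<close>, whereas by symmetry \<open>P\<close> is
   independent from \<open>?a\<close> over \<open>e\<close>.\<close>
 ultimately obtain i y where iy: "i \<in> I" "y \<in> lists P" "length y = m i" "holds C (\<phi> i) (e @ ?a @ y)"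
  using \<beta>(2)[OF pr e] aM by blast
 have \<phi>i: "\<phi> i \<in> fmlas L (length (e0 @ a0) + m i)" using \<phi>[OF iy(1)] c0(2) by simp
 obtain d where "kdiv (set e0) (m i) d (\<phi> i) (e0 @ a0)" using forkset_kdiv[OF e0S c0(1) \<phi>i f0[OF iy(1)]] by blast
 hence "kdiv (h ` set e0) (m i) d (\<phi> i) (map h (e0 @ a0))" by (rule kdiv_aut[OF _ hA e0S(1) c0(1) \<phi>i])
 moreover have "h ` set e0 = set e" using he by (metis set_map)
 ultimately have "kdiv (set e) (m i) d (\<phi> i) (e @ ?a)" unfolding ea by simp
 hence fk: "fork (set e) (m i) (\<phi> i) (e @ ?a)"
  by (rule kdiv_forkset) (use eC aM MC \<phi>i c0(2) e(2) la in \<open>auto simp: lists_eq_set\<close>)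
 have sx: "g ` set ?x = set ?a" unfolding ha set_map ..
 have aC: "inC (set ?a)" using aM(1) MC by (auto simp: lists_eq_set)
 have "ind (set ?a) (set e) P" using g(3) unfolding sx .
 hence "ind P (set e) (set ?a)" by (rule ind_sym[OF eS(1,2) aC order_trans[OF PM MC]])
 moreover have "e @ ?a \<in> lists (set e \<union> set ?a)" by (auto simp: lists_eq_set)
 moreover have "\<phi> i \<in> fmlas L (length (e @ ?a) + length y)" using \<phi>i c0(2) e(2) la iy(3) by simp
 moreover have "holds C (\<phi> i) ((e @ ?a) @ y)" using iy(4) by simp
 ultimately have "\<not> fork (set e) (length y) (\<phi> i) (e @ ?a)" using iy(2) unfolding ind_def by blast
 thus False using fk iy(3) by simp
qed

end

section \<open>Elimination of quantifiers from \<open>\<tau>\<close>-tilde sets\<close>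

lemma map_nth_seg: "i = length xs \<Longrightarrow> j = i + length ys \<Longrightarrow> map (nth (xs @ ys @ zs)) [i..<j] = ys"
 by (auto intro!: nth_equalityI simp: nth_append)

lemma tuple_seqs_snoc: "zs \<in> tuple_seqs C (rs @ [r]) \<longleftrightarrow> (\<exists>zs' z. zs = zs' @ [z] \<and> zs' \<in> tuple_seqs C rs \<and> z \<in> tuples C r)"
proof
 assume "zs \<in> tuple_seqs C (rs @ [r])"
 thus "\<exists>zs' z. zs = zs' @ [z] \<and> zs' \<in> tuple_seqs C rs \<and> z \<in> tuples C r"
  by (auto simp: tuple_seqs_def list_all2_append2 list_all2_Cons2)
next
 assume "\<exists>zs' z. zs = zs' @ [z] \<and> zs' \<in> tuple_seqs C rs \<and> z \<in> tuples C r"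
 thus "zs \<in> tuple_seqs C (rs @ [r])"
  by (elim exE conjE) (simp add: tuple_seqs_def list_all2_appendI)
qed

lemma tuple_seqs_Cons: "zs \<in> tuple_seqs C (r # rs) \<longleftrightarrow> (\<exists>z zs'. zs = z # zs' \<and> z \<in> tuples C r \<and> zs' \<in> tuple_seqs C rs)"
 by (auto simp: tuple_seqs_def list_all2_Cons2)

lemma tuple_seqs_Nil: "zs \<in> tuple_seqs C [] \<longleftrightarrow> zs = []"
 by (simp add: tuple_seqs_def)

lemma tuple_seqs_length: "zs \<in> tuple_seqs C rs \<Longrightarrow> length zs = length rs"
 by (simp add: tuple_seqs_def list_all2_lengthD)

lemma tuple_seqs_concat: "zs \<in> tuple_seqs C rs \<Longrightarrow> concat zs \<in> tuples C (sum_list rs)"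
proof (induction rs arbitrary: zs)
 case (Cons r rs)
 then obtain z zs' where "zs = z # zs'" "z \<in> tuples C r" "zs' \<in> tuple_seqs C rs" by (auto simp: tuple_seqs_Cons)
 thus ?case using Cons.IH[of zs'] by (simp add: tuples_def)
qed (simp add: tuple_seqs_Nil tuples_def)

lemma tuple_seqs_split: "w \<in> tuples C (sum_list rs) \<Longrightarrow> \<exists>zs\<in>tuple_seqs C rs. concat zs = w"
proof (induction rs arbitrary: w)
 case (Cons r rs)
 have "drop r w \<in> tuples C (sum_list rs)" "take r w \<in> tuples C r"
  using Cons.prems set_take_subset[of r w] set_drop_subset[of r w] by (auto simp: tuples_def)
 then obtain zs where "zs \<in> tuple_seqs C rs" "concat zs = drop r w" using Cons.IH by blast
 thus ?case using \<open>take r w \<in> tuples C r\<close> by (intro bexI[of _ "take r w # zs"]) (simp_all add: tuple_seqs_Cons)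
qed (simp add: tuple_seqs_Nil tuples_def)

lemma tuple_seqs_append: "zs \<in> tuple_seqs C rs \<Longrightarrow> zs' \<in> tuple_seqs C rs' \<Longrightarrow> zs @ zs' \<in> tuple_seqs C (rs @ rs')"
 by (simp add: tuple_seqs_def list_all2_appendI)

lemma tuple_seqs_take: "zs \<in> tuple_seqs C rs \<Longrightarrow> take i zs \<in> tuple_seqs C (take i rs)"
 and tuple_seqs_drop: "zs \<in> tuple_seqs C rs \<Longrightarrow> drop i zs \<in> tuple_seqs C (drop i rs)"
 by (simp_all add: tuple_seqs_def list_all2_takeI list_all2_dropI)

lemma tuple_seqs_concat_take:
 assumes "zs \<in> tuple_seqs C rs"
 shows "concat (take i zs) = take (sum_list (take i rs)) (concat zs)"
proof -
 have "length (concat (take i zs)) = sum_list (take i rs)"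
  using tuple_seqs_concat[OF tuple_seqs_take[OF assms]] by (simp add: tuples_def)
 moreover have "concat zs = concat (take i zs) @ concat (drop i zs)" by (metis append_take_drop_id concat_append)
 ultimately show ?thesis by simp
qed

lemma tauf_open_UN: "(\<And>q. q \<in> Q \<Longrightarrow> tauf_open L C A n (U q)) \<Longrightarrow> tauf_open L C A n (\<Union>q\<in>Q. U q)"
proof -
 assume U: "\<And>q. q \<in> Q \<Longrightarrow> tauf_open L C A n (U q)"
 let ?B = "{B. basic_tauf_open L C A n B \<and> (\<exists>q\<in>Q. B \<subseteq> U q)}"
 have "(\<Union>q\<in>Q. U q) \<subseteq> \<Union>?B"
 proof
  fix x assume "x \<in> (\<Union>q\<in>Q. U q)"
  then obtain q where q: "q \<in> Q" "x \<in> U q" by blast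
  from U[OF q(1)] obtain \<B> where "\<forall>B\<in>\<B>. basic_tauf_open L C A n B" "U q = \<Union>\<B>" unfolding tauf_open_def by blast
  thus "x \<in> \<Union>?B" using q by blast
 qed
 hence "(\<Union>q\<in>Q. U q) = \<Union>?B" by blast
 thus ?thesis unfolding tauf_open_def by (intro exI[of _ ?B] conjI ballI) simp_all
qed

context monster
begin

lemma fm_perm:
 assumes "\<phi> \<in> fmlas L (length ks)" "set ks \<subseteq> {..<p}"
 obtains \<phi>' where "\<phi>' \<in> fmlas L p" "\<And>xs. length xs = p \<Longrightarrow> holds C \<phi>' xs \<longleftrightarrow> holds C \<phi> (map (nth xs) ks)"
proof -
 have "dfn L {..<p} (\<lambda>(M :: ('f, 'r, 'u) struct) a. holds M \<phi> (map a ks))" by (rule dfn_holds[OF assms])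
 then obtain \<phi>' where "\<phi>' \<in> fmlas L p"
  "\<And>(M :: ('f, 'r, 'u) struct) xs. length xs = p \<Longrightarrow> holds M \<phi>' xs \<longleftrightarrow> holds M \<phi> (map (nth xs) ks)"
  by (rule fm_exists) (rule that)
 thus thesis by (rule that)
qed

lemma fm_top_bot:
 obtains \<tau> \<beta> where "\<tau> \<in> fmlas L 0" "\<beta> \<in> fmlas L 0" "\<And>xs. holds C \<tau> xs" "\<And>xs. \<not> holds C \<beta> xs"
proof -
 have "dfn L {..<0} (\<lambda>(M :: ('f, 'r, 'u) struct) (a :: nat \<Rightarrow> 'u). True)" by (rule dfn_const)
 then obtain \<tau> where \<tau>: "\<tau> \<in> fmlas L 0" "\<And>(M :: ('f, 'r, 'u) struct) xs. length xs = 0 \<Longrightarrow> holds M \<tau> xs \<longleftrightarrow> True"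
  by (rule fm_exists) (rule that)
 have h: "holds C \<tau> xs" for xs using holds_append[of \<tau> L "[]" C xs] \<tau> by simp
 show thesis by (rule that[OF \<tau>(1), of "Neg \<tau>"]) (use \<tau>(1) h in \<open>simp_all add: fmlas_Neg holds_Neg\<close>)
qed

text \<open>Turns the remainder left by \<open>forkset_shift\<close> back into a formula, as
  \<open>stone_open\<close> requires.\<close>

lemma diff_fm:
 assumes "\<phi> \<in> fmlas L (p + q + m)" "\<chi> \<in> fmlas L (p + m)"
 shows "\<exists>\<delta>\<in>fmlas L (p + q + m). \<forall>e\<in>tup p. \<forall>a\<in>tup q. sols m \<delta> (e @ a) = sols m \<phi> (e @ a) - sols m \<chi> e"
proof -
 let ?ks = "[0..<p] @ [p + q..<p + q + m]"
 have ks: "\<chi> \<in> fmlas L (length ?ks)" "set ?ks \<subseteq> {..<p + q + m}" using assms(2) by auto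
 obtain \<chi>' where \<chi>': "\<chi>' \<in> fmlas L (p + q + m)" "\<And>xs. length xs = p + q + m \<Longrightarrow> holds C \<chi>' xs \<longleftrightarrow> holds C \<chi> (map (nth xs) ?ks)"
  by (rule fm_perm[OF ks]) (rule that)
 show ?thesis
 proof (intro bexI[of _ "And \<phi> (Neg \<chi>')"] ballI)
  fix e a assume ea: "e \<in> tup p" "a \<in> tup q"
  have "holds C \<chi>' (e @ a @ y) \<longleftrightarrow> holds C \<chi> (e @ y)" if "y \<in> tup m" for y
  proof -
   have "map (nth (e @ a @ y)) [0..<p] = e" using map_nth_seg[of 0 "[]" p e "a @ y"] ea by (simp add: tuples_def)
   moreover have "map (nth (e @ a @ y)) [p + q..<p + q + m] = y"
    using map_nth_seg[of "p + q" "e @ a" "p + q + m" y "[]"] ea that by (simp add: tuples_def)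
   ultimately show ?thesis using \<chi>'(2)[of "e @ a @ y"] ea that by (simp add: tuples_def)
  qed
  thus "sols m (And \<phi> (Neg \<chi>')) (e @ a) = sols m \<phi> (e @ a) - sols m \<chi> e"
   by (auto simp: sols_def holds_And holds_Neg)
 qed (use assms(1) \<chi>'(1) in \<open>simp add: fmlas_And fmlas_Neg\<close>)
qed

text \<open>Chains of forking conditions over the growing tuples \<open>b, b z\<^sub>1, b z\<^sub>1 z\<^sub>2, \<dots>\<close>: the \<open>i\<close>th condition is
 imposed over the initial segment of length \<open>lv i\<close>.\<close>

definition wit :: "'u list \<Rightarrow> nat \<Rightarrow> ('f, 'r) fm \<Rightarrow> nat set \<Rightarrow> (nat \<Rightarrow> nat) \<Rightarrow> (nat \<Rightarrow> nat) \<Rightarrow> (nat \<Rightarrow> ('f, 'r) fm) \<Rightarrow> 'u list list \<Rightarrow> bool" where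
 "wit b k \<theta> I lv m \<phi> zs \<longleftrightarrow> (\<exists>a\<in>tup k. holds C \<theta> (b @ concat zs @ a) \<and>
   (\<forall>i\<in>I. fork (set (b @ concat (take (lv i) zs))) (m i) (\<phi> i) (b @ concat zs @ a)))"

definition wit_fmlas :: "nat \<Rightarrow> nat list \<Rightarrow> nat \<Rightarrow> ('f, 'r) fm \<Rightarrow> nat set \<Rightarrow> (nat \<Rightarrow> nat) \<Rightarrow> (nat \<Rightarrow> nat) \<Rightarrow> (nat \<Rightarrow> ('f, 'r) fm) \<Rightarrow> bool" where
 "wit_fmlas l rs k \<theta> I lv m \<phi> \<longleftrightarrow> finite I \<and> \<theta> \<in> fmlas L (l + sum_list rs + k) \<and>
   (\<forall>i\<in>I. lv i \<le> length rs \<and> \<phi> i \<in> fmlas L (l + sum_list rs + k + m i))"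

text \<open>The witness \<open>a\<close> is eliminated. For a base shorter than the full tuple, the
  shift splits \<open>\<phi> i\<close> into \<open>\<chi> i\<close>, which does not mention
  \<open>a\<close> and keeps its base, and a remainder that forks over the full tuple. The
  remainders and the conditions over the full tuple have one common base, so
  \<open>stone_open\<close> turns the existence of \<open>a\<close> into a formula
  \<open>\<alpha>\<close>.\<close>

lemma wit_reduce:
 assumes efo: "extension_property_first_order L T C" and b: "b \<in> lists (dom C)"
  and ok: "wit_fmlas (length b) rs k \<theta> I lv m \<phi>"
 obtains Q where
  "\<And>\<alpha> \<chi>. (\<alpha>, \<chi>) \<in> Q \<Longrightarrow> \<alpha> \<in> fmlas L (length b + sum_list rs)"
  "\<And>\<alpha> \<chi> i. (\<alpha>, \<chi>) \<in> Q \<Longrightarrow> i \<in> I \<Longrightarrow> lv i < length rs \<Longrightarrow> \<chi> i \<in> fmlas L (length b + sum_list rs + m i)"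
  "\<And>zs. zs \<in> tuple_seqs C rs \<Longrightarrow> wit b k \<theta> I lv m \<phi> zs \<longleftrightarrow>
   (\<exists>(\<alpha>, \<chi>)\<in>Q. holds C \<alpha> (b @ concat zs) \<and> (\<forall>i\<in>{i\<in>I. lv i < length rs}.
     fork (set (b @ concat (take (lv i) zs))) (m i) (\<chi> i) (b @ concat zs)))"
proof -
 define p where "p = length b + sum_list rs"
 have I: "finite I" and \<theta>: "\<theta> \<in> fmlas L (p + k)" and lv: "\<And>i. i \<in> I \<Longrightarrow> lv i \<le> length rs"
  and \<phi>: "\<And>i. i \<in> I \<Longrightarrow> \<phi> i \<in> fmlas L (p + k + m i)"
  using ok by (simp_all add: wit_fmlas_def p_def)
 define D where "D \<chi> e a i = sols (m i) (\<phi> i) (e @ a) - (if lv i < length rs then sols (m i) (\<chi> i) e else {})" for \<chi> e a i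
 \<comment> \<open>All pairs for which \<open>\<alpha>(e)\<close> guarantees a witness, uniformly in
   \<open>e\<close>. Soundness is thus built in; that every actual witness is accounted for by some
   member of \<open>Q\<close> needs \<open>stone_open\<close>.\<close>
 define Q where "Q = {(\<alpha>, \<chi>). \<alpha> \<in> fmlas L p \<and> (\<forall>i\<in>I. lv i < length rs \<longrightarrow> \<chi> i \<in> fmlas L (p + m i)) \<and>
  (\<forall>e\<in>tup p. holds C \<alpha> e \<longrightarrow> (\<exists>a\<in>tup k. holds C \<theta> (e @ a) \<and> (\<forall>i\<in>I. forkset (set e) (m i) (D \<chi> e a i))))}"
 have e: "b @ concat zs \<in> tup p" "set (b @ concat (take j zs)) \<subseteq> set (b @ concat zs)"
  if "zs \<in> tuple_seqs C rs" for zs j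
 proof -
  show "b @ concat zs \<in> tup p" using tuple_seqs_concat[OF that] b by (simp add: tuples_def p_def lists_eq_set)
  show "set (b @ concat (take j zs)) \<subseteq> set (b @ concat zs)" using set_take_subset[of j zs] by auto
 qed
 show thesis
 proof (rule that[of Q])
  show "\<alpha> \<in> fmlas L (length b + sum_list rs)" if "(\<alpha>, \<chi>) \<in> Q" for \<alpha> \<chi> using that by (simp add: Q_def p_def)
  show "\<chi> i \<in> fmlas L (length b + sum_list rs + m i)" if "(\<alpha>, \<chi>) \<in> Q" "i \<in> I" "lv i < length rs" for \<alpha> \<chi> i
   using that by (simp add: Q_def p_def)
  fix zs assume zs: "zs \<in> tuple_seqs C rs"
  let ?e = "b @ concat zs"
  let ?A = "\<lambda>i. set (b @ concat (take (lv i) zs))"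
  have et: "?e \<in> tup p" by (rule e(1)[OF zs])
  have eC: "?e \<in> lists (dom C)" "length ?e = p" using et by (simp_all add: tuples_def lists_eq_set)
  show "wit b k \<theta> I lv m \<phi> zs \<longleftrightarrow> (\<exists>(\<alpha>, \<chi>)\<in>Q. holds C \<alpha> ?e \<and> (\<forall>i\<in>{i\<in>I. lv i < length rs}.
     fork (?A i) (m i) (\<chi> i) ?e))"
  proof
   assume "wit b k \<theta> I lv m \<phi> zs"
   then obtain a where a: "a \<in> tup k" "holds C \<theta> (?e @ a)"
    "\<And>i. i \<in> I \<Longrightarrow> fork (?A i) (m i) (\<phi> i) (?e @ a)"
    unfolding wit_def by auto
   have aC: "a \<in> lists (dom C)" "length (?e @ a) = p + k" using a(1) eC(2) by (simp_all add: tuples_def lists_eq_set)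
   have "\<forall>i\<in>{i\<in>I. lv i < length rs}. \<exists>\<chi>. \<chi> \<in> fmlas L (p + m i) \<and> fork (?A i) (m i) \<chi> ?e \<and>
     forkset (set ?e) (m i) (sols (m i) (\<phi> i) (?e @ a) - sols (m i) \<chi> ?e)"
   proof
    fix i assume i: "i \<in> {i\<in>I. lv i < length rs}"
    have "\<phi> i \<in> fmlas L (length (?e @ a) + m i)" using \<phi> i aC(2) by simp
    from forkset_shift[OF eC(1) e(2)[OF zs] aC(1) this a(3)] i eC(2)
    show "\<exists>\<chi>. \<chi> \<in> fmlas L (p + m i) \<and> fork (?A i) (m i) \<chi> ?e \<and>
     forkset (set ?e) (m i) (sols (m i) (\<phi> i) (?e @ a) - sols (m i) \<chi> ?e)" by auto
   qed
   from bchoice[OF this] obtain \<chi> where \<chi>: "\<forall>i\<in>{i\<in>I. lv i < length rs}. \<chi> i \<in> fmlas L (p + m i) \<and>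
    fork (?A i) (m i) (\<chi> i) ?e \<and> forkset (set ?e) (m i) (sols (m i) (\<phi> i) (?e @ a) - sols (m i) (\<chi> i) ?e)" ..
   have "\<forall>i\<in>I. \<exists>\<delta>. \<delta> \<in> fmlas L (p + k + m i) \<and> (\<forall>e\<in>tup p. \<forall>a\<in>tup k. sols (m i) \<delta> (e @ a) = D \<chi> e a i)"
   proof
    fix i assume i: "i \<in> I"
    show "\<exists>\<delta>. \<delta> \<in> fmlas L (p + k + m i) \<and> (\<forall>e\<in>tup p. \<forall>a\<in>tup k. sols (m i) \<delta> (e @ a) = D \<chi> e a i)"
    proof (cases "lv i < length rs")
     case True
     hence "\<chi> i \<in> fmlas L (p + m i)" using \<chi> i by blast
     from diff_fm[OF \<phi>[OF i] this] True show ?thesis by (auto simp: D_def)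
    next
     case False
     thus ?thesis using \<phi>[OF i] by (intro exI[of _ "\<phi> i"]) (simp add: D_def)
    qed
   qed
   from bchoice[OF this] obtain \<delta> where \<delta>: "\<forall>i\<in>I. \<delta> i \<in> fmlas L (p + k + m i) \<and>
    (\<forall>e\<in>tup p. \<forall>a\<in>tup k. sols (m i) (\<delta> i) (e @ a) = D \<chi> e a i)" ..
   have \<delta>1: "\<delta> i \<in> fmlas L (p + k + m i)" if "i \<in> I" for i using \<delta> that by blast
   have \<delta>2: "sols (m i) (\<delta> i) (e @ a) = D \<chi> e a i" if "i \<in> I" "e \<in> tup p" "a \<in> tup k" for i e a using \<delta> that by blast
   have f\<delta>: "fork (set ?e) (m i) (\<delta> i) (?e @ a)" if i: "i \<in> I" for i
   proof (cases "lv i < length rs")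
    case True
    hence "forkset (set ?e) (m i) (sols (m i) (\<phi> i) (?e @ a) - sols (m i) (\<chi> i) ?e)" using \<chi> i by blast
    thus ?thesis unfolding \<delta>2[OF i et a(1)] D_def using True by simp
   next
    case False
    hence "take (lv i) zs = zs" using lv[OF i] tuple_seqs_length[OF zs] by simp
    thus ?thesis unfolding \<delta>2[OF i et a(1)] D_def using False a(3)[OF i] by simp
   qed
   have "\<exists>\<alpha>\<in>fmlas L p. holds C \<alpha> ?e \<and> (\<forall>e\<in>tup p. holds C \<alpha> e \<longrightarrow>
    (\<exists>a\<in>tup k. holds C \<theta> (e @ a) \<and> (\<forall>i\<in>I. fork (set e) (m i) (\<delta> i) (e @ a))))"
    by (rule stone_open[OF efo \<theta> I _ et a(1,2)]) (erule \<delta>1, erule f\<delta>)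
   then obtain \<alpha> where \<alpha>: "\<alpha> \<in> fmlas L p" "holds C \<alpha> ?e"
    "\<forall>e\<in>tup p. holds C \<alpha> e \<longrightarrow> (\<exists>a\<in>tup k. holds C \<theta> (e @ a) \<and> (\<forall>i\<in>I. fork (set e) (m i) (\<delta> i) (e @ a)))"
    by blast
   have "(\<alpha>, \<chi>) \<in> Q" unfolding Q_def mem_Collect_eq prod.case
   proof (intro conjI ballI impI)
    fix e assume ep: "e \<in> tup p" "holds C \<alpha> e"
    then obtain a where a: "a \<in> tup k" "holds C \<theta> (e @ a)" "\<forall>i\<in>I. fork (set e) (m i) (\<delta> i) (e @ a)"
     using \<alpha>(3) by blast
    hence "\<forall>i\<in>I. forkset (set e) (m i) (D \<chi> e a i)" using \<delta>2[OF _ ep(1) a(1)] by simp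
    thus "\<exists>a\<in>tup k. holds C \<theta> (e @ a) \<and> (\<forall>i\<in>I. forkset (set e) (m i) (D \<chi> e a i))" using a by blast
   qed (use \<alpha>(1) \<chi> in auto)
   moreover have "\<forall>i\<in>{i\<in>I. lv i < length rs}. fork (?A i) (m i) (\<chi> i) ?e" using \<chi> by blast
   ultimately show "\<exists>(\<alpha>, \<chi>)\<in>Q. holds C \<alpha> ?e \<and> (\<forall>i\<in>{i\<in>I. lv i < length rs}.
     fork (?A i) (m i) (\<chi> i) ?e)" using \<alpha>(2) by (intro bexI[of _ "(\<alpha>, \<chi>)"]) auto
  next
   assume "\<exists>(\<alpha>, \<chi>)\<in>Q. holds C \<alpha> ?e \<and> (\<forall>i\<in>{i\<in>I. lv i < length rs}.
     fork (?A i) (m i) (\<chi> i) ?e)"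
   then obtain \<alpha> \<chi> where q: "(\<alpha>, \<chi>) \<in> Q" "holds C \<alpha> ?e"
    and fk: "\<And>i. i \<in> I \<Longrightarrow> lv i < length rs \<Longrightarrow> fork (?A i) (m i) (\<chi> i) ?e" by auto
   from q(1) have "\<forall>e\<in>tup p. holds C \<alpha> e \<longrightarrow> (\<exists>a\<in>tup k. holds C \<theta> (e @ a) \<and> (\<forall>i\<in>I. forkset (set e) (m i) (D \<chi> e a i)))"
    unfolding Q_def by simp
   then obtain a where a: "a \<in> tup k" "holds C \<theta> (?e @ a)" "\<And>i. i \<in> I \<Longrightarrow> forkset (set ?e) (m i) (D \<chi> ?e a i)"
    using et q(2) by blast
   have "fork (?A i) (m i) (\<phi> i) (?e @ a)" if i: "i \<in> I" for i
   proof (cases "lv i < length rs")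
    case True
    hence "forkset (set ?e) (m i) (sols (m i) (\<phi> i) (?e @ a) - sols (m i) (\<chi> i) ?e)" using a(3)[OF i] by (simp add: D_def)
    thus ?thesis by (rule forkset_unshift[OF fk[OF i True] _ e(2)[OF zs]])
   next
    case False
    hence "take (lv i) zs = zs" using lv[OF i] tuple_seqs_length[OF zs] by simp
    thus ?thesis using a(3)[OF i] False by (simp add: D_def)
   qed
   thus "wit b k \<theta> I lv m \<phi> zs" unfolding wit_def using a(1,2) by (intro bexI[of _ a]) auto
  qed
 qed
qed

lemma forkset_tup: "A \<subseteq> dom C \<Longrightarrow> \<not> forkset A m (tup m)"
proof -
 assume A: "inC A"
 obtain \<tau> \<beta> where \<tau>: "\<tau> \<in> fmlas L 0" "\<beta> \<in> fmlas L 0" "\<And>xs. holds C \<tau> xs" "\<And>xs. \<not> holds C \<beta> xs" by (rule fm_top_bot) (rule that)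
 have "sols m \<tau> [] = tup m" using \<tau>(3) by (simp add: sols_def)
 moreover have "\<not> fork A m \<tau> []"
  by (rule existence[OF A]) (use \<tau> tup_nonempty[of m] fmlas_mono[OF \<tau>(1), of m] in \<open>auto simp: sols_def\<close>)
 ultimately show ?thesis by simp
qed

lemma forkset_map:
 assumes "forkset A n Z" "set js \<subseteq> {..<m}" "length js = n" "inC A"
  "\<And>y. y \<in> Y \<Longrightarrow> y \<in> tup m \<and> map (nth y) js \<in> Z"
 shows "forkset A m Y"
proof -
 have "forkset A m {y\<in>tup m. map (case_sum (nth y) id) (map Inl js) \<in> Z}"
  by (rule forkset_pullback[OF assms(1)]) (use assms(2,3,4) in auto)
 thus ?thesis by (rule forkset_mono) (use assms(5) in \<open>auto simp: comp_def\<close>)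
qed

text \<open>The formula is a disjunction in disjoint variables. Its solution set is the union of two
  preimages under projections, so it forks if both disjuncts do; conversely each disjunct embeds
  into it by padding a solution to full length.\<close>

lemma fork_conj2:
 assumes \<phi>1: "\<phi>1 \<in> fmlas L (p + m1)" and \<phi>2: "\<phi>2 \<in> fmlas L (p + m2)"
 shows "\<exists>\<phi>\<in>fmlas L (p + (m1 + m2)). \<forall>e\<in>tup p. \<forall>A. A \<subseteq> dom C \<longrightarrow>
  (fork A (m1 + m2) \<phi> e \<longleftrightarrow> fork A m1 \<phi>1 e \<and> fork A m2 \<phi>2 e)"
proof -
 let ?ks = "[0..<p] @ [p + m1..<p + m1 + m2]"
 have ks: "\<phi>2 \<in> fmlas L (length ?ks)" "set ?ks \<subseteq> {..<p + (m1 + m2)}" using \<phi>2 by auto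
 obtain \<phi>2' where \<phi>2': "\<phi>2' \<in> fmlas L (p + (m1 + m2))"
  "\<And>xs. length xs = p + (m1 + m2) \<Longrightarrow> holds C \<phi>2' xs \<longleftrightarrow> holds C \<phi>2 (map (nth xs) ?ks)"
  by (rule fm_perm[OF ks]) (rule that)
 let ?\<phi> = "Neg (And (Neg \<phi>1) (Neg \<phi>2'))"
 have \<phi>1': "\<phi>1 \<in> fmlas L (p + (m1 + m2))" by (rule fmlas_mono[OF \<phi>1]) simp
 show ?thesis
 proof (intro bexI[of _ ?\<phi>] ballI allI impI)
  fix e A assume e: "e \<in> tup p" and A: "inC A"
  have le: "length e = p" using e by (simp add: tuples_def)
  have h: "holds C ?\<phi> (e @ y1 @ y2) \<longleftrightarrow> holds C \<phi>1 (e @ y1) \<or> holds C \<phi>2 (e @ y2)"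
   if "y1 \<in> tup m1" "y2 \<in> tup m2" for y1 y2
  proof -
   have l: "length y1 = m1" "length y2 = m2" using that by (simp_all add: tuples_def)
   have "map (nth (e @ y1 @ y2)) [0..<p] = e" using map_nth_seg[of 0 "[]" p e "y1 @ y2"] le by simp
   moreover have "map (nth (e @ y1 @ y2)) [p + m1..<p + m1 + m2] = y2"
    using map_nth_seg[of "p + m1" "e @ y1" "p + m1 + m2" y2 "[]"] le l by simp
   ultimately have "holds C \<phi>2' (e @ y1 @ y2) \<longleftrightarrow> holds C \<phi>2 (e @ y2)" using \<phi>2'(2)[of "e @ y1 @ y2"] le l by simp
   moreover have "holds C \<phi>1 ((e @ y1) @ y2) \<longleftrightarrow> holds C \<phi>1 (e @ y1)" by (rule holds_append) (use \<phi>1 le l in simp)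
   ultimately show ?thesis by (simp add: holds_And holds_Neg)
  qed
  let ?Z = "sols (m1 + m2) ?\<phi> e"
  have Z: "y1 @ y2 \<in> ?Z \<longleftrightarrow> y1 \<in> sols m1 \<phi>1 e \<or> y2 \<in> sols m2 \<phi>2 e" if "y1 \<in> tup m1" "y2 \<in> tup m2" for y1 y2
   using h[OF that] that by (auto simp: sols_def tuples_def)
  \<comment> \<open>Padding repeats a coordinate, which an empty tuple lacks. In that case a tuple
    outside \<open>?Z\<close> shows that the disjunct has no solution at all.\<close>
  have allZ: "forkset A (m1 + m2) ?Z \<Longrightarrow> \<exists>y1\<in>tup m1. \<exists>y2\<in>tup m2. y1 @ y2 \<notin> ?Z"
  proof (rule ccontr)
   assume f: "forkset A (m1 + m2) ?Z" and n: "\<not> (\<exists>y1\<in>tup m1. \<exists>y2\<in>tup m2. y1 @ y2 \<notin> ?Z)"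
   have "tup (m1 + m2) \<subseteq> ?Z"
   proof
    fix y assume "y \<in> tup (m1 + m2)"
    hence "take m1 y \<in> tup m1" "drop m1 y \<in> tup m2"
     using set_take_subset[of m1 y] set_drop_subset[of m1 y] by (auto simp: tuples_def)
    hence "take m1 y @ drop m1 y \<in> ?Z" using n by blast
    thus "y \<in> ?Z" by simp
   qed
   thus False using forkset_mono[OF f] forkset_tup[OF A] by blast
  qed
  show "forkset A (m1 + m2) ?Z \<longleftrightarrow> fork A m1 \<phi>1 e \<and> fork A m2 \<phi>2 e"
  proof
   assume f: "forkset A (m1 + m2) ?Z"
   obtain u1 u2 where u: "u1 \<in> tup m1" "u2 \<in> tup m2" "u1 @ u2 \<notin> ?Z" using allZ[OF f] by blast
   have "fork A m1 \<phi>1 e"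
   proof (cases "m1 = 0")
    case True
    hence "sols m1 \<phi>1 e = {}" using Z[OF u(1,2)] u(1,3) by (auto simp: sols_def tuples_def)
    thus ?thesis by (simp add: forkset_empty)
   next
    case False
    show ?thesis
    proof (rule forkset_map[OF f, of "[0..<m1] @ replicate m2 0"])
     fix y assume y: "y \<in> sols m1 \<phi>1 e"
     hence yt: "y \<in> tup m1" by (simp add: sols_def)
     hence "replicate m2 (y ! 0) \<in> tup m2" using tup_nth[OF yt, of 0] False by (auto simp: tuples_def)
     moreover have "map (nth y) ([0..<m1] @ replicate m2 0) = y @ replicate m2 (y ! 0)"
      using map_nth_seg[of 0 "[]" "length y" y "[]"] yt by (simp add: tuples_def)
     ultimately show "y \<in> tup m1 \<and> map (nth y) ([0..<m1] @ replicate m2 0) \<in> ?Z" using Z[OF yt] yt y by simp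
    qed (use False A in auto)
   qed
   moreover have "fork A m2 \<phi>2 e"
   proof (cases "m2 = 0")
    case True
    hence "sols m2 \<phi>2 e = {}" using Z[OF u(1,2)] u(2,3) by (auto simp: sols_def tuples_def)
    thus ?thesis by (simp add: forkset_empty)
   next
    case False
    show ?thesis
    proof (rule forkset_map[OF f, of "replicate m1 0 @ [0..<m2]"])
     fix y assume y: "y \<in> sols m2 \<phi>2 e"
     hence yt: "y \<in> tup m2" by (simp add: sols_def)
     hence "replicate m1 (y ! 0) \<in> tup m1" using tup_nth[OF yt, of 0] False by (auto simp: tuples_def)
     moreover have "map (nth y) (replicate m1 0 @ [0..<m2]) = replicate m1 (y ! 0) @ y"
      using map_nth_seg[of 0 "[]" "length y" y "[]"] yt by (simp add: tuples_def)
     ultimately show "y \<in> tup m2 \<and> map (nth y) (replicate m1 0 @ [0..<m2]) \<in> ?Z" using Z[OF _ yt] yt y by simp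
    qed (use False A in auto)
   qed
   ultimately show "fork A m1 \<phi>1 e \<and> fork A m2 \<phi>2 e" ..
  next
   assume f: "fork A m1 \<phi>1 e \<and> fork A m2 \<phi>2 e"
   have sp: "take m1 y \<in> tup m1" "drop m1 y \<in> tup m2" "map (nth y) [0..<m1] = take m1 y" "map (nth y) [m1..<m1 + m2] = drop m1 y"
    if "y \<in> tup (m1 + m2)" for y
   proof -
    show t: "take m1 y \<in> tup m1" "drop m1 y \<in> tup m2"
     using that set_take_subset[of m1 y] set_drop_subset[of m1 y] by (auto simp: tuples_def)
    show "map (nth y) [0..<m1] = take m1 y"
     using map_nth_seg[of 0 "[]" m1 "take m1 y" "drop m1 y"] t by (simp add: tuples_def)
    show "map (nth y) [m1..<m1 + m2] = drop m1 y"
     using map_nth_seg[OF tuplesD(1)[OF t(1), symmetric], of "m1 + m2" "drop m1 y" "[]"] tuplesD(1)[OF t(2)]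
     by (simp del: length_take length_drop)
   qed
   let ?Y1 = "{y\<in>tup (m1 + m2). take m1 y \<in> sols m1 \<phi>1 e}" and ?Y2 = "{y\<in>tup (m1 + m2). drop m1 y \<in> sols m2 \<phi>2 e}"
   have "forkset A (m1 + m2) ?Y1" by (rule forkset_map[OF conjunct1[OF f], of "[0..<m1]"]) (use A sp(3) in auto)
   moreover have "forkset A (m1 + m2) ?Y2" by (rule forkset_map[OF conjunct2[OF f], of "[m1..<m1 + m2]"]) (use A sp(4) in auto)
   moreover have "?Z \<subseteq> ?Y1 \<union> ?Y2"
   proof
    fix y assume y: "y \<in> ?Z"
    hence yt: "y \<in> tup (m1 + m2)" by (simp add: sols_def)
    show "y \<in> ?Y1 \<union> ?Y2" using Z[OF sp(1,2)[OF yt]] y yt by simp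
   qed
   ultimately show "forkset A (m1 + m2) ?Z" using forkset_Un forkset_mono by blast
  qed
 qed (use \<phi>1' \<phi>2'(1) in \<open>simp add: fmlas_And fmlas_Neg\<close>)
qed

lemma fork_conj:
 assumes "finite I" "\<And>i. i \<in> I \<Longrightarrow> \<phi> i \<in> fmlas L (p + m i)"
 shows "\<exists>M. \<exists>\<psi>\<in>fmlas L (p + M). \<forall>e\<in>tup p. \<forall>A. A \<subseteq> dom C \<longrightarrow>
  (fork A M \<psi> e \<longleftrightarrow> (\<forall>i\<in>I. fork A (m i) (\<phi> i) e))"
 using assms
proof (induction I rule: finite_induct)
 case empty
 obtain \<tau> \<beta> where \<tau>: "\<tau> \<in> fmlas L 0" "\<beta> \<in> fmlas L 0" "\<And>xs. holds C \<tau> xs" "\<And>xs. \<not> holds C \<beta> xs" by (rule fm_top_bot) (rule that)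
 have "sols 0 \<beta> e = {}" for e using \<tau>(4) by (simp add: sols_def)
 thus ?case using fmlas_mono[OF \<tau>(2), of "p + 0"] by (intro exI[of _ 0] bexI[of _ \<beta>]) (simp_all add: forkset_empty)
next
 case (insert i I)
 then obtain M \<psi> where \<psi>: "\<psi> \<in> fmlas L (p + M)" "\<forall>e\<in>tup p. \<forall>A. A \<subseteq> dom C \<longrightarrow>
  (fork A M \<psi> e \<longleftrightarrow> (\<forall>i\<in>I. fork A (m i) (\<phi> i) e))" by auto
 have "\<phi> i \<in> fmlas L (p + m i)" using insert.prems by simp
 from fork_conj2[OF this \<psi>(1)] obtain \<psi>' where \<psi>': "\<psi>' \<in> fmlas L (p + (m i + M))" "\<forall>e\<in>tup p. \<forall>A. A \<subseteq> dom C \<longrightarrow>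
  (fork A (m i + M) \<psi>' e \<longleftrightarrow> fork A (m i) (\<phi> i) e \<and> fork A M \<psi> e)" by blast
 show ?case by (intro exI[of _ "m i + M"] bexI[OF _ \<psi>'(1)] ballI allI impI) (use \<psi>(2) \<psi>'(2) in simp)
qed

text \<open>The condition \<open>\<alpha>\<close> is absorbed by the formula
  \<open>\<psi> \<or> \<not>\<alpha>\<close>: where \<open>\<alpha>\<close> fails, its solution set
  consists of all tuples and does not fork.\<close>

lemma basic_open:
 assumes b: "b \<in> lists (dom C)" and I: "finite I" and \<phi>: "\<And>i. i \<in> I \<Longrightarrow> \<phi> i \<in> fmlas L (length b + n + m i)"
  and \<alpha>: "\<alpha> \<in> fms b n"
 shows "basic_tauf_open L C (set b) n {a\<in>tup n. holds C \<alpha> (b @ a) \<and> (\<forall>i\<in>I. fork (set b) (m i) (\<phi> i) (b @ a))}"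
proof -
 let ?p = "length b + n"
 obtain M \<psi> where \<psi>: "\<psi> \<in> fmlas L (?p + M)" "\<forall>e\<in>tup ?p. \<forall>A. A \<subseteq> dom C \<longrightarrow>
  (fork A M \<psi> e \<longleftrightarrow> (\<forall>i\<in>I. fork A (m i) (\<phi> i) e))"
  using fork_conj[of I \<phi> ?p m, OF I \<phi>] by blast
 have bC: "inC (set b)" "small (set b)" using b small_finite by (auto simp: lists_eq_set)
 let ?\<chi> = "Neg (And (Neg \<psi>) \<alpha>)"
 have \<chi>: "?\<chi> \<in> fmlas L (?p + M)" using \<psi>(1) fmlas_mono[OF \<alpha>, of "?p + M"] by (simp add: fmlas_And fmlas_Neg)
 have "forks L C (set b) M ?\<chi> (b @ a) \<longleftrightarrow> holds C \<alpha> (b @ a) \<and> (\<forall>i\<in>I. fork (set b) (m i) (\<phi> i) (b @ a))"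
  if a: "a \<in> tup n" for a
 proof -
  have e: "b @ a \<in> tup ?p" using a b by (auto simp: tuples_def lists_eq_set)
  have h: "holds C ?\<chi> ((b @ a) @ y) \<longleftrightarrow> holds C \<psi> ((b @ a) @ y) \<or> \<not> holds C \<alpha> (b @ a)" for y
   using holds_append[of \<alpha> L "b @ a" C y] \<alpha> a by (auto simp: tuples_def holds_And holds_Neg)
  show ?thesis
  proof (cases "holds C \<alpha> (b @ a)")
   case True
   hence "sols M ?\<chi> (b @ a) = sols M \<psi> (b @ a)" unfolding sols_def h by simp
   thus ?thesis using True \<psi>(2) e bC by (simp add: forks_forkset)
  next
   case False
   hence "sols M ?\<chi> (b @ a) = tup M" unfolding sols_def h by simp
   thus ?thesis using False bC forkset_tup by (simp add: forks_forkset)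
  qed
 qed
 hence "{a\<in>tup n. holds C \<alpha> (b @ a) \<and> (\<forall>i\<in>I. fork (set b) (m i) (\<phi> i) (b @ a))} =
  {a\<in>tup n. forks L C (set b) M ?\<chi> (b @ a)}" by blast
 moreover have "b \<in> lists (set b)" by (simp add: lists_eq_set)
 ultimately show ?thesis unfolding basic_tauf_open_def using \<chi> by blast
qed

text \<open>Once the witness has been eliminated, the last tuple of the sequence takes its role, and
  the bases of the surviving conditions do not contain it. When only \<open>a\<close> is left, all
  surviving conditions are over \<open>b\<close>.\<close>

lemma wit_open:
 assumes efo: "extension_property_first_order L T C" and b: "b \<in> lists (dom C)"
 shows "wit_fmlas (length b) (n # rs) k \<theta> I lv m \<phi> \<Longrightarrow>
  tauf_open L C (set b) n {a\<in>tup n. \<exists>zs\<in>tuple_seqs C rs. wit b k \<theta> I lv m \<phi> (a # zs)}"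
proof (induction rs arbitrary: k \<theta> I lv \<phi> rule: rev_induct)
 case Nil
 obtain Q where Q: "\<And>\<alpha> \<chi>. (\<alpha>, \<chi>) \<in> Q \<Longrightarrow> \<alpha> \<in> fmlas L (length b + sum_list [n])"
  "\<And>\<alpha> \<chi> i. (\<alpha>, \<chi>) \<in> Q \<Longrightarrow> i \<in> I \<Longrightarrow> lv i < length [n] \<Longrightarrow> \<chi> i \<in> fmlas L (length b + sum_list [n] + m i)"
  "\<And>zs. zs \<in> tuple_seqs C [n] \<Longrightarrow> wit b k \<theta> I lv m \<phi> zs \<longleftrightarrow>
   (\<exists>(\<alpha>, \<chi>)\<in>Q. holds C \<alpha> (b @ concat zs) \<and> (\<forall>i\<in>{i\<in>I. lv i < length [n]}.
     fork (set (b @ concat (take (lv i) zs))) (m i) (\<chi> i) (b @ concat zs)))"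
  by (rule wit_reduce[OF efo b Nil]) (rule that)
 let ?J = "{i\<in>I. lv i < 1}"
 let ?U = "\<lambda>(\<alpha>, \<chi>). {a\<in>tup n. holds C \<alpha> (b @ a) \<and> (\<forall>i\<in>?J. fork (set b) (m i) (\<chi> i) (b @ a))}"
 have "tauf_open L C (set b) n (?U q)" if "q \<in> Q" for q
 proof -
  obtain \<alpha> \<chi> where q: "q = (\<alpha>, \<chi>)" by (cases q)
  have "finite ?J" using Nil by (simp add: wit_fmlas_def)
  hence "basic_tauf_open L C (set b) n (?U q)" unfolding q prod.case
   by (rule basic_open[OF b]) (use Q(1,2) that q in auto)
  thus ?thesis unfolding tauf_open_def by (intro exI[of _ "{?U q}"]) simp
 qed
 hence "tauf_open L C (set b) n (\<Union>q\<in>Q. ?U q)" by (rule tauf_open_UN)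
 moreover have "{a\<in>tup n. \<exists>zs\<in>tuple_seqs C []. wit b k \<theta> I lv m \<phi> (a # zs)} = (\<Union>q\<in>Q. ?U q)"
 proof (rule set_eqI)
  fix a
  have 1: "wit b k \<theta> I lv m \<phi> [a] \<longleftrightarrow> (\<exists>(\<alpha>, \<chi>)\<in>Q. holds C \<alpha> (b @ a) \<and> (\<forall>i\<in>?J. fork (set b) (m i) (\<chi> i) (b @ a)))"
   if "a \<in> tup n"
  proof -
   have "[a] \<in> tuple_seqs C [n]" using that by (simp add: tuple_seqs_def)
   from Q(3)[OF this] show ?thesis by (auto cong: conj_cong)
  qed
  have 2: "a \<in> (\<Union>q\<in>Q. ?U q) \<longleftrightarrow> a \<in> tup n \<and>
   (\<exists>(\<alpha>, \<chi>)\<in>Q. holds C \<alpha> (b @ a) \<and> (\<forall>i\<in>?J. fork (set b) (m i) (\<chi> i) (b @ a)))"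
   by (simp add: case_prod_beta)
  have 3: "tuple_seqs C [] = {[]}" by (auto simp: tuple_seqs_Nil)
  show "a \<in> {a\<in>tup n. \<exists>zs\<in>tuple_seqs C []. wit b k \<theta> I lv m \<phi> (a # zs)} \<longleftrightarrow> a \<in> (\<Union>q\<in>Q. ?U q)"
   unfolding 2 3 mem_Collect_eq using 1 by blast
 qed
 ultimately show ?case by simp
next
 case (snoc r rs)
 have ok: "wit_fmlas (length b) (n # rs @ [r]) k \<theta> I lv m \<phi>" by (rule snoc.prems)
 obtain Q where Q: "\<And>\<alpha> \<chi>. (\<alpha>, \<chi>) \<in> Q \<Longrightarrow> \<alpha> \<in> fmlas L (length b + sum_list (n # rs @ [r]))"
  "\<And>\<alpha> \<chi> i. (\<alpha>, \<chi>) \<in> Q \<Longrightarrow> i \<in> I \<Longrightarrow> lv i < length (n # rs @ [r]) \<Longrightarrow> \<chi> i \<in> fmlas L (length b + sum_list (n # rs @ [r]) + m i)"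
  "\<And>zs. zs \<in> tuple_seqs C (n # rs @ [r]) \<Longrightarrow> wit b k \<theta> I lv m \<phi> zs \<longleftrightarrow>
   (\<exists>(\<alpha>, \<chi>)\<in>Q. holds C \<alpha> (b @ concat zs) \<and> (\<forall>i\<in>{i\<in>I. lv i < length (n # rs @ [r])}.
     fork (set (b @ concat (take (lv i) zs))) (m i) (\<chi> i) (b @ concat zs)))"
  by (rule wit_reduce[OF efo b ok]) (rule that)
 let ?J = "{i\<in>I. lv i < length (n # rs @ [r])}"
 let ?U = "\<lambda>(\<alpha>, \<chi>). {a\<in>tup n. \<exists>zs\<in>tuple_seqs C rs. wit b r \<alpha> ?J lv m \<chi> (a # zs)}"
 have "tauf_open L C (set b) n (?U q)" if "q \<in> Q" for q
 proof -
  obtain \<alpha> \<chi> where q: "q = (\<alpha>, \<chi>)" by (cases q)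
  have "wit_fmlas (length b) (n # rs) r \<alpha> ?J lv m \<chi>" unfolding wit_fmlas_def
  proof (intro conjI ballI)
   show "finite ?J" using ok by (simp add: wit_fmlas_def)
   show "\<alpha> \<in> fmlas L (length b + sum_list (n # rs) + r)" using Q(1)[of \<alpha> \<chi>] that q by (simp add: add.assoc)
   fix i assume i: "i \<in> ?J"
   show "lv i \<le> length (n # rs)" using i by simp
   show "\<chi> i \<in> fmlas L (length b + sum_list (n # rs) + r + m i)" using Q(2)[of \<alpha> \<chi> i] that q i by (simp add: add.assoc)
  qed
  from snoc.IH[OF this] show ?thesis unfolding q prod.case .
 qed
 hence "tauf_open L C (set b) n (\<Union>q\<in>Q. ?U q)" by (rule tauf_open_UN)
 moreover have "{a\<in>tup n. \<exists>zs\<in>tuple_seqs C (rs @ [r]). wit b k \<theta> I lv m \<phi> (a # zs)} = (\<Union>q\<in>Q. ?U q)"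
 proof (rule set_eqI)
  fix a
  have eq: "(\<exists>z\<in>tup r. wit b k \<theta> I lv m \<phi> (a # zs @ [z])) \<longleftrightarrow> (\<exists>(\<alpha>, \<chi>)\<in>Q. wit b r \<alpha> ?J lv m \<chi> (a # zs))"
   if a: "a \<in> tup n" and zs: "zs \<in> tuple_seqs C rs" for zs
  proof -
   have tk: "take (lv i) (a # zs @ [z]) = take (lv i) (a # zs)" if "i \<in> ?J" for i z
    using that tuple_seqs_length[OF zs] take_append[of "lv i" "a # zs" "[z]"] by simp
   have "wit b k \<theta> I lv m \<phi> (a # zs @ [z]) \<longleftrightarrow> (\<exists>(\<alpha>, \<chi>)\<in>Q. holds C \<alpha> (b @ concat (a # zs) @ z) \<and>
     (\<forall>i\<in>?J. fork (set (b @ concat (take (lv i) (a # zs)))) (m i) (\<chi> i) (b @ concat (a # zs) @ z)))"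
    if z: "z \<in> tup r" for z
   proof -
    have "a # zs @ [z] \<in> tuple_seqs C (n # rs @ [r])" using a zs z by (simp add: tuple_seqs_Cons tuple_seqs_snoc)
    moreover have "concat (a # zs @ [z]) = concat (a # zs) @ z" by simp
    ultimately show ?thesis using Q(3)[of "a # zs @ [z]"] by (simp only: tk cong: ball_cong)
   qed
   thus ?thesis unfolding wit_def by blast
  qed
  show "a \<in> {a\<in>tup n. \<exists>zs\<in>tuple_seqs C (rs @ [r]). wit b k \<theta> I lv m \<phi> (a # zs)} \<longleftrightarrow> a \<in> (\<Union>q\<in>Q. ?U q)"
  proof (cases "a \<in> tup n")
   case True
   have "(\<exists>zs\<in>tuple_seqs C (rs @ [r]). wit b k \<theta> I lv m \<phi> (a # zs)) \<longleftrightarrow>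
    (\<exists>zs\<in>tuple_seqs C rs. \<exists>z\<in>tup r. wit b k \<theta> I lv m \<phi> (a # zs @ [z]))"
    unfolding Bex_def tuple_seqs_snoc by blast
   also have "\<dots> \<longleftrightarrow> (\<exists>zs\<in>tuple_seqs C rs. \<exists>(\<alpha>, \<chi>)\<in>Q. wit b r \<alpha> ?J lv m \<chi> (a # zs))" using eq[OF True] by (rule bex_cong[OF refl])
   finally show ?thesis using True by auto
  qed auto
 qed
 ultimately show ?case by simp
qed

section \<open>Sections of pre-tilde relations along maximal sequences\<close>

lemma shift_fm:
 assumes \<phi>: "\<phi> \<in> fmlas L (k + m)"
 shows "\<exists>\<phi>'\<in>fmlas L (p + k + m). \<forall>e\<in>tup p. \<forall>a\<in>tup k. sols m \<phi>' (e @ a) = sols m \<phi> a"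
proof -
 let ?ks = "[p..<p + k] @ [p + k..<p + k + m]"
 have ks: "\<phi> \<in> fmlas L (length ?ks)" "set ?ks \<subseteq> {..<p + k + m}" using \<phi> by auto
 obtain \<phi>' where \<phi>': "\<phi>' \<in> fmlas L (p + k + m)"
  "\<And>xs. length xs = p + k + m \<Longrightarrow> holds C \<phi>' xs \<longleftrightarrow> holds C \<phi> (map (nth xs) ?ks)"
  by (rule fm_perm[OF ks]) (rule that)
 show ?thesis
 proof (intro bexI[OF _ \<phi>'(1)] ballI)
  fix e a assume ea: "e \<in> tup p" "a \<in> tup k"
  have "holds C \<phi>' (e @ a @ y) \<longleftrightarrow> holds C \<phi> (a @ y)" if "y \<in> tup m" for y
  proof -
   have "map (nth (e @ a @ y)) [p..<p + k] = a" using map_nth_seg[of p e "p + k" a y] ea by (simp add: tuples_def)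
   moreover have "map (nth (e @ a @ y)) [p + k..<p + k + m] = y"
    using map_nth_seg[of "p + k" "e @ a" "p + k + m" y "[]"] ea that by (simp add: tuples_def)
   ultimately show ?thesis using \<phi>'(2)[of "e @ a @ y"] ea that by (simp add: tuples_def)
  qed
  thus "sols m \<phi>' (e @ a) = sols m \<phi> a" by (auto simp: sols_def)
 qed
qed

lemma witness_iff:
 assumes w: "pre_tilde_witness L C n rs V k \<theta> m \<phi>" and a: "a \<in> tup n" and zs: "zs \<in> tuple_seqs C rs"
 shows "V a zs \<longleftrightarrow> (\<exists>a'\<in>tup k. holds C \<theta> (a @ a' @ concat zs) \<and>
  (\<forall>i\<le>length rs. fork (set (concat (take i zs))) (m i) (\<phi> i) a'))"
proof -
 have "forks L C (set (concat (take i zs))) (m i) (\<phi> i) a' \<longleftrightarrow> fork (set (concat (take i zs))) (m i) (\<phi> i) a'" for i a'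
 proof (rule forks_forkset)
  show "inC (set (concat (take i zs)))" using tuple_seqs_concat[OF tuple_seqs_take[OF zs]] by (simp add: tuples_def)
  show "small (set (concat (take i zs)))" by (rule small_finite) simp
 qed
 thus ?thesis using w a zs unfolding pre_tilde_witness_def by simp
qed

lemma section_iff:
 assumes w: "pre_tilde_witness L C n rs V k \<theta> m \<phi>" and ds: "ds \<in> tuple_seqs C (take (length ds) rs)"
 shows "a \<in> section_set C n rs V ds \<longleftrightarrow> a \<in> tup n \<and> (\<exists>es\<in>tuple_seqs C (drop (length ds) rs). \<exists>a'\<in>tup k.
  holds C \<theta> (a @ a' @ concat ds @ concat es) \<and>
  (\<forall>i\<le>length rs. fork (set (concat (take i (ds @ es)))) (m i) (\<phi> i) a'))"
proof -
 have "ds @ es \<in> tuple_seqs C rs" if "es \<in> tuple_seqs C (drop (length ds) rs)" for es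
  using tuple_seqs_append[OF ds that] by simp
 hence "V a (ds @ es) \<longleftrightarrow> (\<exists>a'\<in>tup k. holds C \<theta> (a @ a' @ concat ds @ concat es) \<and>
  (\<forall>i\<le>length rs. fork (set (concat (take i (ds @ es)))) (m i) (\<phi> i) a'))"
  if "a \<in> tup n" "es \<in> tuple_seqs C (drop (length ds) rs)" for es
  using witness_iff[OF w that(1), of "ds @ es"] that(2) by simp
 thus ?thesis unfolding section_set_def by auto
qed

text \<open>By maximality, any prolongation of \<open>ds\<close> has a bounded section, and
  \<open>a\<close> belongs to the section of this one.\<close>

lemma maximal_section_acl:
 assumes max: "maximal_unbounded_section L C n rs V ds"
  and es: "es \<in> tuple_seqs C (drop (length ds) rs)" and a: "a \<in> tup n" "V a (ds @ es)" and j: "0 < j" "j \<le> length es"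
 shows "set a \<subseteq> acl L C (set (concat (ds @ take j es)))"
proof -
 let ?l = "length ds"
 have us: "?l \<le> length rs" "ds \<in> tuple_seqs C (take ?l rs)"
  using max by (simp_all add: maximal_unbounded_section_def unbounded_section_def)
 have le: "length es = length rs - ?l" using tuple_seqs_length[OF es] by simp
 have l: "length (ds @ take j es) = ?l + j" using j by simp
 have "a \<in> section_set C n rs V (ds @ take j es)" unfolding section_set_def
 proof (intro CollectI conjI bexI)
  show "V a ((ds @ take j es) @ drop j es)" using a(2) by simp
  show "drop j es \<in> tuple_seqs C (drop (length (ds @ take j es)) rs)"
   using tuple_seqs_drop[OF es, of j] unfolding l by (simp add: add.commute)
 qed (rule a)
 moreover have "take j es \<noteq> []" using j by auto
 hence "\<not> unbounded_section L C n rs V (ds @ take j es)"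
  using max unfolding maximal_unbounded_section_def by blast
 moreover have "ds @ take j es \<in> tuple_seqs C (take (length (ds @ take j es)) rs)"
  unfolding l take_add by (rule tuple_seqs_append[OF us(2) tuple_seqs_take[OF es]])
 moreover have "length (ds @ take j es) \<le> length rs" unfolding l using j le us(1) by linarith
 ultimately have "a \<in> lists (acl L C (set (concat (ds @ take j es))))"
  unfolding unbounded_section_def unbounded_def by blast
 thus ?thesis by (simp add: lists_eq_set)
qed

text \<open>\<open>wit_open\<close> admits the base \<open>b\<close>, and larger bases only if they
  contain both \<open>b\<close> and \<open>a\<close>. Bases inside \<open>ds\<close> are raised to
  \<open>b\<close> by the shift, at the price of a condition on the fixed tuple \<open>b\<close>. To
  the later bases \<open>a\<close> may be added, since it is algebraic over them.\<close>

lemma maximal_section_open: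
 assumes efo: "extension_property_first_order L T C"
  and w: "pre_tilde_witness L C n rs V k \<theta> m \<phi>" and max: "maximal_unbounded_section L C n rs V ds"
 shows "tauf_open L C (set (concat ds)) n (section_set C n rs V ds)"
proof -
 define l where "l = length ds"
 define b where "b = concat ds"
 define rs2 where "rs2 = drop l rs"
 define s where "s = sum_list rs2"
 define lb where "lb = length b"
 have us: "l \<le> length rs" "ds \<in> tuple_seqs C (take l rs)"
  using max by (simp_all add: maximal_unbounded_section_def unbounded_section_def l_def)
 have bt: "b \<in> tup (sum_list (take l rs))" unfolding b_def by (rule tuple_seqs_concat[OF us(2)])
 hence bC: "b \<in> lists (dom C)" "inC (set b)" and bl: "b \<in> tup lb" "lb = sum_list (take l rs)"
  by (simp_all add: tuples_def lists_eq_set lb_def)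
 have R: "sum_list rs = lb + s" unfolding bl(2) s_def rs2_def by (metis append_take_drop_id sum_list_append)
 have \<theta>: "\<theta> \<in> fmlas L (n + k + (lb + s))" and \<phi>: "\<And>i. i \<le> length rs \<Longrightarrow> \<phi> i \<in> fmlas L (k + m i)"
  using w by (simp_all add: pre_tilde_witness_def R)
 have sec: "a \<in> section_set C n rs V ds \<longleftrightarrow> a \<in> tup n \<and> (\<exists>es\<in>tuple_seqs C rs2. \<exists>a'\<in>tup k. holds C \<theta> (a @ a' @ b @ concat es) \<and>
  (\<forall>i\<le>length rs. fork (set (concat (take i (ds @ es)))) (m i) (\<phi> i) a'))" for a
  using section_iff[OF w us(2)[unfolded l_def]] unfolding b_def rs2_def l_def by blast
 \<comment> \<open>\<open>\<theta>\<close> expects the order x, witness, \<open>ds\<close>,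
   remaining tuples; \<open>wit\<close> has \<open>ds\<close>, x, remaining tuples, witness.\<close>
 let ?ks = "[lb..<lb + n] @ [lb + n + s..<lb + n + s + k] @ [0..<lb] @ [lb + n..<lb + n + s]"
 have ks: "\<theta> \<in> fmlas L (length ?ks)" "set ?ks \<subseteq> {..<lb + (n + s) + k}" using \<theta> by (auto simp: ac_simps)
 obtain \<theta>' where \<theta>': "\<theta>' \<in> fmlas L (lb + (n + s) + k)"
  "\<And>xs. length xs = lb + (n + s) + k \<Longrightarrow> holds C \<theta>' xs \<longleftrightarrow> holds C \<theta> (map (nth xs) ?ks)"
  by (rule fm_perm[OF ks]) (rule that)
 have \<theta>'_iff: "holds C \<theta>' (b @ concat (a # es) @ a') \<longleftrightarrow> holds C \<theta> (a @ a' @ b @ concat es)"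
  if "a \<in> tup n" "es \<in> tuple_seqs C rs2" "a' \<in> tup k" for a es a'
 proof -
  let ?c = "concat es"
  have len: "length a = n" "length ?c = s" "length a' = k" "length b = lb"
   using that tuple_seqs_concat[OF that(2)] by (simp_all add: tuples_def s_def lb_def)
  have "map (nth (b @ a @ ?c @ a')) [lb..<lb + n] = a"
   using map_nth_seg[of lb b "lb + n" a "?c @ a'"] len by simp
  moreover have "map (nth (b @ a @ ?c @ a')) [lb + n + s..<lb + n + s + k] = a'"
   using map_nth_seg[of "lb + n + s" "b @ a @ ?c" "lb + n + s + k" a' "[]"] len by simp
  moreover have "map (nth (b @ a @ ?c @ a')) [0..<lb] = b"
   using map_nth_seg[of 0 "[]" lb b "a @ ?c @ a'"] len by simp
  moreover have "map (nth (b @ a @ ?c @ a')) [lb + n..<lb + n + s] = ?c"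
   using map_nth_seg[of "lb + n" "b @ a" "lb + n + s" ?c a'] len by simp
  moreover have "length (b @ a @ ?c @ a') = lb + (n + s) + k" using len by simp
  ultimately show ?thesis using \<theta>'(2)[of "b @ a @ ?c @ a'"] by simp
 qed
 \<comment> \<open>Conditions up to \<open>l\<close> are moved to the base \<open>b\<close>. A later
   base consists of \<open>b\<close>, of \<open>a\<close> and of \<open>i - l\<close> further
   tuples; \<open>a\<close> accounts for \<open>Suc\<close>.\<close>
 define lv where "lv i = (if i \<le> l then 0 else Suc (i - l))" for i
 define D where "D \<chi> i a' = sols (m i) (\<phi> i) a' - (if i \<le> l then sols (m i) (\<chi> i) b else {})" for \<chi> i a'
 \<comment> \<open>The forking condition on \<open>\<chi>\<close> concerns the fixed tuple
   \<open>b\<close> and not \<open>a\<close>, so it merely restricts the index set of the union. The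
   formulas \<open>\<phi>'\<close> represent the remainders as long as the first entries are
   \<open>b\<close>.\<close>
 define Q where "Q = {(\<chi>, \<phi>'). (\<forall>i\<le>l. fork (set (concat (take i ds))) (m i) (\<chi> i) b) \<and>
  (\<forall>i\<le>length rs. \<phi>' i \<in> fmlas L (lb + (n + s) + k + m i)) \<and>
  (\<forall>i\<le>length rs. \<forall>x\<in>tup (n + s). \<forall>a'\<in>tup k. sols (m i) (\<phi>' i) (b @ x @ a') = D \<chi> i a')}"
 let ?I = "{..length rs}"
 let ?U = "\<lambda>(\<chi> :: nat \<Rightarrow> ('f, 'r) fm, \<phi>'). {a\<in>tup n. \<exists>es\<in>tuple_seqs C rs2. wit b k \<theta>' ?I lv m \<phi>' (a # es)}"
 have "tauf_open L C (set b) n (?U q)" if "q \<in> Q" for q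
 proof -
  obtain \<chi> \<phi>' where q: "q = (\<chi>, \<phi>')" by (cases q)
  have "\<forall>i\<le>length rs. \<phi>' i \<in> fmlas L (lb + (n + s) + k + m i)" using that q by (simp add: Q_def)
  hence "wit_fmlas (length b) (n # rs2) k \<theta>' ?I lv m \<phi>'"
   using \<theta>'(1) by (auto simp: wit_fmlas_def lv_def rs2_def s_def lb_def)
  from wit_open[OF efo bC(1) this] show ?thesis unfolding q prod.case .
 qed
 hence "tauf_open L C (set b) n (\<Union>q\<in>Q. ?U q)" by (rule tauf_open_UN)
 moreover have "section_set C n rs V ds = (\<Union>q\<in>Q. ?U q)"
 proof (rule set_eqI)
  fix a
  have xt: "concat (a # es) \<in> tup (n + s)" if "a \<in> tup n" "es \<in> tuple_seqs C rs2" for es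
   using that tuple_seqs_concat[OF that(2)] by (simp add: tuples_def s_def)
  have base0: "take i (ds @ es) = take i ds" "lv i = 0" if "i \<le> l" for i es using that by (simp_all add: l_def lv_def)
  have base1: "set (b @ concat (take (lv i) (a # es))) = set (concat (take i (ds @ es))) \<union> set a"
   "concat (take i (ds @ es)) = concat (ds @ take (i - l) es)" if "\<not> i \<le> l" for i es
   using that by (auto simp: l_def lv_def b_def)
  show "a \<in> section_set C n rs V ds \<longleftrightarrow> a \<in> (\<Union>q\<in>Q. ?U q)"
  proof
   assume as: "a \<in> section_set C n rs V ds"
   then obtain es a' where a: "a \<in> tup n" and es: "es \<in> tuple_seqs C rs2" and a': "a' \<in> tup k" "holds C \<theta> (a @ a' @ b @ concat es)"
    and fk: "\<And>i. i \<le> length rs \<Longrightarrow> fork (set (concat (take i (ds @ es)))) (m i) (\<phi> i) a'"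
    unfolding sec by auto
   have dses: "ds @ es \<in> tuple_seqs C rs" using tuple_seqs_append[OF us(2) es] by (simp add: rs2_def)
   have Va: "V a (ds @ es)" unfolding witness_iff[OF w a dses] using a' fk by (intro bexI[of _ a']) (auto simp: b_def)
   have a'C: "a' \<in> lists (dom C)" "length a' = k" using a'(1) by (simp_all add: tuples_def lists_eq_set)
   have "\<forall>i\<in>{..l}. \<exists>\<chi>. \<chi> \<in> fmlas L (lb + m i) \<and> fork (set (concat (take i ds))) (m i) \<chi> b \<and>
    forkset (set b) (m i) (sols (m i) (\<phi> i) a' - sols (m i) \<chi> b)"
   proof
    fix i assume "i \<in> {..l}"
    hence i: "i \<le> l" "i \<le> length rs" using us(1) by auto
    obtain \<psi> where \<psi>: "\<psi> \<in> fmlas L (lb + k + m i)" "\<forall>e\<in>tup lb. \<forall>a\<in>tup k. sols (m i) \<psi> (e @ a) = sols (m i) (\<phi> i) a"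
     using shift_fm[OF \<phi>[OF i(2)]] by blast
    have eq: "sols (m i) \<psi> (b @ a') = sols (m i) (\<phi> i) a'" using \<psi>(2) bl(1) a'(1) by blast
    have sub: "set (concat (take i ds)) \<subseteq> set b" unfolding b_def using set_take_subset[of i ds] by auto
    have "\<psi> \<in> fmlas L (length (b @ a') + m i)" using \<psi>(1) a'C(2) by (simp add: lb_def)
    moreover have "fork (set (concat (take i ds))) (m i) \<psi> (b @ a')"
     using fk[OF i(2)] unfolding eq base0(1)[OF i(1)] .
    ultimately have "\<exists>\<chi>\<in>fmlas L (length b + m i). fork (set (concat (take i ds))) (m i) \<chi> b \<and>
     forkset (set b) (m i) (sols (m i) \<psi> (b @ a') - sols (m i) \<chi> b)"
     by (rule forkset_shift[OF bC(1) sub a'C(1)])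
    then
    show "\<exists>\<chi>. \<chi> \<in> fmlas L (lb + m i) \<and> fork (set (concat (take i ds))) (m i) \<chi> b \<and>
     forkset (set b) (m i) (sols (m i) (\<phi> i) a' - sols (m i) \<chi> b)" unfolding eq lb_def by (simp only: Bex_def)
   qed
   from bchoice[OF this] obtain \<chi> where \<chi>: "\<forall>i\<in>{..l}. \<chi> i \<in> fmlas L (lb + m i) \<and>
    fork (set (concat (take i ds))) (m i) (\<chi> i) b \<and>
    forkset (set b) (m i) (sols (m i) (\<phi> i) a' - sols (m i) (\<chi> i) b)" ..
   have "\<forall>i\<in>{..length rs}. \<exists>\<delta>. \<delta> \<in> fmlas L (lb + (n + s) + k + m i) \<and>
    (\<forall>x\<in>tup (n + s). \<forall>a'\<in>tup k. sols (m i) \<delta> (b @ x @ a') = D \<chi> i a')"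
   proof
    fix i assume "i \<in> {..length rs}"
    hence "i \<le> length rs" by simp
    from shift_fm[OF \<phi>[OF this], of "lb + (n + s)"] obtain \<psi> where \<psi>: "\<psi> \<in> fmlas L (lb + (n + s) + k + m i)"
     "\<forall>e\<in>tup (lb + (n + s)). \<forall>a\<in>tup k. sols (m i) \<psi> (e @ a) = sols (m i) (\<phi> i) a"
     by (elim bexE) (rule that)
    have eq: "sols (m i) \<psi> (b @ x @ a') = sols (m i) (\<phi> i) a'" if "x \<in> tup (n + s)" "a' \<in> tup k" for x a'
    proof -
     have "b @ x \<in> tup (lb + (n + s))" using bl(1) that(1) by (simp add: tuples_def)
     hence "sols (m i) \<psi> ((b @ x) @ a') = sols (m i) (\<phi> i) a'" using \<psi>(2) that(2) by blast
     thus ?thesis by simp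
    qed
    show "\<exists>\<delta>. \<delta> \<in> fmlas L (lb + (n + s) + k + m i) \<and>
     (\<forall>x\<in>tup (n + s). \<forall>a'\<in>tup k. sols (m i) \<delta> (b @ x @ a') = D \<chi> i a')"
    proof (cases "i \<le> l")
     case False
     thus ?thesis using \<psi>(1) eq by (intro exI[of _ \<psi>]) (simp add: D_def)
    next
     case True
     have "\<chi> i \<in> fmlas L (lb + m i)" using \<chi> True by blast
     moreover have "\<psi> \<in> fmlas L (lb + (n + s + k) + m i)" using \<psi>(1) by (simp add: add.assoc)
     ultimately obtain \<delta> where \<delta>: "\<delta> \<in> fmlas L (lb + (n + s + k) + m i)"
      "\<forall>e\<in>tup lb. \<forall>a\<in>tup (n + s + k). sols (m i) \<delta> (e @ a) = sols (m i) \<psi> (e @ a) - sols (m i) (\<chi> i) e"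
      using diff_fm by blast
     have "sols (m i) \<delta> (b @ x @ a') = D \<chi> i a'" if "x \<in> tup (n + s)" "a' \<in> tup k" for x a'
     proof -
      have "x @ a' \<in> tup (n + s + k)" using that by (simp add: tuples_def)
      hence "sols (m i) \<delta> (b @ x @ a') = sols (m i) \<psi> (b @ x @ a') - sols (m i) (\<chi> i) b" using \<delta>(2) bl(1) by blast
      thus ?thesis using True eq[OF that] by (simp add: D_def)
     qed
     thus ?thesis using \<delta>(1) by (intro exI[of _ \<delta>]) (simp add: add.assoc)
    qed
   qed
   from bchoice[OF this] obtain \<phi>' where \<phi>': "\<forall>i\<in>{..length rs}. \<phi>' i \<in> fmlas L (lb + (n + s) + k + m i) \<and>
    (\<forall>x\<in>tup (n + s). \<forall>a'\<in>tup k. sols (m i) (\<phi>' i) (b @ x @ a') = D \<chi> i a')" ..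
   have Q: "(\<chi>, \<phi>') \<in> Q" using \<chi> \<phi>' by (simp add: Q_def)
   have "wit b k \<theta>' ?I lv m \<phi>' (a # es)" unfolding wit_def
   proof (intro bexI[OF _ a'(1)] conjI ballI)
    show "holds C \<theta>' (b @ concat (a # es) @ a')" using \<theta>'_iff[OF a es a'(1)] a'(2) by blast
    fix i assume i: "i \<in> ?I"
    have eq: "sols (m i) (\<phi>' i) (b @ concat (a # es) @ a') = D \<chi> i a'" using \<phi>' i xt[OF a es] a'(1) by blast
    show "fork (set (b @ concat (take (lv i) (a # es)))) (m i) (\<phi>' i) (b @ concat (a # es) @ a')"
    proof (cases "i \<le> l")
     case True
     hence "forkset (set b) (m i) (sols (m i) (\<phi> i) a' - sols (m i) (\<chi> i) b)" using \<chi> by blast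
     thus ?thesis unfolding eq base0(2)[OF True] using True by (simp add: D_def)
    next
     case False
     have il: "i - l \<le> length es" "0 < i - l" using i False tuple_seqs_length[OF es] by (auto simp: rs2_def)
     let ?A = "set (concat (take i (ds @ es)))"
     \<comment> \<open>Here maximality is used: at least one tuple beyond \<open>ds\<close> belongs
       to this base.\<close>
     have acl: "set a \<subseteq> acl L C ?A"
      unfolding base1(2)[OF False] using es by (intro maximal_section_acl[OF max _ a Va il(2,1)]) (simp add: rs2_def l_def)
     have AC: "inC ?A" using tuple_seqs_concat[OF tuple_seqs_take[OF dses]] by (simp add: tuples_def)
     have "fork (?A \<union> set a) (m i) (\<phi> i) a'" by (rule forkset_acl[OF AC acl fk]) (use i in simp)
     thus ?thesis unfolding eq base1(1)[OF False] using False by (simp add: D_def)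
    qed
   qed
   thus "a \<in> (\<Union>q\<in>Q. ?U q)" using Q a es by (intro UN_I[of "(\<chi>, \<phi>')"]) auto
  next
   assume "a \<in> (\<Union>q\<in>Q. ?U q)"
   then obtain \<chi> \<phi>' es where Q: "(\<chi>, \<phi>') \<in> Q" and a: "a \<in> tup n" and es: "es \<in> tuple_seqs C rs2"
    and wt: "wit b k \<theta>' ?I lv m \<phi>' (a # es)" by auto
   from wt obtain a' where a': "a' \<in> tup k" "holds C \<theta>' (b @ concat (a # es) @ a')"
    and fk: "\<And>i. i \<le> length rs \<Longrightarrow> fork (set (b @ concat (take (lv i) (a # es)))) (m i) (\<phi>' i) (b @ concat (a # es) @ a')"
    unfolding wit_def by auto
   have \<chi>: "fork (set (concat (take i ds))) (m i) (\<chi> i) b" if "i \<le> l" for i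
    using Q that by (simp add: Q_def)
   have eq: "sols (m i) (\<phi>' i) (b @ concat (a # es) @ a') = D \<chi> i a'" if "i \<le> length rs" for i
    using Q that xt[OF a es] a'(1) unfolding Q_def by blast
   have "fork (set (concat (take i (ds @ es)))) (m i) (\<phi> i) a'" if i: "i \<le> length rs" for i
   proof (cases "i \<le> l")
    case True
    have "forkset (set b) (m i) (sols (m i) (\<phi> i) a' - sols (m i) (\<chi> i) b)"
     using fk[OF i] True unfolding eq[OF i] base0(2)[OF True] by (simp add: D_def)
    moreover have "set (concat (take i ds)) \<subseteq> set b" unfolding b_def using set_take_subset[of i ds] by auto
    ultimately show ?thesis unfolding base0(1)[OF True] by (rule forkset_unshift[OF \<chi>[OF True]])
   next
    case False
    have "fork (set (b @ concat (take (lv i) (a # es)))) (m i) (\<phi> i) a'"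
     using fk[OF i] False unfolding eq[OF i] by (simp add: D_def)
    \<comment> \<open>Dropping \<open>a\<close> from the base preserves forking.\<close>
    thus ?thesis by (rule forkset_base) (use base1(1)[OF False] in blast)
   qed
   thus "a \<in> section_set C n rs V ds"
    unfolding sec using a es a'(1) a'(2)[unfolded \<theta>'_iff[OF a es a'(1)]] by blast
  qed
 qed
 ultimately show ?thesis by (simp add: b_def)
qed

section \<open>Type-definability of sections in the stable case\<close>

text \<open>The formulas over \<open>b\<close> that hold throughout \<open>U\<close> define its
  closure in the space of types over \<open>b\<close>, and \<open>cl\<close> says that
  \<open>U\<close> is closed.\<close>

lemma type_definable_closed:
 assumes U: "U \<subseteq> tup n"
  and cl: "\<And>a. a \<in> tup n \<Longrightarrow> (\<And>\<psi>. \<psi> \<in> fmlas L (n + length b) \<Longrightarrow> holds C \<psi> (a @ b) \<Longrightarrow> \<exists>u\<in>U. holds C \<psi> (u @ b)) \<Longrightarrow> a \<in> U"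
 shows "type_definable L C (set b) n U"
proof -
 let ?\<Sigma> = "{(\<psi>, c). c = b \<and> \<psi> \<in> fmlas L (n + length b) \<and> (\<forall>u\<in>U. holds C \<psi> (u @ b))}"
 have "U = {a\<in>tup n. \<forall>(\<psi>, c)\<in>?\<Sigma>. holds C \<psi> (a @ c)}"
 proof
  show "U \<subseteq> {a\<in>tup n. \<forall>(\<psi>, c)\<in>?\<Sigma>. holds C \<psi> (a @ c)}" using U by auto
  show "{a\<in>tup n. \<forall>(\<psi>, c)\<in>?\<Sigma>. holds C \<psi> (a @ c)} \<subseteq> U"
  proof
   fix a assume "a \<in> {a\<in>tup n. \<forall>(\<psi>, c)\<in>?\<Sigma>. holds C \<psi> (a @ c)}"
   hence a: "a \<in> tup n" "\<And>\<psi>. \<psi> \<in> fmlas L (n + length b) \<Longrightarrow> \<forall>u\<in>U. holds C \<psi> (u @ b) \<Longrightarrow> holds C \<psi> (a @ b)" by auto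
   show "a \<in> U"
   proof (rule cl[OF a(1)])
    fix \<psi> assume \<psi>: "\<psi> \<in> fmlas L (n + length b)" "holds C \<psi> (a @ b)"
    show "\<exists>u\<in>U. holds C \<psi> (u @ b)"
    proof (rule ccontr)
     assume "\<not> (\<exists>u\<in>U. holds C \<psi> (u @ b))"
     hence "holds C (Neg \<psi>) (a @ b)" using \<psi>(1) by (intro a(2)) (auto simp: fmlas_Neg holds_Neg)
     thus False using \<psi>(2) by (simp add: holds_Neg)
    qed
   qed
  qed
 qed
 moreover have "\<forall>(\<psi>, c)\<in>?\<Sigma>. c \<in> lists (set b) \<and> \<psi> \<in> fmlas L (n + length c)" by (auto simp: lists_eq_set)
 ultimately show ?thesis unfolding type_definable_def by blast
qed

text \<open>For stable formulas forking is witnessed by sequences with a uniform degree of inconsistency, which turns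
 membership in a section into the realizability of a set of formulas in countably many variables.\<close>

lemma section_type_definable:
 assumes w: "pre_tilde_witness L C n rs V k \<theta> m \<phi>"
  and st: "\<And>i. i \<le> length rs \<Longrightarrow> stable_formula C k (m i) (\<phi> i)"
  and ds: "length ds \<le> length rs" "ds \<in> tuple_seqs C (take (length ds) rs)"
 shows "type_definable L C (set (concat ds)) n (section_set C n rs V ds)"
proof (rule type_definable_closed)
 show "section_set C n rs V ds \<subseteq> tup n" by (auto simp: section_set_def)
 define b where "b = concat ds"
 define R where "R = sum_list rs"
 define lb where "lb = length b"
 define r where "r i = sum_list (take i rs)" for i
 have "b \<in> tup (sum_list (take (length ds) rs))" unfolding b_def by (rule tuple_seqs_concat[OF ds(2)])
 hence bC: "b \<in> lists (dom C)" "inC (set b)" and lb: "lb = sum_list (take (length ds) rs)"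
  by (simp_all add: tuples_def lists_eq_set lb_def)
 have R: "R = lb + sum_list (drop (length ds) rs)" unfolding lb R_def by (metis append_take_drop_id sum_list_append)
 have rR: "r i \<le> R" for i unfolding r_def R_def by (metis append_take_drop_id sum_list_append le_add1)
 have \<theta>: "\<theta> \<in> fmlas L (n + k + R)" and \<phi>: "\<And>i. i \<le> length rs \<Longrightarrow> \<phi> i \<in> fmlas L (k + m i)"
  using w by (simp_all add: pre_tilde_witness_def R_def)
 \<comment> \<open>Without a degree that is independent of the witness, dividing would be an
   infinite disjunction over all degrees and not a set of formulas.\<close>
 have "\<forall>i\<in>{..length rs}. \<exists>N :: nat. \<forall>A b. A \<subseteq> dom C \<and> small A \<and> b \<in> tup k \<longrightarrow>
  (fork A (m i) (\<phi> i) b \<longleftrightarrow> kdiv A (m i) N (\<phi> i) b)"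
 proof
  fix i assume "i \<in> {..length rs}"
  hence i: "i \<le> length rs" by simp
  obtain N :: nat where "\<And>A b. A \<subseteq> dom C \<Longrightarrow> small A \<Longrightarrow> b \<in> tup k \<Longrightarrow> fork A (m i) (\<phi> i) b \<longleftrightarrow> kdiv A (m i) N (\<phi> i) b"
   by (rule stable_kdiv[OF \<phi>[OF i] st[OF i]]) (rule that)
  thus "\<exists>N :: nat. \<forall>A b. A \<subseteq> dom C \<and> small A \<and> b \<in> tup k \<longrightarrow>
   (fork A (m i) (\<phi> i) b \<longleftrightarrow> kdiv A (m i) N (\<phi> i) b)" by (intro exI[of _ N]) simp
 qed
 from bchoice[OF this] obtain N :: "nat \<Rightarrow> nat" where N0: "\<forall>i\<in>{..length rs}. \<forall>A b. A \<subseteq> dom C \<and> small A \<and> b \<in> tup k \<longrightarrow>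
  (fork A (m i) (\<phi> i) b \<longleftrightarrow> kdiv A (m i) (N i) (\<phi> i) b)" ..
 have N: "fork (set (concat (take i zs))) (m i) (\<phi> i) a' \<longleftrightarrow> kdiv (set (concat (take i zs))) (m i) (N i) (\<phi> i) a'"
  if "i \<le> length rs" "zs \<in> tuple_seqs C rs" "a' \<in> tup k" for i zs a'
 proof -
  have "inC (set (concat (take i zs)))" using tuple_seqs_concat[OF tuple_seqs_take[OF that(2)]] by (simp add: tuples_def)
  moreover have "small (set (concat (take i zs)))" by (rule small_finite) simp
  ultimately show ?thesis using N0 that by simp
 qed
 \<comment> \<open>\<open>v\<close> names the coordinates of x, of all the tuples z and of the
   witness, in this order; \<open>sv i j\<close> names member \<open>j\<close> of the sequence
   showing that condition \<open>i\<close> divides.\<close>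
 define v where "v i = (0 :: nat, 0 :: nat, i :: nat)" for i
 define sv where "sv i j x = (Suc i, j :: nat, x :: nat)" for i j x
 let ?Xf = "v ` {..<n + lb}"
 define X where "X = v ` {..<n + R + k} \<union> (\<Union>i\<in>{..length rs}. \<Union>j. sv i j ` {..<k})"
 have XfX: "?Xf \<subseteq> X" unfolding X_def R by auto
 have svX: "sv i j x \<in> X" if "i \<le> length rs" "x < k" for i j x
  unfolding X_def by (intro UnI2 UN_I[of i] UN_I[of j] imageI) (use that in simp_all)
 \<comment> \<open>\<open>D\<theta>\<close> is the relation itself, \<open>Dt\<close> gives each
   member of the sequence the type of the witness over the base, and \<open>Dk\<close> is
   inconsistency of degree \<open>N i\<close>.\<close>
 define D\<theta> where "D\<theta> = (\<lambda>(M :: ('f, 'r, 'u) struct) f. holds M \<theta> (map f (map v ([0..<n] @ [n + R..<n + R + k] @ [n..<n + R]))))"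
 define Dt where "Dt i j \<chi> = (\<lambda>(M :: ('f, 'r, 'u) struct) f. holds M \<chi> (map f (map v [n..<n + r i] @ map (sv i j) [0..<k])) \<longleftrightarrow>
  holds M \<chi> (map f (map v [n..<n + r i] @ map v [n + R..<n + R + k])))" for i j \<chi>
 define Dk where "Dk i S = (\<lambda>(M :: ('f, 'r, 'u) struct) f. \<not> (\<exists>y\<in>tuples M (m i). \<forall>j\<in>S. holds M (\<phi> i) (map f (map (sv i j) [0..<k]) @ y)))" for i S
 define J where "J = {D\<theta>} \<union> {Dt i j \<chi> | i j \<chi>. i \<le> length rs \<and> \<chi> \<in> fmlas L (r i + k)} \<union>
  {Dk i S | i S. i \<le> length rs \<and> finite S \<and> card S = N i}"
 have Jdfn: "dfn L X D" if "D \<in> J" for D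
 proof -
  have vX: "v ` set ks \<subseteq> X" if "set ks \<subseteq> {..<n + R + k}" for ks using that by (auto simp: X_def)
  have sX: "set (map (sv i j) [0..<k]) \<subseteq> X" if "i \<le> length rs" for i j using svX[OF that] by auto
  have d1: "set (map v [n..<n + r i]) \<subseteq> X" for i using rR[of i] vX[of "[n..<n + r i]"] by (auto simp: subset_iff)
  have d2: "set (map v [n + R..<n + R + k]) \<subseteq> X" using vX[of "[n + R..<n + R + k]"] by (auto simp: subset_iff)
  from that consider "D = D\<theta>" | i j \<chi> where "D = Dt i j \<chi>" "i \<le> length rs" "\<chi> \<in> fmlas L (r i + k)"
   | i S where "D = Dk i S" "i \<le> length rs" "finite S" "card S = N i" unfolding J_def by blast
  thus ?thesis
  proof cases
   case 1
   have "set (map v ([0..<n] @ [n + R..<n + R + k] @ [n..<n + R])) \<subseteq> X"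
    using vX[of "[0..<n] @ [n + R..<n + R + k] @ [n..<n + R]"] by (auto simp: subset_iff)
   thus ?thesis unfolding 1 D\<theta>_def by (intro dfn_holds) (use \<theta> in \<open>simp_all add: add.assoc\<close>)
  next
   case 2
   thus ?thesis unfolding 2(1) Dt_def
    by (intro dfn_Iff dfn_holds) (use d1 d2 sX[OF 2(2)] in simp_all)
  next
   case 3
   show ?thesis unfolding 3(1) Dk_def
    by (intro dfn_Neg dfn_ex_holds) (use 3 \<phi>[OF 3(2)] sX[OF 3(2)] in simp_all)
  qed
 qed
 have full: "\<exists>f. f ` X \<subseteq> dom C \<and> (\<forall>i<n + lb. f (v i) = (u @ b) ! i) \<and> (\<forall>D\<in>J. D C f)"
  if u: "u \<in> section_set C n rs V ds" for u
 proof -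
  obtain es a' where ut: "u \<in> tup n" and es: "es \<in> tuple_seqs C (drop (length ds) rs)" and a': "a' \<in> tup k"
   "holds C \<theta> (u @ a' @ b @ concat es)"
   and fk: "\<And>i. i \<le> length rs \<Longrightarrow> fork (set (concat (take i (ds @ es)))) (m i) (\<phi> i) a'"
   using u unfolding section_iff[OF w ds(2)] b_def by auto
  let ?zs = "ds @ es"
  have zs: "?zs \<in> tuple_seqs C rs" using tuple_seqs_append[OF ds(2) es] by simp
  let ?z = "concat ?zs"
  have lz: "length ?z = R" "inC (set ?z)" using tuple_seqs_concat[OF zs] by (simp_all add: tuples_def R_def)
  have lu: "length u = n" "inC (set u)" "length a' = k" "a' \<in> lists (dom C)" "inC (set a')"
   using ut a'(1) by (simp_all add: tuples_def lists_eq_set)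
  let ?d = "\<lambda>i. concat (take i ?zs)"
  have d: "?d i = take (r i) ?z" "?d i \<in> lists (dom C)" "length (?d i) = r i" for i
  proof -
   show "?d i = take (r i) ?z" unfolding r_def by (rule tuple_seqs_concat_take[OF zs])
   show "?d i \<in> lists (dom C)" "length (?d i) = r i" unfolding r_def
    using tuple_seqs_concat[OF tuple_seqs_take[OF zs]] by (simp_all add: tuples_def lists_eq_set)
  qed
  have "\<forall>i\<in>{..length rs}. \<exists>h :: nat \<Rightarrow> 'u \<Rightarrow> 'u. (\<forall>j. h j \<in> auts (set (?d i))) \<and> kinc (m i) (\<phi> i) (N i) (\<lambda>j. map (h j) a')"
   using fk N[OF _ zs a'(1)] unfolding kdiv_def by simp
  from bchoice[OF this] obtain h :: "nat \<Rightarrow> nat \<Rightarrow> 'u \<Rightarrow> 'u" where h: "\<forall>i\<in>{..length rs}. (\<forall>j. h i j \<in> auts (set (?d i))) \<and>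
   kinc (m i) (\<phi> i) (N i) (\<lambda>j. map (h i j) a')" ..
  let ?xs = "u @ ?z @ a'"
  define f where "f = (\<lambda>(t, j, x). if t = 0 then ?xs ! x else map (h (t - 1) j) a' ! x)"
  have fv: "f (v i) = ?xs ! i" for i by (simp add: f_def v_def)
  have fs: "f (sv i j x) = map (h i j) a' ! x" for i j x by (simp add: f_def sv_def)
  have fvm: "map f (map v ks) = map (nth ?xs) ks" for ks by (simp add: fv comp_def)
  have fsm: "map f (map (sv i j) [0..<k]) = map (h i j) a'" for i j
   using map_nth[of "map (h i j) a'"] lu(3) by (simp add: fs comp_def)
  have seg: "map f (map v [n..<n + r i]) = ?d i" "map f (map v [n + R..<n + R + k]) = a'" for i
  proof -
   have "?xs = u @ ?d i @ (drop (r i) ?z @ a')" unfolding d(1) by (simp del: concat_append)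
   thus "map f (map v [n..<n + r i]) = ?d i"
    unfolding fvm using map_nth_seg[of n u "n + r i" "?d i" "drop (r i) ?z @ a'"] lu d(3) by metis
   show "map f (map v [n + R..<n + R + k]) = a'"
    unfolding fvm using map_nth_seg[of "n + R" "u @ ?z" "n + R + k" a' "[]"] lu lz by simp
  qed
  have "inC (f ` X)"
  proof -
   have "f (v i) \<in> dom C" if "i < n + R + k" for i
   proof -
    have "?xs \<in> lists (dom C)" "i < length ?xs" using lu lz that by (simp_all add: lists_eq_set)
    thus ?thesis unfolding fv by (rule lists_nth)
   qed
   moreover have "f (sv i j x) \<in> dom C" if "i \<le> length rs" "x < k" for i j x
   proof -
    have "h i j \<in> auts (set (?d i))" using h that(1) by blast
    hence "map (h i j) a' \<in> lists (dom C)" using lu(4) by (rule auts_dom_lists)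
    thus ?thesis unfolding fs by (rule lists_nth) (simp add: lu(3) that(2))
   qed
   ultimately show ?thesis by (auto simp: X_def)
  qed
  moreover have "f (v i) = (u @ b) ! i" if "i < n + lb" for i
  proof -
   have "?xs = (u @ b) @ (concat es @ a')" by (simp add: b_def)
   moreover have "i < length (u @ b)" using that lu(1) by (simp add: lb_def)
   ultimately show ?thesis unfolding fv by (simp only: nth_append if_True)
  qed
  moreover have "D C f" if "D \<in> J" for D
  proof -
   from that consider "D = D\<theta>" | i j \<chi> where "D = Dt i j \<chi>" "i \<le> length rs" "\<chi> \<in> fmlas L (r i + k)"
    | i S where "D = Dk i S" "i \<le> length rs" "finite S" "card S = N i" unfolding J_def by blast
   thus ?thesis
   proof cases
    case 1
    have "map f (map v [0..<n]) = u" unfolding fvm using map_nth_seg[of 0 "[]" n u "?z @ a'"] lu by simp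
    moreover have "map f (map v [n..<n + R]) = ?z" unfolding fvm using map_nth_seg[of n u "n + R" ?z a'] lu lz by simp
    ultimately show ?thesis unfolding 1 D\<theta>_def using a'(2) seg(2) by (simp add: b_def del: map_map)
   next
    case 2
    have hi: "h i j \<in> auts (set (?d i))" using h 2(2) by blast
    have "holds C \<chi> (map (h i j) (?d i @ a')) \<longleftrightarrow> holds C \<chi> (?d i @ a')"
    proof (rule aut_holds[OF hi])
     show "\<chi> \<in> fmlas L (length (?d i @ a'))" unfolding length_append d(3) lu(3) by (rule 2(3))
     show "?d i @ a' \<in> lists (dom C)" unfolding append_in_lists_conv using d(2) lu(4) by blast
    qed
    moreover have "map (h i j) (?d i) = ?d i" by (rule auts_fix[OF hi]) (simp add: lists_eq_set)
    ultimately show ?thesis unfolding 2(1) Dt_def map_append seg fsm by simp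
   next
    case 3
    have "kinc (m i) (\<phi> i) (N i) (\<lambda>j. map (h i j) a')" using h 3(2) by blast
    thus ?thesis unfolding 3(1) Dk_def fsm kinc_def using 3(3,4) by blast
   qed
  qed
  ultimately show ?thesis by blast
 qed
 fix a assume a: "a \<in> tup n"
  and cl: "\<And>\<psi>. \<psi> \<in> fmlas L (n + length (concat ds)) \<Longrightarrow> holds C \<psi> (a @ concat ds) \<Longrightarrow>
   \<exists>u\<in>section_set C n rs V ds. holds C \<psi> (u @ concat ds)"
 have la: "length a = n" "inC (set a)" using a by (simp_all add: tuples_def)
 let ?p = "\<lambda>x :: nat \<times> nat \<times> nat. snd (snd x)"
 have pv: "?p (v i) = i" for i by (simp add: v_def)
 have "\<exists>f. f ` X \<subseteq> dom C \<and> (\<forall>x\<in>?Xf. f x = (a @ b) ! ?p x) \<and> (\<forall>D\<in>J. D C f)"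
 proof (rule assignment_C[of X J "\<lambda>D. D"])
  show "small X" by (rule small_countable)
  show "dfn L X D" if "D \<in> J" for D by (rule Jdfn[OF that])
  show "?Xf \<subseteq> X" by (rule XfX)
  fix J0 assume J0: "J0 \<subseteq> J" "finite J0"
  let ?D = "\<lambda>(M :: ('f, 'r, 'u) struct) f. \<forall>D\<in>J0. D M f"
  have "dfn L X ?D" by (rule dfn_ball[OF J0(2)]) (use Jdfn J0(1) in blast)
  then obtain W where W: "finite W" "W \<subseteq> X" "dfn L W ?D" by (rule dfn_support) (rule that)
  let ?Z = "W - ?Xf"
  have Z: "finite ?Z" using W(1) by simp
  \<comment> \<open>Quantifying away all variables but those of x and \<open>b\<close> turns a
    finite part of the system into a formula about \<open>a\<close> and \<open>b\<close>. If it
    failed for \<open>a\<close>, its negation would hold for some \<open>u\<close> in the section,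
    but \<open>u\<close> solves the whole system.\<close>
  have "dfn L (?Z \<union> ?Xf) ?D" by (rule dfn_mono[OF W(3)]) blast
  hence "dfn L ?Xf (\<lambda>M f. \<exists>g. g ` ?Z \<subseteq> dom M \<and> ?D M (override_on f g ?Z))" by (rule dfn_ex_set[OF Z])
  hence "dfn L {..<n + lb} (\<lambda>M xs. \<exists>g. g ` ?Z \<subseteq> dom M \<and> ?D M (override_on (\<lambda>y. xs (?p y)) g ?Z))"
   by (rule dfn_reindex) (auto simp: pv)
  then obtain \<psi> where \<psi>: "\<psi> \<in> fmlas L (n + lb)" "\<And>(M :: ('f, 'r, 'u) struct) xs. length xs = n + lb \<Longrightarrow>
   holds M \<psi> xs \<longleftrightarrow> (\<exists>g. g ` ?Z \<subseteq> dom M \<and> ?D M (override_on (\<lambda>y. xs ! ?p y) g ?Z))"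
   by (rule fm_exists) (rule that)
  have "holds C \<psi> (a @ b)"
  proof (rule ccontr)
   assume "\<not> holds C \<psi> (a @ b)"
   then obtain u where u: "u \<in> section_set C n rs V ds" "\<not> holds C \<psi> (u @ b)"
    using cl[of "Neg \<psi>"] \<psi>(1) by (auto simp: fmlas_Neg holds_Neg b_def lb_def)
   have lu: "length (u @ b) = n + lb" using u(1) by (simp add: section_set_def tuples_def lb_def)
   obtain f where f: "inC (f ` X)" "\<forall>i<n + lb. f (v i) = (u @ b) ! i" "\<forall>D\<in>J. D C f" using full[OF u(1)] by blast
   have "?D C (override_on (\<lambda>y. (u @ b) ! ?p y) f ?Z) \<longleftrightarrow> ?D C f"
    by (rule dfn_cong[OF W(3)]) (use f(2) in \<open>auto simp: override_on_def pv\<close>)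
   moreover have "?D C f" using f(3) J0(1) by blast
   moreover have "inC (f ` ?Z)" using f(1) W(2) by blast
   ultimately show False using u(2) \<psi>(2)[OF lu] by blast
  qed
  moreover have lab: "length (a @ b) = n + lb" using la(1) by (simp add: lb_def)
  ultimately obtain g where g: "inC (g ` ?Z)" "?D C (override_on (\<lambda>y. (a @ b) ! ?p y) g ?Z)" using \<psi>(2)[OF lab] by blast
  obtain u0 where u0: "u0 \<in> dom C" using dom_nonempty by blast
  let ?f = "override_on (\<lambda>x. if x \<in> ?Xf then (a @ b) ! ?p x else u0) g ?Z"
  have ab: "(a @ b) ! i \<in> dom C" if "i < n + lb" for i
   by (rule lists_nth) (use la bC that in \<open>simp_all add: lists_eq_set lb_def\<close>)
  have "?f x \<in> dom C" for x
  proof (cases "x \<in> ?Z")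
   case True thus ?thesis using g(1) by (auto simp: override_on_def)
  next
   case False
   thus ?thesis using u0 ab by (auto simp: override_on_def pv)
  qed
  moreover have "?f x = (a @ b) ! ?p x" if "x \<in> ?Xf" for x using that by (simp add: override_on_def)
  moreover have "?D C ?f \<longleftrightarrow> ?D C (override_on (\<lambda>y. (a @ b) ! ?p y) g ?Z)"
   by (rule dfn_cong[OF W(3)]) (auto simp: override_on_def)
  ultimately show "\<exists>f. f ` X \<subseteq> dom C \<and> (\<forall>x\<in>?Xf. f x = (a @ b) ! ?p x) \<and> ?D C f"
   using g(2) by (intro exI[of _ ?f]) blast
 qed
 then obtain f where f: "inC (f ` X)" "\<forall>x\<in>?Xf. f x = (a @ b) ! ?p x" "\<forall>D\<in>J. D C f" by (elim exE conjE) (rule that)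
 have fv: "f (v i) = (a @ b) ! i" if "i < n + lb" for i using f(2) that by (auto simp: pv)
 have fC: "f (v i) \<in> dom C" if "i < n + R + k" for i using f(1) that by (auto simp: X_def)
 let ?w = "map f (map v [n..<n + R])" and ?a' = "map f (map v [n + R..<n + R + k])"
 have fa: "map f (map v [0..<n]) = a" by (rule nth_equalityI) (use la fv in \<open>auto simp: nth_append\<close>)
 have fb: "take lb ?w = b" by (rule nth_equalityI) (use fv la R in \<open>auto simp: nth_append lb_def\<close>)
 have a't: "?a' \<in> tup k" using fC by (auto simp: tuples_def)
 have "drop lb ?w \<in> tup (sum_list (drop (length ds) rs))"
  using R fC set_drop_subset[of lb ?w] by (auto simp: tuples_def)
 then obtain es where es: "es \<in> tuple_seqs C (drop (length ds) rs)" "concat es = drop lb ?w" using tuple_seqs_split by blast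
 have zw: "concat (ds @ es) = ?w" using fb es(2) append_take_drop_id[of lb ?w] by (simp add: b_def)
 have zs: "ds @ es \<in> tuple_seqs C rs" using tuple_seqs_append[OF ds(2) es(1)] by simp
 show "a \<in> section_set C n rs V ds" unfolding section_iff[OF w ds(2)]
 proof (intro conjI a bexI[OF _ es(1)] bexI[OF _ a't] allI impI)
  have "D\<theta> C f" using f(3) by (simp add: J_def)
  thus "holds C \<theta> (a @ ?a' @ concat ds @ concat es)"
   unfolding D\<theta>_def map_append fa using zw by simp
  fix i assume i: "i \<le> length rs"
  let ?d = "concat (take i (ds @ es))"
  have d: "?d = map f (map v [n..<n + r i])"
   using tuple_seqs_concat_take[OF zs, of i] unfolding zw r_def[symmetric] using rR[of i] by (simp add: take_map)
  have dC: "inC (set ?d)" "length ?d = r i"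
   using tuple_seqs_concat[OF tuple_seqs_take[OF zs]] unfolding r_def by (simp_all add: tuples_def)
  have a'C: "?a' \<in> lists (dom C)" "length ?a' = k" using a't by (simp_all add: tuples_def lists_eq_set)
  have "kdiv (set ?d) (m i) (N i) (\<phi> i) ?a'"
  proof (rule kdivI[OF dC(1) _ a'C(1)])
   show "small (set ?d)" by (rule small_finite) simp
   fix j
   show "map f (map (sv i j) [0..<k]) \<in> tup (length ?a')" using f(1) svX[OF i] by (auto simp: tuples_def)
   show "tp L C (set ?d) (map f (map (sv i j) [0..<k])) = tp L C (set ?d) ?a'"
   proof (rule tp_eqI)
    fix \<chi> c assume c: "c \<in> lists (set ?d)" "\<chi> \<in> fmlas L (length c + length ?a')" "holds C \<chi> (c @ ?a')"
    have "\<chi> \<in> fms c k" using c(2) a'C(2) by simp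
    from fm_reparam[OF c(1) this] obtain \<chi>' where \<chi>': "\<chi>' \<in> fms ?d k"
     "\<forall>y. length y = k \<longrightarrow> (holds C \<chi>' (?d @ y) \<longleftrightarrow> holds C \<chi> (c @ y))" by blast
    have "Dt i j \<chi>' \<in> J" unfolding J_def using i \<chi>'(1)[unfolded dC(2)] by blast
    hence "Dt i j \<chi>' C f" by (rule bspec[OF f(3)])
    hence "holds C \<chi>' (?d @ map f (map (sv i j) [0..<k])) \<longleftrightarrow> holds C \<chi>' (?d @ ?a')"
     unfolding Dt_def map_append d .
    thus "holds C \<chi> (c @ map f (map (sv i j) [0..<k]))" using \<chi>'(2) c(3) a'C(2) by simp
   qed simp
  next
   have "Dk i S C f" if "finite S" "card S = N i" for S using f(3) i that by (auto simp: J_def)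
   thus "kinc (m i) (\<phi> i) (N i) (\<lambda>j. map f (map (sv i j) [0..<k]))" unfolding kinc_def Dk_def by blast
  qed
  thus "fork (set ?d) (m i) (\<phi> i) ?a'" using N[OF i zs a't] by blast
 qed
qed

section \<open>Existence of maximal sequences and the two parts of the theorem\<close>

text \<open>The empty sequence has an unbounded section, and the length of \<open>rs\<close> bounds
  all lengths; a longest sequence is maximal.\<close>

lemma maximal_section_exists:
 assumes "unbounded L C {} {a\<in>tup n. \<exists>es\<in>tuple_seqs C rs. V a es}"
 obtains ds where "maximal_unbounded_section L C n rs V ds"
proof -
 let ?P = "\<lambda>ds. unbounded_section L C n rs V ds"
 have "?P []" using assms by (simp add: unbounded_section_def section_set_def tuple_seqs_Nil)
 moreover have "length ds < Suc (length rs)" if "?P ds" for ds using that by (simp add: unbounded_section_def)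
 ultimately obtain ds where ds: "?P ds" "\<And>es. ?P es \<Longrightarrow> length es \<le> length ds"
  using ex_has_greatest_nat[of ?P "[]" length "Suc (length rs)"] by blast
 have "\<not> ?P (ds @ es)" if "es \<noteq> []" for es using ds(2)[of "ds @ es"] that by auto
 thus thesis using that ds(1) unfolding maximal_unbounded_section_def by blast
qed

lemma maximal_sectionD:
 assumes "maximal_unbounded_section L C n rs V ds"
 shows "inC (set (concat ds))" "unbounded L C (set (concat ds)) (section_set C n rs V ds)"
  "section_set C n rs V ds \<subseteq> {a\<in>tup n. \<exists>es\<in>tuple_seqs C rs. V a es}"
  "length ds \<le> length rs" "ds \<in> tuple_seqs C (take (length ds) rs)"
proof -
 show ds: "length ds \<le> length rs" "ds \<in> tuple_seqs C (take (length ds) rs)"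
  and "unbounded L C (set (concat ds)) (section_set C n rs V ds)"
  using assms by (simp_all add: maximal_unbounded_section_def unbounded_section_def)
 show "inC (set (concat ds))" using tuple_seqs_concat[OF ds(2)] by (simp add: tuples_def)
 show "section_set C n rs V ds \<subseteq> {a\<in>tup n. \<exists>es\<in>tuple_seqs C rs. V a es}"
  using tuple_seqs_append[OF ds(2), of _ "drop (length ds) rs"] by (auto simp: section_set_def)
qed

lemma tilde_part:
 assumes efo: "extension_property_first_order L T C" and U: "tilde_set L C n U" "unbounded L C {} U"
 shows "\<exists>A U'. finite A \<and> A \<subseteq> dom C \<and> tauf_open L C A n U' \<and> unbounded L C A U' \<and> U' \<subseteq> U"
proof -
 obtain rs V where V: "pre_tilde_rel L C n rs V" and Ue: "U = {a\<in>tup n. \<exists>ds\<in>tuple_seqs C rs. V a ds}"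
  using U(1) unfolding tilde_set_def by blast
 obtain ds where ds: "maximal_unbounded_section L C n rs V ds" using maximal_section_exists U(2) unfolding Ue by blast
 have "tauf_open L C (set (concat ds)) n (section_set C n rs V ds)"
  using V maximal_section_open[OF efo _ ds] unfolding pre_tilde_rel_def by blast
 thus ?thesis using maximal_sectionD[OF ds] unfolding Ue by (intro exI conjI) (rule finite_set, assumption+)
qed

lemma maximal_section_st_open:
 assumes efo: "extension_property_first_order L T C"
  and V: "pre_tilde_st_rel L C n rs V" and max: "maximal_unbounded_section L C n rs V ds"
 shows "basic_tauf_inf_open L C (set (concat ds)) n (section_set C n rs V ds)"
proof -
 obtain k \<theta> m \<phi> where w: "pre_tilde_witness L C n rs V k \<theta> m \<phi>" "\<And>i. i \<le> length rs \<Longrightarrow> stable_formula C k (m i) (\<phi> i)"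
  using V unfolding pre_tilde_st_rel_def by blast
 show ?thesis unfolding basic_tauf_inf_open_def
  using section_type_definable[OF w maximal_sectionD(4,5)[OF max]] maximal_section_open[OF efo w(1) max] by blast
qed

lemma tilde_st_part:
 assumes efo: "extension_property_first_order L T C" and U: "tilde_st_set L C n U" "unbounded L C {} U"
 shows "\<exists>A U'. finite A \<and> A \<subseteq> dom C \<and> tauf_inf_open L C A n U' \<and> unbounded L C A U' \<and> U' \<subseteq> U"
proof -
 obtain rs V where V: "pre_tilde_st_rel L C n rs V" and Ue: "U = {a\<in>tup n. \<exists>ds\<in>tuple_seqs C rs. V a ds}"
  using U(1) unfolding tilde_st_set_def by blast
 obtain ds where ds: "maximal_unbounded_section L C n rs V ds" using maximal_section_exists U(2) unfolding Ue by blast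
 have "tauf_inf_open L C (set (concat ds)) n (section_set C n rs V ds)" unfolding tauf_inf_open_def
  using maximal_section_st_open[OF efo V ds] by (intro exI[of _ "{section_set C n rs V ds}"]) simp
 thus ?thesis using maximal_sectionD[OF ds] unfolding Ue by (intro exI conjI) (rule finite_set, assumption+)
qed

end

theorem theorem8p7:
  fixes L :: "('f, 'r) lang" and T :: "('f, 'r) fm set"
    and \<kappa> :: "'k rel" and C :: "('f, 'r, 'u) struct"
  assumes "complete_theory L T"
    and "monster_model L T \<kappa> C"
    and "simple_theory L C"
    and "extension_property_first_order L T C"
  shows
    "(\<forall>n U. tilde_set L C n U \<and> unbounded L C {} U \<longrightarrow>
        (\<exists>A U'. finite A \<and> A \<subseteq> dom C \<and> tauf_open L C A n U' \<and> unbounded L C A U' \<and> U' \<subseteq> U) \<and>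
        (\<forall>rs V ds. pre_tilde_rel L C n rs V \<and>
           U = {a\<in>tuples C n. \<exists>es\<in>tuple_seqs C rs. V a es} \<and>
           maximal_unbounded_section L C n rs V ds \<longrightarrow>
           tauf_open L C (set (concat ds)) n (section_set C n rs V ds)))
   \<and> (\<forall>n U. tilde_st_set L C n U \<and> unbounded L C {} U \<longrightarrow>
        (\<exists>A U'. finite A \<and> A \<subseteq> dom C \<and> tauf_inf_open L C A n U' \<and> unbounded L C A U' \<and> U' \<subseteq> U) \<and>
        (\<forall>rs V ds. pre_tilde_st_rel L C n rs V \<and>
           U = {a\<in>tuples C n. \<exists>es\<in>tuple_seqs C rs. V a es} \<and>
           maximal_unbounded_section L C n rs V ds \<longrightarrow>
           basic_tauf_inf_open L C (set (concat ds)) n (section_set C n rs V ds)))"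
proof -
 interpret monster L T \<kappa> C by unfold_locales (fact assms)+
 show ?thesis
 proof (intro conjI allI impI)
  fix n U assume "tilde_set L C n U \<and> unbounded L C {} U"
  thus "\<exists>A U'. finite A \<and> A \<subseteq> dom C \<and> tauf_open L C A n U' \<and> unbounded L C A U' \<and> U' \<subseteq> U"
   by (elim conjE) (rule tilde_part[OF assms(4)])
 next
  fix n U rs V ds
  assume "pre_tilde_rel L C n rs V \<and> U = {a\<in>tuples C n. \<exists>es\<in>tuple_seqs C rs. V a es} \<and> maximal_unbounded_section L C n rs V ds"
  thus "tauf_open L C (set (concat ds)) n (section_set C n rs V ds)"
   unfolding pre_tilde_rel_def by (elim conjE exE) (rule maximal_section_open[OF assms(4)])
 next
  fix n U assume "tilde_st_set L C n U \<and> unbounded L C {} U"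
  thus "\<exists>A U'. finite A \<and> A \<subseteq> dom C \<and> tauf_inf_open L C A n U' \<and> unbounded L C A U' \<and> U' \<subseteq> U"
   by (elim conjE) (rule tilde_st_part[OF assms(4)])
 next
  fix n U rs V ds
  assume "pre_tilde_st_rel L C n rs V \<and> U = {a\<in>tuples C n. \<exists>es\<in>tuple_seqs C rs. V a es} \<and> maximal_unbounded_section L C n rs V ds"
  thus "basic_tauf_inf_open L C (set (concat ds)) n (section_set C n rs V ds)"
   by (elim conjE) (rule maximal_section_st_open[OF assms(4)])
 qed
qed

end
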